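(* Suppose that the Coxeter group $W=W(X)$ has Property F and Property W, and let $x,w\in W_c$. Then $M(x,w)=\mu(x,w)$. In particular, for every $s\in S$ and $w\in W_c$, $$c_s c_w=\begin{cases}(v+v^{-1})\,c_w & \text{if } \ell(sw)<\ell(w),\\ c_{sw}+\sum_{sy<y}\mu(y,w)\,c_y & \text{if } \ell(sw)>\ell(w),\end{cases}$$ where $c_z$ is defined to be zero whenever $z\notin W_c$.
   Context: **Hecke algebra.** $X$ is an arbitrary Coxeter graph and $W=W(X)$ the Coxeter group with finite set $S$ of distinguished generating involutions, $W=\langle S\mid (st)^{m(s,t)}=1 \text{ for } m(s,t)<\infty\rangle$, $m(s,s)=1$; $\ell$ is the length function and $\le$ the Bruhat order. Put $\mathcal A=\mathbb Z[v,v^{-1}]$, $\mathcal A^-=\mathbb Z[v^{-1}]$, $q=v^2$. $\mathcal H=\mathcal H(X)$ is the $\mathcal A$-algebra with basis $\{T_w:w\in W\}$ such that, for $s\in S$, $T_sT_w=T_{sw}$ if $\ell(sw)>\ell(w)$ and $T_sT_w=qT_{sw}+(q-1)T_w$ if $\ell(sw)<\ell(w)$. Put $\widetilde T_w=v^{-\ell(w)}T_w$. The bar involution is the ring automorphism of $\mathcal H$ with $\overline{\sum a_w\widetilde T_w}=\sum\overline{a_w}\,\widetilde T_{w^{-1}}^{-1}$, where $\bar{\ }$ on $\mathcal A$ exchanges $v$ and $v^{-1}$. **Kazhdan--Lusztig basis.** $C'_w$ is the unique bar-invariant element of $\mathcal H$ of the form $\widetilde T_w+\sum_{y<w}P^*_{y,w}\widetilde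 T_y$ with $P^*_{y,w}\in v^{-1}\mathcal A^-$. The Kazhdan--Lusztig polynomial is $P_{y,w}=v^{\ell(w)-\ell(y)}P^*_{y,w}$, a polynomial in $q$ (and $P_{w,w}=1$, $P_{y,w}=0$ if $y\not\le w$). $\mu(y,w)$ is the coefficient of $q^{(\ell(w)-\ell(y)-1)/2}$ in $P_{y,w}$; it is zero unless $y<w$ and $\ell(w)-\ell(y)$ is odd. **Temperley--Lieb quotient.** $J(X)$ is the two-sided ideal of $\mathcal H$ generated by the elements $\sum_{w\in\langle s,s'\rangle}T_w$, for all pairs of noncommuting $s,s'\in S$ with $m(s,s')<\infty$. $TL(X)=\mathcal H/J(X)$, and $\widetilde t_w$ is the image of $\widetilde T_w$. The bar involution descends to $TL(X)$. An element $w\in W$ is complex if $w=x_1w_{ss'}x_2$ with $\ell(w)=\ell(x_1)+\ell(w_{ss'})+\ell(x_2)$, where $w_{ss'}$ is the longest element of a finite parabolic subgroup $\langle s,s'\rangle$ with $s,s'\in S$ noncommuting; $W_c$ is the set of elements that are not complex (fully commutative elements). $\{\widetilde t_w:w\in W_c\}$ is an $\mathcal A$-basis of $TL(X)$; $\mathcal L$ is its $\mathcal A^-$-span. For $w\in W_c$, $c_w$ is the unique element of $TL(X)$ with $\overline{c_w}=c_w$ and $c_w-\widetilde t_w\in v^{-1}\mathcal L$; $\{c_w:w\in W_c\}$ is an $\mathcal A$-basis of $TL(X)$. Write $c_w=\sum_{y\in W_c}p^*(y,w)\widetilde t_y$; $M(y,w)$ is the coefficient of $v^{-1}$ in $p^*(y,w)$.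 **Star reducibility and Property F.** Let $I=\{s,t\}\subseteq S$ be noncommuting generators with $m=m(s,t)$ ($m=\infty$ allowed). Let $W_I=\langle s,t\rangle$ and $W^I=\{w\in W:\ell(sw)>\ell(w),\ \ell(tw)>\ell(w)\}$; each $w\in W$ is uniquely $w=w_Iw^I$ with $w_I\in W_I$, $w^I\in W^I$, and $\ell(w)=\ell(w_I)+\ell(w^I)$. The left $\{s,t\}$-strings are the sequences of $m-1$ elements $sw^I,tsw^I,stsw^I,\dots$ and $tw^I,stw^I,tstw^I,\dots$. If $x,y$ belong to the same left $\{s,t\}$-string and $\ell(x)=\ell(y)-1$, then $y$ is left star reducible to $x$. Right strings and right star reducibility are defined symmetrically. $y$ is star reducible to $x$ if there is a (possibly trivial) sequence $x=w_0,w_1,\dots,w_k=y$ such that each $w_{i+1}$ is left or right star reducible to $w_i$ with respect to some pair of noncommuting generators. $W$ has Property F if every element of $W_c$ is star reducible to a product of (distinct) commuting generators from $S$. **Property W.** $w\in W$ is weakly complex if $w$ is complex and $w=su$ with $s\in S$ and $u\in W_c$. $W$ has Property W if $\widetilde t_x\in v^{-1}\mathcal L$ for every weakly complex $x\in W$. *)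

theory Defs
  imports
    "HOL-Algebra.Generated_Groups"
    "HOL-Library.Extended_Nat"
    "HOL-Library.Poly_Mapping"
begin

section \<open>Laurent polynomials\<close>

text \<open>The ring of integral Laurent polynomials in \<open>v\<close> is the monoid ring of the additive monoid
  \<^typ>\<open>int\<close>: the key \<open>k\<close> stands for the power \<open>v\<close> to the \<open>k\<close>.\<close>

type_synonym laurent = "int \<Rightarrow>\<^sub>0 int"

definition vpow :: "int \<Rightarrow> laurent" where
  "vpow k = Poly_Mapping.single k 1"

definition qq :: laurent where
  "qq = vpow 2"

definition A_minus :: "laurent set" where
  "A_minus = {a. Poly_Mapping.keys a \<subseteq> {..0}}"

definition v_inv_A_minus :: "laurent set" where
  "v_inv_A_minus = (\<lambda>a. vpow (- 1) * a) ` A_minus"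

definition bar_A :: "laurent \<Rightarrow> laurent" where
  "bar_A a = Poly_Mapping.map_key uminus a"


section \<open>Coxeter groups\<close>

text \<open>\<open>cox_mat W s t = \<infinity>\<close> means that no relation is imposed on the pair \<open>s\<close>, \<open>t\<close>.\<close>

record 'w coxeter = "'w monoid" +
  cox_gens :: "'w set"
  cox_mat :: "'w \<Rightarrow> 'w \<Rightarrow> enat"

definition word_prod :: "('w, 'z) monoid_scheme \<Rightarrow> 'w list \<Rightarrow> 'w" where
  "word_prod G xs = foldr (mult G) xs (one G)"

text \<open>The congruence on words over the generators which is generated by the relators
  \<open>(st)^m(s,t)\<close>. Since \<open>m(s,s) = 1\<close>, every generator is its own inverse modulo this congruence,
  so that the quotient monoid is the group given by the presentation.\<close>

inductive cox_eq :: "('w, 'z) coxeter_scheme \<Rightarrow> 'w list \<Rightarrow> 'w list \<Rightarrow> bool" for W where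
  refl: "cox_eq W xs xs"
| sym: "cox_eq W xs ys \<Longrightarrow> cox_eq W ys xs"
| trans: "cox_eq W xs ys \<Longrightarrow> cox_eq W ys zs \<Longrightarrow> cox_eq W xs zs"
| relator: "\<lbrakk>s \<in> cox_gens W; t \<in> cox_gens W; cox_mat W s t = enat k;
     xs \<in> lists (cox_gens W); ys \<in> lists (cox_gens W)\<rbrakk>
    \<Longrightarrow> cox_eq W (xs @ concat (replicate k [s, t]) @ ys) (xs @ ys)"

locale coxeter_system = group W for W :: "'w coxeter" (structure) +
  assumes finite_gens: "finite (cox_gens W)"
    and gens_carrier: "cox_gens W \<subseteq> carrier W"
    and mat_diag: "s \<in> cox_gens W \<Longrightarrow> cox_mat W s s = 1"
    and mat_sym: "\<lbrakk>s \<in> cox_gens W; t \<in> cox_gens W\<rbrakk> \<Longrightarrow> cox_mat W s t = cox_mat W t s"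
    and mat_off_diag: "\<lbrakk>s \<in> cox_gens W; t \<in> cox_gens W; s \<noteq> t\<rbrakk> \<Longrightarrow> 2 \<le> cox_mat W s t"
    and generated: "generate W (cox_gens W) = carrier W"
    and presentation: "xs \<in> lists (cox_gens W) \<Longrightarrow>
      word_prod W xs = \<one> \<longleftrightarrow> cox_eq W xs []"
begin

abbreviation S :: "'w set" where
  "S \<equiv> cox_gens W"

definition len :: "'w \<Rightarrow> nat" where
  "len w = (LEAST n. \<exists>xs \<in> lists S. length xs = n \<and> word_prod W xs = w)"

definition reflections :: "'w set" where
  "reflections = {g \<otimes> s \<otimes> inv g | g s. g \<in> carrier W \<and> s \<in> S}"

definition bruhat_less :: "'w \<Rightarrow> 'w \<Rightarrow> bool" where
  "bruhat_less =
    (\<lambda>u w. u \<in> carrier W \<and> (\<exists>r \<in> reflections. w = u \<otimes> r) \<and> len u < len w)\<^sup>+\<^sup>+"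

definition noncommuting :: "'w \<Rightarrow> 'w \<Rightarrow> bool" where
  "noncommuting s t \<longleftrightarrow> s \<in> S \<and> t \<in> S \<and> s \<otimes> t \<noteq> t \<otimes> s"

definition is_longest :: "'w \<Rightarrow> 'w \<Rightarrow> 'w \<Rightarrow> bool" where
  "is_longest s t u \<longleftrightarrow>
    u \<in> generate W {s, t} \<and> (\<forall>u' \<in> generate W {s, t}. len u' \<le> len u)"

definition complex :: "'w \<Rightarrow> bool" where
  "complex w \<longleftrightarrow> (\<exists>s t u x\<^sub>1 x\<^sub>2.
    noncommuting s t \<and> finite (generate W {s, t}) \<and> is_longest s t u \<and>
    x\<^sub>1 \<in> carrier W \<and> x\<^sub>2 \<in> carrier W \<and>
    w = x\<^sub>1 \<otimes> u \<otimes> x\<^sub>2 \<and> len w = len x\<^sub>1 + len u + len x\<^sub>2)"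

definition W\<^sub>c :: "'w set" where
  "W\<^sub>c = {w \<in> carrier W. \<not> complex w}"

definition weakly_complex :: "'w \<Rightarrow> bool" where
  "weakly_complex w \<longleftrightarrow> complex w \<and> (\<exists>s \<in> S. \<exists>u \<in> W\<^sub>c. w = s \<otimes> u)"

text \<open>The alternating products \<open>s, ts, sts, \<dots>\<close> and \<open>s, st, sts, \<dots>\<close> with \<open>k\<close> factors.\<close>

primrec alt_left :: "'w \<Rightarrow> 'w \<Rightarrow> nat \<Rightarrow> 'w" where
  "alt_left s t 0 = \<one>"
| "alt_left s t (Suc k) = (if even k then s else t) \<otimes> alt_left s t k"

primrec alt_right :: "'w \<Rightarrow> 'w \<Rightarrow> nat \<Rightarrow> 'w" where
  "alt_right s t 0 = \<one>"
| "alt_right s t (Suc k) = alt_right s t k \<otimes> (if even k then s else t)"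

text \<open>A string has \<open>m(s,t) - 1\<close> elements; it is infinite if \<open>m(s,t) = \<infinity>\<close>. The other
  \<open>{s,t}\<close>-string belonging to \<open>u\<close> is obtained by exchanging \<open>s\<close> and \<open>t\<close>.\<close>

definition left_string :: "'w \<Rightarrow> 'w \<Rightarrow> 'w \<Rightarrow> 'w set" where
  "left_string s t u = {alt_left s t k \<otimes> u | k. 1 \<le> k \<and> enat k < cox_mat W s t}"

definition right_string :: "'w \<Rightarrow> 'w \<Rightarrow> 'w \<Rightarrow> 'w set" where
  "right_string s t u = {u \<otimes> alt_right s t k | k. 1 \<le> k \<and> enat k < cox_mat W s t}"

definition left_star_reducible :: "'w \<Rightarrow> 'w \<Rightarrow> bool" where
  "left_star_reducible y x \<longleftrightarrow> (\<exists>s t u.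
    noncommuting s t \<and> u \<in> carrier W \<and> len u < len (s \<otimes> u) \<and> len u < len (t \<otimes> u) \<and>
    x \<in> left_string s t u \<and> y \<in> left_string s t u \<and> Suc (len x) = len y)"

definition right_star_reducible :: "'w \<Rightarrow> 'w \<Rightarrow> bool" where
  "right_star_reducible y x \<longleftrightarrow> (\<exists>s t u.
    noncommuting s t \<and> u \<in> carrier W \<and> len u < len (u \<otimes> s) \<and> len u < len (u \<otimes> t) \<and>
    x \<in> right_string s t u \<and> y \<in> right_string s t u \<and> Suc (len x) = len y)"

definition star_reducible :: "'w \<Rightarrow> 'w \<Rightarrow> bool" where
  "star_reducible = (\<lambda>y x. left_star_reducible y x \<or> right_star_reducible y x)\<^sup>*\<^sup>*"

definition commuting_product :: "'w \<Rightarrow> bool" where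
  "commuting_product x \<longleftrightarrow> (\<exists>ss. distinct ss \<and> set ss \<subseteq> S \<and>
    (\<forall>s \<in> set ss. \<forall>t \<in> set ss. s \<otimes> t = t \<otimes> s) \<and> x = word_prod W ss)"

definition property_F :: bool where
  "property_F \<longleftrightarrow> (\<forall>w \<in> W\<^sub>c. \<exists>x. commuting_product x \<and> star_reducible w x)"

end


section \<open>Hecke algebras and Kazhdan--Lusztig polynomials\<close>

definition ring_inverse :: "'h::monoid_mult \<Rightarrow> 'h" where
  "ring_inverse x = (THE y. x * y = 1 \<and> y * x = 1)"

definition two_sided_ideal :: "'h::ring set \<Rightarrow> bool" where
  "two_sided_ideal I \<longleftrightarrow> 0 \<in> I \<and> (\<forall>x \<in> I. \<forall>y \<in> I. x - y \<in> I) \<and>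
    (\<forall>x \<in> I. \<forall>r. r * x \<in> I \<and> x * r \<in> I)"

text \<open>\<open>sc\<close> is the action of the Laurent polynomials on the algebra \<^typ>\<open>'h\<close>. The axiom
  \<open>T_one\<close> follows from the others unless there are no generators.\<close>

locale hecke_algebra =
  coxeter_system W + H: module sc
  for W :: "'w coxeter" (structure)
    and sc :: "laurent \<Rightarrow> 'h \<Rightarrow> 'h::ring_1"
    and T :: "'w \<Rightarrow> 'h" +
  assumes sc_mult_left: "sc a x * y = sc a (x * y)"
    and sc_mult_right: "x * sc a y = sc a (x * y)"
    and T_inj: "inj_on T (carrier W)"
    and T_independent: "\<not> H.dependent (T ` carrier W)"
    and T_span: "H.span (T ` carrier W) = UNIV"
    and T_one: "T \<one> = 1"
    and T_mult_up: "\<lbrakk>s \<in> cox_gens W; w \<in> carrier W; len (s \<otimes> w) > len w\<rbrakk>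
      \<Longrightarrow> T s * T w = T (s \<otimes> w)"
    and T_mult_down: "\<lbrakk>s \<in> cox_gens W; w \<in> carrier W; len (s \<otimes> w) < len w\<rbrakk>
      \<Longrightarrow> T s * T w = sc qq (T (s \<otimes> w)) + sc (qq - 1) (T w)"
begin

definition Tn :: "'w \<Rightarrow> 'h" where
  "Tn w = sc (vpow (- int (len w))) (T w)"

definition coeff :: "'h \<Rightarrow> 'w \<Rightarrow> laurent" where
  "coeff h w = H.representation (Tn ` carrier W) h (Tn w)"

definition bar_H :: "'h \<Rightarrow> 'h" where
  "bar_H h = (\<Sum>w | w \<in> carrier W \<and> coeff h w \<noteq> 0.
    sc (bar_A (coeff h w)) (ring_inverse (Tn (inv w))))"

definition KL :: "'w \<Rightarrow> 'h" where
  "KL w = (THE h. bar_H h = h \<and>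
    (\<exists>P. (\<forall>y. bruhat_less y w \<longrightarrow> P y \<in> v_inv_A_minus) \<and>
      h = Tn w + (\<Sum>y | bruhat_less y w. sc (P y) (Tn y))))"

definition KL_poly :: "'w \<Rightarrow> 'w \<Rightarrow> laurent" where
  "KL_poly y w = vpow (int (len w) - int (len y)) * coeff (KL w) y"

text \<open>The coefficient of \<open>q\<close> to the power \<open>(\<ell>(w) - \<ell>(y) - 1) / 2\<close>, as \<open>q\<close> is the square of \<open>v\<close>.\<close>

definition mu :: "'w \<Rightarrow> 'w \<Rightarrow> int" where
  "mu y w = (if bruhat_less y w \<and> odd (int (len w) - int (len y))
    then Poly_Mapping.lookup (KL_poly y w) (int (len w) - int (len y) - 1) else 0)"

definition J_gens :: "'h set" where
  "J_gens = {(\<Sum>w \<in> generate W {s, t}. T w) | s t. noncommuting s t \<and> cox_mat W s t < \<infinity>}"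

definition J :: "'h set" where
  "J = \<Inter>{I. two_sided_ideal I \<and> J_gens \<subseteq> I}"

end


section \<open>Temperley--Lieb quotients\<close>

text \<open>The type \<^typ>\<open>'q\<close> is the quotient algebra of the Hecke algebra by the ideal \<open>J\<close>, with
  projection \<open>pr\<close>. The sort is that of a unital ring which is allowed to be zero, so that the
  choice of \<^typ>\<open>'q\<close> does not presuppose that \<open>J\<close> is a proper ideal.\<close>

locale temperley_lieb =
  hecke_algebra W sc T + TL: module_hom sc scq pr
  for W :: "'w coxeter" (structure)
    and sc :: "laurent \<Rightarrow> 'h \<Rightarrow> 'h::ring_1"
    and T :: "'w \<Rightarrow> 'h"
    and scq :: "laurent \<Rightarrow> 'q \<Rightarrow> 'q::{ring, monoid_mult}"
    and pr :: "'h \<Rightarrow> 'q" +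
  assumes pr_one: "pr 1 = 1"
    and pr_mult: "pr (x * y) = pr x * pr y"
    and pr_surj: "surj pr"
    and pr_kernel: "pr x = 0 \<longleftrightarrow> x \<in> J"
begin

definition tn :: "'w \<Rightarrow> 'q" where
  "tn w = pr (Tn w)"

definition bar_TL :: "'q \<Rightarrow> 'q" where
  "bar_TL x = (THE y. \<forall>h. pr h = x \<longrightarrow> y = pr (bar_H h))"

definition lattice_L :: "'q set" where
  "lattice_L = {(\<Sum>w \<in> F. scq (a w) (tn w)) | F a.
    finite F \<and> F \<subseteq> W\<^sub>c \<and> (\<forall>w \<in> F. a w \<in> A_minus)}"

definition v_inv_L :: "'q set" where
  "v_inv_L = scq (vpow (- 1)) ` lattice_L"

definition c :: "'w \<Rightarrow> 'q" where
  "c w = (if w \<in> W\<^sub>c then THE x. bar_TL x = x \<and> x - tn w \<in> v_inv_L else 0)"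

definition p_star :: "'w \<Rightarrow> 'w \<Rightarrow> laurent" where
  "p_star y w = TL.m2.representation (tn ` W\<^sub>c) (c w) (tn y)"

definition M :: "'w \<Rightarrow> 'w \<Rightarrow> int" where
  "M y w = Poly_Mapping.lookup (p_star y w) (- 1)"

definition property_W :: bool where
  "property_W \<longleftrightarrow> (\<forall>x. weakly_complex x \<longrightarrow> tn x \<in> v_inv_L)"

end

end

theory Submission
  imports Defs
begin

text \<open>The Hecke algebra with the basis indexed by \<open>W\<close> and the Temperley--Lieb algebra with the
  basis indexed by \<open>W\<^sub>c\<close> are two instances of the same situation: a module with a basis, a bar
  involution and left multiplications by the elements \<open>b\<^sub>s\<close>, in which a canonical basis exists. In
  both, the coefficients \<open>\<mu>(x, w)\<close> and \<open>M(x, w)\<close> are governed by the formula for the product of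
  \<open>b\<^sub>s\<close> with a canonical basis element, and this formula makes them transform in the same way when
  \<open>w\<close> is replaced by an element to which it is star reducible. Property W is what makes the formula
  hold in the Temperley--Lieb algebra. Property F reduces the comparison of \<open>\<mu>\<close> and \<open>M\<close> to products
  of commuting generators, where both canonical basis elements are explicit; right stars are turned
  into left ones by the anti-involution.

  That the images of the \<open>T\<^sub>w\<close>, \<open>w\<close> in \<open>W\<^sub>c\<close>, are independent is seen by letting the generators act
  on the span of the \<open>T\<^sub>w\<close> with \<open>w\<close> in \<open>W\<^sub>c\<close> by explicit operators.\<close>

text \<open>That st has order m(s,t) and that the fully commutative elements index a basis of the
  quotient are not part of the definitions; both are proved. Spanning is a matter of shortening
  complex elements. For independence a module is built by recursion on length, and the obstacle is
  that several reductions of one product compete: their agreement and the defining relations need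
  each other at smaller lengths, so all go through one induction.

  Stars work because of a collapse. The coefficient of v^-1 at x in c_s c_w contains a sum of
  \<mu>(y,w)\<mu>(x,y) over many y. If t is a descent of w but not of x, then t determines one of
  the two factors, and only y = tw and y = tx survive.

  Property W enters at one place: when sw is complex, b_s sends the image of T_w into v^-1 times the
  lattice, so products that leave \<open>W\<^sub>c\<close> are invisible modulo v^-1, and modulo
  v^-2 once multiplied by a further coefficient of negative degree. The Hecke algebra has no such
  products. The two recursions still coincide, because tx leaves \<open>W\<^sub>c\<close> only if s
  is a descent of tx, and then the term in question is absent from both.\<close>

context coxeter_system
begin

section \<open>Words, lengths and left descents\<close>

lemma gens_closed [simp]: "s \<in> S \<Longrightarrow> s \<in> carrier W"
  using gens_carrier by blast

lemmas [simp] = in_lists_conv_set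

lemma mult_inv_cancel [simp]: "\<lbrakk>x \<in> carrier W; y \<in> carrier W\<rbrakk> \<Longrightarrow> x \<otimes> (inv x \<otimes> y) = y"
  by (simp add: m_assoc[symmetric])

lemma inv_mult_cancel [simp]: "\<lbrakk>x \<in> carrier W; y \<in> carrier W\<rbrakk> \<Longrightarrow> inv x \<otimes> (x \<otimes> y) = y"
  by (simp add: m_assoc[symmetric])

lemma word_prod_Nil [simp]: "word_prod W [] = \<one>"
  by (simp add: word_prod_def)

lemma word_prod_Cons [simp]: "word_prod W (s # xs) = s \<otimes> word_prod W xs"
  by (simp add: word_prod_def)

lemma word_prod_closed [simp]: "xs \<in> lists S \<Longrightarrow> word_prod W xs \<in> carrier W"
  by (induction xs) auto

lemma word_prod_append:
  "\<lbrakk>xs \<in> lists S; ys \<in> lists S\<rbrakk> \<Longrightarrow> word_prod W (xs @ ys) = word_prod W xs \<otimes> word_prod W ys"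
  by (induction xs) (auto simp: m_assoc)

lemma gen_square [simp]: "s \<in> S \<Longrightarrow> s \<otimes> s = \<one>"
proof -
  assume s: "s \<in> S"
  have "cox_eq W ([] @ concat (replicate 1 [s, s]) @ []) ([] @ [])"
    using s mat_diag[OF s] by (intro cox_eq.relator) (auto simp: one_enat_def)
  then show ?thesis
    using presentation[of "[s, s]"] s by simp
qed

lemma gen_inv [simp]: "s \<in> S \<Longrightarrow> inv s = s"
  by (simp add: inv_equality)

lemma gen_cancel [simp]: "\<lbrakk>s \<in> S; w \<in> carrier W\<rbrakk> \<Longrightarrow> s \<otimes> (s \<otimes> w) = w"
  by (simp add: m_assoc[symmetric])

lemma inv_word_prod: "xs \<in> lists S \<Longrightarrow> inv (word_prod W xs) = word_prod W (rev xs)"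
  by (induction xs) (auto simp: inv_mult_group word_prod_append)

lemma ex_word: "w \<in> carrier W \<Longrightarrow> \<exists>xs \<in> lists S. word_prod W xs = w"
proof -
  assume "w \<in> carrier W"
  then have "w \<in> generate W S"
    by (simp add: generated)
  then show ?thesis
  proof (induction rule: generate.induct)
    case one
    show ?case by (rule bexI[of _ "[]"]) auto
  next
    case (incl h)
    then show ?case by (intro bexI[of _ "[h]"]) auto
  next
    case (inv h)
    then show ?case by (intro bexI[of _ "[h]"]) auto
  next
    case (eng h1 h2)
    then obtain xs ys where "xs \<in> lists S" "ys \<in> lists S" "word_prod W xs = h1" "word_prod W ys = h2"
      by auto
    then show ?case by (intro bexI[of _ "xs @ ys"]) (auto simp: word_prod_append)
  qed
qed

lemma len_le_length: "xs \<in> lists S \<Longrightarrow> len (word_prod W xs) \<le> length xs"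
  unfolding len_def by (rule Least_le) auto

lemma ex_reduced_word:
  assumes "w \<in> carrier W"
  obtains xs where "xs \<in> lists S" "length xs = len w" "word_prod W xs = w"
proof -
  have "\<exists>n. \<exists>xs \<in> lists S. length xs = n \<and> word_prod W xs = w"
    using ex_word[OF assms] by auto
  from LeastI_ex[OF this] show ?thesis
    using that unfolding len_def by blast
qed

lemma len_one [simp]: "len \<one> = 0"
  using len_le_length[of "[]"] by simp

lemma len_eq_0_iff: "w \<in> carrier W \<Longrightarrow> len w = 0 \<longleftrightarrow> w = \<one>"
  by (metis ex_reduced_word len_one length_0_conv word_prod_Nil)

lemma len_mult_le: "\<lbrakk>x \<in> carrier W; y \<in> carrier W\<rbrakk> \<Longrightarrow> len (x \<otimes> y) \<le> len x + len y"
proof -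
  assume "x \<in> carrier W" "y \<in> carrier W"
  then obtain xs ys where "xs \<in> lists S" "length xs = len x" "word_prod W xs = x"
    "ys \<in> lists S" "length ys = len y" "word_prod W ys = y"
    by (metis ex_reduced_word)
  then show ?thesis
    using len_le_length[of "xs @ ys"] by (auto simp: word_prod_append)
qed

lemma len_inv [simp]: "w \<in> carrier W \<Longrightarrow> len (inv w) = len w"
proof -
  have le: "len (inv w) \<le> len w" if w: "w \<in> carrier W" for w
  proof -
    obtain xs where "xs \<in> lists S" "length xs = len w" "word_prod W xs = w"
      using ex_reduced_word[OF w] .
    then show ?thesis
      using len_le_length[of "rev xs"] inv_word_prod[of xs] by simp
  qed
  assume w: "w \<in> carrier W"
  show ?thesis
    using le[OF w] le[of "inv w"] w by simp
qed

text \<open>Relators have even length, so the parity of a word is an invariant of its element. This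
  is the sign character; it forces l(sw) to differ from l(w).\<close>

lemma cox_eq_even_length: "cox_eq W xs ys \<Longrightarrow> even (length xs) \<longleftrightarrow> even (length ys)"
proof (induction rule: cox_eq.induct)
  case (relator s t k xs ys)
  have "even (length (concat (replicate k [s, t])))"
    by (induction k) auto
  then show ?case by auto
qed auto

text \<open>The presentation speaks only about words for the identity. Two words for one element are
  therefore compared through the first followed by the reverse of the second, which stands for its
  inverse.\<close>

lemma word_prod_eq_imp_cox_eq:
  assumes "xs \<in> lists S" "ys \<in> lists S" "word_prod W xs = word_prod W ys"
  shows "cox_eq W (xs @ rev ys) []"
proof -
  have "word_prod W (xs @ rev ys) = word_prod W xs \<otimes> inv (word_prod W ys)"
    using assms by (subst inv_word_prod) (auto simp: word_prod_append)
  then have "word_prod W (xs @ rev ys) = \<one>"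
    using assms by simp
  then show ?thesis
    using presentation[of "xs @ rev ys"] assms by auto
qed

lemma even_length_word:
  assumes "xs \<in> lists S" "ys \<in> lists S" "word_prod W xs = word_prod W ys"
  shows "even (length xs) \<longleftrightarrow> even (length ys)"
  using cox_eq_even_length[OF word_prod_eq_imp_cox_eq[OF assms]] by auto

lemma even_len_word_prod: "xs \<in> lists S \<Longrightarrow> even (len (word_prod W xs)) \<longleftrightarrow> even (length xs)"
  by (metis ex_reduced_word even_length_word word_prod_closed)

lemma even_len_mult:
  assumes "x \<in> carrier W" "y \<in> carrier W"
  shows "even (len (x \<otimes> y)) \<longleftrightarrow> even (len x + len y)"
proof -
  obtain xs ys where xs: "xs \<in> lists S" "length xs = len x" "word_prod W xs = x"
    "ys \<in> lists S" "length ys = len y" "word_prod W ys = y"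
    using assms by (metis ex_reduced_word)
  then show ?thesis
    using even_len_word_prod[of "xs @ ys"] by (auto simp: word_prod_append)
qed

lemma len_gen [simp]: "s \<in> S \<Longrightarrow> len s = 1"
proof -
  assume s: "s \<in> S"
  have "len s \<le> 1" "odd (len s)"
    using len_le_length[of "[s]"] even_len_word_prod[of "[s]"] s by auto
  then show ?thesis by (cases "len s") auto
qed

lemma gen_neq_one: "s \<in> S \<Longrightarrow> s \<noteq> \<one>"
  by (metis len_gen len_one zero_neq_one)

lemma len_gen_mult:
  assumes "s \<in> S" "w \<in> carrier W"
  shows "len (s \<otimes> w) = Suc (len w) \<or> Suc (len (s \<otimes> w)) = len w"
proof -
  have "len (s \<otimes> w) \<le> Suc (len w)" "len w \<le> Suc (len (s \<otimes> w))"
    using len_mult_le[of s w] len_mult_le[of s "s \<otimes> w"] assms by auto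
  moreover have "even (len (s \<otimes> w)) \<longleftrightarrow> odd (len w)"
    using even_len_mult[of s w] assms by auto
  ultimately show ?thesis by presburger
qed

text \<open>Left descent. Right descents of \<open>w\<close> are expressed as left descents of its
  inverse.\<close>

definition dl :: "'w \<Rightarrow> 'w \<Rightarrow> bool" where
  "dl s w \<longleftrightarrow> len (s \<otimes> w) < len w"

lemma len_down: "\<lbrakk>s \<in> S; w \<in> carrier W; dl s w\<rbrakk> \<Longrightarrow> Suc (len (s \<otimes> w)) = len w"
  using len_gen_mult unfolding dl_def by fastforce

lemma len_up: "\<lbrakk>s \<in> S; w \<in> carrier W; \<not> dl s w\<rbrakk> \<Longrightarrow> len (s \<otimes> w) = Suc (len w)"
  using len_gen_mult unfolding dl_def by fastforce

lemma dl_mult: "\<lbrakk>s \<in> S; w \<in> carrier W\<rbrakk> \<Longrightarrow> dl s (s \<otimes> w) \<longleftrightarrow> \<not> dl s w"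
  using len_gen_mult unfolding dl_def by fastforce

lemma ex_dl:
  assumes "w \<in> carrier W" "w \<noteq> \<one>"
  obtains s where "s \<in> S" "dl s w"
proof -
  obtain xs where xs: "xs \<in> lists S" "length xs = len w" "word_prod W xs = w"
    using ex_reduced_word[OF assms(1)] .
  then obtain s ys where ys: "xs = s # ys"
    using assms(2) by (cases xs) auto
  then have "s \<otimes> w = word_prod W ys"
    using xs by auto
  then have "dl s w"
    unfolding dl_def using xs ys len_le_length[of ys] by auto
  then show ?thesis
    using that xs ys by auto
qed

lemma finite_len_le: "finite {w \<in> carrier W. len w \<le> n}"
proof (rule finite_subset)
  show "{w \<in> carrier W. len w \<le> n} \<subseteq> word_prod W ` {xs. set xs \<subseteq> S \<and> length xs \<le> n}"
  proof
    fix w assume "w \<in> {w \<in> carrier W. len w \<le> n}"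
    then obtain xs where "xs \<in> lists S" "length xs = len w" "word_prod W xs = w" "len w \<le> n"
      using ex_reduced_word by blast
    then show "w \<in> word_prod W ` {xs. set xs \<subseteq> S \<and> length xs \<le> n}"
      by (intro image_eqI[of _ _ xs]) auto
  qed
  show "finite (word_prod W ` {xs. set xs \<subseteq> S \<and> length xs \<le> n})"
    using finite_lists_length_le[OF finite_gens] by blast
qed

section \<open>The exchange condition\<close>

text \<open>The parity of the number of letters of a word which give rise to the reflection \<open>r\<close>
  (Bourbaki, Lie Groups and Lie Algebras, Ch. IV, 1.4).\<close>

primrec refl_parity :: "'w list \<Rightarrow> 'w \<Rightarrow> bool" where
  "refl_parity [] r \<longleftrightarrow> False"
| "refl_parity (s # xs) r \<longleftrightarrow>
    refl_parity xs r \<noteq> (word_prod W xs \<otimes> r \<otimes> inv (word_prod W xs) = s)"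

text \<open>A cocycle identity: the letters of \<open>xs\<close> see \<open>r\<close> after
  conjugation by the product of \<open>ys\<close>. With it, invariance under the congruence reduces
  to the relators.\<close>

lemma refl_parity_append:
  assumes "xs \<in> lists S" "ys \<in> lists S" "r \<in> carrier W"
  shows "refl_parity (xs @ ys) r \<longleftrightarrow>
    refl_parity ys r \<noteq> refl_parity xs (word_prod W ys \<otimes> r \<otimes> inv (word_prod W ys))"
  using assms(1)
proof (induction xs)
  case (Cons s xs)
  have "word_prod W (xs @ ys) \<otimes> r \<otimes> inv (word_prod W (xs @ ys)) =
    word_prod W xs \<otimes> (word_prod W ys \<otimes> r \<otimes> inv (word_prod W ys)) \<otimes> inv (word_prod W xs)"
    using Cons.hyps assms by (simp add: word_prod_append inv_mult_group m_assoc)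
  then show ?case using Cons by auto
qed auto

lemma word_prod_replicate:
  "\<lbrakk>s \<in> S; t \<in> S\<rbrakk> \<Longrightarrow> word_prod W (concat (replicate k [s, t])) = (s \<otimes> t) [^] k"
  by (induction k) (auto simp: m_assoc[symmetric] nat_pow_Suc2[symmetric] simp del: nat_pow_Suc)

lemma pow_conj: "\<lbrakk>s \<in> S; t \<in> S\<rbrakk> \<Longrightarrow> t \<otimes> (s \<otimes> t) [^] (k::nat) = (t \<otimes> s) [^] k \<otimes> t"
  by (induction k) (auto simp: m_assoc[symmetric])

lemma inv_pow_gens: "\<lbrakk>s \<in> S; t \<in> S\<rbrakk> \<Longrightarrow> inv ((s \<otimes> t) [^] (k::nat)) = (t \<otimes> s) [^] k"
  by (simp add: nat_pow_inv[symmetric] inv_mult_group)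

text \<open>Read from the right, the letters of (st)^k give rise to the reflections (ts)^i t with i
  = 0, ..., 2k-1.\<close>

lemma refl_parity_replicate:
  assumes "s \<in> S" "t \<in> S" "r \<in> carrier W"
  shows "refl_parity (concat (replicate k [s, t])) r \<longleftrightarrow>
    odd (card {i. i < 2 * k \<and> (t \<otimes> s) [^] i \<otimes> t = r})"
proof (induction k)
  case (Suc k)
  define g where "g = (s \<otimes> t) [^] k"
  define h where "h = (t \<otimes> s) [^] k"
  have [simp]: "g \<in> carrier W" "h \<in> carrier W" and ginv: "inv g = h"
    using assms by (simp_all add: g_def h_def inv_pow_gens)
  have gh: "h \<otimes> g = \<one>"
    using ginv by (metis \<open>g \<in> carrier W\<close> l_inv)
  have tg: "t \<otimes> g = h \<otimes> t"
    using assms by (simp add: g_def h_def pow_conj)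
  have hh: "(t \<otimes> s) [^] (2 * k) = h \<otimes> h"
    using assms by (simp add: h_def nat_pow_mult mult_2)
  have comm: "t \<otimes> s \<otimes> h = h \<otimes> (t \<otimes> s)"
    using nat_pow_Suc2[of "t \<otimes> s" k] assms by (simp add: h_def)
  have conj: "g \<otimes> r \<otimes> h = x \<longleftrightarrow> r = h \<otimes> x \<otimes> g" if "x \<in> carrier W" for x
  proof
    assume "g \<otimes> r \<otimes> h = x"
    then have "h \<otimes> x \<otimes> g = (h \<otimes> g) \<otimes> r \<otimes> (h \<otimes> g)"
      using assms by (auto simp: m_assoc)
    then show "r = h \<otimes> x \<otimes> g" using gh assms by simp
  next
    assume "r = h \<otimes> x \<otimes> g"
    moreover have "g \<otimes> h = \<one>" using ginv r_inv[of g] by simp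
    ultimately show "g \<otimes> r \<otimes> h = x"
      using that by (metis (no_types, lifting) \<open>g \<in> carrier W\<close> \<open>h \<in> carrier W\<close> l_one m_assoc m_closed r_one)
  qed
  \<comment> \<open>The two letters put in front account for the index 2k (letter \<open>t\<close>,
    here) and the index 2k+1 (letter \<open>s\<close>, in \<open>B\<close>).\<close>
  have A: "g \<otimes> r \<otimes> h = t \<longleftrightarrow> (t \<otimes> s) [^] (2 * k) \<otimes> t = r"
  proof -
    have "h \<otimes> t \<otimes> g = h \<otimes> h \<otimes> t"
      using assms tg by (simp add: m_assoc)
    then show ?thesis
      using conj[of t] hh assms by auto
  qed
  have B: "t \<otimes> g \<otimes> r \<otimes> (h \<otimes> t) = s \<longleftrightarrow> (t \<otimes> s) [^] (Suc (2 * k)) \<otimes> t = r"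
  proof -
    have "t \<otimes> g \<otimes> r \<otimes> (h \<otimes> t) = s \<longleftrightarrow> t \<otimes> (g \<otimes> r \<otimes> h) \<otimes> t = s"
      using assms by (simp add: m_assoc)
    also have "\<dots> \<longleftrightarrow> g \<otimes> r \<otimes> h = t \<otimes> s \<otimes> t"
    proof
      assume "t \<otimes> (g \<otimes> r \<otimes> h) \<otimes> t = s"
      then have "t \<otimes> s \<otimes> t = t \<otimes> (t \<otimes> (g \<otimes> r \<otimes> h) \<otimes> t) \<otimes> t" by simp
      also have "\<dots> = g \<otimes> r \<otimes> h"
        using assms by (simp add: m_assoc)
      finally show "g \<otimes> r \<otimes> h = t \<otimes> s \<otimes> t" by simp
    next
      assume "g \<otimes> r \<otimes> h = t \<otimes> s \<otimes> t"
      then show "t \<otimes> (g \<otimes> r \<otimes> h) \<otimes> t = s"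
        using assms by (simp add: m_assoc)
    qed
    also have "\<dots> \<longleftrightarrow> r = h \<otimes> (t \<otimes> s \<otimes> t) \<otimes> g"
      using assms by (intro conj) simp
    also have "h \<otimes> (t \<otimes> s \<otimes> t) \<otimes> g = (t \<otimes> s) [^] (Suc (2 * k)) \<otimes> t"
    proof -
      have "h \<otimes> (t \<otimes> s \<otimes> t) \<otimes> g = h \<otimes> (t \<otimes> s) \<otimes> h \<otimes> t"
        using assms tg by (simp add: m_assoc)
      also have "h \<otimes> (t \<otimes> s) \<otimes> h = h \<otimes> h \<otimes> (t \<otimes> s)"
        using assms comm by (simp add: m_assoc)
      finally show ?thesis using hh assms by simp
    qed
    finally show ?thesis by auto
  qed
  have fin: "finite {i. i < 2 * k \<and> (t \<otimes> s) [^] i \<otimes> t = r}" by simp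
  have set: "{i. i < 2 * Suc k \<and> (t \<otimes> s) [^] i \<otimes> t = r} =
    {i. i < 2 * k \<and> (t \<otimes> s) [^] i \<otimes> t = r}
    \<union> (if (t \<otimes> s) [^] (2 * k) \<otimes> t = r then {2 * k} else {})
    \<union> (if (t \<otimes> s) [^] (Suc (2 * k)) \<otimes> t = r then {Suc (2 * k)} else {})"
    by (auto simp: less_Suc_eq simp del: nat_pow_Suc)
  have par: "odd (card {i. i < 2 * Suc k \<and> (t \<otimes> s) [^] i \<otimes> t = r}) \<longleftrightarrow>
    (odd (card {i. i < 2 * k \<and> (t \<otimes> s) [^] i \<otimes> t = r}) \<noteq> ((t \<otimes> s) [^] (2 * k) \<otimes> t = r))
      \<noteq> ((t \<otimes> s) [^] (Suc (2 * k)) \<otimes> t = r)"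
    unfolding set using fin by (simp del: nat_pow_Suc)
  have wpk: "word_prod W (concat (replicate k [s, t])) = g"
    using assms by (simp add: word_prod_replicate g_def)
  have "refl_parity (concat (replicate (Suc k) [s, t])) r \<longleftrightarrow>
    (refl_parity (concat (replicate k [s, t])) r \<noteq> (g \<otimes> r \<otimes> h = t))
      \<noteq> (t \<otimes> g \<otimes> r \<otimes> (h \<otimes> t) = s)"
    using wpk assms ginv by (simp add: inv_mult_group)
  then show ?case
    unfolding par A B Suc.IH .
qed simp

text \<open>If (st)^k = 1, then (ts)^i t has period k in i, so the 2k indices come in pairs with
  equal values.\<close>

lemma refl_parity_relator:
  assumes "s \<in> S" "t \<in> S" "r \<in> carrier W" "(s \<otimes> t) [^] k = \<one>"
  shows "\<not> refl_parity (concat (replicate k [s, t])) r"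
proof -
  have k: "(t \<otimes> s) [^] k = \<one>"
    using inv_pow_gens[of s t k] assms by simp
  let ?f = "\<lambda>i. (t \<otimes> s) [^] i \<otimes> t"
  have per: "?f (i + k) = ?f i" for i
    using assms k by (simp add: nat_pow_mult[symmetric])
  have "{i. i < 2 * k \<and> ?f i = r} = {i. i < k \<and> ?f i = r} \<union> (\<lambda>i. i + k) ` {i. i < k \<and> ?f i = r}"
    (is "?L = ?A \<union> ?B")
  proof (intro Set.set_eqI iffI)
    fix i assume i: "i \<in> ?L"
    show "i \<in> ?A \<union> ?B"
    proof (cases "i < k")
      case False
      then have "i - k \<in> ?A" "i = (i - k) + k"
        using i per[of "i - k"] by auto
      then show ?thesis by blast
    qed (use i in auto)
  qed (use per in auto)
  moreover have "card (?A \<union> ?B) = card ?A + card ?B"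
    by (rule card_Un_disjoint) auto
  moreover have "card ?B = card ?A"
    by (rule card_image) auto
  ultimately have "even (card {i. i < 2 * k \<and> ?f i = r})" by simp
  then show ?thesis
    using refl_parity_replicate[OF assms(1-3)] by blast
qed

lemma relator_pow:
  assumes "s \<in> S" "t \<in> S" "cox_mat W s t = enat k"
  shows "(s \<otimes> t) [^] k = \<one>"
proof -
  have "cox_eq W ([] @ concat (replicate k [s, t]) @ []) ([] @ [])"
    using assms by (intro cox_eq.relator) auto
  then have "word_prod W (concat (replicate k [s, t])) = \<one>"
    using presentation[of "concat (replicate k [s, t])"] assms(1,2) by simp
  then show ?thesis
    using assms by (simp add: word_prod_replicate)
qed

lemma cox_eq_lists: "cox_eq W xs ys \<Longrightarrow> xs \<in> lists S \<longleftrightarrow> ys \<in> lists S"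
  by (induction rule: cox_eq.induct) (auto simp: in_lists_conv_set)

lemma cox_eq_refl_parity:
  "cox_eq W xs ys \<Longrightarrow> xs \<in> lists S \<Longrightarrow> r \<in> carrier W \<Longrightarrow> refl_parity xs r \<longleftrightarrow> refl_parity ys r"
proof (induction rule: cox_eq.induct)
  case (relator s t k xs ys)
  have R: "concat (replicate k [s, t]) \<in> lists S"
    using relator by (auto simp: in_lists_conv_set)
  have "word_prod W (concat (replicate k [s, t])) = \<one>"
    using relator relator_pow[of s t k] by (simp add: word_prod_replicate)
  moreover have "\<not> refl_parity (concat (replicate k [s, t])) (word_prod W ys \<otimes> r \<otimes> inv (word_prod W ys))"
    using relator relator_pow[of s t k] by (intro refl_parity_relator) auto
  ultimately show ?case
    using R relator by (simp add: refl_parity_append word_prod_append)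
qed (use cox_eq_lists in auto)

text \<open>Appending \<open>rev ys\<close> to both words gives words congruent to the empty one,
  whose parities vanish; cancelling the common contribution of \<open>rev ys\<close> compares
  \<open>xs\<close> with \<open>ys\<close>. The parities are taken at a conjugate of
  \<open>r\<close>, chosen so that conjugation by the product of \<open>rev ys\<close> gives
  \<open>r\<close> back.\<close>

lemma refl_parity_word_cong:
  assumes "xs \<in> lists S" "ys \<in> lists S" "word_prod W xs = word_prod W ys" "r \<in> carrier W"
  shows "refl_parity xs r \<longleftrightarrow> refl_parity ys r"
proof -
  let ?r = "\<lambda>zs. word_prod W zs \<otimes> r \<otimes> inv (word_prod W zs)"
  have rev: "rev ys \<in> lists S" and wr: "word_prod W (rev ys) \<otimes> word_prod W ys = \<one>"
    using assms inv_word_prod[of ys, symmetric] by auto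
  have r': "?r ys \<in> carrier W" using assms by simp
  have conj: "word_prod W (rev ys) \<otimes> ?r ys \<otimes> inv (word_prod W (rev ys)) = r"
    using assms inv_word_prod[of ys, symmetric] by (simp add: m_assoc inv_solve_left')
  have "\<not> refl_parity (zs @ rev ys) (?r ys)"
    if "zs \<in> lists S" "word_prod W zs = word_prod W ys" for zs
    using cox_eq_refl_parity[OF word_prod_eq_imp_cox_eq[OF that(1) assms(2) that(2)], of "?r ys"]
      assms that by auto
  from this[OF assms(1,3)] this[OF assms(2) HOL.refl] show ?thesis
    unfolding refl_parity_append[OF assms(1) rev r'] refl_parity_append[OF assms(2) rev r'] conj
    by blast
qed

text \<open>An odd count is positive, so some letter gives rise to \<open>r\<close>, and
  multiplication by \<open>r\<close> on the right removes just that letter.\<close>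

lemma deletion:
  assumes "xs \<in> lists S" "r \<in> carrier W" "refl_parity xs r"
  shows "\<exists>us s vs. xs = us @ s # vs \<and> word_prod W xs \<otimes> r = word_prod W (us @ vs)"
  using assms(1,3)
proof (induction xs)
  case (Cons s xs)
  show ?case
  proof (cases "word_prod W xs \<otimes> r \<otimes> inv (word_prod W xs) = s")
    case True
    then have "word_prod W xs \<otimes> r = s \<otimes> word_prod W xs"
      using Cons assms(2) by (metis in_lists_conv_set inv_solve_right list.set_intros(1) m_closed
          gens_closed word_prod_closed)
    then have "word_prod W (s # xs) \<otimes> r = word_prod W ([] @ xs)"
      using Cons assms(2) by (simp add: m_assoc)
    then show ?thesis by blast
  next
    case False
    then obtain us s' vs where us: "xs = us @ s' # vs" "word_prod W xs \<otimes> r = word_prod W (us @ vs)"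
      using Cons by auto
    then have "word_prod W (s # xs) \<otimes> r = word_prod W ((s # us) @ vs)"
      using Cons.hyps assms(2) by (simp add: m_assoc)
    then show ?thesis using us by (metis append_Cons)
  qed
qed simp

lemma reflections_closed: "r \<in> reflections \<Longrightarrow> r \<in> carrier W"
  unfolding reflections_def by auto

lemma reflection_square: "r \<in> reflections \<Longrightarrow> r \<otimes> r = \<one>"
proof -
  assume "r \<in> reflections"
  then obtain g s where r: "r = g \<otimes> s \<otimes> inv g" "g \<in> carrier W" "s \<in> S"
    unfolding reflections_def by auto
  then show ?thesis by (simp add: m_assoc)
qed

text \<open>The palindrome \<open>u @ [s] @ rev u\<close> for \<open>r\<close> is odd at
  \<open>r\<close>: its two halves contribute equally and the middle letter counts once. By the
  cocycle identity, multiplication by \<open>r\<close> then flips the parity.\<close>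

lemma refl_parity_reflection:
  assumes "xs \<in> lists S" "ys \<in> lists S" "r \<in> reflections" "word_prod W ys = word_prod W xs \<otimes> r"
  shows "refl_parity ys r \<longleftrightarrow> \<not> refl_parity xs r"
proof -
  obtain g s where g: "r = g \<otimes> s \<otimes> inv g" "g \<in> carrier W" "s \<in> S"
    using assms(3) unfolding reflections_def by auto
  obtain u where u: "u \<in> lists S" "word_prod W u = g"
    using ex_word[OF g(2)] by auto
  have rc: "r \<in> carrier W" using assms(3) by (rule reflections_closed)
  have wrev: "word_prod W (rev u) = inv g" "rev u \<in> lists S"
    using inv_word_prod u by auto
  have wr: "word_prod W (u @ [s] @ rev u) = r"
    using u g wrev by (simp add: word_prod_append m_assoc)
  have conj: "inv g \<otimes> r \<otimes> inv (inv g) = s"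
    using g by (simp add: m_assoc inv_solve_left')
  have "\<not> refl_parity (u @ rev u) r"
    using refl_parity_word_cong[of "u @ rev u" "[]" r] u wrev rc g by (simp add: word_prod_append)
  then have "refl_parity (rev u) r \<longleftrightarrow> refl_parity u s"
    using refl_parity_append[of u "rev u" r] u wrev rc conj by simp
  moreover have "refl_parity (u @ ([s] @ rev u)) r \<longleftrightarrow>
      refl_parity ([s] @ rev u) r \<noteq> refl_parity u (s \<otimes> inv g \<otimes> r \<otimes> inv (s \<otimes> inv g))"
    using refl_parity_append[of u "[s] @ rev u" r] u wrev rc g by simp
  moreover have "s \<otimes> inv g \<otimes> r \<otimes> inv (s \<otimes> inv g) = s \<otimes> (inv g \<otimes> r \<otimes> inv (inv g)) \<otimes> s"
    using g rc by (simp add: m_assoc inv_mult_group)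
  moreover have "\<dots> = s"
    unfolding conj using g by simp
  moreover have "refl_parity ([s] @ rev u) r \<longleftrightarrow> \<not> refl_parity (rev u) r"
    using conj wrev by simp
  ultimately have R: "refl_parity (u @ [s] @ rev u) r" by simp
  have "word_prod W ys = word_prod W (xs @ (u @ [s] @ rev u))"
    using assms wr u g by (simp add: word_prod_append)
  then have "refl_parity ys r \<longleftrightarrow> refl_parity (xs @ (u @ [s] @ rev u)) r"
    using assms u wrev g rc by (intro refl_parity_word_cong) auto
  also have "\<dots> \<longleftrightarrow> True \<noteq> refl_parity xs (r \<otimes> r \<otimes> inv r)"
    using refl_parity_append[of xs "u @ [s] @ rev u" r] assms u g rc R wr by auto
  also have "r \<otimes> r \<otimes> inv r = r"
    using rc by (simp add: m_assoc)
  finally show ?thesis by simp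
qed

text \<open>Odd parity allows a deletion in a reduced word. If the parity at \<open>r\<close> is
  even for w, it is odd for wr, so the step from wr back to w is the one that shortens.\<close>

lemma len_mult_reflection_iff:
  assumes "xs \<in> lists S" "r \<in> reflections"
  shows "len (word_prod W xs \<otimes> r) < len (word_prod W xs) \<longleftrightarrow> refl_parity xs r"
proof -
  have less: "len (word_prod W zs \<otimes> r) < len (word_prod W zs)"
    if zs: "zs \<in> lists S" and p: "refl_parity zs r" for zs
  proof -
    obtain ys where ys: "ys \<in> lists S" "length ys = len (word_prod W zs)" "word_prod W ys = word_prod W zs"
      using ex_reduced_word[OF word_prod_closed[OF zs]] .
    then have "refl_parity ys r"
      using refl_parity_word_cong[OF ys(1) zs ys(3)] p reflections_closed[OF assms(2)] by simp
    then obtain us s vs where "ys = us @ s # vs" "word_prod W ys \<otimes> r = word_prod W (us @ vs)"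
      using deletion ys reflections_closed[OF assms(2)] by blast
    then show ?thesis
      using len_le_length[of "us @ vs"] ys by auto
  qed
  show ?thesis
  proof
    assume lt: "len (word_prod W xs \<otimes> r) < len (word_prod W xs)"
    show "refl_parity xs r"
    proof (rule ccontr)
      assume n: "\<not> refl_parity xs r"
      obtain ys where ys: "ys \<in> lists S" "word_prod W ys = word_prod W xs \<otimes> r"
        using ex_word[of "word_prod W xs \<otimes> r"] assms reflections_closed by auto
      then have "refl_parity ys r"
        using refl_parity_reflection[OF assms(1) ys(1) assms(2) ys(2)] n by simp
      moreover have "word_prod W ys \<otimes> r = word_prod W xs"
        using ys(2) assms reflection_square[OF assms(2)] reflections_closed[OF assms(2)]
        by (simp add: m_assoc)
      ultimately show False
        using less[OF ys(1)] lt ys(2) by simp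
    qed
  qed (use less assms in auto)
qed

lemma strong_exchange:
  assumes "xs \<in> lists S" "r \<in> reflections" "len (word_prod W xs \<otimes> r) < len (word_prod W xs)"
  obtains us s vs where "xs = us @ s # vs" "word_prod W xs \<otimes> r = word_prod W (us @ vs)"
  using deletion[OF assms(1)] len_mult_reflection_iff[OF assms(1,2)] reflections_closed[OF assms(2)] assms(3)
  by blast

lemma conj_reflection: "\<lbrakk>s \<in> S; w \<in> carrier W\<rbrakk> \<Longrightarrow> inv w \<otimes> s \<otimes> w \<in> reflections"
  unfolding reflections_def by (rule CollectI, rule exI[of _ "inv w"], rule exI[of _ s]) simp

lemma mult_conj_gen: "\<lbrakk>s \<in> S; w \<in> carrier W\<rbrakk> \<Longrightarrow> w \<otimes> (inv w \<otimes> s \<otimes> w) = s \<otimes> w"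
  by (simp add: m_assoc)

text \<open>The case of \<open>strong_exchange\<close> with the reflection w^-1 s w, since sw =
  w(w^-1 s w).\<close>

lemma exchange:
  assumes "xs \<in> lists S" "s \<in> S" "dl s (word_prod W xs)"
  obtains us u vs where "xs = us @ u # vs" "s \<otimes> word_prod W xs = word_prod W (us @ vs)"
proof (rule strong_exchange[OF assms(1)])
  show "inv (word_prod W xs) \<otimes> s \<otimes> word_prod W xs \<in> reflections"
    using assms by (intro conj_reflection) auto
  then show "len (word_prod W xs \<otimes> (inv (word_prod W xs) \<otimes> s \<otimes> word_prod W xs)) < len (word_prod W xs)"
    using assms by (simp add: mult_conj_gen dl_def)
  fix us u vs assume *: "xs = us @ u # vs"
    "word_prod W xs \<otimes> (inv (word_prod W xs) \<otimes> s \<otimes> word_prod W xs) = word_prod W (us @ vs)"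
  from *(2) have "s \<otimes> word_prod W xs = word_prod W (us @ vs)"
    by (metis assms(1,2) mult_conj_gen word_prod_closed)
  with *(1) show thesis using that by blast
qed

end

section \<open>The order of a product of two generators\<close>

context coxeter_system
begin

text \<open>The action of \<open>W\<close> on the dual of its geometric representation (the ``numbers game'').\<close>

definition edge_weight :: "'w \<Rightarrow> 'w \<Rightarrow> real" where
  "edge_weight s t = (case cox_mat W s t of enat m \<Rightarrow> 2 * cos (pi / m) | \<infinity> \<Rightarrow> 2)"

definition fire :: "'w \<Rightarrow> ('w \<Rightarrow> real) \<Rightarrow> 'w \<Rightarrow> real" where
  "fire s f = (\<lambda>r. f r + edge_weight s r * f s)"

text \<open>As m(s,s) = 1, the general weight is 2 cos \<pi> = -2, so the one formula for
  \<open>fire\<close> also negates the value at the fired vertex.\<close>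

lemma edge_weight_self: "s \<in> S \<Longrightarrow> edge_weight s s = - 2"
  by (simp add: edge_weight_def mat_diag one_enat_def)

lemma edge_weight_sym: "\<lbrakk>s \<in> S; t \<in> S\<rbrakk> \<Longrightarrow> edge_weight s t = edge_weight t s"
  by (simp add: edge_weight_def mat_sym)

text \<open>\<open>a n\<close> is the value at the vertex fired in move n, counted from 0;
  \<open>t\<close> fires first because \<open>foldr\<close> starts at the right end. The fired
  values obey a three-term recurrence, and every other vertex accumulates them with its edge
  weights.\<close>

lemma fire_alternating:
  assumes "s \<in> S" "t \<in> S" "s \<noteq> t"
    and a: "a 0 = f t" "a (Suc 0) = f s + edge_weight s t * f t"
      "\<And>n. a (Suc (Suc n)) = edge_weight s t * a (Suc n) - a n"
  defines "g \<equiv> \<lambda>j. foldr fire (concat (replicate j [s, t])) f"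
  shows "g j t = a (2 * j) \<and> g j s = a (Suc (2 * j)) - edge_weight s t * a (2 * j) \<and>
    (\<forall>r. r \<noteq> s \<and> r \<noteq> t \<longrightarrow>
      g j r = f r + edge_weight t r * (\<Sum>i<j. a (2 * i)) + edge_weight s r * (\<Sum>i<j. a (Suc (2 * i))))"
proof (induction j)
  case 0
  show ?case using a by (simp add: g_def)
next
  case (Suc j)
  have g: "g (Suc j) = fire s (fire t (g j))"
    by (simp add: g_def)
  have w: "edge_weight t s = edge_weight s t" "edge_weight t t = - 2" "edge_weight s s = - 2"
    using assms edge_weight_self edge_weight_sym by auto
  have ft: "fire t (g j) t = - a (2 * j)" "fire t (g j) s = a (Suc (2 * j))"
    using Suc w by (auto simp: fire_def)
  have "g (Suc j) t = a (2 * Suc j)"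
    unfolding g fire_def[of s] ft using a(3)[of "2 * j"] by simp
  moreover have "g (Suc j) s = a (Suc (2 * Suc j)) - edge_weight s t * a (2 * Suc j)"
    unfolding g fire_def[of s] ft w using a(3)[of "Suc (2 * j)"] by simp
  moreover have "g (Suc j) r = f r + edge_weight t r * (\<Sum>i<Suc j. a (2 * i))
      + edge_weight s r * (\<Sum>i<Suc j. a (Suc (2 * i)))" if "r \<noteq> s \<and> r \<noteq> t" for r
    unfolding g fire_def[of s] ft using Suc that by (simp add: fire_def algebra_simps)
  ultimately show ?case by blast
qed

text \<open>The angles are spaced evenly over a full turn; multiplied by 2 sin \<theta> the sum
  telescopes.\<close>

lemma sin_arith_sum:
  assumes "\<theta> = pi / real m" "m \<ge> 2"
  shows "(\<Sum>i<m. sin (2 * real i * \<theta> + \<phi>)) = 0"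
proof -
  have pos: "sin \<theta> > 0"
    unfolding assms(1) using assms(2) by (intro sin_gt_zero) (auto simp: field_simps)
  have "2 * sin \<theta> * (\<Sum>i<j. sin (2 * real i * \<theta> + \<phi>)) = cos (\<phi> - \<theta>) - cos (2 * real j * \<theta> + \<phi> - \<theta>)" for j :: nat
  proof (induction j)
    case (Suc j)
    have "2 * sin \<theta> * sin (2 * real j * \<theta> + \<phi>) =
        cos (2 * real j * \<theta> + \<phi> - \<theta>) - cos (2 * real j * \<theta> + \<phi> + \<theta>)"
      by (simp add: cos_diff cos_add)
    moreover have "2 * real (Suc j) * \<theta> + \<phi> - \<theta> = 2 * real j * \<theta> + \<phi> + \<theta>"
      by (simp add: algebra_simps)
    ultimately show ?case
      using Suc by (simp only: sum.lessThan_Suc distrib_left)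
  qed simp
  from this[of m] have "2 * sin \<theta> * (\<Sum>i<m. sin (2 * real i * \<theta> + \<phi>)) =
      cos (\<phi> - \<theta>) - cos (2 * pi + (\<phi> - \<theta>))"
    using assms by (simp add: algebra_simps)
  then show ?thesis
    using pos by (simp add: cos_add)
qed

lemma sin_recurrence:
  "sin (real (Suc (Suc n)) * \<theta> + \<phi>) = 2 * cos \<theta> * sin (real (Suc n) * \<theta> + \<phi>) - sin (real n * \<theta> + \<phi>)"
proof -
  have "real (Suc (Suc n)) * \<theta> + \<phi> = (real (Suc n) * \<theta> + \<phi>) + \<theta>"
    "real n * \<theta> + \<phi> = (real (Suc n) * \<theta> + \<phi>) - \<theta>"
    by (simp_all add: algebra_simps)
  then show ?thesis
    by (simp only: sin_add sin_diff) (simp add: algebra_simps)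
qed

lemma fire_relator:
  assumes "s \<in> S" "t \<in> S" "cox_mat W s t = enat m"
  shows "foldr fire (concat (replicate m [s, t])) f = f"
proof (cases "s = t")
  case True
  have "m = 1"
    using assms mat_diag True by (simp add: one_enat_def)
  then show ?thesis
    using True assms edge_weight_self by (auto simp: fire_def algebra_simps)
next
  case False
  define \<theta> where "\<theta> = pi / real m"
  have m2: "m \<ge> 2"
    using mat_off_diag[of s t] assms False by (simp add: numeral_eq_enat)
  have ew: "edge_weight s t = 2 * cos \<theta>"
    using assms by (simp add: edge_weight_def \<theta>_def)
  have pos: "sin \<theta> > 0"
    using m2 unfolding \<theta>_def by (intro sin_gt_zero) (auto simp: field_simps)
  \<comment> \<open>The recurrence with weight 2 cos \<theta> is solved by sin(n\<theta> + \<phi>)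
    for every phase; \<open>x\<close> and \<open>y\<close> fit a combination of the phases 0 and
    -\<theta> to the two initial values.\<close>
  define x y where "x = (f s + edge_weight s t * f t) / sin \<theta>" and "y = f t / sin \<theta>"
  define a where "a n = x * sin (real n * \<theta> + 0) - y * sin (real n * \<theta> + - \<theta>)" for n
  have a: "a 0 = f t" "a (Suc 0) = f s + edge_weight s t * f t"
    using pos by (simp_all add: a_def x_def y_def)
  have rec: "a (Suc (Suc n)) = edge_weight s t * a (Suc n) - a n" for n
    unfolding a_def ew sin_recurrence by (simp add: algebra_simps)
  have per: "a (n + 2 * m) = a n" for n
  proof -
    have "real (n + 2 * m) * \<theta> + \<psi> = (real n * \<theta> + \<psi>) + 2 * pi" for \<psi>
      using m2 by (simp add: \<theta>_def field_simps)
    then show ?thesis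
      unfolding a_def by (simp only: sin_periodic)
  qed
  have sum0: "(\<Sum>i<m. a (2 * i)) = 0"
    using sin_arith_sum[OF \<theta>_def m2, of 0] sin_arith_sum[OF \<theta>_def m2, of "- \<theta>"]
    by (simp add: a_def sum_subtractf sum_distrib_left[symmetric])
  have sum1: "(\<Sum>i<m. a (Suc (2 * i))) = 0"
  proof -
    have "a (Suc (2 * i)) = x * sin (2 * real i * \<theta> + \<theta>) - y * sin (2 * real i * \<theta> + 0)" for i
      by (simp add: a_def algebra_simps)
    then show ?thesis
      using sin_arith_sum[OF \<theta>_def m2, of 0] sin_arith_sum[OF \<theta>_def m2, of \<theta>]
      by (simp add: sum_subtractf sum_distrib_left[symmetric])
  qed
  have "foldr fire (concat (replicate m [s, t])) f r = f r" for r
    using fire_alternating[of s t a f m, OF assms(1,2) False a rec] sum0 sum1 per[of 0] per[of 1] a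
    by (cases "r = s"; cases "r = t") auto
  then show ?thesis by blast
qed

lemma cox_eq_fire: "cox_eq W xs ys \<Longrightarrow> foldr fire xs f = foldr fire ys f"
proof (induction rule: cox_eq.induct)
  case (relator s t k xs ys)
  then show ?case by (simp add: fire_relator)
qed auto

text \<open>With \<open>relator_pow\<close> this shows that st has order exactly m(s,t): the action
  on functions already separates the powers from the identity.\<close>

lemma pow_neq_one:
  assumes "s \<in> S" "t \<in> S" "s \<noteq> t" "0 < k" "enat k < cox_mat W s t"
  shows "(s \<otimes> t) [^] k \<noteq> \<one>"
proof
  assume "(s \<otimes> t) [^] k = \<one>"
  then have eq: "foldr fire (concat (replicate k [s, t])) f = f" for f
    using presentation[of "concat (replicate k [s, t])"] cox_eq_fire[of "concat (replicate k [s, t])" "[]"] assms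
    by (simp add: word_prod_replicate)
  \<comment> \<open>Starting from the indicator of \<open>s\<close>, the fired values are n for
    weight 2 and sin(n\<theta>)/sin \<theta> for finite m. A return to the start after 2k moves
    would force k = 0 or cos(2k\<theta>) = 1.\<close>
  define f where "f = (\<lambda>r. if r = s then 1 else 0 :: real)"
  show False
  proof (cases "cox_mat W s t")
    case infinity
    then have "edge_weight s t = 2" by (simp add: edge_weight_def)
    then show False
      using fire_alternating[of s t real f k] assms eq[of f] by (simp add: f_def)
  next
    case (enat m)
    define \<theta> where "\<theta> = pi / real m"
    have m2: "m \<ge> 2" and km: "k < m"
      using mat_off_diag[of s t] assms enat by (simp_all add: numeral_eq_enat)
    have ew: "edge_weight s t = 2 * cos \<theta>"
      using enat by (simp add: edge_weight_def \<theta>_def)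
    have pos: "sin \<theta> > 0"
      using m2 unfolding \<theta>_def by (intro sin_gt_zero) (auto simp: field_simps)
    have pos2: "sin (real k * \<theta>) > 0"
      using km assms unfolding \<theta>_def by (intro sin_gt_zero) (auto simp: field_simps)
    define a where "a n = sin (real n * \<theta> + 0) / sin \<theta>" for n
    have a0: "a 0 = f t" "a (Suc 0) = f s + edge_weight s t * f t"
      using pos assms by (simp_all add: a_def f_def)
    have rec: "a (Suc (Suc n)) = edge_weight s t * a (Suc n) - a n" for n
      unfolding a_def ew sin_recurrence by (simp add: diff_divide_distrib)
    have "a (2 * k) = 0" "a (Suc (2 * k)) = 1"
      using fire_alternating[of s t a f k, OF assms(1-3) a0 rec] eq[of f] assms by (auto simp: f_def)
    then have "sin (2 * (real k * \<theta>)) = 0" "sin (2 * (real k * \<theta>) + \<theta>) = sin \<theta>"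
      using pos by (simp_all add: a_def algebra_simps)
    then have "cos (2 * (real k * \<theta>)) = 1"
      using pos by (simp add: sin_add)
    then show False
      using pos2 by (simp add: cos_double_sin)
  qed
qed

end

section \<open>Dihedral subgroups\<close>

fun alternating :: "'a \<Rightarrow> 'a \<Rightarrow> nat \<Rightarrow> 'a list" where
  "alternating s t 0 = []"
| "alternating s t (Suc k) = s # alternating t s k"

lemma length_alternating [simp]: "length (alternating s t k) = k"
  by (induction s t k rule: alternating.induct) auto

lemma set_alternating: "set (alternating s t k) \<subseteq> {s, t}"
  by (induction s t k rule: alternating.induct) auto

lemma alternating_add:
  "alternating s t (j + k) = alternating s t j @ (if even j then alternating s t k else alternating t s k)"
  by (induction s t j rule: alternating.induct) auto

lemma alternating_snoc:
  "alternating s t (Suc k) = alternating s t k @ [if even k then s else t]"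
  using alternating_add[of s t k 1] by simp

lemma rev_alternating:
  "rev (alternating s t k) = (if odd k then alternating s t k else alternating t s k)"
proof (induction k arbitrary: s t)
  case (Suc k)
  show ?case
    using Suc[of s t] alternating_snoc[of s t k] alternating_snoc[of t s k] by auto
qed simp

context coxeter_system
begin

text \<open>Here the leftmost factor is fixed, whereas \<open>alt_left\<close> fixes the rightmost
  one. Putting a letter in front then just exchanges the roles of \<open>s\<close> and
  \<open>t\<close>.\<close>

definition al :: "'w \<Rightarrow> 'w \<Rightarrow> nat \<Rightarrow> 'w" where
  "al s t k = word_prod W (alternating s t k)"

lemma al_0 [simp]: "al s t 0 = \<one>"
  by (simp add: al_def)

lemma al_Suc: "al s t (Suc k) = s \<otimes> al t s k"
  by (simp add: al_def)

lemma alternating_lists: "\<lbrakk>s \<in> S; t \<in> S\<rbrakk> \<Longrightarrow> alternating s t k \<in> lists S"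
  using set_alternating[of s t k] by auto

lemma al_closed [simp]: "\<lbrakk>s \<in> S; t \<in> S\<rbrakk> \<Longrightarrow> al s t k \<in> carrier W"
  unfolding al_def by (rule word_prod_closed[OF alternating_lists])

lemma al_add:
  "\<lbrakk>s \<in> S; t \<in> S\<rbrakk> \<Longrightarrow> al s t (j + k) = al s t j \<otimes> (if even j then al s t k else al t s k)"
  unfolding al_def alternating_add
  by (simp add: word_prod_append[OF alternating_lists alternating_lists])

lemma inv_al: "\<lbrakk>s \<in> S; t \<in> S\<rbrakk> \<Longrightarrow> inv (al s t k) = (if odd k then al s t k else al t s k)"
  unfolding al_def by (simp add: inv_word_prod[OF alternating_lists] rev_alternating)

lemma al_even: "\<lbrakk>s \<in> S; t \<in> S\<rbrakk> \<Longrightarrow> al s t (2 * k) = (s \<otimes> t) [^] k"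
  by (induction k) (auto simp: al_Suc m_assoc[symmetric] nat_pow_Suc2[symmetric] simp del: nat_pow_Suc)

lemma even_len_al: "\<lbrakk>s \<in> S; t \<in> S\<rbrakk> \<Longrightarrow> even (len (al s t k)) \<longleftrightarrow> even k"
  unfolding al_def by (simp add: even_len_word_prod[OF alternating_lists])

text \<open>An odd number of factors is excluded by parity. An even number 2i has 0 < i < k, so the
  product is a power of st with exponent below m(s,t).\<close>

lemma al_neq_one:
  assumes "s \<in> S" "t \<in> S" "s \<noteq> t" "0 < k" "enat k \<le> cox_mat W s t" "k' < k"
  shows "al s t (k + k') \<noteq> \<one>"
proof
  assume eq: "al s t (k + k') = \<one>"
  then have "even (k + k')"
    using even_len_al[of s t "k + k'"] assms by simp
  then obtain i where i: "k + k' = 2 * i" by blast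
  have "i < k" "0 < i" using i assms by auto
  then have "enat i < cox_mat W s t"
    using assms by (metis enat_ord_simps(2) order_less_le_trans)
  then show False
    using pow_neq_one[OF assms(1-3) \<open>0 < i\<close>] eq al_even[OF assms(1,2), of i] i by simp
qed

text \<open>The quotient of two alternating products is again alternating, with k - j factors if
  they start with the same letter and k + j factors if not.\<close>

lemma al_neq:
  assumes "s \<in> S" "t \<in> S" "s \<noteq> t" "j < k" "enat k \<le> cox_mat W s t"
  shows "al s t k \<noteq> al s t j" "al s t k \<noteq> al t s j"
proof -
  note st = assms(1,2)
  show "al s t k \<noteq> al s t j"
  proof
    assume eq: "al s t k = al s t j"
    have "al s t j \<otimes> (if even j then al s t (k - j) else al t s (k - j)) = al s t j"
      using al_add[OF st, of j "k - j"] eq assms by simp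
    then have "(if even j then al s t (k - j) else al t s (k - j)) = \<one>"
      using st l_cancel_one'[of "al s t j"] by auto
    moreover have "0 < k - j" "enat (k - j) \<le> cox_mat W s t" "enat (k - j) \<le> cox_mat W t s"
      using assms mat_sym[of s t] by (auto intro: order_trans[of _ "enat k"])
    ultimately show False
      using al_neq_one[of s t "k - j" 0] al_neq_one[of t s "k - j" 0] assms by (auto split: if_splits)
  qed
  show "al s t k \<noteq> al t s j"
  proof
    assume eq: "al s t k = al t s j"
    have "(if odd j then al t s (j + k) else al s t (j + k)) = inv (al t s j) \<otimes> al s t k"
      using al_add[OF st, of j k] al_add[of t s j k] inv_al[of t s j] st by auto
    also have "\<dots> = \<one>"
      using eq st by simp
    finally show False
      using al_neq_one[of s t k j] al_neq_one[of t s k j] assms mat_sym[of s t]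
      by (auto simp: add.commute split: if_splits)
  qed
qed

text \<open>The relator is an alternating product with 2m factors; cut in the middle, it says that
  one half is the inverse of the other.\<close>

lemma al_braid:
  assumes "s \<in> S" "t \<in> S" "cox_mat W s t = enat m"
  shows "al s t m = al t s m"
proof -
  have "al s t (m + m) = \<one>"
    using al_even[of s t m] relator_pow[of s t m] assms by (simp add: mult_2)
  then have "al s t m = inv (if even m then al s t m else al t s m)"
    using al_add[of s t m m] assms by (intro inv_equality[symmetric]) auto
  then show ?thesis
    using inv_al assms by (auto split: if_splits)
qed

text \<open>The subgroup generated by \<open>s\<close> and \<open>t\<close> (see
  \<open>generate_pair\<close>), given through words so that deletion of letters visibly stays
  inside.\<close>

definition dihedral :: "'w \<Rightarrow> 'w \<Rightarrow> 'w set" where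
  "dihedral s t = word_prod W ` lists {s, t}"

lemma al_in_dihedral [simp]: "al s t k \<in> dihedral s t" "al t s k \<in> dihedral s t"
  unfolding dihedral_def al_def using set_alternating[of s t k] set_alternating[of t s k] by auto

lemma gen_in_dihedral [simp]: "s \<in> S \<Longrightarrow> s \<in> dihedral s t" "t \<in> S \<Longrightarrow> t \<in> dihedral s t"
  using al_in_dihedral(1)[of s t 1] al_in_dihedral(2)[of t s 1] by (simp_all add: al_Suc)

lemma lists_pair: "\<lbrakk>s \<in> S; t \<in> S; xs \<in> lists {s, t}\<rbrakk> \<Longrightarrow> xs \<in> lists S"
  by auto

lemma dihedral_closed: "\<lbrakk>s \<in> S; t \<in> S; g \<in> dihedral s t\<rbrakk> \<Longrightarrow> g \<in> carrier W"
  unfolding dihedral_def by (auto intro!: word_prod_closed)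

lemma dihedral_mult:
  "\<lbrakk>s \<in> S; t \<in> S; g \<in> dihedral s t; h \<in> dihedral s t\<rbrakk> \<Longrightarrow> g \<otimes> h \<in> dihedral s t"
proof -
  assume st: "s \<in> S" "t \<in> S" and gh: "g \<in> dihedral s t" "h \<in> dihedral s t"
  obtain xs ys where "xs \<in> lists {s, t}" "g = word_prod W xs" "ys \<in> lists {s, t}" "h = word_prod W ys"
    using gh unfolding dihedral_def by blast
  then show ?thesis
    unfolding dihedral_def using word_prod_append[of xs ys] lists_pair[OF st]
    by (intro image_eqI[of _ _ "xs @ ys"]) auto
qed

lemma dihedral_inv: "\<lbrakk>s \<in> S; t \<in> S; g \<in> dihedral s t\<rbrakk> \<Longrightarrow> inv g \<in> dihedral s t"
proof -
  assume st: "s \<in> S" "t \<in> S" and g: "g \<in> dihedral s t"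
  obtain xs where xs: "xs \<in> lists {s, t}" "g = word_prod W xs"
    using g unfolding dihedral_def by blast
  then have "inv g = word_prod W (rev xs)"
    using st by (subst xs(2), subst inv_word_prod) auto
  then show ?thesis
    unfolding dihedral_def using xs by auto
qed

lemma dihedral_word:
  assumes "s \<in> S" "t \<in> S" "xs \<in> lists {s, t}"
  shows "\<exists>j \<le> length xs. word_prod W xs = al s t j \<or> word_prod W xs = al t s j"
  using assms(3)
proof (induction xs)
  case Nil
  show ?case by auto
next
  case (Cons x xs)
  then obtain j where j: "j \<le> length xs" "word_prod W xs = al s t j \<or> word_prod W xs = al t s j"
    by auto
  have step: "\<exists>i \<le> Suc (length xs). a \<otimes> word_prod W xs = al a b i \<or> a \<otimes> word_prod W xs = al b a i"
    if ab: "a \<in> S" "b \<in> S" "word_prod W xs = al a b j \<or> word_prod W xs = al b a j" for a b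
  proof -
    consider "word_prod W xs = al b a j" | "word_prod W xs = al a b j" "j \<noteq> 0"
      using ab by (cases j) auto
    then show ?thesis
    proof cases
      case 1
      then have "a \<otimes> word_prod W xs = al a b (Suc j)" by (simp add: al_Suc)
      then show ?thesis using j by auto
    next
      case 2
      then obtain i where "j = Suc i" by (cases j) auto
      then have "a \<otimes> word_prod W xs = al b a i"
        using 2 ab by (simp add: al_Suc)
      then show ?thesis using j \<open>j = Suc i\<close> by (intro exI[of _ i]) auto
    qed
  qed
  from Cons.hyps have "x = s \<or> x = t" by auto
  then show ?case
    using step[of s t] step[of t s] j(2) assms by auto
qed

text \<open>The length inside the dihedral subgroup. Its agreement with \<open>len\<close> is
  contained in \<open>len_coset_minimal\<close>.\<close>

definition dlen :: "'w \<Rightarrow> 'w \<Rightarrow> 'w \<Rightarrow> nat" where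
  "dlen s t g = (LEAST k. g = al s t k \<or> g = al t s k)"

lemma dlen_le: "g = al s t k \<or> g = al t s k \<Longrightarrow> dlen s t g \<le> k"
  unfolding dlen_def by (rule Least_le)

lemma dlen_le_length:
  "\<lbrakk>s \<in> S; t \<in> S; xs \<in> lists {s, t}\<rbrakk> \<Longrightarrow> dlen s t (word_prod W xs) \<le> length xs"
  using dihedral_word[of s t xs] dlen_le by (meson order_trans)

lemma dlen_witness:
  assumes "s \<in> S" "t \<in> S" "g \<in> dihedral s t"
  shows "g = al s t (dlen s t g) \<or> g = al t s (dlen s t g)"
proof -
  have "\<exists>k. g = al s t k \<or> g = al t s k"
    using assms dihedral_word[of s t] unfolding dihedral_def by blast
  then show ?thesis
    unfolding dlen_def by (rule LeastI_ex)
qed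

lemma dlen_al:
  assumes "s \<in> S" "t \<in> S" "s \<noteq> t" "enat k \<le> cox_mat W s t"
  shows "dlen s t (al s t k) = k"
  using dlen_witness[OF assms(1,2) al_in_dihedral(1)] al_neq[OF assms(1-3) _ assms(4)]
    dlen_le[of "al s t k" s t k] by (metis le_neq_implies_less)

lemma dlen_mult_gen_le:
  assumes "s \<in> S" "t \<in> S" "g \<in> dihedral s t" "a = s \<or> a = t"
  shows "dlen s t (a \<otimes> g) \<le> Suc (dlen s t g)"
proof -
  define k where "k = dlen s t g"
  have "g = word_prod W (alternating s t k) \<or> g = word_prod W (alternating t s k)"
    using dlen_witness[OF assms(1-3)] by (simp add: al_def k_def)
  then obtain xs where xs: "xs \<in> lists {s, t}" "length xs = k" "g = word_prod W xs"
    using set_alternating[of s t k] set_alternating[of t s k] length_alternating by (metis in_lists_conv_set insert_commute subsetD)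
  have "dlen s t (word_prod W (a # xs)) \<le> length (a # xs)"
    using xs assms by (intro dlen_le_length) auto
  then show ?thesis
    using xs by (simp add: k_def)
qed

text \<open>In an alternating word with more than m letters, turning m consecutive letters around by
  the braid relation makes two equal letters meet, so the word was not shortest.\<close>

lemma dlen_le_cox_mat:
  assumes "s \<in> S" "t \<in> S" "g \<in> dihedral s t"
  shows "enat (dlen s t g) \<le> cox_mat W s t"
proof (cases "cox_mat W s t")
  case (enat m)
  define k where "k = dlen s t g"
  have long: False if mk: "m < k" and st: "{a, b} = {s, t}" and g: "g = al a b k" for a b
  proof -
    have ab: "a \<in> S" "b \<in> S" using st assms by (auto simp: doubleton_eq_iff)
    have m: "cox_mat W a b = enat m"
      using st enat mat_sym[of s t] assms by (auto simp: doubleton_eq_iff)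
    have m0: "m \<noteq> 0"
    proof
      assume "m = 0"
      then have "cox_mat W a b = 0" using m by (simp add: zero_enat_def)
      then show False
        using mat_diag[of a] mat_off_diag[of a b] ab by (cases "a = b") auto
    qed
    then obtain m' where m': "m = Suc m'" by (cases m) auto
    define xs where "xs = (if even (Suc m) then alternating a b (k - Suc m) else alternating b a (k - Suc m))"
    have xs: "set xs \<subseteq> {s, t}" "length xs = k - Suc m"
      using set_alternating[of a b "k - Suc m"] set_alternating[of b a "k - Suc m"] st
      by (auto simp: xs_def split: if_splits)
    have "al a b (Suc m) = a \<otimes> al a b m"
      using al_braid[OF ab m] by (simp add: al_Suc)
    then have *: "al a b (Suc m) = al b a m'"
      using ab by (simp add: m' al_Suc)
    have "g = al a b (Suc m + (k - Suc m))"
      using g mk by simp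
    also have "\<dots> = al a b (Suc m) \<otimes> word_prod W xs"
      unfolding xs_def if_distrib[of "word_prod W"] al_def[symmetric] by (rule al_add[OF ab])
    also have "\<dots> = word_prod W (alternating b a m' @ xs)"
      unfolding * unfolding al_def using alternating_lists[OF ab(2,1), of m'] xs st assms
      by (subst word_prod_append) auto
    finally have "g = word_prod W (alternating b a m' @ xs)" .
    moreover have "alternating b a m' @ xs \<in> lists {s, t}"
      using set_alternating[of b a m'] xs st by auto
    ultimately have "dlen s t g \<le> length (alternating b a m' @ xs)"
      using dlen_le_length assms by blast
    then show False
      using xs mk m' by (auto simp: k_def)
  qed
  show ?thesis
  proof (rule ccontr)
    assume "\<not> enat (dlen s t g) \<le> cox_mat W s t"
    then have "m < k" using enat by (simp add: k_def)
    then show False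
      using dlen_witness[OF assms] long[of s t] long[of t s] unfolding k_def by blast
  qed
qed simp

section \<open>Minimal representatives of dihedral cosets\<close>

definition coset_minimal :: "'w \<Rightarrow> 'w \<Rightarrow> 'w \<Rightarrow> bool" where
  "coset_minimal s t z \<longleftrightarrow> z \<in> carrier W \<and> (\<forall>g \<in> dihedral s t. len z \<le> len (g \<otimes> z))"

text \<open>Letters are put in front of \<open>z\<close> one at a time. If one of them shortened the
  product, exchange would delete a letter either of the dihedral word, against the minimality of
  \<open>dlen\<close>, or of a reduced word of \<open>z\<close>, against the minimality of
  \<open>z\<close> in its coset.\<close>

lemma len_coset_minimal:
  assumes "s \<in> S" "t \<in> S" "coset_minimal s t z" "g \<in> dihedral s t"
  shows "len (g \<otimes> z) = dlen s t g + len z"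
  using assms(4)
proof (induction "dlen s t g" arbitrary: g)
  case 0
  then have "g = \<one>"
    using dlen_witness[of s t g] assms by auto
  then show ?case using 0 assms by (simp add: coset_minimal_def)
next
  case (Suc k)
  note st = assms(1,2)
  have z: "z \<in> carrier W" using assms by (simp add: coset_minimal_def)
  obtain a b where ab: "{a, b} = {s, t}" "g = al a b (Suc k)"
    using dlen_witness[OF assms(1,2) Suc.prems] Suc.hyps(2) by (metis insert_commute)
  have abS: "a \<in> S" "b \<in> S" using ab st by (auto simp: doubleton_eq_iff)
  define g' where "g' = al b a k"
  have g': "g' \<in> dihedral s t" "g' \<in> carrier W" "g = a \<otimes> g'"
    using ab abS by (auto simp: g'_def al_Suc doubleton_eq_iff)
  have "dlen s t g' \<le> k"
    using ab by (intro dlen_le) (auto simp: g'_def doubleton_eq_iff)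
  moreover have "Suc k \<le> Suc (dlen s t g')"
    using dlen_mult_gen_le[OF st g'(1), of a] ab Suc.hyps(2) g'(3) by (auto simp: doubleton_eq_iff)
  ultimately have IH: "len (g' \<otimes> z) = k + len z"
    using Suc.hyps(1)[of g'] g' by simp
  have "\<not> dl a (g' \<otimes> z)"
  proof
    assume dl: "dl a (g' \<otimes> z)"
    obtain zs where zs: "zs \<in> lists S" "length zs = len z" "word_prod W zs = z"
      using ex_reduced_word[OF z] .
    have wp: "word_prod W (alternating b a k @ zs) = g' \<otimes> z" "alternating b a k @ zs \<in> lists S"
      using zs alternating_lists[OF abS(2,1), of k] abS by (auto simp: word_prod_append g'_def al_def)
    obtain us u vs where del: "alternating b a k @ zs = us @ u # vs"
      "a \<otimes> (g' \<otimes> z) = word_prod W (us @ vs)"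
      using exchange[of "alternating b a k @ zs" a] wp dl abS by metis
    have gz: "g \<otimes> z = word_prod W (us @ vs)"
      using del g' z abS by (simp add: m_assoc)
    from del(1) consider qs where "alternating b a k = us @ u # qs" "vs = qs @ zs"
      | qs where "zs = qs @ u # vs" "us = alternating b a k @ qs"
      by (auto simp: append_eq_append_conv2 append_eq_Cons_conv Cons_eq_append_conv)
    then show False
    proof cases
      case 1
      have us: "us @ qs \<in> lists {s, t}" "Suc (length (us @ qs)) = k"
        using set_alternating[of b a k] 1 ab length_alternating[of b a k] by (auto simp: doubleton_eq_iff)
      then have usS: "us @ qs \<in> lists S" using st by auto
      have "g \<otimes> z = word_prod W (us @ qs) \<otimes> z"
        using gz 1 usS zs word_prod_append[of "us @ qs" zs] by auto
      then have "g = word_prod W (us @ qs)"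
        using z g' abS usS by auto
      then have "dlen s t g \<le> length (us @ qs)"
        using dlen_le_length[OF st us(1)] by simp
      then show False using us Suc.hyps(2) by simp
    next
      case 2
      have qv: "qs @ vs \<in> lists S" using zs 2 by auto
      have "word_prod W (us @ vs) = g' \<otimes> word_prod W (qs @ vs)"
        using 2 qv word_prod_append[OF alternating_lists[OF abS(2,1)], of "qs @ vs"]
        by (auto simp: g'_def al_def)
      then have "inv g' \<otimes> g \<otimes> z = word_prod W (qs @ vs)"
        using gz g' z abS qv by (simp add: m_assoc)
      moreover have "inv g' \<otimes> g \<in> dihedral s t"
        using dihedral_mult dihedral_inv st g' Suc.prems by auto
      ultimately have "len z \<le> len (word_prod W (qs @ vs))"
        using assms(3) unfolding coset_minimal_def by metis
      also have "\<dots> \<le> length (qs @ vs)"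
        using len_le_length qv by blast
      finally show False using zs 2 by simp
    qed
  qed
  then have "len (a \<otimes> (g' \<otimes> z)) = Suc (k + len z)"
    using len_up[of a "g' \<otimes> z"] IH abS g' z by simp
  then show ?case
    using g' z abS Suc.hyps(2) by (simp add: m_assoc)
qed

lemma coset_decomposition:
  assumes "s \<in> S" "t \<in> S" "w \<in> carrier W"
  obtains g z where "g \<in> dihedral s t" "coset_minimal s t z" "w = g \<otimes> z"
proof -
  define h where "h = arg_min (\<lambda>h. len (h \<otimes> w)) (\<lambda>h. h \<in> dihedral s t)"
  have one: "\<one> \<in> dihedral s t"
    using al_in_dihedral[of s t 0] by simp
  have h: "h \<in> dihedral s t" and min: "\<And>g. g \<in> dihedral s t \<Longrightarrow> len (h \<otimes> w) \<le> len (g \<otimes> w)"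
    unfolding h_def using arg_min_natI[of "\<lambda>h. h \<in> dihedral s t" \<one> "\<lambda>h. len (h \<otimes> w)"]
      arg_min_nat_le[of "\<lambda>h. h \<in> dihedral s t" _ "\<lambda>h. len (h \<otimes> w)"] one by auto
  have hc: "h \<in> carrier W" using dihedral_closed assms h by blast
  have "coset_minimal s t (h \<otimes> w)"
    unfolding coset_minimal_def
  proof (intro conjI ballI)
    fix g assume g: "g \<in> dihedral s t"
    then have "g \<in> carrier W" using dihedral_closed assms by blast
    then show "len (h \<otimes> w) \<le> len (g \<otimes> (h \<otimes> w))"
      using min[of "g \<otimes> h"] dihedral_mult[OF assms(1,2) g h] hc assms by (simp add: m_assoc)
  qed (use hc assms in simp)
  moreover have "w = inv h \<otimes> (h \<otimes> w)"
    using hc assms by simp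
  ultimately show ?thesis
    using that dihedral_inv[OF assms(1,2) h] by blast
qed

text \<open>If the dihedral part of \<open>z\<close> were nontrivial, its first letter would be a
  descent of \<open>z\<close>.\<close>

lemma coset_minimalI:
  assumes "s \<in> S" "t \<in> S" "z \<in> carrier W" "\<not> dl s z" "\<not> dl t z"
  shows "coset_minimal s t z"
proof -
  obtain g z' where g: "g \<in> dihedral s t" "coset_minimal s t z'" "z = g \<otimes> z'"
    using coset_decomposition[OF assms(1-3)] .
  have z': "z' \<in> carrier W" using g by (simp add: coset_minimal_def)
  show ?thesis
  proof (cases "dlen s t g")
    case 0
    then have "g = \<one>" using dlen_witness[OF assms(1,2) g(1)] by auto
    then show ?thesis using g z' by simp
  next
    case (Suc k)
    then obtain a b where ab: "{a, b} = {s, t}" "g = al a b (Suc k)"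
      using dlen_witness[OF assms(1,2) g(1)] by (metis insert_commute)
    have abS: "a \<in> S" "b \<in> S" using ab assms by (auto simp: doubleton_eq_iff)
    have "a \<otimes> z = al b a k \<otimes> z'"
      using g ab abS z' by (simp add: al_Suc m_assoc)
    moreover have "al b a k \<in> dihedral s t" "dlen s t (al b a k) \<le> k"
      using ab by (auto simp: doubleton_eq_iff intro!: dlen_le)
    ultimately have "len (a \<otimes> z) < len z"
      using len_coset_minimal[OF assms(1,2) g(2)] g(1,3) Suc by simp
    then have "dl a z" by (simp add: dl_def)
    then show ?thesis using ab assms by (auto simp: doubleton_eq_iff)
  qed
qed

lemma len_al_mult:
  assumes "s \<in> S" "t \<in> S" "s \<noteq> t" "z \<in> carrier W" "\<not> dl s z" "\<not> dl t z" "enat k \<le> cox_mat W s t"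
  shows "len (al s t k \<otimes> z) = k + len z"
  using len_coset_minimal[OF assms(1,2) coset_minimalI] dlen_al assms by simp

lemma not_dl_one [simp]: "\<not> dl s \<one>"
  by (simp add: dl_def)

lemma len_al:
  assumes "s \<in> S" "t \<in> S" "s \<noteq> t" "enat k \<le> cox_mat W s t"
  shows "len (al s t k) = k"
  using len_al_mult[of s t "\<one>" k] assms by simp

text \<open>Write \<open>w\<close> as a dihedral part times a minimal representative. Each of the
  two descents must be a possible first letter of the dihedral part, which therefore equals both
  alternating products with k factors; for k > 0 this needs k = m(s,t).\<close>

lemma two_descents:
  assumes "s \<in> S" "t \<in> S" "s \<noteq> t" "w \<in> carrier W" "dl s w" "dl t w"
  obtains m z where "cox_mat W s t = enat m" "z \<in> carrier W" "\<not> dl s z" "\<not> dl t z"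
    "w = al s t m \<otimes> z" "len w = m + len z"
proof -
  obtain g z where g: "g \<in> dihedral s t" "coset_minimal s t z" "w = g \<otimes> z"
    using coset_decomposition[OF assms(1,2,4)] .
  have z: "z \<in> carrier W" and gc: "g \<in> carrier W"
    using g dihedral_closed assms by (auto simp: coset_minimal_def)
  define k where "k = dlen s t g"
  have lw: "len w = k + len z"
    using len_coset_minimal[OF assms(1,2) g(2,1)] g(3) by (simp add: k_def)
  have g_al: "g = al a b k" if ab: "{a, b} = {s, t}" and dl: "dl a w" for a b
  proof -
    have abS: "a \<in> S" "b \<in> S" using ab assms by (auto simp: doubleton_eq_iff)
    have ag: "a \<otimes> g \<in> dihedral s t"
      using dihedral_mult[OF assms(1,2) _ g(1), of a] ab assms by (auto simp: doubleton_eq_iff)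
    define j where "j = dlen s t (a \<otimes> g)"
    have "len (a \<otimes> w) = j + len z"
      using len_coset_minimal[OF assms(1,2) g(2) ag] g z abS gc by (simp add: m_assoc j_def)
    then have j: "Suc j = k"
      using len_down[OF abS(1) assms(4) dl] lw by simp
    have "a \<otimes> g = al a b j \<or> a \<otimes> g = al b a j"
      using dlen_witness[OF assms(1,2) ag] ab by (auto simp: j_def doubleton_eq_iff)
    then have g2: "g = a \<otimes> al a b j \<or> g = a \<otimes> al b a j"
      using gc abS by (metis gen_cancel)
    show ?thesis
    proof (cases "g = a \<otimes> al b a j")
      case True
      then show ?thesis by (simp add: j[symmetric] al_Suc)
    next
      case False
      then have g3: "g = a \<otimes> al a b j" using g2 by blast
      then obtain i where i: "j = Suc i" using False by (cases j) auto
      then have "g = al b a i" using g3 abS by (simp add: al_Suc)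
      then have "k \<le> i"
        unfolding k_def using ab by (intro dlen_le) (auto simp: doubleton_eq_iff)
      then show ?thesis using i j by simp
    qed
  qed
  have g1: "g = al s t k" and g2: "g = al t s k"
    using g_al[of s t] g_al[of t s] assms by auto
  have km: "enat k \<le> cox_mat W s t"
    unfolding k_def using dlen_le_cox_mat[OF assms(1,2) g(1)] .
  have "k \<noteq> 0"
    using lw assms len_down[of s w] len_coset_minimal[OF assms(1,2) g(2), of s] g al_in_dihedral(1)[of s t 1]
      dlen_le[of s s t 1] g1
    by (metis One_nat_def Suc_n_not_le_n al_0 al_Suc coset_minimal_def gens_closed l_one le_add2 r_one)
  then obtain k' where k': "k = Suc k'" by (cases k) auto
  \<comment> \<open>Otherwise one more letter in front would cancel: \<open>al s t (Suc k)\<close>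
    would equal an alternating product with k - 1 factors.\<close>
  have "\<not> enat k < cox_mat W s t"
  proof
    assume "enat k < cox_mat W s t"
    then have "enat (Suc k) \<le> cox_mat W s t"
      by (simp add: Suc_ile_eq)
    moreover have "al s t (Suc k) = al t s k'"
      using g1 g2 assms by (simp add: al_Suc k')
    ultimately show False
      using al_neq(2)[OF assms(1-3), of k' "Suc k"] k' by simp
  qed
  then have "cox_mat W s t = enat k" using km by simp
  moreover have "\<not> dl s z" "\<not> dl t z"
    using g(2) assms(1,2) unfolding coset_minimal_def dl_def by (auto simp: not_less)
  ultimately show ?thesis
    using that g1 g lw z by blast
qed

end

context coxeter_system
begin

section \<open>Longest elements of dihedral subgroups and complex elements\<close>

lemma dihedral_one [simp]: "\<one> \<in> dihedral s t"
  using al_in_dihedral(1)[of s t 0] by simp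

lemma len_al_le: "\<lbrakk>s \<in> S; t \<in> S\<rbrakk> \<Longrightarrow> len (al s t k) \<le> k"
  using len_le_length[OF alternating_lists, of s t k] by (simp add: al_def)

lemma generate_pair:
  assumes "s \<in> S" "t \<in> S"
  shows "generate W {s, t} = dihedral s t"
proof (rule Set.set_eqI, rule iffI)
  fix g assume "g \<in> generate W {s, t}"
  then show "g \<in> dihedral s t"
  proof (induction rule: generate.induct)
    case (eng h1 h2)
    then show ?case using dihedral_mult assms by blast
  qed (use assms in auto)
next
  fix g assume "g \<in> dihedral s t"
  then obtain xs where xs: "xs \<in> lists {s, t}" "g = word_prod W xs"
    unfolding dihedral_def by blast
  have "word_prod W xs \<in> generate W {s, t}"
    using xs(1)
  proof (induction xs)
    case Nil
    show ?case by (simp add: generate.one)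
  next
    case (Cons x xs)
    then show ?case by (auto intro!: generate.eng intro: generate.incl)
  qed
  then show "g \<in> generate W {s, t}" using xs by simp
qed

lemma dihedral_eq:
  assumes "s \<in> S" "t \<in> S" "cox_mat W s t = enat m"
  shows "dihedral s t = (\<lambda>k. al s t k) ` {..m} \<union> (\<lambda>k. al t s k) ` {..m}"
proof (intro equalityI subsetI)
  fix g assume g: "g \<in> dihedral s t"
  have "dlen s t g \<le> m"
    using dlen_le_cox_mat[OF assms(1,2) g] assms by simp
  then show "g \<in> (\<lambda>k. al s t k) ` {..m} \<union> (\<lambda>k. al t s k) ` {..m}"
    using dlen_witness[OF assms(1,2) g] by auto
qed auto

lemma finite_dihedral_iff:
  assumes "s \<in> S" "t \<in> S" "s \<noteq> t"
  shows "finite (dihedral s t) \<longleftrightarrow> cox_mat W s t \<noteq> \<infinity>"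
proof
  assume fin: "finite (dihedral s t)"
  show "cox_mat W s t \<noteq> \<infinity>"
  proof
    assume "cox_mat W s t = \<infinity>"
    then have "inj (\<lambda>k. al s t k)"
      using len_al[OF assms] by (metis enat_ord_code(3) injI)
    then have "infinite (range (\<lambda>k. al s t k))"
      using range_inj_infinite by blast
    moreover have "range (\<lambda>k. al s t k) \<subseteq> dihedral s t" by auto
    ultimately show False using fin finite_subset by blast
  qed
next
  assume "cox_mat W s t \<noteq> \<infinity>"
  then show "finite (dihedral s t)"
    using dihedral_eq[OF assms(1,2)] by auto
qed

lemma noncommuting_sym: "noncommuting s t \<Longrightarrow> noncommuting t s"
  unfolding noncommuting_def by auto

lemma noncommutingD:
  assumes "noncommuting s t"
  shows "s \<in> S" "t \<in> S" "s \<noteq> t" "s \<otimes> t \<noteq> t \<otimes> s"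
  using assms unfolding noncommuting_def by auto

lemma commuting_cox_mat:
  assumes "s \<in> S" "t \<in> S" "s \<noteq> t"
  shows "s \<otimes> t = t \<otimes> s \<longleftrightarrow> cox_mat W s t = 2"
proof
  assume "s \<otimes> t = t \<otimes> s"
  then have sq: "s \<otimes> t \<otimes> (s \<otimes> t) = \<one>"
    using assms by (metis gen_cancel gen_square gens_closed m_assoc m_closed)
  then have "(s \<otimes> t) [^] (2::nat) = \<one>"
    using assms sq by (simp add: numeral_2_eq_2)
  then have "\<not> enat 2 < cox_mat W s t"
    using pow_neq_one[of s t 2] assms by auto
  then show "cox_mat W s t = 2"
    using mat_off_diag[OF assms] by (simp add: numeral_eq_enat)
next
  assume "cox_mat W s t = 2"
  then have "al s t 2 = al t s 2"
    using al_braid[of s t 2] assms by (simp add: numeral_eq_enat)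
  then show "s \<otimes> t = t \<otimes> s"
    using assms by (simp add: numeral_2_eq_2 al_Suc)
qed

lemma noncommuting_cox_mat:
  assumes "noncommuting s t" "cox_mat W s t = enat m"
  shows "3 \<le> m"
  using commuting_cox_mat[of s t] mat_off_diag[of s t] noncommutingD[OF assms(1)] assms(2)
  by (cases "m = 2") (auto simp: numeral_eq_enat)

lemma is_longest_iff:
  assumes "s \<in> S" "t \<in> S" "s \<noteq> t" "cox_mat W s t = enat m"
  shows "is_longest s t u \<longleftrightarrow> u = al s t m"
proof -
  have mt: "cox_mat W t s = enat m" using assms mat_sym by simp
  have le: "len g \<le> m \<and> (len g = m \<longrightarrow> g = al s t m)" if g: "g \<in> dihedral s t" for g
  proof -
    have "dlen s t g \<le> m"
      using dlen_le_cox_mat[OF assms(1,2) g] assms(4) by simp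
    then obtain k where k: "k \<le> m" "g = al s t k \<or> g = al t s k"
      using dlen_witness[OF assms(1,2) g] by metis
    then have "len g = k"
      using len_al[of s t k] len_al[of t s k] assms mt by auto
    then show ?thesis
      using k al_braid[OF assms(1,2,4)] by auto
  qed
  have "len (al s t m) = m"
    using len_al assms by simp
  then show ?thesis
    unfolding is_longest_def generate_pair[OF assms(1,2)] using le al_in_dihedral(1)[of s t m]
    by (metis le_antisym)
qed

text \<open>The working form of \<open>complex\<close>: finiteness of the subgroup becomes
  finiteness of m(s,t), and the longest element becomes explicit.\<close>

lemma complex_iff:
  "complex w \<longleftrightarrow> (\<exists>s t m x y. noncommuting s t \<and> cox_mat W s t = enat m \<and>
    x \<in> carrier W \<and> y \<in> carrier W \<and> w = x \<otimes> al s t m \<otimes> y \<and> len w = len x + m + len y)"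
proof -
  have longest: "finite (generate W {s, t}) \<and> is_longest s t u \<longleftrightarrow>
      (\<exists>m. cox_mat W s t = enat m \<and> u = al s t m)" if "noncommuting s t" for s t u
    using finite_dihedral_iff[of s t] is_longest_iff[of s t] generate_pair[of s t] noncommutingD[OF that]
    by (cases "cox_mat W s t") auto
  have len: "len (al s t m) = m" if "noncommuting s t" "cox_mat W s t = enat m" for s t m
    using len_al[of s t m] noncommutingD[OF that(1)] that(2) by simp
  show ?thesis
  proof
    assume "complex w"
    then obtain s t u x y where *: "noncommuting s t" "finite (generate W {s, t}) \<and> is_longest s t u"
      "x \<in> carrier W" "y \<in> carrier W" "w = x \<otimes> u \<otimes> y" "len w = len x + len u + len y"
      unfolding complex_def by blast
    then obtain m where "cox_mat W s t = enat m" "u = al s t m"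
      using longest by blast
    then show "\<exists>s t m x y. noncommuting s t \<and> cox_mat W s t = enat m \<and> x \<in> carrier W \<and>
        y \<in> carrier W \<and> w = x \<otimes> al s t m \<otimes> y \<and> len w = len x + m + len y"
      using * len[of s t m]
      by (intro exI[of _ s] exI[of _ t] exI[of _ m] exI[of _ x] exI[of _ y]) simp
  next
    assume "\<exists>s t m x y. noncommuting s t \<and> cox_mat W s t = enat m \<and> x \<in> carrier W \<and>
        y \<in> carrier W \<and> w = x \<otimes> al s t m \<otimes> y \<and> len w = len x + m + len y"
    then obtain s t m x y where *: "noncommuting s t" "cox_mat W s t = enat m" "x \<in> carrier W"
      "y \<in> carrier W" "w = x \<otimes> al s t m \<otimes> y" "len w = len x + m + len y" by blast
    then have "finite (generate W {s, t}) \<and> is_longest s t (al s t m)"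
      using longest by blast
    then show "complex w"
      unfolding complex_def using * len[OF *(1,2)]
      by (intro exI[of _ s] exI[of _ t] exI[of _ "al s t m"] exI[of _ x] exI[of _ y]) simp
  qed
qed

lemma complexI:
  assumes "noncommuting s t" "cox_mat W s t = enat m" "x \<in> carrier W" "y \<in> carrier W"
    "w = x \<otimes> al s t m \<otimes> y" "len w = len x + m + len y"
  shows "complex w"
  unfolding complex_iff using assms
  by (intro exI[of _ s] exI[of _ t] exI[of _ m] exI[of _ x] exI[of _ y]) simp

lemma complexE:
  assumes "complex w"
  obtains s t m x y where "noncommuting s t" "cox_mat W s t = enat m" "x \<in> carrier W"
    "y \<in> carrier W" "w = x \<otimes> al s t m \<otimes> y" "len w = len x + m + len y"
  using assms unfolding complex_iff by (elim exE conjE) (rule that)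

section \<open>Fully commutative elements\<close>

lemma fc_iff: "w \<in> carrier W \<Longrightarrow> w \<in> W\<^sub>c \<longleftrightarrow> \<not> complex w"
  by (simp add: W\<^sub>c_def)

lemma fc_closed [simp]: "w \<in> W\<^sub>c \<Longrightarrow> w \<in> carrier W"
  by (simp add: W\<^sub>c_def)

text \<open>A factorization of \<open>y\<close> around a longest element extends to the whole
  product, because subadditivity leaves no room for a loss of length.\<close>

lemma not_fc_mult:
  assumes "x \<in> carrier W" "y \<in> carrier W" "z \<in> carrier W" "y \<notin> W\<^sub>c"
    "len (x \<otimes> y \<otimes> z) = len x + len y + len z"
  shows "x \<otimes> y \<otimes> z \<notin> W\<^sub>c"
proof -
  have "complex y" using assms fc_iff by blast
  then obtain s t m a b where *: "noncommuting s t" "cox_mat W s t = enat m" "a \<in> carrier W"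
    "b \<in> carrier W" "y = a \<otimes> al s t m \<otimes> b" "len y = len a + m + len b"
    by (rule complexE)
  note st = noncommutingD[OF *(1)]
  have eq: "x \<otimes> y \<otimes> z = (x \<otimes> a) \<otimes> al s t m \<otimes> (b \<otimes> z)"
    using * assms st by (simp add: m_assoc)
  have "len (x \<otimes> a \<otimes> al s t m \<otimes> (b \<otimes> z)) \<le> len (x \<otimes> a) + len (al s t m) + len (b \<otimes> z)"
    using len_mult_le[of "x \<otimes> a \<otimes> al s t m" "b \<otimes> z"] len_mult_le[of "x \<otimes> a" "al s t m"] * assms st
    by simp
  moreover have "len (al s t m) = m"
    using len_al st *(2) by simp
  moreover have "len (x \<otimes> a) \<le> len x + len a" "len (b \<otimes> z) \<le> len b + len z"
    using len_mult_le * assms by auto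
  ultimately have "len (x \<otimes> y \<otimes> z) = len (x \<otimes> a) + m + len (b \<otimes> z)"
    using assms(5) *(6) eq by simp
  then have "complex (x \<otimes> y \<otimes> z)"
    using * assms st eq by (intro complexI[OF *(1,2), of "x \<otimes> a" "b \<otimes> z"]) auto
  then show ?thesis using assms fc_iff by (meson m_closed)
qed

lemma fc_suffix:
  assumes "x \<in> carrier W" "y \<in> carrier W" "x \<otimes> y \<in> W\<^sub>c" "len (x \<otimes> y) = len x + len y"
  shows "y \<in> W\<^sub>c"
  using not_fc_mult[of x y \<one>] assms by auto

lemma fc_down:
  assumes "s \<in> S" "w \<in> W\<^sub>c" "dl s w"
  shows "s \<otimes> w \<in> W\<^sub>c"
  using fc_suffix[of s "s \<otimes> w"] len_down[of s w] assms by simp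

lemma fc_up:
  assumes "s \<in> S" "w \<in> carrier W" "\<not> dl s w" "w \<notin> W\<^sub>c"
  shows "s \<otimes> w \<notin> W\<^sub>c"
  using not_fc_mult[of s w \<one>] len_up[of s w] assms by auto

lemma fc_inv: "w \<in> W\<^sub>c \<Longrightarrow> inv w \<in> W\<^sub>c"
proof -
  assume w: "w \<in> W\<^sub>c"
  show ?thesis
  proof (rule ccontr)
    assume "inv w \<notin> W\<^sub>c"
    then have "complex (inv w)" using w fc_iff by (meson fc_closed inv_closed)
    then obtain s t m x y where *: "noncommuting s t" "cox_mat W s t = enat m"
      "x \<in> carrier W" "y \<in> carrier W" "inv w = x \<otimes> al s t m \<otimes> y" "len (inv w) = len x + m + len y"
      by (rule complexE)
    note st = noncommutingD[OF *(1)]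
    have "w = inv (x \<otimes> al s t m \<otimes> y)"
      using *(5) w by (metis fc_closed inv_inv)
    also have "\<dots> = inv y \<otimes> al s t m \<otimes> inv x"
      using * st al_braid[of s t m] by (simp add: inv_mult_group inv_al m_assoc)
    finally have "w = inv y \<otimes> al s t m \<otimes> inv x" .
    moreover have "len w = len (inv y) + m + len (inv x)"
      using *(3,4,6) len_inv[OF fc_closed[OF w]] by simp
    ultimately have "complex w"
      using * by (intro complexI[OF *(1,2), of "inv y" "inv x"]) auto
    then show False using w fc_iff fc_closed by blast
  qed
qed

lemma al_top_not_fc:
  assumes "noncommuting s t" "cox_mat W s t = enat m" "z \<in> carrier W" "len (al s t m \<otimes> z) = m + len z"
  shows "al s t m \<otimes> z \<notin> W\<^sub>c"
proof -
  have "complex (al s t m \<otimes> z)"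
    using assms noncommutingD[OF assms(1)] by (intro complexI[OF assms(1,2), of \<one> z]) auto
  then show ?thesis using fc_iff fc_closed by blast
qed

lemma two_descents_not_fc:
  assumes "noncommuting s t" "w \<in> carrier W" "dl s w" "dl t w"
  shows "w \<notin> W\<^sub>c"
  using two_descents[of s t w] al_top_not_fc[OF assms(1)] noncommutingD[OF assms(1)] assms by metis

lemma fc_descents_commute:
  assumes "s \<in> S" "t \<in> S" "w \<in> W\<^sub>c" "dl s w" "dl t w"
  shows "s \<otimes> t = t \<otimes> s"
  using two_descents_not_fc[of s t w] assms unfolding noncommuting_def by auto

lemma len_ge_3_if_not_fc: "w \<in> carrier W \<Longrightarrow> w \<notin> W\<^sub>c \<Longrightarrow> 3 \<le> len w"
proof -
  assume "w \<in> carrier W" "w \<notin> W\<^sub>c"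
  then have "complex w" using fc_iff by blast
  then show ?thesis
    by (rule complexE) (use noncommuting_cox_mat in fastforce)
qed

lemma one_fc [simp]: "\<one> \<in> W\<^sub>c"
  using len_ge_3_if_not_fc[of \<one>] by fastforce

lemma gen_fc [simp]: "s \<in> S \<Longrightarrow> s \<in> W\<^sub>c"
  using len_ge_3_if_not_fc[of s] by fastforce

section \<open>Descents and the loss of full commutativity under left multiplication\<close>

lemma commuting_descent:
  assumes "s \<in> S" "t \<in> S" "s \<noteq> t" "s \<otimes> t = t \<otimes> s" "w \<in> carrier W" "dl s w" "dl t w"
  shows "dl s (t \<otimes> w)"
proof -
  obtain m z where m: "cox_mat W s t = enat m" "z \<in> carrier W" "\<not> dl s z" "\<not> dl t z" "w = al s t m \<otimes> z"
    "len w = m + len z"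
    using two_descents[OF assms(1-3,5-7)] .
  have "m = 2"
    using commuting_cox_mat[OF assms(1-3)] assms(4) m(1) by (simp add: numeral_eq_enat)
  then have "s \<otimes> (t \<otimes> w) = z"
    using m assms by (simp add: numeral_2_eq_2 al_Suc m_assoc)
  then show ?thesis
    using len_down[of t w] m \<open>m = 2\<close> assms by (simp add: dl_def)
qed

lemma commuting_descent_up:
  assumes "s \<in> S" "p \<in> S" "s \<otimes> p = p \<otimes> s" "w \<in> carrier W" "dl p w" "\<not> dl s w"
  shows "dl p (s \<otimes> w)"
proof -
  have "p \<otimes> (s \<otimes> w) = s \<otimes> (p \<otimes> w)"
    using assms by (metis gens_closed m_assoc)
  then have "len (p \<otimes> (s \<otimes> w)) \<le> Suc (len (p \<otimes> w))"
    using len_mult_le[of s "p \<otimes> w"] assms by simp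
  then show ?thesis
    using len_down[of p w] len_up[of s w] assms by (simp add: dl_def)
qed

text \<open>\<open>y\<close> begins with the longest element of the subgroup of \<open>t\<close> and
  \<open>p\<close>, which has at least three letters t, p, t, ...; these come off one after
  another.\<close>

lemma noncommuting_descents:
  assumes "noncommuting t p" "y \<in> carrier W" "dl t y" "dl p y"
  shows "dl p (t \<otimes> y)" "dl t (p \<otimes> (t \<otimes> y))"
proof -
  note tp = noncommutingD[OF assms(1)]
  obtain m z where m: "cox_mat W t p = enat m" "z \<in> carrier W" "\<not> dl t z" "\<not> dl p z"
    "y = al t p m \<otimes> z" "len y = m + len z"
    using two_descents[OF tp(1-3) assms(2-4)] .
  obtain m' where m': "m = Suc (Suc (Suc m'))"
    using noncommuting_cox_mat[OF assms(1) m(1)] by (metis add.commute add_Suc_right le_Suc_ex numeral_3_eq_3 plus_nat.add_0)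
  have mp: "enat (Suc (Suc m')) \<le> cox_mat W p t" "enat (Suc m') \<le> cox_mat W t p" "enat m' \<le> cox_mat W p t"
    using m m' mat_sym[of t p] tp by auto
  have x: "t \<otimes> y = al p t (Suc (Suc m')) \<otimes> z"
    using m m' tp by (auto simp: al_Suc m_assoc)
  have px: "p \<otimes> (t \<otimes> y) = al t p (Suc m') \<otimes> z"
    using x m tp by (simp add: al_Suc m_assoc)
  have tpx: "t \<otimes> (p \<otimes> (t \<otimes> y)) = al p t m' \<otimes> z"
    using px m tp by (simp add: al_Suc m_assoc)
  note len = len_al_mult[OF tp(1-3) m(2-4)] len_al_mult[OF tp(2,1) tp(3)[symmetric] m(2,4,3)]
  show "dl p (t \<otimes> y)"
    unfolding dl_def px unfolding x using len mp by simp
  show "dl t (p \<otimes> (t \<otimes> y))"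
    unfolding dl_def tpx unfolding px using len mp by simp
qed

text \<open>In a factorization of \<open>y\<close> around a longest element, the left factor is
  either trivial, which gives two noncommuting descents, or it has a first letter \<open>p\<close>
  that can be removed. The inductions below run over this alternative.\<close>

lemma not_fc_top:
  assumes "y \<in> carrier W" "y \<notin> W\<^sub>c"
  obtains (braid) r r' where "noncommuting r r'" "dl r y" "dl r' y"
    | (down) p where "p \<in> S" "dl p y" "p \<otimes> y \<notin> W\<^sub>c"
proof -
  have "complex y" using assms fc_iff by blast
  then obtain r r' m x1 x2 where *: "noncommuting r r'" "cox_mat W r r' = enat m" "x1 \<in> carrier W"
    "x2 \<in> carrier W" "y = x1 \<otimes> al r r' m \<otimes> x2" "len y = len x1 + m + len x2"
    by (rule complexE)
  note rr = noncommutingD[OF *(1)]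
  show thesis
  proof (cases "x1 = \<one>")
    case True
    have m0: "m = Suc (m - 1)" using noncommuting_cox_mat *(1,2) by fastforce
    have dlr: "dl a y" if "{a, b} = {r, r'}" for a b
    proof -
      have ab: "a \<in> S" "b \<in> S" using that rr by (auto simp: doubleton_eq_iff)
      have "y = al a b m \<otimes> x2"
        using * True al_braid[of r r' m] rr that by (auto simp: doubleton_eq_iff)
      then have "y = a \<otimes> (al b a (m - 1) \<otimes> x2)"
        using ab * by (subst (asm) m0) (simp add: al_Suc m_assoc)
      then have "a \<otimes> y = al b a (m - 1) \<otimes> x2"
        using ab * by simp
      then have "len (a \<otimes> y) \<le> (m - 1) + len x2"
        using len_mult_le[of "al b a (m - 1)" x2] len_al_le[OF ab(2,1), of "m - 1"] ab *(4)
        by (metis (no_types, lifting) add_le_mono1 al_closed order_trans)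
      then show ?thesis
        using *(6) True m0 by (simp add: dl_def)
    qed
    show thesis using braid[OF *(1)] dlr[of r r'] dlr[of r' r] by auto
  next
    case False
    then obtain p where p: "p \<in> S" "dl p x1" using ex_dl * by blast
    define x1' where "x1' = p \<otimes> x1"
    have x1': "x1' \<in> carrier W" "x1 = p \<otimes> x1'" "len x1 = Suc (len x1')"
      using p * len_down[of p x1] by (auto simp: x1'_def)
    have py: "p \<otimes> y = x1' \<otimes> al r r' m \<otimes> x2"
      using * p rr x1' by (simp add: m_assoc)
    have "len (p \<otimes> y) \<le> len x1' + m + len x2"
      unfolding py using len_mult_le[of "x1' \<otimes> al r r' m" x2] len_mult_le[of x1' "al r r' m"] x1' * rr
        len_al_le[OF rr(1,2), of m] by simp
    then have dlpy: "dl p y" using *(6) x1' by (simp add: dl_def)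
    then have lpy: "len (p \<otimes> y) = len x1' + m + len x2"
      using len_down[OF p(1) assms(1)] *(6) x1' by simp
    have "complex (p \<otimes> y)"
      using * x1' by (intro complexI[OF *(1,2) _ _ py lpy]) auto
    then show thesis using down[OF p(1) dlpy] fc_iff fc_closed by blast
  qed
qed

text \<open>The braid that appears when \<open>t\<close> is put in front of \<open>x\<close> must
  involve \<open>t\<close>, and the only descent of \<open>x\<close> that can close it is
  \<open>s\<close>. Descents of tx that commute with \<open>t\<close> are removed by
  induction.\<close>

lemma not_fc_descent:
  assumes "noncommuting s t" "x \<in> W\<^sub>c" "dl s x" "t \<otimes> x \<notin> W\<^sub>c"
  shows "dl s (t \<otimes> x)"
  using assms(2-)
proof (induction "len x" arbitrary: x rule: less_induct)
  case less
  note st = noncommutingD[OF assms(1)]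
  have xc: "x \<in> carrier W" using less by simp
  define y where "y = t \<otimes> x"
  have yc: "y \<in> carrier W" "y \<notin> W\<^sub>c" using st xc less by (auto simp: y_def)
  have tx: "\<not> dl t x"
    using two_descents_not_fc[OF assms(1) xc] less by auto
  have ty: "dl t y" "t \<otimes> y = x" using st xc tx by (auto simp: y_def dl_mult)
  \<comment> \<open>A descent \<open>p\<close> other than \<open>s\<close> that fails to commute
    with \<open>t\<close> would leave the fully commutative element px with the noncommuting
    descents \<open>s\<close> and \<open>t\<close>.\<close>
  have noncomm: "dl s y" if p: "p \<in> S" "dl p y" "p \<otimes> t \<noteq> t \<otimes> p" for p
  proof (cases "p = s")
    case False
    have nc: "noncommuting t p" using p st by (auto simp: noncommuting_def)
    have dlp: "dl p x" and dlt: "dl t (p \<otimes> x)"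
      using noncommuting_descents[OF nc yc(1) ty(1) p(2)] ty by auto
    have "s \<otimes> p = p \<otimes> s"
      using fc_descents_commute st p less.prems dlp by blast
    then have "dl s (p \<otimes> x)"
      using commuting_descent[of s p x] st p False xc dlp less.prems by auto
    then have False
      using two_descents_not_fc[OF assms(1), of "p \<otimes> x"] dlt fc_down[OF p(1) less.prems(1) dlp] p xc by auto
    then show ?thesis ..
  qed (use p in simp)
  have comm: "dl p x" if p: "p \<in> S" "dl p y" "p \<noteq> t" "p \<otimes> t = t \<otimes> p" for p
    using commuting_descent[of p t y] p st yc ty by simp
  show ?case
    unfolding y_def[symmetric]
    using yc
  proof (cases rule: not_fc_top)
    case (braid r r')
    note rr = noncommutingD[OF braid(1)]
    show "dl s y"
    proof (rule ccontr)
      assume "\<not> dl s y"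
      then have c: "r \<otimes> t = t \<otimes> r" "r' \<otimes> t = t \<otimes> r'"
        using noncomm rr braid by auto
      then have "r \<noteq> t" "r' \<noteq> t" using rr by auto
      then have "dl r x" "dl r' x" using comm c rr braid by auto
      then show False using fc_descents_commute[of r r' x] rr less by blast
    qed
  next
    case (down p)
    note p = down(1) and dlpy = down(2) and pyc = down(3)
    have pt: "p \<noteq> t" using pyc ty less by auto
    show "dl s y"
    proof (cases "p \<otimes> t = t \<otimes> p")
      case False
      then show ?thesis using noncomm p dlpy by blast
    next
      case True
      have px: "dl p x" using comm p dlpy pt True by blast
      have sp: "s \<otimes> p = p \<otimes> s" "s \<noteq> p"
        using fc_descents_commute[of s p x] st p px less True by auto
      have px': "p \<otimes> x \<in> W\<^sub>c" using fc_down p px less by blast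
      have tpx: "t \<otimes> (p \<otimes> x) = p \<otimes> y"
        unfolding y_def using True p st xc by (metis gens_closed m_assoc)
      have "dl s (p \<otimes> x)" using commuting_descent[of s p x] sp st p px less xc by blast
      moreover have "len (p \<otimes> x) < len x" using px by (simp add: dl_def)
      ultimately have "dl s (p \<otimes> y)"
        using less.hyps[of "p \<otimes> x"] px' tpx pyc by simp
      then have "len (s \<otimes> (p \<otimes> y)) + 2 = len y"
        using len_down[of s "p \<otimes> y"] len_down[of p y] dlpy p st yc by simp
      moreover have "s \<otimes> y = p \<otimes> (s \<otimes> (p \<otimes> y))"
        using sp p st yc by (metis gen_cancel gens_closed m_assoc m_closed)
      ultimately show ?thesis
        using len_mult_le[of p "s \<otimes> (p \<otimes> y)"] p st yc by (simp add: dl_def)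
    qed
  qed
qed

text \<open>The case distinction behind the definition of \<open>lam\<close>: either a braid with
  some \<open>t\<close> closes at once, or a letter \<open>p\<close> commuting with \<open>s\<close>
  can be moved out of the way.\<close>

lemma not_fc_cases:
  assumes "s \<in> S" "x \<in> W\<^sub>c" "s \<otimes> x \<notin> W\<^sub>c"
  obtains (noncomm) t where "noncommuting s t" "dl t x"
    | (comm) p where "p \<in> S" "p \<noteq> s" "s \<otimes> p = p \<otimes> s" "dl p x" "s \<otimes> (p \<otimes> x) \<notin> W\<^sub>c"
proof -
  have xc: "x \<in> carrier W" using assms by simp
  define y where "y = s \<otimes> x"
  have sx: "\<not> dl s x" using fc_down assms by blast
  have y: "y \<in> carrier W" "y \<notin> W\<^sub>c" "dl s y" "s \<otimes> y = x"
    using assms xc sx by (auto simp: y_def dl_mult)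
  have cases: thesis if p: "p \<in> S" "dl p y" "p \<noteq> s" "dl p x \<Longrightarrow> s \<otimes> p = p \<otimes> s \<Longrightarrow> thesis" for p
  proof (cases "s \<otimes> p = p \<otimes> s")
    case True
    then show thesis using commuting_descent[of p s y] p assms y by auto
  next
    case False
    then have "noncommuting s p" using p assms by (auto simp: noncommuting_def)
    then show thesis using noncommuting_descents(1)[of s p y] noncomm y p by auto
  qed
  from y(1,2) show thesis
  proof (cases rule: not_fc_top)
    case (braid r r')
    note rr = noncommutingD[OF braid(1)]
    show thesis
    proof (cases "r = s \<or> r' = s")
      case True
      then obtain t where "noncommuting s t" "dl t y"
        using braid noncommuting_sym by auto
      then show thesis using noncommuting_descents(1)[of s t y] noncomm y by auto
    next
      case False
      then show thesis
        using cases[of r] cases[of r'] braid rr fc_descents_commute[of r r' x] assms by metis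
    qed
  next
    case (down p)
    have "p \<noteq> s" using down y assms by auto
    then show thesis
    proof (rule cases[OF down(1,2)])
      assume "dl p x" "s \<otimes> p = p \<otimes> s"
      moreover have "s \<otimes> (p \<otimes> x) = p \<otimes> y"
        unfolding y_def using calculation down(1) assms xc by (metis gens_closed m_assoc)
      ultimately show thesis using comm[OF down(1) \<open>p \<noteq> s\<close>] down by simp
    qed
  qed
qed

text \<open>\<open>not_fc_cases\<close> provides one commuting letter that may be removed; here
  every commuting descent will do. This justifies the arbitrary choice of \<open>p\<close> in
  \<open>lam\<close>.\<close>

lemma not_fc_commuting_descent:
  assumes "s \<in> S" "x \<in> W\<^sub>c" "s \<otimes> x \<notin> W\<^sub>c" "p \<in> S" "dl p x" "s \<otimes> p = p \<otimes> s"
  shows "s \<otimes> (p \<otimes> x) \<notin> W\<^sub>c"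
  using assms(2-5)
proof (induction "len x" arbitrary: x rule: less_induct)
  case less
  note s = assms(1) and p = assms(4)
  have xc: "x \<in> carrier W" using less by simp
  have sx: "\<not> dl s x" using fc_down s less by blast
  have ps: "p \<noteq> s" using sx less by auto
  have comm: "s \<otimes> (p \<otimes> x) = p \<otimes> (s \<otimes> x)"
    using assms(6) s p xc by (metis gens_closed m_assoc)
  have dlp: "dl p (s \<otimes> x)"
    using commuting_descent_up[of s p x] s p sx xc less assms(6) by simp
  have dls: "dl s (p \<otimes> (s \<otimes> x))"
    using commuting_descent[of s p "s \<otimes> x"] s p ps assms(6) xc dlp sx by (simp add: dl_mult)
  from s less.prems(1,2) show ?case
  proof (cases rule: not_fc_cases)
    case (noncomm t)
    note st = noncommutingD[OF noncomm(1)]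
    have "dl t (s \<otimes> x)"
      using not_fc_descent[OF noncommuting_sym[OF noncomm(1)]] noncomm less by blast
    moreover have pt: "p \<otimes> t = t \<otimes> p" "p \<noteq> t"
      using fc_descents_commute[of p t x] noncomm p st less assms(6) by auto
    ultimately have "dl t (p \<otimes> (s \<otimes> x))"
      using commuting_descent[of t p "s \<otimes> x"] dlp p st xc by auto
    then show ?thesis
      unfolding comm using two_descents_not_fc[OF noncomm(1)] dls p s xc by simp
  next
    case (comm p1)
    show ?thesis
    proof (cases "p1 = p")
      case True
      then show ?thesis using comm by simp
    next
      case False
      have pp: "p \<otimes> p1 = p1 \<otimes> p"
        using fc_descents_commute less p comm by blast
      have "dl p (p1 \<otimes> x)"
        using commuting_descent[of p p1 x] pp False p comm xc less by blast
      moreover have "len (p1 \<otimes> x) < len x" using comm by (simp add: dl_def)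
      ultimately have IH: "s \<otimes> (p \<otimes> (p1 \<otimes> x)) \<notin> W\<^sub>c"
        using less.hyps[of "p1 \<otimes> x"] comm fc_down less p by blast
      have dl1: "dl p1 (s \<otimes> x)"
        using commuting_descent_up[of s p1 x] s comm sx xc by simp
      have "dl p1 (p \<otimes> (s \<otimes> x))"
        using commuting_descent[of p1 p "s \<otimes> x"] False pp p comm s xc dlp dl1 by auto
      moreover have "p1 \<otimes> (p \<otimes> (s \<otimes> x)) = s \<otimes> (p \<otimes> (p1 \<otimes> x))"
        using pp comm(3) assms(6) s p comm(1) xc by (metis gens_closed m_assoc m_closed)
      ultimately show ?thesis
        using fc_down[OF comm(1), of "p \<otimes> (s \<otimes> x)"] IH \<open>s \<otimes> (p \<otimes> x) = p \<otimes> (s \<otimes> x)\<close> by auto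
    qed
  qed
qed

text \<open>Two candidates are descents of \<open>x\<close>, hence commute, and then tx would be
  fully commutative with the noncommuting descents \<open>s\<close> and \<open>t'\<close>. Thus the
  choice of \<open>t\<close> in \<open>lam\<close> is forced.\<close>

lemma noncommuting_descent_unique:
  assumes "x \<in> W\<^sub>c" "s \<otimes> x \<notin> W\<^sub>c" "noncommuting s t" "dl t x" "noncommuting s t'" "dl t' x"
  shows "t = t'"
proof (rule ccontr)
  assume ne: "t \<noteq> t'"
  note st = noncommutingD[OF assms(3)] and st' = noncommutingD[OF assms(5)]
  have xc: "x \<in> carrier W" using assms by simp
  have sx: "\<not> dl s x" using fc_down st assms by blast
  have "dl t (s \<otimes> x)"
    using not_fc_descent[OF noncommuting_sym[OF assms(3)]] assms by blast
  then have "dl s (t \<otimes> x)"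
    using noncommuting_descents(2)[OF assms(3), of "s \<otimes> x"] st xc sx by (simp add: dl_mult)
  moreover have "dl t' (t \<otimes> x)"
    using commuting_descent[of t' t x] fc_descents_commute[of t t' x] ne st st' assms xc by auto
  ultimately show False
    using two_descents_not_fc[OF assms(5), of "t \<otimes> x"] fc_down[of t x] st assms xc by simp
qed

section \<open>The Bruhat order\<close>

abbreviation bruhat_le :: "'w \<Rightarrow> 'w \<Rightarrow> bool" where
  "bruhat_le u w \<equiv> u = w \<or> bruhat_less u w"

lemma bruhat_less_step:
  "\<lbrakk>u \<in> carrier W; r \<in> reflections; len u < len (u \<otimes> r)\<rbrakk> \<Longrightarrow> bruhat_less u (u \<otimes> r)"
  unfolding bruhat_less_def by (rule tranclp.r_into_trancl) auto

lemma bruhat_less_imp: "bruhat_less u w \<Longrightarrow> u \<in> carrier W \<and> w \<in> carrier W \<and> len u < len w"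
  unfolding bruhat_less_def
proof (induction rule: tranclp_induct)
  case (base y)
  then show ?case using reflections_closed by auto
next
  case (step y z)
  then show ?case using reflections_closed by auto
qed

lemma bruhat_less_trans: "\<lbrakk>bruhat_less u v; bruhat_less v w\<rbrakk> \<Longrightarrow> bruhat_less u w"
  unfolding bruhat_less_def by (rule tranclp_trans)

lemma gen_mult_reflection:
  "\<lbrakk>s \<in> S; w \<in> carrier W\<rbrakk> \<Longrightarrow> \<exists>r \<in> reflections. s \<otimes> w = w \<otimes> r"
  using conj_reflection[of s w] mult_conj_gen[of s w, symmetric] by (intro bexI[of _ "inv w \<otimes> s \<otimes> w"]) auto

lemma bruhat_less_gen_iff:
  assumes "s \<in> S" "w \<in> carrier W"
  shows "bruhat_less (s \<otimes> w) w \<longleftrightarrow> dl s w"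
proof
  assume "dl s w"
  obtain r where "r \<in> reflections" "s \<otimes> (s \<otimes> w) = (s \<otimes> w) \<otimes> r"
    using gen_mult_reflection[of s "s \<otimes> w"] assms by auto
  then show "bruhat_less (s \<otimes> w) w"
    using bruhat_less_step[of "s \<otimes> w" r] \<open>dl s w\<close> assms by (simp add: dl_def)
qed (use bruhat_less_imp in \<open>auto simp: dl_def\<close>)

lemma bruhat_less_up: "\<lbrakk>s \<in> S; w \<in> carrier W; \<not> dl s w\<rbrakk> \<Longrightarrow> bruhat_less w (s \<otimes> w)"
  using bruhat_less_gen_iff[of s "s \<otimes> w"] by (simp add: dl_mult)

text \<open>The lengths of su and sur differ by parity. If su is the longer one, strong exchange
  deletes a letter of \<open>s # us\<close>; it must be the first one, since deleting a letter of
  \<open>us\<close> would make ur shorter than u.\<close>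

lemma bruhat_step_lift:
  assumes s: "s \<in> S" and u: "u \<in> carrier W" and r: "r \<in> reflections" and lt: "len u < len (u \<otimes> r)"
  shows "s \<otimes> u = u \<otimes> r \<or> bruhat_less (s \<otimes> u) (s \<otimes> (u \<otimes> r))"
proof -
  have rc: "r \<in> carrier W" using r reflections_closed by simp
  have sur: "s \<otimes> (u \<otimes> r) = (s \<otimes> u) \<otimes> r" using s u rc by (simp add: m_assoc)
  have "len (s \<otimes> u \<otimes> r) \<noteq> len (s \<otimes> u)"
  proof -
    obtain g a where "r = g \<otimes> a \<otimes> inv g" "g \<in> carrier W" "a \<in> S"
      using r unfolding reflections_def by auto
    then have "odd (len r)"
      by (simp add: even_len_mult)
    then show ?thesis
      using even_len_mult[of "s \<otimes> u" r] s u rc by fastforce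
  qed
  then consider "len (s \<otimes> u) < len (s \<otimes> u \<otimes> r)" | "len (s \<otimes> u \<otimes> r) < len (s \<otimes> u)"
    by linarith
  then show ?thesis
  proof cases
    case 1
    then show ?thesis
      using bruhat_less_step[of "s \<otimes> u" r] s u r sur by simp
  next
    case 2
    have up: "\<not> dl s u"
    proof
      assume "dl s u"
      then have "Suc (len (s \<otimes> u)) = len u" using len_down s u by blast
      moreover have "len (u \<otimes> r) \<le> Suc (len (s \<otimes> (u \<otimes> r)))"
        using len_mult_le[of s "s \<otimes> (u \<otimes> r)"] s u rc by simp
      ultimately show False using 2 lt sur by simp
    qed
    obtain us where us: "us \<in> lists S" "length us = len u" "word_prod W us = u"
      using ex_reduced_word[OF u] .
    have "s # us \<in> lists S" using us s by simp
    moreover have "len (word_prod W (s # us) \<otimes> r) < len (word_prod W (s # us))"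
      using 2 us by simp
    ultimately obtain xs a ys where *: "s # us = xs @ a # ys" "word_prod W (s # us) \<otimes> r = word_prod W (xs @ ys)"
      using strong_exchange[OF _ r] by metis
    show ?thesis
    proof (cases xs)
      case Nil
      then have "s \<otimes> u \<otimes> r = u" using * us by auto
      then have "s \<otimes> (s \<otimes> u \<otimes> r) = s \<otimes> u" by simp
      then show ?thesis using s u rc by (simp add: m_assoc)
    next
      case (Cons b xs')
      then have b: "b = s" "us = xs' @ a # ys" using * by auto
      then have sub: "xs' @ ys \<in> lists S" using us by auto
      have "s \<otimes> (u \<otimes> r) = s \<otimes> word_prod W (xs' @ ys)"
        using * Cons b us sur by simp
      then have "s \<otimes> (s \<otimes> (u \<otimes> r)) = s \<otimes> (s \<otimes> word_prod W (xs' @ ys))" by simp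
      then have "u \<otimes> r = word_prod W (xs' @ ys)"
        using s u rc sub by simp
      then have "len (u \<otimes> r) \<le> length (xs' @ ys)"
        using len_le_length[OF sub] by simp
      then show ?thesis using lt us b by simp
    qed
  qed
qed

text \<open>The lifting property, obtained by following a chain of reflections from \<open>u\<close>
  to \<open>w\<close>.\<close>

lemma bruhat_lift:
  assumes "s \<in> S" "bruhat_less u w"
  shows "bruhat_le (s \<otimes> u) w \<or> bruhat_le (s \<otimes> u) (s \<otimes> w)"
  using assms(2) unfolding bruhat_less_def
proof (induction rule: converse_tranclp_induct)
  case (base u)
  then obtain r where "u \<in> carrier W" "r \<in> reflections" "w = u \<otimes> r" "len u < len w" by blast
  then show ?case using bruhat_step_lift[OF assms(1), of u r] unfolding bruhat_less_def by auto
next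
  case (step u v)
  then obtain r where r: "u \<in> carrier W" "r \<in> reflections" "v = u \<otimes> r" "len u < len v" by blast
  have vw: "bruhat_less v w" using step unfolding bruhat_less_def by blast
  have IH: "bruhat_le (s \<otimes> v) w \<or> bruhat_le (s \<otimes> v) (s \<otimes> w)"
    using step.IH unfolding bruhat_less_def .
  have "s \<otimes> u = v \<or> bruhat_less (s \<otimes> u) (s \<otimes> v)"
    using bruhat_step_lift[OF assms(1), of u r] r by auto
  then have "bruhat_le (s \<otimes> u) w \<or> bruhat_le (s \<otimes> u) (s \<otimes> w)"
    using IH vw bruhat_less_trans by metis
  then show ?case unfolding bruhat_less_def .
qed

lemma bruhat_lift_up:
  assumes "s \<in> S" "w \<in> carrier W" "\<not> dl s w" "bruhat_le u w"
  shows "bruhat_le (s \<otimes> u) (s \<otimes> w)" "bruhat_le u (s \<otimes> w)"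
  using bruhat_lift[OF assms(1)] bruhat_less_up[OF assms(1-3)] bruhat_less_trans assms(4) by metis+

end

section \<open>Degrees of Laurent polynomials\<close>

definition deg_le :: "int \<Rightarrow> laurent \<Rightarrow> bool" where
  "deg_le n a \<longleftrightarrow> (\<forall>k. Poly_Mapping.lookup a k \<noteq> 0 \<longrightarrow> k \<le> n)"

lemma vpow_add: "vpow j * vpow k = vpow (j + k)"
  by (simp add: vpow_def mult_single)

lemma vpow_0 [simp]: "vpow 0 = 1"
  by (simp add: vpow_def)

lemma laurent_induct [case_names zero vpow diff]:
  assumes "P 0" "\<And>k. P (vpow k)" "\<And>a b. P a \<Longrightarrow> P b \<Longrightarrow> P (a - b)"
  shows "P (a :: laurent)"
  using frag_induction[of a UNIV P] assms by (simp add: vpow_def)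

lemma lookup_vpow_mult [simp]: "Poly_Mapping.lookup (vpow k * a) n = Poly_Mapping.lookup a (n - k)"
proof (induction a rule: laurent_induct)
  case (vpow j)
  then show ?case by (auto simp: vpow_add) (auto simp: vpow_def lookup_single when_def)
qed (simp_all add: right_diff_distrib lookup_minus)

lemma lookup_vpow: "Poly_Mapping.lookup (vpow k) n = (if n = k then 1 else 0)"
  by (auto simp: vpow_def lookup_single when_def)

lemma lookup_of_int_mult:
  "Poly_Mapping.lookup (of_int n * a) k = n * Poly_Mapping.lookup (a :: laurent) k"
proof (induction a rule: laurent_induct)
  case (vpow j)
  have "Poly_Mapping.lookup (vpow j * of_int n) k = n * Poly_Mapping.lookup (vpow j) k"
    by (auto simp: lookup_of_int lookup_vpow when_def)
  then show ?case by (simp only: mult.commute)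
qed (simp_all add: right_diff_distrib lookup_minus)

lemma lookup_one_laurent: "Poly_Mapping.lookup (1 :: laurent) n = (if n = 0 then 1 else 0)"
  using lookup_vpow[of 0 n] by simp

lemma lookup_bar_A [simp]: "Poly_Mapping.lookup (bar_A a) k = Poly_Mapping.lookup a (- k)"
  by (simp add: bar_A_def map_key.rep_eq)

lemma bar_A_diff: "bar_A (a - b) = bar_A a - bar_A b"
  by (rule poly_mapping_eqI) (simp add: lookup_minus)

lemma bar_A_add: "bar_A (a + b) = bar_A a + bar_A b"
  by (rule poly_mapping_eqI) (simp add: lookup_add)

lemma bar_A_0 [simp]: "bar_A 0 = 0"
  by (rule poly_mapping_eqI) simp

lemma bar_A_vpow [simp]: "bar_A (vpow k) = vpow (- k)"
  by (rule poly_mapping_eqI) (auto simp: lookup_vpow)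

lemma bar_A_1 [simp]: "bar_A 1 = 1"
  using bar_A_vpow[of 0] by simp

lemma bar_A_vpow_mult: "bar_A (vpow k * a) = vpow (- k) * bar_A a"
proof (rule poly_mapping_eqI)
  fix n
  have "- n - k = - (n - (- k))" by simp
  then show "Poly_Mapping.lookup (bar_A (vpow k * a)) n = Poly_Mapping.lookup (vpow (- k) * bar_A a) n"
    by (simp only: lookup_bar_A lookup_vpow_mult)
qed

lemma bar_A_mult: "bar_A (a * b) = bar_A a * bar_A b"
  by (induction a rule: laurent_induct) (simp_all add: left_diff_distrib bar_A_diff bar_A_vpow_mult)

lemma bar_A_of_int [simp]: "bar_A (of_int n) = of_int n"
  by (rule poly_mapping_eqI) (simp add: lookup_of_int when_def)

lemma deg_leD: "deg_le n a \<Longrightarrow> n < k \<Longrightarrow> Poly_Mapping.lookup a k = 0"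
  by (force simp: deg_le_def)

lemma deg_le_0 [simp]: "deg_le n 0"
  by (simp add: deg_le_def)

lemma deg_le_mono: "deg_le n a \<Longrightarrow> n \<le> n' \<Longrightarrow> deg_le n' a"
  by (force simp: deg_le_def)

lemma deg_le_add: "deg_le n a \<Longrightarrow> deg_le n b \<Longrightarrow> deg_le n (a + b)"
  unfolding deg_le_def lookup_add by (metis add.right_neutral)

lemma deg_le_uminus: "deg_le n a \<Longrightarrow> deg_le n (- a)"
  by (simp add: deg_le_def)

lemma deg_le_diff: "deg_le n a \<Longrightarrow> deg_le n b \<Longrightarrow> deg_le n (a - b)"
  using deg_le_add[of n a "- b"] deg_le_uminus[of n b] by simp

lemma deg_le_sum: "(\<And>i. i \<in> I \<Longrightarrow> deg_le n (f i)) \<Longrightarrow> deg_le n (sum f I)"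
  by (induction I rule: infinite_finite_induct) (auto intro: deg_le_add)

lemma deg_le_mult: "deg_le m a \<Longrightarrow> deg_le n b \<Longrightarrow> deg_le (m + n) (a * b)"
  unfolding deg_le_def
proof (intro allI impI)
  fix k assume *: "\<forall>k. Poly_Mapping.lookup a k \<noteq> 0 \<longrightarrow> k \<le> m" "\<forall>k. Poly_Mapping.lookup b k \<noteq> 0 \<longrightarrow> k \<le> n"
    and "Poly_Mapping.lookup (a * b) k \<noteq> 0"
  then have "k \<in> Poly_Mapping.keys (a * b)" by (simp add: in_keys_iff)
  then obtain i j where "i \<in> Poly_Mapping.keys a" "j \<in> Poly_Mapping.keys b" "k = i + j"
    using keys_mult[of a b] by blast
  then show "k \<le> m + n"
    using * by (simp add: in_keys_iff add_mono)
qed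

lemma deg_le_vpow: "k \<le> n \<Longrightarrow> deg_le n (vpow k)"
  by (simp add: deg_le_def lookup_vpow)

lemma deg_le_vpow_mult: "deg_le n (vpow k * a) \<longleftrightarrow> deg_le (n - k) a"
  unfolding deg_le_def
proof (intro iffI allI impI)
  fix j assume "\<forall>j. Poly_Mapping.lookup (vpow k * a) j \<noteq> 0 \<longrightarrow> j \<le> n" "Poly_Mapping.lookup a j \<noteq> 0"
  then show "j \<le> n - k" using lookup_vpow_mult[of k a "j + k"] by (metis add_diff_cancel_right' le_diff_eq)
next
  fix j assume "\<forall>j. Poly_Mapping.lookup a j \<noteq> 0 \<longrightarrow> j \<le> n - k" "Poly_Mapping.lookup (vpow k * a) j \<noteq> 0"
  then show "j \<le> n" by force
qed

lemma deg_le_of_int: "0 \<le> n \<Longrightarrow> deg_le n (of_int k)"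
  by (simp add: deg_le_def lookup_of_int when_def)

lemma deg_le_1: "0 \<le> n \<Longrightarrow> deg_le n 1"
  using deg_le_of_int[of n 1] by simp

lemma deg_le_leading:
  assumes "deg_le n a"
  shows "deg_le (n - 1) (a - vpow n * of_int (Poly_Mapping.lookup a n))"
  using assms unfolding deg_le_def
  by (auto simp: lookup_minus lookup_of_int when_def split: if_splits)

lemma A_minus_iff: "a \<in> A_minus \<longleftrightarrow> deg_le 0 a"
  by (auto simp: A_minus_def deg_le_def in_keys_iff)

lemma v_inv_A_minus_iff: "a \<in> v_inv_A_minus \<longleftrightarrow> deg_le (- 1) a"
proof
  assume "deg_le (- 1) a"
  then have "deg_le 0 (vpow 1 * a)" by (simp add: deg_le_vpow_mult)
  moreover have "a = vpow (- 1) * (vpow 1 * a)" by (simp add: mult.assoc[symmetric] vpow_add)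
  ultimately show "a \<in> v_inv_A_minus"
    unfolding v_inv_A_minus_def using A_minus_iff by blast
qed (auto simp: v_inv_A_minus_def A_minus_iff deg_le_vpow_mult)

text \<open>The bar involution reflects exponents at 0, so a nonzero fixed polynomial has a
  nonnegative exponent. Uniqueness of both canonical bases rests on this.\<close>

lemma bar_A_fixed_neg:
  assumes "bar_A a = a" "deg_le (- 1) a"
  shows "a = 0"
proof (rule poly_mapping_eqI)
  fix k
  have "Poly_Mapping.lookup a k = Poly_Mapping.lookup a (- k)"
    using assms(1) lookup_bar_A[of a k] by simp
  then show "Poly_Mapping.lookup a k = Poly_Mapping.lookup 0 k"
    using assms(2)[unfolded deg_le_def, rule_format, of k] assms(2)[unfolded deg_le_def, rule_format, of "- k"]
    by fastforce
qed

section \<open>Modules with a basis\<close>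

locale based_module = module scale for scale :: "laurent \<Rightarrow> 'm \<Rightarrow> 'm::ab_group_add" +
  fixes X :: "'i set" and e :: "'i \<Rightarrow> 'm"
  assumes inj_e: "inj_on e X"
    and independent_e: "independent (e ` X)"
    and span_e: "span (e ` X) = UNIV"
begin

definition cf :: "'m \<Rightarrow> 'i \<Rightarrow> laurent" where
  "cf h w = representation (e ` X) h (e w)"

definition supp :: "'m \<Rightarrow> 'i set" where
  "supp h = {w \<in> X. cf h w \<noteq> 0}"

lemma cf_add: "cf (g + h) w = cf g w + cf h w"
  by (simp add: cf_def representation_add[OF independent_e] span_e)

lemma cf_diff: "cf (g - h) w = cf g w - cf h w"
  by (simp add: cf_def representation_diff[OF independent_e] span_e)

lemma cf_uminus: "cf (- h) w = - cf h w"
  by (simp add: cf_def representation_neg[OF independent_e] span_e)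

lemma cf_scale: "cf (scale a h) w = a * cf h w"
  by (simp add: cf_def representation_scale[OF independent_e] span_e)

lemma cf_0 [simp]: "cf 0 w = 0"
  by (simp add: cf_def representation_zero)

lemma cf_sum: "cf (sum f I) w = (\<Sum>i\<in>I. cf (f i) w)"
  by (induction I rule: infinite_finite_induct) (auto simp: cf_add)

lemma cf_basis: "\<lbrakk>w \<in> X; y \<in> X\<rbrakk> \<Longrightarrow> cf (e w) y = (if y = w then 1 else 0)"
  using inj_e by (auto simp: cf_def representation_basis[OF independent_e] dest: inj_onD)

lemma finite_supp [simp]: "finite (supp h)"
proof -
  have "e ` supp h \<subseteq> {b. representation (e ` X) h b \<noteq> 0}"
    by (auto simp: supp_def cf_def)
  then have "finite (e ` supp h)"
    using finite_representation finite_subset by blast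
  moreover have "inj_on e (supp h)"
    using inj_e by (rule inj_on_subset) (auto simp: supp_def)
  ultimately show ?thesis using finite_imageD by blast
qed

lemma supp_subset: "supp h \<subseteq> X"
  by (auto simp: supp_def)

lemma expand: "h = (\<Sum>w \<in> supp h. scale (cf h w) (e w))"
proof -
  have "{b. representation (e ` X) h b \<noteq> 0} = e ` supp h"
    using representation_ne_zero[of "e ` X" h] by (auto simp: supp_def cf_def)
  moreover have "inj_on e (supp h)"
    using inj_e by (rule inj_on_subset) (auto simp: supp_def)
  ultimately have "(\<Sum>b | representation (e ` X) h b \<noteq> 0. scale (representation (e ` X) h b) b) =
      (\<Sum>w \<in> supp h. scale (cf h w) (e w))"
    by (simp add: sum.reindex cf_def)
  then show ?thesis
    using sum_nonzero_representation_eq[OF independent_e, of h] span_e by simp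
qed

lemma cf_eqI: "(\<And>w. w \<in> X \<Longrightarrow> cf g w = cf h w) \<Longrightarrow> g = h"
proof -
  assume "\<And>w. w \<in> X \<Longrightarrow> cf g w = cf h w"
  then have "supp (g - h) = {}"
    by (simp add: supp_def cf_diff)
  then have "g - h = 0"
    using expand[of "g - h"] by simp
  then show ?thesis by simp
qed

lemma supp_basis: "w \<in> X \<Longrightarrow> supp (e w) = {w}"
  by (auto simp: supp_def cf_basis split: if_splits)

text \<open>Semilinear extension from the basis: \<sigma> is the identity for linear maps and
  \<open>bar_A\<close> for the bar involution.\<close>

definition ext :: "(laurent \<Rightarrow> laurent) \<Rightarrow> ('i \<Rightarrow> 'm) \<Rightarrow> 'm \<Rightarrow> 'm" where
  "ext \<sigma> f h = (\<Sum>w \<in> supp h. scale (\<sigma> (cf h w)) (f w))"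

lemma ext_superset:
  assumes "finite F" "supp h \<subseteq> F" "F \<subseteq> X" "\<sigma> 0 = 0"
  shows "ext \<sigma> f h = (\<Sum>w \<in> F. scale (\<sigma> (cf h w)) (f w))"
  unfolding ext_def
  by (rule sum.mono_neutral_left) (use assms in \<open>auto simp: supp_def\<close>)

lemma ext_basis: "\<lbrakk>w \<in> X; \<sigma> 1 = 1\<rbrakk> \<Longrightarrow> ext \<sigma> f (e w) = f w"
  by (simp add: ext_def supp_basis cf_basis)

lemma ext_add:
  assumes "\<And>a b. \<sigma> (a + b) = \<sigma> a + \<sigma> b"
  shows "ext \<sigma> f (g + h) = ext \<sigma> f g + ext \<sigma> f h"
proof -
  have 0: "\<sigma> 0 = 0" using assms[of 0 0] by simp
  let ?F = "supp g \<union> supp h"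
  have F: "finite ?F" "supp g \<subseteq> ?F" "supp h \<subseteq> ?F" "supp (g + h) \<subseteq> ?F" "?F \<subseteq> X"
    using finite_supp[of g] finite_supp[of h] by (auto simp: supp_def cf_add)
  show ?thesis
    unfolding ext_superset[where \<sigma> = \<sigma>, OF F(1,2,5) 0] ext_superset[where \<sigma> = \<sigma>, OF F(1,3,5) 0] ext_superset[where \<sigma> = \<sigma>, OF F(1,4,5) 0]
    by (simp add: cf_add assms scale_left_distrib sum.distrib)
qed

lemma ext_scale:
  assumes "\<And>a b. \<sigma> (a * b) = \<sigma> a * \<sigma> b" "\<sigma> 0 = 0"
  shows "ext \<sigma> f (scale a h) = scale (\<sigma> a) (ext \<sigma> f h)"
proof -
  have F: "finite (supp h)" "supp (scale a h) \<subseteq> supp h" "supp h \<subseteq> X"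
    using finite_supp[of h] by (auto simp: supp_def cf_scale)
  show ?thesis
    unfolding ext_superset[where \<sigma> = \<sigma>, OF F(1,2,3) assms(2)] unfolding ext_def
    by (simp add: cf_scale assms scale_sum_right)
qed

lemma semilinear_expand:
  assumes "\<And>g h. f (g + h) = f g + (f h :: 'm)" "\<And>a h. f (scale a h) = scale (\<sigma> a) (f h)"
  shows "f h = (\<Sum>w \<in> supp h. scale (\<sigma> (cf h w)) (f (e w)))"
proof -
  interpret f: additive f by standard (rule assms)
  have "f h = f (\<Sum>w \<in> supp h. scale (cf h w) (e w))"
    by (subst expand[of h]) (rule HOL.refl)
  also have "\<dots> = (\<Sum>w \<in> supp h. scale (\<sigma> (cf h w)) (f (e w)))"
    by (simp add: f.sum assms(2))
  finally show ?thesis .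
qed

lemma semilinear_eqI:
  assumes "\<And>g h. f (g + h) = f g + (f h :: 'm)" "\<And>a h. f (scale a h) = scale (\<sigma> a) (f h)"
    and "\<And>g h. f' (g + h) = f' g + (f' h :: 'm)" "\<And>a h. f' (scale a h) = scale (\<sigma> a) (f' h)"
    and "\<And>w. w \<in> X \<Longrightarrow> f (e w) = f' (e w)"
  shows "f h = f' h"
proof -
  have "f h = (\<Sum>w \<in> supp h. scale (\<sigma> (cf h w)) (f (e w)))"
    by (rule semilinear_expand) (rule assms)+
  also have "\<dots> = (\<Sum>w \<in> supp h. scale (\<sigma> (cf h w)) (f' (e w)))"
    using assms(5) by (intro sum.cong) (auto simp: supp_def)
  also have "\<dots> = f' h"
    by (rule semilinear_expand[symmetric]) (rule assms)+
  finally show ?thesis .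
qed

text \<open>\<open>lat 0\<close> is the lattice spanned by the basis over the polynomials in v^-1,
  and \<open>lat (- 1)\<close> is v^-1 times this lattice.\<close>

definition lat :: "int \<Rightarrow> 'm \<Rightarrow> bool" where
  "lat n h \<longleftrightarrow> (\<forall>y \<in> X. deg_le n (cf h y))"

lemma lat_0 [simp]: "lat n 0" by (simp add: lat_def)

lemma lat_add: "lat n g \<Longrightarrow> lat n h \<Longrightarrow> lat n (g + h)"
  by (simp add: lat_def cf_add deg_le_add)

lemma lat_diff: "lat n g \<Longrightarrow> lat n h \<Longrightarrow> lat n (g - h)"
  by (simp add: lat_def cf_diff deg_le_diff)

lemma lat_sum: "(\<And>i. i \<in> I \<Longrightarrow> lat n (f i)) \<Longrightarrow> lat n (sum f I)"
  by (simp add: lat_def cf_sum deg_le_sum)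

lemma lat_scale: "deg_le m a \<Longrightarrow> lat n h \<Longrightarrow> lat (m + n) (scale a h)"
  by (simp add: lat_def cf_scale deg_le_mult)

lemma lat_basis: "w \<in> X \<Longrightarrow> lat 0 (e w)"
  by (simp add: lat_def cf_basis deg_le_1)

lemma lat_mono: "lat n h \<Longrightarrow> n \<le> m \<Longrightarrow> lat m h"
  using deg_le_mono by (auto simp: lat_def)

end

section \<open>Canonical bases\<close>

text \<open>\<open>b s\<close> stands for left multiplication by the Kazhdan-Lusztig element of
  \<open>s\<close>; \<open>X\<close> is all of \<open>W\<close> for the Hecke algebra and
  \<open>W\<^sub>c\<close> for the quotient. Products that leave \<open>X\<close> are not prescribed
  but bounded by the last two axioms, which are vacuous for the Hecke algebra. In the quotient,
  \<open>b_out_lat\<close> is Property W.\<close>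

locale kl_module =
  coxeter_system W + based_module scale X e
  for W :: "'w coxeter" (structure) and scale :: "laurent \<Rightarrow> 'm \<Rightarrow> 'm::ab_group_add"
    and X :: "'w set" and e :: "'w \<Rightarrow> 'm" +
  fixes b :: "'w \<Rightarrow> 'm \<Rightarrow> 'm" and bar :: "'m \<Rightarrow> 'm"
  assumes X_carrier: "X \<subseteq> carrier W"
    and one_X: "\<one> \<in> X"
    and X_down: "\<lbrakk>s \<in> cox_gens W; w \<in> X; dl s w\<rbrakk> \<Longrightarrow> s \<otimes> w \<in> X"
    and b_add: "s \<in> cox_gens W \<Longrightarrow> b s (g + h) = b s g + b s h"
    and b_scale: "s \<in> cox_gens W \<Longrightarrow> b s (scale a h) = scale a (b s h)"
    and b_square: "s \<in> cox_gens W \<Longrightarrow> b s (b s h) = scale (vpow 1 + vpow (- 1)) (b s h)"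
    and bar_add: "bar (g + h) = bar g + bar h"
    and bar_scale: "bar (scale a h) = scale (bar_A a) (bar h)"
    and bar_one: "bar (e \<one>) = e \<one>"
    and bar_b: "s \<in> cox_gens W \<Longrightarrow> bar (b s h) = b s (bar h)"
    and b_up: "\<lbrakk>s \<in> cox_gens W; w \<in> X; \<not> dl s w; s \<otimes> w \<in> X\<rbrakk>
      \<Longrightarrow> b s (e w) = e (s \<otimes> w) + scale (vpow (- 1)) (e w)"
    and b_down: "\<lbrakk>s \<in> cox_gens W; w \<in> X; dl s w\<rbrakk>
      \<Longrightarrow> b s (e w) = e (s \<otimes> w) + scale (vpow 1) (e w)"
    and b_out_lat: "\<lbrakk>s \<in> cox_gens W; w \<in> X; \<not> dl s w; s \<otimes> w \<notin> X\<rbrakk> \<Longrightarrow> lat (- 1) (b s (e w))"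
    and b_out_len: "\<lbrakk>s \<in> cox_gens W; w \<in> X; \<not> dl s w; s \<otimes> w \<notin> X; y \<in> supp (b s (e w))\<rbrakk>
      \<Longrightarrow> len y \<le> Suc (len w)"
begin

lemma X_closed [simp]: "w \<in> X \<Longrightarrow> w \<in> carrier W"
  using X_carrier by blast

lemma b_0: "s \<in> S \<Longrightarrow> b s 0 = 0"
  using b_add[of s 0 0] by simp

lemma b_diff: "s \<in> S \<Longrightarrow> b s (g - h) = b s g - b s h"
  using b_add[of s "g - h" h] by (simp add: algebra_simps)

lemma b_sum: "s \<in> S \<Longrightarrow> b s (sum f I) = (\<Sum>i\<in>I. b s (f i))"
  by (induction I rule: infinite_finite_induct) (auto simp: b_0 b_add)

lemma b_expand: "s \<in> S \<Longrightarrow> b s h = (\<Sum>y \<in> supp h. scale (cf h y) (b s (e y)))"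
  using semilinear_expand[of "b s" "\<lambda>a. a" h] b_add b_scale by simp

lemma cf_b: "s \<in> S \<Longrightarrow> cf (b s h) x = (\<Sum>y \<in> supp h. cf h y * cf (b s (e y)) x)"
  by (subst b_expand) (auto simp: cf_sum cf_scale)

lemma bar_diff: "bar (g - h) = bar g - bar h"
  using bar_add[of "g - h" h] by (simp add: algebra_simps)

lemma bar_0: "bar 0 = 0"
  using bar_add[of 0 0] by simp

lemma bar_sum: "bar (sum f I) = (\<Sum>i\<in>I. bar (f i))"
  by (induction I rule: infinite_finite_induct) (auto simp: bar_0 bar_add)

text \<open>Triangularity is measured by length, which serves both instances. The finer support in
  the Bruhat order is established for the Hecke algebra in \<open>supp_KH_can\<close>.\<close>

definition below :: "nat \<Rightarrow> 'm \<Rightarrow> bool" where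
  "below n h \<longleftrightarrow> (\<forall>y \<in> supp h. len y < n)"

lemma below_iff: "below n h \<longleftrightarrow> (\<forall>y \<in> X. n \<le> len y \<longrightarrow> cf h y = 0)"
  by (auto simp: below_def supp_def)

lemma below_add: "below n g \<Longrightarrow> below n h \<Longrightarrow> below n (g + h)"
  by (simp add: below_iff cf_add)

lemma below_diff: "below n g \<Longrightarrow> below n h \<Longrightarrow> below n (g - h)"
  by (simp add: below_iff cf_diff)

lemma below_scale: "below n h \<Longrightarrow> below n (scale a h)"
  by (simp add: below_iff cf_scale)

lemma below_sum: "(\<And>i. i \<in> I \<Longrightarrow> below n (f i)) \<Longrightarrow> below n (sum f I)"
  by (simp add: below_iff cf_sum)

lemma below_basis: "w \<in> X \<Longrightarrow> len w < n \<Longrightarrow> below n (e w)"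
  by (auto simp: below_def supp_basis)

lemma below_mono: "below n h \<Longrightarrow> n \<le> n' \<Longrightarrow> below n' h"
  by (auto simp: below_def)

lemma below_b:
  assumes "s \<in> S" "below n h"
  shows "below (Suc n) (b s h)"
proof -
  have "below (Suc n) (scale (cf h y) (b s (e y)))" if "y \<in> supp h" for y
  proof (rule below_scale)
    have y: "y \<in> X" "len y < n" using that assms by (auto simp: below_def supp_def)
    consider "dl s y" | "\<not> dl s y" "s \<otimes> y \<in> X" | "\<not> dl s y" "s \<otimes> y \<notin> X" by blast
    then show "below (Suc n) (b s (e y))"
    proof cases
      case 1
      then show ?thesis
        using b_down[OF assms(1) y(1)] X_down assms(1) y len_down[of s y]
        by (auto intro!: below_add below_scale below_basis)
    next
      case 2
      then show ?thesis
        using b_up[OF assms(1) y(1)] assms(1) y len_up[of s y]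
        by (auto intro!: below_add below_scale below_basis)
    next
      case 3
      then show ?thesis
        using b_out_len[OF assms(1) y(1)] y unfolding below_def by force
    qed
  qed
  then show ?thesis
    by (subst b_expand[OF assms(1)]) (rule below_sum)
qed

text \<open>As bar commutes with \<open>b s\<close>, writing e_w = b_s e_u - v^-1 e_u with u = sw
  reduces the claim to the shorter \<open>u\<close>, without any inverse of a basis element.\<close>

lemma bar_basis: "w \<in> X \<Longrightarrow> below (len w) (bar (e w) - e w)"
proof (induction "len w" arbitrary: w rule: less_induct)
  case less
  show ?case
  proof (cases "w = \<one>")
    case True
    then show ?thesis by (simp add: bar_one below_iff)
  next
    case False
    obtain s where s: "s \<in> S" "dl s w"
      by (rule ex_dl[OF X_closed[OF less.prems] False])
    define u where "u = s \<otimes> w"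
    have u: "u \<in> X" "s \<otimes> u = w" "\<not> dl s u" "len w = Suc (len u)"
      using X_down s less len_down[of s w] by (auto simp: u_def dl_mult)
    have ew: "e w = b s (e u) - scale (vpow (- 1)) (e u)"
      using b_up[OF s(1) u(1,3)] u less by simp
    have IH: "below (len u) (bar (e u) - e u)" using less u by simp
    have "bar (e w) = b s (bar (e u)) - scale (vpow 1) (bar (e u))"
      unfolding ew using s by (simp add: bar_diff bar_scale bar_b)
    then have "bar (e w) - e w = b s (bar (e u) - e u) - scale (vpow 1) (bar (e u) - e u)
        + (scale (vpow (- 1)) (e u) - scale (vpow 1) (e u))"
      unfolding ew using s by (simp add: b_diff algebra_simps scale_right_diff_distrib)
    moreover have "below (len w) \<dots>"
      using below_b[OF s(1) IH] below_mono[OF IH, of "len w"] below_basis[OF u(1), of "len w"] u(4)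
      by (intro below_add below_diff[of _ "b s _"] below_diff[of _ "scale _ (e u)"] below_scale) auto
    ultimately show ?thesis by simp
  qed
qed

text \<open>At an element of maximal length in the support, no other term contributes to the
  coefficient of bar h. This coefficient is thus bar-fixed and of negative degree.\<close>

lemma bar_invariant_unique:
  assumes "bar h = h" "lat (- 1) h"
  shows "h = 0"
proof (rule ccontr)
  assume "h \<noteq> 0"
  then have "supp h \<noteq> {}" using expand[of h] by auto
  then have "Max (len ` supp h) \<in> len ` supp h" by (intro Max_in) auto
  then obtain w where w: "w \<in> supp h" "len w = Max (len ` supp h)" by auto
  have max: "len y \<le> len w" if "y \<in> supp h" for y
    using that w(2) by simp
  have wX: "w \<in> X" using w by (simp add: supp_def)
  have summand: "cf (scale (bar_A (cf h y)) (bar (e y))) w = (if y = w then bar_A (cf h w) else 0)"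
    if y: "y \<in> supp h" for y
  proof -
    have "below (len y) (bar (e y) - e y)" using bar_basis y by (simp add: supp_def)
    then have "cf (bar (e y) - e y) w = 0"
      using max[OF y] wX by (simp add: below_iff)
    then have "cf (bar (e y)) w = cf (e y) w" by (simp add: cf_diff)
    then show ?thesis using y wX by (auto simp: cf_scale cf_basis supp_def)
  qed
  have "cf (bar h) w = (\<Sum>y \<in> supp h. cf (scale (bar_A (cf h y)) (bar (e y))) w)"
    by (subst semilinear_expand[of bar bar_A h]) (auto simp: bar_add bar_scale cf_sum)
  also have "\<dots> = bar_A (cf h w)"
    using w(1) by (subst sum.cong[OF HOL.refl summand]) auto
  finally have "bar_A (cf h w) = cf h w" using assms by simp
  then have "cf h w = 0"
    using bar_A_fixed_neg assms(2) wX by (simp add: lat_def)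
  then show False using w by (simp add: supp_def)
qed

definition is_can :: "'w \<Rightarrow> 'm \<Rightarrow> bool" where
  "is_can w h \<longleftrightarrow> bar h = h \<and> lat (- 1) (h - e w)"

definition can :: "'w \<Rightarrow> 'm" where
  "can w = (THE h. is_can w h)"

text \<open>The bound on lengths is carried along because the construction of the next longer
  element needs it.\<close>

definition ex_can :: "'w \<Rightarrow> bool" where
  "ex_can w \<longleftrightarrow> (\<exists>h. is_can w h \<and> below (len w) (h - e w))"

lemma is_can_unique: "is_can w h \<Longrightarrow> is_can w h' \<Longrightarrow> h = h'"
  using bar_invariant_unique[of "h - h'"] lat_diff[of "- 1" "h - e w" "h' - e w"]
  by (simp add: is_can_def bar_diff)

lemma can_eqI: "is_can w h \<Longrightarrow> can w = h"
  unfolding can_def using is_can_unique by blast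

definition pp :: "'w \<Rightarrow> 'w \<Rightarrow> laurent" where
  "pp y w = cf (can w) y"

definition mm :: "'w \<Rightarrow> 'w \<Rightarrow> int" where
  "mm y w = Poly_Mapping.lookup (pp y w) (- 1)"

definition lower :: "'w \<Rightarrow> 'w \<Rightarrow> 'w set" where
  "lower s w = {y \<in> X. dl s y \<and> mm y w \<noteq> 0}"

text \<open>Existence at \<open>w\<close> is a hypothesis here, so that the facts below are
  available inside the induction that establishes it.\<close>

context
  fixes w assumes w: "w \<in> X" and ex: "ex_can w"
begin

lemma ex_can_is_can: "is_can w (can w)" and ex_can_below: "below (len w) (can w - e w)"
  using ex can_eqI unfolding ex_can_def by auto

lemma pp_self: "pp w w = 1"
proof -
  have "cf (can w - e w) w = 0"
    using ex_can_below w by (simp add: below_iff)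
  then show ?thesis using w by (simp add: pp_def cf_diff cf_basis)
qed

lemma pp_deg: "y \<in> X \<Longrightarrow> y \<noteq> w \<Longrightarrow> deg_le (- 1) (pp y w)"
proof -
  assume y: "y \<in> X" "y \<noteq> w"
  then have "deg_le (- 1) (cf (can w - e w) y)"
    using ex_can_is_can by (simp add: is_can_def lat_def)
  then show ?thesis using y w by (simp add: pp_def cf_diff cf_basis)
qed

lemma pp_len: "y \<in> X \<Longrightarrow> pp y w \<noteq> 0 \<Longrightarrow> y = w \<or> len y < len w"
  using ex_can_below w by (auto simp: below_iff pp_def cf_diff cf_basis not_less[symmetric] split: if_splits)

lemma mm_len: "y \<in> X \<Longrightarrow> mm y w \<noteq> 0 \<Longrightarrow> len y < len w"
proof -
  assume y: "y \<in> X" "mm y w \<noteq> 0"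
  then have "pp y w \<noteq> 0" by (auto simp: mm_def)
  moreover have "y \<noteq> w" using y pp_self by (auto simp: mm_def lookup_one_laurent)
  ultimately show ?thesis using pp_len y by blast
qed

lemma finite_lower: "finite (lower s w)"
  by (rule finite_subset[OF _ finite_len_le[of "len w"]]) (use mm_len in \<open>force simp: lower_def\<close>)

text \<open>Modulo v^-1 times the lattice, a term p(y,w) b_s e_y with y \<noteq> w survives only if
  \<open>s\<close> is a descent of \<open>y\<close>: then v p(y,w) leaves its constant term
  \<open>mm y w\<close>. The term at \<open>w\<close> itself leaves e_sw, or nothing if sw is
  outside \<open>X\<close>.\<close>

lemma b_can_congruence:
  assumes s: "s \<in> S" and up: "\<not> dl s w"
  shows "lat (- 1) (b s (can w) - (if s \<otimes> w \<in> X then e (s \<otimes> w) else 0)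
    - (\<Sum>y \<in> lower s w. scale (of_int (mm y w)) (e y)))"
proof -
  \<comment> \<open>The residue of the term at \<open>y\<close> modulo
    \<open>lat (- 1)\<close>.\<close>
  define \<tau> where "\<tau> y = (if y = w then (if s \<otimes> w \<in> X then e (s \<otimes> w) else 0)
    else if dl s y then scale (of_int (mm y w)) (e y) else 0)" for y
  have summand: "lat (- 1) (scale (pp y w) (b s (e y)) - \<tau> y)" if y: "y \<in> supp (can w)" for y
  proof (cases "y = w")
    case True
    have "lat (- 1) (scale (vpow (- 1)) (e w))"
      using lat_scale[of "- 1" "vpow (- 1)" 0 "e w"] lat_basis w deg_le_vpow by simp
    then show ?thesis
      using True b_up[OF s w up] b_out_lat[OF s w up] pp_self by (auto simp: \<tau>_def)
  next
    case False
    have yX: "y \<in> X" using y by (simp add: supp_def)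
    have p: "deg_le (- 1) (pp y w)" using pp_deg yX False by blast
    consider "dl s y" | "\<not> dl s y" "s \<otimes> y \<in> X" | "\<not> dl s y" "s \<otimes> y \<notin> X" by blast
    then show ?thesis
    proof cases
      case 1
      have "lat (- 1) (scale (pp y w) (e (s \<otimes> y)))"
        using lat_scale[OF p lat_basis[OF X_down[OF s yX 1]]] by simp
      moreover have "lat (- 1) (scale (vpow 1 * pp y w - of_int (mm y w)) (e y))"
      proof -
        have "deg_le (- 2) (pp y w - vpow (- 1) * of_int (mm y w))"
          using deg_le_leading[OF p] by (simp add: mm_def)
        then have "deg_le (- 1) (vpow 1 * (pp y w - vpow (- 1) * of_int (mm y w)))"
          by (simp add: deg_le_vpow_mult)
        then have "deg_le (- 1) (vpow 1 * pp y w - of_int (mm y w))"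
          by (simp add: right_diff_distrib mult.assoc[symmetric] vpow_add)
        then show ?thesis using lat_scale[OF _ lat_basis[OF yX]] by force
      qed
      ultimately have "lat (- 1) (scale (pp y w) (e (s \<otimes> y)) + scale (vpow 1 * pp y w - of_int (mm y w)) (e y))"
        by (rule lat_add)
      then show ?thesis
        using False 1 b_down[OF s yX 1]
        by (simp add: \<tau>_def scale_right_distrib scale_left_diff_distrib algebra_simps)
    next
      case 2
      have "lat 0 (b s (e y))"
        unfolding b_up[OF s yX 2]
        using 2 yX lat_scale[of 0 "vpow (- 1)" 0 "e y"] by (intro lat_add lat_basis) (auto simp: lat_basis deg_le_vpow)
      then show ?thesis
        using lat_scale[OF p, of 0] False 2 by (simp add: \<tau>_def)
    next
      case 3
      then have "lat (- 2) (scale (pp y w) (b s (e y)))"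
        using lat_scale[OF p b_out_lat[OF s yX]] by simp
      then show ?thesis using False 3 lat_mono by (auto simp: \<tau>_def)
    qed
  qed
  have wsupp: "w \<in> supp (can w)" using w pp_self by (simp add: supp_def pp_def[symmetric])
  have "(\<Sum>y \<in> supp (can w). \<tau> y) = \<tau> w + (\<Sum>y \<in> supp (can w) - {w}. \<tau> y)"
    using wsupp by (simp add: sum.remove)
  also have "(\<Sum>y \<in> supp (can w) - {w}. \<tau> y) = (\<Sum>y \<in> lower s w. scale (of_int (mm y w)) (e y))"
  proof (rule sum.mono_neutral_cong_right)
    show "lower s w \<subseteq> supp (can w) - {w}"
      using up by (auto simp: lower_def supp_def mm_def pp_def)
    show "\<forall>i \<in> supp (can w) - {w} - lower s w. \<tau> i = 0"
      by (auto simp: \<tau>_def lower_def supp_def)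
  qed (auto simp: \<tau>_def lower_def up)
  finally have sum: "(\<Sum>y \<in> supp (can w). \<tau> y) = (if s \<otimes> w \<in> X then e (s \<otimes> w) else 0)
    + (\<Sum>y \<in> lower s w. scale (of_int (mm y w)) (e y))"
    by (simp add: \<tau>_def)
  have "lat (- 1) (\<Sum>y \<in> supp (can w). scale (pp y w) (b s (e y)) - \<tau> y)"
    by (rule lat_sum) (rule summand)
  moreover have "(\<Sum>y \<in> supp (can w). scale (pp y w) (b s (e y)) - \<tau> y) =
      b s (can w) - (\<Sum>y \<in> supp (can w). \<tau> y)"
    by (simp add: sum_subtractf pp_def b_expand[OF s, of "can w", symmetric])
  ultimately show ?thesis
    unfolding sum by (simp add: algebra_simps)
qed

text \<open>Subtracting multiples of bar-invariant elements removes the lower residues. What remains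
  is the candidate for the canonical element of sw, or for zero if sw is outside
  \<open>X\<close>.\<close>

lemma b_can_step:
  assumes s: "s \<in> S" and up: "\<not> dl s w" and low: "\<And>y. y \<in> lower s w \<Longrightarrow> ex_can y"
  defines "h \<equiv> b s (can w) - (\<Sum>y \<in> lower s w. scale (of_int (mm y w)) (can y))"
  shows "bar h = h" "lat (- 1) (h - (if s \<otimes> w \<in> X then e (s \<otimes> w) else 0))"
    "s \<otimes> w \<in> X \<Longrightarrow> below (Suc (len w)) (h - e (s \<otimes> w))"
proof -
  have y: "is_can y (can y)" "below (len y) (can y - e y)" "len y < len w" "y \<in> X" if yl: "y \<in> lower s w" for y
  proof -
    obtain g where "is_can y g" "below (len y) (g - e y)"
      using low[OF yl] unfolding ex_can_def by blast
    then show "is_can y (can y)" "below (len y) (can y - e y)" using can_eqI by auto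
    show "len y < len w" "y \<in> X" using yl mm_len by (auto simp: lower_def)
  qed
  show "bar h = h"
    unfolding h_def using y(1) ex_can_is_can s
    by (simp add: bar_diff bar_b bar_sum bar_scale is_can_def)
  have "lat (- 1) (\<Sum>y \<in> lower s w. scale (of_int (mm y w)) (can y - e y))"
  proof (rule lat_sum)
    fix y assume "y \<in> lower s w"
    then show "lat (- 1) (scale (of_int (mm y w)) (can y - e y))"
      using lat_scale[OF deg_le_of_int, of 0 "- 1"] y(1) by (simp add: is_can_def)
  qed
  from lat_diff[OF b_can_congruence[OF s up] this]
  show "lat (- 1) (h - (if s \<otimes> w \<in> X then e (s \<otimes> w) else 0))"
    by (simp add: h_def scale_right_diff_distrib sum_subtractf algebra_simps)
  show "below (Suc (len w)) (h - e (s \<otimes> w))" if sw: "s \<otimes> w \<in> X"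
  proof -
    have "h - e (s \<otimes> w) = scale (vpow (- 1)) (e w) + b s (can w - e w)
        - (\<Sum>y \<in> lower s w. scale (of_int (mm y w)) (can y - e y + e y))"
      using b_up[OF s w up sw] s by (simp add: h_def b_diff algebra_simps)
    moreover have "below (Suc (len w)) \<dots>"
    proof (rule below_diff[OF below_add below_sum])
      show "below (Suc (len w)) (b s (can w - e w))"
        using below_b[OF s ex_can_below] .
      show "below (Suc (len w)) (scale (vpow (- 1)) (e w))"
        using w by (intro below_scale below_basis) auto
      fix y assume yl: "y \<in> lower s w"
      show "below (Suc (len w)) (scale (of_int (mm y w)) (can y - e y + e y))"
        using y[OF yl] below_mono[OF y(2)[OF yl], of "Suc (len w)"]
        by (intro below_scale below_add below_basis) auto
    qed
    ultimately show ?thesis by simp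
  qed
qed

end

lemma can_exists: "w \<in> X \<Longrightarrow> ex_can w"
proof (induction "len w" arbitrary: w rule: less_induct)
  case less
  show ?case
  proof (cases "w = \<one>")
    case True
    then have "is_can w (e w) \<and> below (len w) (e w - e w)"
      by (simp add: is_can_def bar_one below_iff)
    then show ?thesis unfolding ex_can_def by blast
  next
    case False
    obtain s where s: "s \<in> S" "dl s w"
      by (rule ex_dl[OF X_closed[OF less.prems] False])
    define u where "u = s \<otimes> w"
    have u: "u \<in> X" "s \<otimes> u = w" "\<not> dl s u" "len w = Suc (len u)"
      using X_down s less len_down[of s w] by (auto simp: u_def dl_mult)
    have exu: "ex_can u" using less u by simp
    have "ex_can y" if "y \<in> lower s u" for y
      using that mm_len[OF u(1) exu] less(1)[of y] u by (force simp: lower_def)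
    from b_can_step[OF u(1) exu s(1) u(3) this] less(2) u
    show ?thesis unfolding ex_can_def is_can_def by auto
  qed
qed

lemma is_can_can: "w \<in> X \<Longrightarrow> is_can w (can w)"
  using ex_can_is_can can_exists by blast

text \<open>A bar-invariant element is determined by its residue, so the congruence of
  \<open>b_can_step\<close> becomes an equation.\<close>

theorem b_can_up:
  assumes "s \<in> S" "w \<in> X" "\<not> dl s w"
  shows "b s (can w) = (if s \<otimes> w \<in> X then can (s \<otimes> w) else 0)
    + (\<Sum>y \<in> lower s w. scale (of_int (mm y w)) (can y))"
proof -
  define h where "h = b s (can w) - (\<Sum>y \<in> lower s w. scale (of_int (mm y w)) (can y))"
  have "ex_can y" if "y \<in> lower s w" for y
    using can_exists that by (simp add: lower_def)
  note * = b_can_step(1,2)[OF assms(2) can_exists[OF assms(2)] assms(1,3) this, folded h_def]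
  have "h = (if s \<otimes> w \<in> X then can (s \<otimes> w) else 0)"
  proof (cases "s \<otimes> w \<in> X")
    case True
    then have "is_can (s \<otimes> w) h" using * by (simp add: is_can_def)
    then show ?thesis using can_eqI True by simp
  next
    case False
    then show ?thesis using * bar_invariant_unique by simp
  qed
  then show ?thesis by (simp add: h_def algebra_simps)
qed

text \<open>\<open>can w\<close> is b_s applied to \<open>can u\<close>, u = sw, minus shorter
  canonical elements with descent \<open>s\<close>. On the first part b_s is multiplication by v +
  v^-1 because of \<open>b_square\<close>, on the rest by induction.\<close>

theorem b_can_down:
  assumes "s \<in> S" "w \<in> X" "dl s w"
  shows "b s (can w) = scale (vpow 1 + vpow (- 1)) (can w)"
  using assms(2,3)
proof (induction "len w" arbitrary: w rule: less_induct)
  case less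
  define u where "u = s \<otimes> w"
  have u: "u \<in> X" "s \<otimes> u = w" "\<not> dl s u" "len w = Suc (len u)"
    using X_down assms(1) less len_down[of s w] by (auto simp: u_def dl_mult)
  have can: "can w = b s (can u) - (\<Sum>y \<in> lower s u. scale (of_int (mm y u)) (can y))"
    using b_can_up[OF assms(1) u(1,3)] u less by simp
  have "b s (can y) = scale (vpow 1 + vpow (- 1)) (can y)" if "y \<in> lower s u" for y
    using less.hyps[of y] that mm_len[OF u(1) can_exists[OF u(1)]] u by (force simp: lower_def)
  then show ?case
    unfolding can using assms(1)
    by (simp add: b_diff b_square b_sum b_scale scale_right_diff_distrib scale_sum_right mult.commute
        cong: sum.cong)
qed

section \<open>Coefficients of the canonical basis and the star recursion\<close>

lemma supp_can: "y \<in> supp (can w) \<longleftrightarrow> y \<in> X \<and> pp y w \<noteq> 0"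
  by (simp add: supp_def pp_def)

text \<open>Compare coefficients at \<open>x\<close> in b_s c_w = (v + v^-1) c_w. A product leaving
  \<open>X\<close> comes with two factors of degree at most -1, its coefficient in c_w and the one
  from \<open>b_out_lat\<close>, so it disappears modulo terms of degree at most -2.\<close>

lemma pp_descent:
  assumes s: "s \<in> S" and w: "w \<in> X" and x: "x \<in> X" and dw: "dl s w" and ux: "\<not> dl s x"
  shows "deg_le (- 2) (vpow 1 * pp x w - (if s \<otimes> x \<in> X then pp (s \<otimes> x) w else 0))"
proof -
  note deg = pp_deg[OF w can_exists[OF w]]
  have xw: "x \<noteq> w" using dw ux by auto
  have summand: "deg_le (- 2) (pp y w * cf (b s (e y)) x - (if y = s \<otimes> x then pp y w else 0))"
    if y: "y \<in> supp (can w)" for y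
  proof -
    have yX: "y \<in> X" using y by (simp add: supp_can)
    consider "dl s y" | "\<not> dl s y" "s \<otimes> y \<in> X" | "\<not> dl s y" "s \<otimes> y \<notin> X" by blast
    then show ?thesis
    proof cases
      case 1
      have "x \<noteq> y" using 1 ux by auto
      moreover have "x = s \<otimes> y \<longleftrightarrow> y = s \<otimes> x"
        using s x yX by auto
      ultimately show ?thesis
        using b_down[OF s yX 1] X_down[OF s yX 1] x yX by (auto simp: cf_add cf_scale cf_basis)
    next
      case 2
      have ne: "x \<noteq> s \<otimes> y" "y \<noteq> s \<otimes> x"
        using 2 ux s x yX dl_mult by auto
      have "deg_le (- 2) (pp x w * vpow (- 1))"
        using deg_le_mult[OF deg[OF x xw] deg_le_vpow[of "- 1" "- 1"]] by simp
      then show ?thesis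
        using b_up[OF s yX 2] 2 x yX ne by (auto simp: cf_add cf_scale cf_basis)
    next
      case 3
      have ne: "y \<noteq> s \<otimes> x" using 3 ux s x yX dl_mult by auto
      have "y \<noteq> w" using 3 dw by auto
      then have "deg_le (- 2) (pp y w * cf (b s (e y)) x)"
        using deg_le_mult[OF deg[OF yX], of "- 1"] b_out_lat[OF s yX 3] x by (simp add: lat_def)
      then show ?thesis using ne by simp
    qed
  qed
  have "(vpow 1 + vpow (- 1)) * pp x w = cf (b s (can w)) x"
    unfolding b_can_down[OF s w dw] by (simp add: cf_scale pp_def)
  also have "\<dots> = (\<Sum>y \<in> supp (can w). pp y w * cf (b s (e y)) x)"
    unfolding pp_def by (rule cf_b[OF s])
  finally have eq: "(vpow 1 + vpow (- 1)) * pp x w = \<dots>" .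
  have delta: "(\<Sum>y \<in> supp (can w). if y = s \<otimes> x then pp y w else 0) = (if s \<otimes> x \<in> X then pp (s \<otimes> x) w else 0)"
    by (auto simp: sum.delta supp_can)
  have "deg_le (- 2) (\<Sum>y \<in> supp (can w). pp y w * cf (b s (e y)) x - (if y = s \<otimes> x then pp y w else 0))"
    by (rule deg_le_sum) (rule summand)
  then have "deg_le (- 2) ((vpow 1 + vpow (- 1)) * pp x w - (if s \<otimes> x \<in> X then pp (s \<otimes> x) w else 0))"
    unfolding sum_subtractf delta eq .
  moreover have "deg_le (- 2) (vpow (- 1) * pp x w)"
    using deg[OF x xw] by (simp add: deg_le_vpow_mult)
  ultimately have "deg_le (- 2) ((vpow 1 + vpow (- 1)) * pp x w - (if s \<otimes> x \<in> X then pp (s \<otimes> x) w else 0)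
      - vpow (- 1) * pp x w)"
    by (rule deg_le_diff)
  then show ?thesis by (simp add: algebra_simps)
qed

text \<open>The constant terms in \<open>pp_descent\<close>: that of p(sx,w) is 1 for sx = w and 0
  otherwise.\<close>

lemma mm_descent:
  assumes "s \<in> S" "w \<in> X" "x \<in> X" "dl s w" "\<not> dl s x"
  shows "mm x w = (if s \<otimes> x = w then 1 else 0)"
proof -
  have "Poly_Mapping.lookup (vpow 1 * pp x w - (if s \<otimes> x \<in> X then pp (s \<otimes> x) w else 0)) 0 = 0"
    using deg_leD[OF pp_descent[OF assms]] by simp
  then have "mm x w = (if s \<otimes> x \<in> X then Poly_Mapping.lookup (pp (s \<otimes> x) w) 0 else 0)"
    by (auto simp: lookup_minus mm_def split: if_splits)
  moreover have "Poly_Mapping.lookup (pp (s \<otimes> x) w) 0 = (if s \<otimes> x = w then 1 else 0)" if "s \<otimes> x \<in> X"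
    using pp_deg[OF assms(2) can_exists[OF assms(2)] that] pp_self[OF assms(2) can_exists[OF assms(2)]]
    by (force simp: deg_le_def lookup_one_laurent)
  ultimately show ?thesis using assms(2) by auto
qed

text \<open>The next coefficient of the same congruence. It lets \<open>mm_recursion\<close> express
  the coefficient of v^-2 in p(x,w) through \<open>mm\<close>.\<close>

lemma lookup_pp_descent:
  assumes "s \<in> S" "w \<in> X" "x \<in> X" "dl s w" "\<not> dl s x"
  shows "Poly_Mapping.lookup (pp x w) (- 2) = (if s \<otimes> x \<in> X then mm (s \<otimes> x) w else 0)"
proof -
  have "Poly_Mapping.lookup (vpow 1 * pp x w - (if s \<otimes> x \<in> X then pp (s \<otimes> x) w else 0)) (- 1) = 0"
    using deg_leD[OF pp_descent[OF assms]] by simp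
  then show ?thesis
    by (auto simp: lookup_minus mm_def split: if_splits)
qed

text \<open>Take the coefficient of v^-1 at \<open>x\<close> in the formula for b_s c_w. On the
  left, v p(x,w) + p(sx,w) gives \<open>mm\<close> at tx, by \<open>lookup_pp_descent\<close> for
  \<open>t\<close>, and at sx. On the right the sum over lower elements collapses to two terms, one
  of which cancels the term at tx when \<open>s\<close> is a descent of tx.\<close>

theorem mm_recursion:
  assumes s: "s \<in> S" and t: "t \<in> S" and w: "w \<in> X" and x: "x \<in> X" and sw: "s \<otimes> w \<in> X"
    and "dl t w" "\<not> dl s w" "dl s x" "\<not> dl t x"
  shows "mm x (s \<otimes> w) = mm (s \<otimes> x) w
    + (if t \<otimes> x \<in> X \<and> \<not> dl s (t \<otimes> x) then mm (t \<otimes> x) w else 0)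
    - (if dl s (t \<otimes> w) then mm x (t \<otimes> w) else 0)"
proof -
  note deg = pp_deg[OF w can_exists[OF w]]
  have sx: "s \<otimes> x \<in> X" "\<not> dl s (s \<otimes> x)" "s \<otimes> (s \<otimes> x) = x" "s \<otimes> x \<noteq> x"
    using X_down s x assms(8) dl_mult gen_neq_one by auto
  have summand: "deg_le (- 2) (pp y w * cf (b s (e y)) x - (if y = x then vpow 1 * pp y w else 0)
      - (if y = s \<otimes> x then pp y w else 0))"
    if y: "y \<in> supp (can w)" for y
  proof -
    have yX: "y \<in> X" using y by (simp add: supp_can)
    consider "dl s y" | "\<not> dl s y" "s \<otimes> y \<in> X" | "\<not> dl s y" "s \<otimes> y \<notin> X" by blast
    then show ?thesis
    proof cases
      case 1
      have "x \<noteq> s \<otimes> y" "y \<noteq> s \<otimes> x" using 1 assms(8) s yX sx dl_mult by auto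
      then show ?thesis
        using b_down[OF s yX 1] X_down[OF s yX 1] x yX by (auto simp: cf_add cf_scale cf_basis mult.commute)
    next
      case 2
      have "x \<noteq> y" using 2 assms(8) by auto
      moreover have "x = s \<otimes> y \<longleftrightarrow> y = s \<otimes> x" using s x yX by auto
      ultimately show ?thesis
        using b_up[OF s yX 2] 2 x yX by (auto simp: cf_add cf_scale cf_basis)
    next
      case 3
      have "y \<noteq> x" "y \<noteq> s \<otimes> x" using 3 assms(8) sx x by auto
      moreover have "y \<noteq> w" using 3 sw by auto
      then have "deg_le (- 2) (pp y w * cf (b s (e y)) x)"
        using deg_le_mult[OF deg[OF yX], of "- 1"] b_out_lat[OF s yX 3] x by (simp add: lat_def)
      ultimately show ?thesis by simp
    qed
  qed
  have cf_sum: "cf (b s (can w)) x = (\<Sum>y \<in> supp (can w). pp y w * cf (b s (e y)) x)"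
    unfolding pp_def by (rule cf_b[OF s])
  have delta: "(\<Sum>y \<in> supp (can w). if y = x then vpow 1 * pp y w else 0) = vpow 1 * pp x w"
    "(\<Sum>y \<in> supp (can w). if y = s \<otimes> x then pp y w else 0) = pp (s \<otimes> x) w"
    using x sx(1) by (auto simp: sum.delta supp_can)
  have "deg_le (- 2) (\<Sum>y \<in> supp (can w). pp y w * cf (b s (e y)) x
      - (if y = x then vpow 1 * pp y w else 0) - (if y = s \<otimes> x then pp y w else 0))"
    by (rule deg_le_sum) (rule summand)
  then have "deg_le (- 2) (cf (b s (can w)) x - vpow 1 * pp x w - pp (s \<otimes> x) w)"
    unfolding sum_subtractf delta cf_sum .
  then have "Poly_Mapping.lookup (cf (b s (can w)) x - vpow 1 * pp x w - pp (s \<otimes> x) w) (- 1) = 0"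
    using deg_leD by force
  then have L: "Poly_Mapping.lookup (cf (b s (can w)) x) (- 1) =
      (if t \<otimes> x \<in> X then mm (t \<otimes> x) w else 0) + mm (s \<otimes> x) w"
    using lookup_pp_descent[OF t w x assms(6,9)] by (simp add: lookup_minus mm_def)
  have tw: "t \<otimes> w \<in> X" "\<not> dl t (t \<otimes> w)" "t \<otimes> (t \<otimes> w) = w" using X_down t w assms(6) dl_mult by auto
  have "Poly_Mapping.lookup (cf (b s (can w)) x) (- 1) =
      mm x (s \<otimes> w) + (\<Sum>y \<in> lower s w. mm y w * mm x y)"
  proof -
    show ?thesis
      unfolding b_can_up[OF s w assms(7)] using sw
      by (simp add: cf_add based_module.cf_sum[OF based_module_axioms] cf_scale lookup_add lookup_sum lookup_of_int_mult mm_def pp_def)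
  qed
  \<comment> \<open>If \<open>t\<close> is a descent of \<open>y\<close>, then \<open>mm x y\<close>
    is known from \<open>mm_descent\<close>, as \<open>t\<close> is no descent of \<open>x\<close>;
    if not, then \<open>mm y w\<close> is known, as \<open>t\<close> is a descent of
    \<open>w\<close>. Hence only tx and tw remain.\<close>
  also have "(\<Sum>y \<in> lower s w. mm y w * mm x y) =
      (\<Sum>y \<in> lower s w. (if y = t \<otimes> w then mm x (t \<otimes> w) else 0) + (if y = t \<otimes> x then mm (t \<otimes> x) w else 0))"
  proof (rule sum.cong[OF HOL.refl])
    fix y assume "y \<in> lower s w"
    then have y: "y \<in> X" "dl s y" by (auto simp: lower_def)
    show "mm y w * mm x y = (if y = t \<otimes> w then mm x (t \<otimes> w) else 0) + (if y = t \<otimes> x then mm (t \<otimes> x) w else 0)"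
    proof (cases "dl t y")
      case True
      then have "y \<noteq> t \<otimes> w" using tw by auto
      moreover have "mm x y = (if y = t \<otimes> x then 1 else 0)"
        using mm_descent[OF t y(1) x True assms(9)] by auto
      ultimately show ?thesis by simp
    next
      case False
      have "y \<noteq> t \<otimes> x" using False t x assms(9) dl_mult by auto
      moreover have "t \<otimes> y = w \<longleftrightarrow> y = t \<otimes> w" using t w y by auto
      then have "mm y w = (if y = t \<otimes> w then 1 else 0)"
        using mm_descent[OF t w y(1) assms(6) False] by auto
      ultimately show ?thesis by simp
    qed
  qed
  also have "\<dots> = (if t \<otimes> w \<in> lower s w then mm x (t \<otimes> w) else 0)
      + (if t \<otimes> x \<in> lower s w then mm (t \<otimes> x) w else 0)"
    using finite_lower[OF w can_exists[OF w]] by (simp add: sum.distrib sum.delta)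
  also have "t \<otimes> w \<in> lower s w \<longleftrightarrow> dl s (t \<otimes> w)"
    using mm_descent[OF t w tw(1) assms(6) tw(2)] tw by (auto simp: lower_def)
  finally show ?thesis
    using L by (auto simp: lower_def split: if_splits)
qed

text \<open>A linear map that inverts the labels of the basis and commutes with bar carries the
  characterization of \<open>can w\<close> to that of \<open>can (inv w)\<close>.\<close>

lemma can_anti:
  assumes "\<And>g h. st (g + h) = st g + st h" "\<And>a h. st (scale a h) = scale a (st h)"
    and "\<And>w. w \<in> X \<Longrightarrow> st (e w) = e (inv w)" "\<And>w. w \<in> X \<Longrightarrow> inv w \<in> X"
    and "\<And>h. bar (st h) = st (bar h)"
    and w: "w \<in> X" and x: "x \<in> X"
  shows "mm (inv x) (inv w) = mm x w"
proof -
  interpret st: additive st by standard (rule assms)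
  have cf: "cf (st h) (inv y) = cf h y" if y: "y \<in> X" for h y
  proof -
    have "cf (st h) (inv y) = (\<Sum>z \<in> supp h. cf h z * cf (e (inv z)) (inv y))"
      by (subst semilinear_expand[of st "\<lambda>a. a" h])
        (auto simp: assms cf_sum cf_scale supp_def intro!: sum.cong)
    also have "\<dots> = (\<Sum>z \<in> supp h. if z = y then cf h y else 0)"
    proof (rule sum.cong[OF HOL.refl])
      fix z assume "z \<in> supp h"
      then have z: "z \<in> X" by (simp add: supp_def)
      have "inv y = inv z \<longleftrightarrow> y = z"
        using y z by (metis X_closed inv_inv)
      then show "cf h z * cf (e (inv z)) (inv y) = (if z = y then cf h y else 0)"
        using assms(4)[OF z] assms(4)[OF y] by (auto simp: cf_basis)
    qed
    also have "\<dots> = cf h y" using y by (simp add: sum.delta) (simp add: supp_def)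
    finally show ?thesis .
  qed
  have "is_can (inv w) (st (can w))"
    unfolding is_can_def
  proof
    show "bar (st (can w)) = st (can w)"
      using is_can_can[OF w] assms(5) by (simp add: is_can_def)
    have "lat (- 1) (st (can w - e w))"
      unfolding lat_def
    proof
      fix y assume y: "y \<in> X"
      then have "cf (st (can w - e w)) y = cf (can w - e w) (inv y)"
        using cf[of "inv y" "can w - e w"] assms(4) by simp
      then show "deg_le (- 1) (cf (st (can w - e w)) y)"
        using is_can_can[OF w] assms(4)[OF y] by (simp add: is_can_def lat_def)
    qed
    then show "lat (- 1) (st (can w) - e (inv w))"
      using w by (simp add: st.diff assms)
  qed
  then have "can (inv w) = st (can w)" by (rule can_eqI)
  then show ?thesis
    using cf[OF x] by (simp add: mm_def pp_def)
qed

end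

section \<open>The Hecke algebra\<close>

context hecke_algebra
begin

lemma based_module_T: "based_module sc (carrier W) T"
  by unfold_locales (use T_inj T_independent T_span in auto)

lemma T_eq_Tn: "T w = sc (vpow (int (len w))) (Tn w)"
  by (simp add: Tn_def vpow_add)

text \<open>The basis is rescaled by units; the linear map doing this is injective because powers of
  v can be cancelled.\<close>

lemma based_module_Tn: "based_module sc (carrier W) Tn"
proof -
  interpret BT: based_module sc "carrier W" T by (rule based_module_T)
  define D where "D = BT.ext (\<lambda>a. a) Tn"
  have D_add: "D (g + h) = D g + D h" and D_scale: "D (sc a h) = sc a (D h)" for g h a
    unfolding D_def by (rule BT.ext_add BT.ext_scale, simp_all)+
  have D_T: "D (T w) = Tn w" if "w \<in> carrier W" for w
    unfolding D_def using that by (simp add: BT.ext_basis)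
  interpret D: module_hom sc sc D
    by unfold_locales (auto simp: D_add D_scale)
  have cf: "BT.cf (D h) w = vpow (- int (len w)) * BT.cf h w" if w: "w \<in> carrier W" for h w
  proof -
    have "BT.cf (D h) w = (\<Sum>y \<in> BT.supp h. BT.cf h y * BT.cf (Tn y) w)"
      by (simp add: D_def BT.ext_def BT.cf_sum BT.cf_scale)
    also have "\<dots> = (\<Sum>y \<in> BT.supp h. if y = w then vpow (- int (len w)) * BT.cf h w else 0)"
      by (rule sum.cong) (use w in \<open>auto simp: Tn_def BT.cf_scale BT.cf_basis BT.supp_def\<close>)
    also have "\<dots> = vpow (- int (len w)) * BT.cf h w"
      using w by (simp add: sum.delta) (simp add: BT.supp_def)
    finally show ?thesis .
  qed
  have inj: "inj D"
  proof (rule injI)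
    fix g h assume eq: "D g = D h"
    show "g = h"
    proof (rule BT.cf_eqI)
      fix w assume w: "w \<in> carrier W"
      have "vpow (int (len w)) * BT.cf (D g) w = vpow (int (len w)) * BT.cf (D h) w" using eq by simp
      then show "BT.cf g w = BT.cf h w"
        using w by (simp add: cf mult.assoc[symmetric] vpow_add)
    qed
  qed
  have img: "D ` T ` carrier W = Tn ` carrier W"
    by (auto simp: D_T image_iff)
  show ?thesis
  proof unfold_locales
    show "inj_on Tn (carrier W)"
      using inj T_inj D_T by (metis (no_types, lifting) inj_on_def UNIV_I)
    show "\<not> H.dependent (Tn ` carrier W)"
      using D.independent_injective_image[OF T_independent inj_on_subset[OF inj subset_UNIV]] img by simp
    have "T x \<in> H.span (Tn ` carrier W)" if "x \<in> carrier W" for x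
      using that by (subst T_eq_Tn) (intro H.span_scale H.span_base imageI)
    then have "T ` carrier W \<subseteq> H.span (Tn ` carrier W)" by auto
    then have "H.span (T ` carrier W) \<subseteq> H.span (Tn ` carrier W)"
      by (simp add: H.span_minimal)
    then show "H.span (Tn ` carrier W) = UNIV"
      using T_span by auto
  qed
qed

end

sublocale hecke_algebra \<subseteq> B: based_module sc "carrier W" Tn
  by (rule based_module_Tn)

context hecke_algebra
begin

lemma coeff_eq: "coeff h w = B.cf h w"
  by (simp add: coeff_def B.cf_def)

lemma Tn_one [simp]: "Tn \<one> = 1"
  by (simp add: Tn_def T_one)

lemma Tn_up:
  assumes "s \<in> S" "w \<in> carrier W" "\<not> dl s w"
  shows "Tn s * Tn w = Tn (s \<otimes> w)"
proof -
  have c: "- 1 - int (len w) = - int (len w) - 1" by simp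
  show ?thesis
    using len_up[OF assms] assms T_mult_up[of s w]
    by (simp add: Tn_def sc_mult_left sc_mult_right vpow_add c)
qed

abbreviation vdiff :: laurent where "vdiff \<equiv> vpow 1 - vpow (- 1)"

lemma Tn_down:
  assumes "s \<in> S" "w \<in> carrier W" "dl s w"
  shows "Tn s * Tn w = Tn (s \<otimes> w) + sc vdiff (Tn w)"
proof -
  have l: "int (len w) = int (len (s \<otimes> w)) + 1"
    using len_down[OF assms] by simp
  have c: "- 1 - int (len w) = - int (len w) - 1" by simp
  have "Tn s * Tn w = sc (vpow (- 1 - int (len w))) (sc qq (T (s \<otimes> w)) + sc (qq - 1) (T w))"
    using T_mult_down[OF assms(1,2)] assms by (simp add: Tn_def sc_mult_left sc_mult_right vpow_add dl_def c)
  also have "\<dots> = sc (vpow (- 1 - int (len w)) * qq) (T (s \<otimes> w)) + sc (vpow (- 1 - int (len w)) * (qq - 1)) (T w)"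
    by (simp add: H.scale_right_distrib)
  also have "vpow (- 1 - int (len w)) * qq = vpow (- int (len (s \<otimes> w)))"
    by (simp add: qq_def vpow_add l)
  also have "vpow (- 1 - int (len w)) * (qq - 1) = vdiff * vpow (- int (len w))"
    by (simp add: qq_def right_diff_distrib left_diff_distrib vpow_add)
  finally show ?thesis by (simp add: Tn_def)
qed

lemma Tn_mult:
  assumes "x \<in> carrier W" "y \<in> carrier W" "len (x \<otimes> y) = len x + len y"
  shows "Tn x * Tn y = Tn (x \<otimes> y)"
  using assms
proof (induction "len x" arbitrary: x)
  case 0
  then show ?case using len_eq_0_iff by simp
next
  case (Suc n)
  then have "x \<noteq> \<one>" by auto
  then obtain s where s: "s \<in> S" "dl s x" using ex_dl Suc.prems by metis
  define u where "u = s \<otimes> x"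
  have u: "u \<in> carrier W" "s \<otimes> u = x" "\<not> dl s u" "len x = Suc (len u)"
    using s Suc.prems len_down[of s x] by (auto simp: u_def dl_mult)
  have xy: "x \<otimes> y = s \<otimes> (u \<otimes> y)" using u s Suc.prems by (metis gens_closed m_assoc)
  have "len (x \<otimes> y) \<le> Suc (len (u \<otimes> y))"
    unfolding xy using len_mult_le[of s "u \<otimes> y"] s u Suc.prems by simp
  then have luy: "len (u \<otimes> y) = len u + len y"
    using len_mult_le[of u y] u Suc.prems by simp
  then have "\<not> dl s (u \<otimes> y)"
    using Suc.prems u xy by (simp add: dl_def)
  then have "Tn (x \<otimes> y) = Tn s * Tn (u \<otimes> y)"
    unfolding xy using Tn_up s u Suc.prems by simp
  also have "Tn (u \<otimes> y) = Tn u * Tn y"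
    using Suc.hyps(1)[of u] Suc.hyps(2) Suc.prems u luy by simp
  finally show ?case
    using Tn_up[OF s(1) u(1,3)] u by (simp add: mult.assoc[symmetric])
qed

lemma Tn_square: "s \<in> S \<Longrightarrow> Tn s * Tn s = 1 + sc vdiff (Tn s)"
  using Tn_down[of s s] by (simp add: dl_def)

lemma len_up_right: 
  assumes "s \<in> S" "w \<in> carrier W"
  shows "\<not> dl s (inv w) \<Longrightarrow> len (w \<otimes> s) = Suc (len w)" "dl s (inv w) \<Longrightarrow> Suc (len (w \<otimes> s)) = len w"
proof -
  have "len (w \<otimes> s) = len (s \<otimes> inv w)"
    using len_inv[of "w \<otimes> s"] assms by (simp add: inv_mult_group)
  then show "\<not> dl s (inv w) \<Longrightarrow> len (w \<otimes> s) = Suc (len w)" "dl s (inv w) \<Longrightarrow> Suc (len (w \<otimes> s)) = len w"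
    using len_up[of s "inv w"] len_down[of s "inv w"] assms by auto
qed

lemma Tn_up_right:
  assumes "s \<in> S" "w \<in> carrier W" "\<not> dl s (inv w)"
  shows "Tn w * Tn s = Tn (w \<otimes> s)"
  using Tn_mult[of w s] len_up_right(1) assms by simp

lemma Tn_down_right:
  assumes "s \<in> S" "w \<in> carrier W" "dl s (inv w)"
  shows "Tn w * Tn s = Tn (w \<otimes> s) + sc vdiff (Tn w)"
proof -
  have "Tn (w \<otimes> s) * Tn s = Tn w"
    using Tn_mult[of "w \<otimes> s" s] len_up_right(2)[OF assms] assms by (simp add: m_assoc)
  then have "Tn w * Tn s = Tn (w \<otimes> s) * (Tn s * Tn s)"
    by (simp add: mult.assoc[symmetric])
  also have "\<dots> = Tn (w \<otimes> s) + sc vdiff (Tn (w \<otimes> s) * Tn s)"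
    using assms by (simp add: Tn_square distrib_left sc_mult_right)
  finally show ?thesis
    using \<open>Tn (w \<otimes> s) * Tn s = Tn w\<close> by simp
qed

lemma Hecke_induct [case_names basis add scale]:
  assumes "\<And>w. w \<in> carrier W \<Longrightarrow> P (Tn w)" "\<And>g h. P g \<Longrightarrow> P h \<Longrightarrow> P (g + h)" "\<And>a h. P h \<Longrightarrow> P (sc a h)"
  shows "P h"
proof -
  have P0: "P 0" using assms(3)[OF assms(1)[of \<one>], of 0] by simp
  have "P (\<Sum>w \<in> F. sc (B.cf h w) (Tn w))" if "finite F" "F \<subseteq> carrier W" for F
    using that by (induction F rule: finite_induct) (auto intro: P0 assms)
  then show ?thesis
    using B.expand[of h] B.supp_subset[of h] by (metis B.finite_supp)
qed

text \<open>Left multiplication by the Kazhdan-Lusztig basis element of \<open>s\<close>.\<close>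

definition bH :: "'w \<Rightarrow> 'h \<Rightarrow> 'h" where
  "bH s h = Tn s * h + sc (vpow (- 1)) h"

lemma bH_add: "bH s (g + h) = bH s g + bH s h"
  by (simp add: bH_def distrib_left H.scale_right_distrib)

lemma bH_scale: "bH s (sc a h) = sc a (bH s h)"
  by (simp add: bH_def sc_mult_right H.scale_right_distrib mult.commute)

lemma bH_up:
  "\<lbrakk>s \<in> S; w \<in> carrier W; \<not> dl s w\<rbrakk> \<Longrightarrow> bH s (Tn w) = Tn (s \<otimes> w) + sc (vpow (- 1)) (Tn w)"
  by (simp add: bH_def Tn_up)

lemma bH_down:
  "\<lbrakk>s \<in> S; w \<in> carrier W; dl s w\<rbrakk> \<Longrightarrow> bH s (Tn w) = Tn (s \<otimes> w) + sc (vpow 1) (Tn w)"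
  by (simp add: bH_def Tn_down H.scale_left_diff_distrib)

subsection \<open>The bar involution\<close>

lemma ring_inverse_eqI: "x * y = 1 \<Longrightarrow> y * x = 1 \<Longrightarrow> ring_inverse x = (y :: 'h)"
  unfolding ring_inverse_def
  by (rule the_equality) (auto, metis mult.assoc mult.left_neutral mult.right_neutral)

definition Tinv :: "'w \<Rightarrow> 'h" where
  "Tinv s = Tn s - sc vdiff 1"

lemma Tinv_left: "s \<in> S \<Longrightarrow> Tinv s * Tn s = 1"
  by (simp add: Tinv_def left_diff_distrib Tn_square sc_mult_left)

lemma Tinv_right: "s \<in> S \<Longrightarrow> Tn s * Tinv s = 1"
  by (simp add: Tinv_def right_diff_distrib Tn_square sc_mult_right)

lemma Tinv_square: "s \<in> S \<Longrightarrow> Tinv s * Tinv s = 1 - sc vdiff (Tinv s)"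
proof -
  assume s: "s \<in> S"
  have "Tinv s * Tinv s = Tinv s * Tn s - sc vdiff (Tinv s)"
    by (subst (2) Tinv_def) (simp add: right_diff_distrib sc_mult_right)
  then show ?thesis using Tinv_left[OF s] by simp
qed

lemma bar_A_vdiff: "bar_A vdiff = - vdiff"
  by (simp add: bar_A_diff)

definition iT :: "'w \<Rightarrow> 'h" where
  "iT w = ring_inverse (Tn (inv w))"

text \<open>Invertibility at \<open>w\<close> uses the product rule at a shorter element, so both
  statements go through one induction.\<close>

lemma iT_inverse:
  "w \<in> carrier W \<Longrightarrow> Tn (inv w) * iT w = 1 \<and> iT w * Tn (inv w) = 1 \<and>
    (\<forall>s \<in> S. \<not> dl s w \<longrightarrow> iT (s \<otimes> w) = Tinv s * iT w)"
proof (induction "len w" arbitrary: w rule: less_induct)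
  case less
  have inv: "Tn (inv w) * iT w = 1 \<and> iT w * Tn (inv w) = 1"
  proof (cases "w = \<one>")
    case True
    have "ring_inverse (1 :: 'h) = 1" by (rule ring_inverse_eqI) auto
    then show ?thesis using True by (simp add: iT_def)
  next
    case False
    then obtain s where s: "s \<in> S" "dl s w" using ex_dl less.prems by metis
    define u where "u = s \<otimes> w"
    have u: "u \<in> carrier W" "s \<otimes> u = w" "\<not> dl s u" "len w = Suc (len u)"
      using s less.prems len_down[of s w] by (auto simp: u_def dl_mult)
    have IH: "Tn (inv u) * iT u = 1" "iT u * Tn (inv u) = 1" "iT w = Tinv s * iT u"
      using less.hyps[of u] u s by auto
    have "inv w = inv u \<otimes> s" using u s by (metis gen_inv gens_closed inv_mult_group)
    then have T: "Tn (inv w) = Tn (inv u) * Tn s"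
      using Tn_up_right[of s "inv u"] u s by simp
    have "Tn (inv w) * iT w = Tn (inv u) * (Tn s * Tinv s) * iT u"
      unfolding T IH(3) by (simp add: mult.assoc)
    moreover have "iT w * Tn (inv w) = Tinv s * (iT u * Tn (inv u)) * Tn s"
      unfolding T IH(3) by (simp add: mult.assoc)
    ultimately show ?thesis using IH Tinv_left[OF s(1)] Tinv_right[OF s(1)] by simp
  qed
  have "iT (s \<otimes> w) = Tinv s * iT w" if s: "s \<in> S" "\<not> dl s w" for s
  proof -
    have "inv (s \<otimes> w) = inv w \<otimes> s" using less.prems s by (simp add: inv_mult_group)
    then have T: "Tn (inv (s \<otimes> w)) = Tn (inv w) * Tn s"
      using Tn_up_right[of s "inv w"] less.prems s by simp
    show ?thesis
      unfolding iT_def[of "s \<otimes> w"] T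
    proof (rule ring_inverse_eqI)
      have "Tn (inv w) * Tn s * (Tinv s * iT w) = Tn (inv w) * (Tn s * Tinv s) * iT w"
        by (simp add: mult.assoc)
      then show "Tn (inv w) * Tn s * (Tinv s * iT w) = 1" using Tinv_right[OF s(1)] inv by simp
      have "Tinv s * iT w * (Tn (inv w) * Tn s) = Tinv s * (iT w * Tn (inv w)) * Tn s"
        by (simp add: mult.assoc)
      then show "Tinv s * iT w * (Tn (inv w) * Tn s) = 1" using Tinv_left[OF s(1)] inv by simp
    qed
  qed
  then show ?case using inv by blast
qed

lemma bar_H_eq: "bar_H h = B.ext bar_A iT h"
  by (simp add: bar_H_def B.ext_def coeff_eq iT_def B.supp_def)

lemma bar_H_add: "bar_H (g + h) = bar_H g + bar_H h"
  unfolding bar_H_eq by (rule B.ext_add) (rule bar_A_add)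

lemma bar_H_scale: "bar_H (sc a h) = sc (bar_A a) (bar_H h)"
  unfolding bar_H_eq by (rule B.ext_scale) (auto simp: bar_A_mult)

lemma bar_H_0 [simp]: "bar_H 0 = 0"
  using bar_H_add[of 0 0] by simp

lemma bar_H_Tn: "w \<in> carrier W \<Longrightarrow> bar_H (Tn w) = iT w"
  unfolding bar_H_eq by (rule B.ext_basis) auto

text \<open>\<open>bar_H\<close> is defined coefficientwise, so its multiplicativity has to be
  proved, for generators first. The case of a descent is the quadratic relation of the inverse
  generator.\<close>

lemma bar_H_gen_mult:
  assumes "s \<in> S"
  shows "bar_H (Tn s * h) = Tinv s * bar_H h"
proof (rule B.semilinear_eqI[where f = "\<lambda>h. bar_H (Tn s * h)" and f' = "\<lambda>h. Tinv s * bar_H h" and \<sigma> = bar_A])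
  fix w assume w: "w \<in> carrier W"
  show "bar_H (Tn s * Tn w) = Tinv s * bar_H (Tn w)"
  proof (cases "dl s w")
    case False
    then show ?thesis using Tn_up iT_inverse bar_H_Tn w assms by simp
  next
    case True
    define u where "u = s \<otimes> w"
    have u: "u \<in> carrier W" "s \<otimes> u = w" "\<not> dl s u"
      using assms w True by (auto simp: u_def dl_mult)
    have iw: "iT w = Tinv s * iT u" using iT_inverse[OF u(1)] u assms by auto
    have "bar_H (Tn s * Tn w) = iT u - sc vdiff (iT w)"
      using Tn_down[OF assms w True] u w
      by (simp add: bar_H_add bar_H_scale bar_H_Tn bar_A_vdiff u_def[symmetric] del: minus_diff_eq)
    also have "\<dots> = (Tinv s * Tinv s) * iT u"
      unfolding iw Tinv_square[OF assms] by (simp add: left_diff_distrib sc_mult_left)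
    finally show ?thesis using iw w by (simp add: bar_H_Tn mult.assoc)
  qed
qed (auto simp: distrib_left bar_H_add sc_mult_right bar_H_scale)

lemma bar_H_bH: "s \<in> S \<Longrightarrow> bar_H (bH s h) = bH s (bar_H h)"
proof -
  assume s: "s \<in> S"
  have "bar_H (bH s h) = Tinv s * bar_H h + sc (vpow 1) (bar_H h)"
    using s by (simp add: bH_def bar_H_add bar_H_scale bar_H_gen_mult)
  also have "\<dots> = bH s (bar_H h)"
    by (simp add: bH_def Tinv_def left_diff_distrib sc_mult_left H.scale_left_diff_distrib)
  finally show ?thesis .
qed

lemma bar_H_one [simp]: "bar_H 1 = 1"
  using bar_H_Tn[of \<one>] iT_inverse[of \<one>] by simp

lemma bar_H_mult: "bar_H (x * y) = bar_H x * bar_H y"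
proof (rule B.semilinear_eqI[where f = "\<lambda>x. bar_H (x * y)" and f' = "\<lambda>x. bar_H x * bar_H y" and \<sigma> = bar_A])
  fix w assume "w \<in> carrier W"
  then show "bar_H (Tn w * y) = bar_H (Tn w) * bar_H y"
  proof (induction "len w" arbitrary: w)
    case 0
    then show ?case using len_eq_0_iff by simp
  next
    case (Suc n)
    then have "w \<noteq> \<one>" by auto
    then obtain s where s: "s \<in> S" "dl s w" using ex_dl Suc.prems by metis
    define u where "u = s \<otimes> w"
    have u: "u \<in> carrier W" "s \<otimes> u = w" "\<not> dl s u" "len w = Suc (len u)"
      using s Suc.prems len_down[of s w] by (auto simp: u_def dl_mult)
    have T: "Tn w = Tn s * Tn u" using Tn_up[OF s(1) u(1,3)] u by simp
    show ?case
      unfolding T using Suc.hyps(1)[of u] Suc.hyps(2) u s by (simp add: bar_H_gen_mult mult.assoc)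
  qed
qed (auto simp: distrib_right bar_H_add sc_mult_left bar_H_scale)

lemma bH_square: "s \<in> S \<Longrightarrow> bH s (bH s h) = sc (vpow 1 + vpow (- 1)) (bH s h)"
proof -
  assume s: "s \<in> S"
  have "Tn s * (Tn s * h) = h + sc vdiff (Tn s * h)"
    using Tn_square[OF s] by (simp add: mult.assoc[symmetric] distrib_right sc_mult_left)
  moreover have "vpow (- 1) * vpow (- 1) = vpow (- 2)" "vpow 1 * vpow (- 1) = 1"
    by (simp_all add: vpow_add)
  ultimately show ?thesis
    by (simp add: bH_def distrib_left sc_mult_right H.scale_right_distrib H.scale_left_distrib
        H.scale_left_diff_distrib distrib_right algebra_simps)
qed

end

sublocale hecke_algebra \<subseteq> KH: kl_module W sc "carrier W" Tn bH bar_H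
  by unfold_locales
    (auto simp: bH_add bH_scale bH_up bH_down bH_square bar_H_bH bar_H_add bar_H_scale)

context hecke_algebra
begin

subsection \<open>The anti-involution\<close>

definition star :: "'h \<Rightarrow> 'h" where
  "star = B.ext (\<lambda>a. a) (\<lambda>w. Tn (inv w))"

lemma star_add: "star (g + h) = star g + star h"
  unfolding star_def by (rule B.ext_add) simp

lemma star_scale: "star (sc a h) = sc a (star h)"
  unfolding star_def by (rule B.ext_scale) auto

lemma star_Tn: "w \<in> carrier W \<Longrightarrow> star (Tn w) = Tn (inv w)"
  unfolding star_def by (rule B.ext_basis) auto

lemma star_gen_mult:
  assumes "s \<in> S"
  shows "star (Tn s * h) = star h * Tn s"
proof (rule B.semilinear_eqI[where f = "\<lambda>h. star (Tn s * h)" and f' = "\<lambda>h. star h * Tn s" and \<sigma> = "\<lambda>a. a"])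
  fix w assume w: "w \<in> carrier W"
  show "star (Tn s * Tn w) = star (Tn w) * Tn s"
    using Tn_up[of s w] Tn_down[of s w] Tn_up_right[of s "inv w"] Tn_down_right[of s "inv w"] w assms
    by (cases "dl s w") (auto simp: star_Tn star_add star_scale inv_mult_group)
qed (auto simp: distrib_left distrib_right star_add sc_mult_right sc_mult_left star_scale)

lemma star_mult: "star (x * y) = star y * star x"
proof (rule B.semilinear_eqI[where f = "\<lambda>x. star (x * y)" and f' = "\<lambda>x. star y * star x" and \<sigma> = "\<lambda>a. a"])
  fix w assume "w \<in> carrier W"
  then show "star (Tn w * y) = star y * star (Tn w)"
  proof (induction "len w" arbitrary: w)
    case 0
    then have "w = \<one>" using len_eq_0_iff by simp
    moreover have "star 1 = 1" using star_Tn[of \<one>] by simp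
    ultimately show ?case by simp
  next
    case (Suc n)
    then have "w \<noteq> \<one>" by auto
    then obtain s where s: "s \<in> S" "dl s w" using ex_dl Suc.prems by metis
    define u where "u = s \<otimes> w"
    have u: "u \<in> carrier W" "s \<otimes> u = w" "\<not> dl s u" "len w = Suc (len u)"
      using s Suc.prems len_down[of s w] by (auto simp: u_def dl_mult)
    have T: "Tn w = Tn s * Tn u" using Tn_up[OF s(1) u(1,3)] u by simp
    show ?case
      unfolding T using Suc.hyps(1)[of u] Suc.hyps(2) u s by (simp add: star_gen_mult mult.assoc)
  qed
qed (auto simp: distrib_left distrib_right star_add sc_mult_right sc_mult_left star_scale)

lemma star_star: "star (star h) = h"
  by (rule B.semilinear_eqI[where f = "\<lambda>h. star (star h)" and f' = "\<lambda>h. h" and \<sigma> = "\<lambda>a. a"]) (auto simp: star_add star_scale star_Tn)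

lemma star_one: "star 1 = 1"
  using star_Tn[of \<one>] by simp

lemma bar_H_star: "bar_H (star h) = star (bar_H h)"
proof (rule B.semilinear_eqI[where f = "\<lambda>h. bar_H (star h)" and f' = "\<lambda>h. star (bar_H h)" and \<sigma> = bar_A])
  fix w assume w: "w \<in> carrier W"
  have "iT (inv w) = star (iT w)"
    unfolding iT_def[of "inv w"]
  proof (rule ring_inverse_eqI)
    have "star (iT w * Tn (inv w)) = 1" "star (Tn (inv w) * iT w) = 1"
      using iT_inverse[OF w] star_one by auto
    then show "Tn (inv (inv w)) * star (iT w) = 1" "star (iT w) * Tn (inv (inv w)) = 1"
      using w by (simp_all add: star_mult star_Tn)
  qed
  then show "bar_H (star (Tn w)) = star (bar_H (Tn w))"
    using w by (simp add: star_Tn bar_H_Tn)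
qed (auto simp: star_add star_scale bar_H_add bar_H_scale)

lemma KH_mm_inv: "\<lbrakk>x \<in> carrier W; w \<in> carrier W\<rbrakk> \<Longrightarrow> KH.mm (inv x) (inv w) = KH.mm x w"
  by (rule KH.can_anti[where st = star]) (auto simp: star_add star_scale star_Tn bar_H_star)

subsection \<open>Kazhdan--Lusztig polynomials\<close>

lemma cf_bH:
  assumes s: "s \<in> S" and x: "x \<in> carrier W"
  shows "B.cf (bH s h) x = B.cf h (s \<otimes> x) + vpow (if dl s x then 1 else - 1) * B.cf h x"
proof (induction h rule: Hecke_induct)
  case (basis w)
  then show ?case
    using KH.b_up[OF s basis] KH.b_down[OF s basis] s x
    by (cases "dl s w") (auto simp: B.cf_add B.cf_scale B.cf_basis)
next
  case (add g h)
  then show ?case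
    using s by (simp add: KH.b_add B.cf_add distrib_left)
next
  case (scale a h)
  then show ?case
    using s by (simp add: KH.b_scale B.cf_scale distrib_left mult.left_commute)
qed

text \<open>The definition of \<open>KL\<close> asks for support in the Bruhat order. The recursion
  for \<open>can\<close> preserves such support by the lifting property.\<close>

lemma supp_KH_can: "w \<in> carrier W \<Longrightarrow> y \<in> B.supp (KH.can w) \<Longrightarrow> bruhat_le y w"
proof (induction "len w" arbitrary: w y rule: less_induct)
  case less
  show ?case
  proof (cases "w = \<one>")
    case True
    have "KH.is_can \<one> (Tn \<one>)" by (simp add: KH.is_can_def)
    then have "KH.can w = Tn \<one>" using KH.can_eqI True by simp
    then show ?thesis using less.prems True B.supp_basis[of \<one>] by simp
  next
    case False
    then obtain s where s: "s \<in> S" "dl s w" using ex_dl less.prems by metis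
    define u where "u = s \<otimes> w"
    have u: "u \<in> carrier W" "s \<otimes> u = w" "\<not> dl s u" "len w = Suc (len u)"
      using s less.prems len_down[of s w] by (auto simp: u_def dl_mult)
    have can: "KH.can w = bH s (KH.can u) - (\<Sum>z \<in> KH.lower s u. sc (of_int (KH.mm z u)) (KH.can z))"
      using KH.b_can_up[OF s(1) u(1,3)] u less.prems by simp
    have y: "y \<in> carrier W" using less.prems by (simp add: B.supp_def)
    have IHu: "bruhat_le z u" if "z \<in> B.supp (KH.can u)" for z
      using less.hyps[of u z] u that by simp
    show ?thesis
    proof (cases "y \<in> B.supp (bH s (KH.can u))")
      case True
      then have "B.cf (KH.can u) (s \<otimes> y) \<noteq> 0 \<or> B.cf (KH.can u) y \<noteq> 0"
        using cf_bH[OF s(1) y] by (auto simp: B.supp_def)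
      then have "bruhat_le (s \<otimes> y) u \<or> bruhat_le y u"
        using IHu[of "s \<otimes> y"] IHu[of y] s y by (auto simp: B.supp_def)
      then show ?thesis
        using bruhat_lift_up[OF s(1) u(1,3)] s y u by (metis gen_cancel)
    next
      case False
      then have "B.cf (\<Sum>z \<in> KH.lower s u. sc (of_int (KH.mm z u)) (KH.can z)) y \<noteq> 0"
        using less.prems can y by (auto simp: B.supp_def B.cf_diff)
      then have "(\<Sum>z \<in> KH.lower s u. of_int (KH.mm z u) * B.cf (KH.can z) y) \<noteq> 0"
        by (simp add: B.cf_sum B.cf_scale)
      then obtain z where "z \<in> KH.lower s u" "of_int (KH.mm z u) * B.cf (KH.can z) y \<noteq> 0"
        by (rule sum.not_neutral_contains_not_neutral)
      then have z: "z \<in> KH.lower s u" "B.cf (KH.can z) y \<noteq> 0" by auto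
      have zc: "z \<in> carrier W" "KH.mm z u \<noteq> 0" using z by (auto simp: KH.lower_def)
      then have "z \<in> B.supp (KH.can u)"
        by (auto simp: B.supp_def KH.mm_def KH.pp_def)
      then have zu: "bruhat_le z u" by (rule IHu)
      have "len z < len w"
        using KH.mm_len[OF u(1) KH.can_exists[OF u(1)] zc] u by simp
      then have "bruhat_le y z"
        using less.hyps[of z y] zc z y by (simp add: B.supp_def)
      then have "bruhat_le y u" using zu bruhat_less_trans by metis
      then show ?thesis
        using bruhat_lift_up[OF s(1) u(1,3)] u by metis
    qed
  qed
qed

text \<open>\<open>mu\<close> is zero by definition when the length difference is even. That
  \<open>mm\<close> vanishes there too follows because all exponents in p(y,w) have the parity of
  l(w) - l(y).\<close>

lemma KH_parity:
  "\<lbrakk>w \<in> carrier W; y \<in> carrier W; Poly_Mapping.lookup (KH.pp y w) k \<noteq> 0\<rbrakk>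
    \<Longrightarrow> even (k + int (len y) + int (len w))"
proof (induction "len w" arbitrary: w y k rule: less_induct)
  case less
  show ?case
  proof (cases "w = \<one>")
    case True
    have "KH.is_can \<one> (Tn \<one>)" by (simp add: KH.is_can_def)
    then have "KH.can w = Tn \<one>" using KH.can_eqI True by simp
    then show ?thesis
      using less.prems True B.cf_basis[of \<one> y] by (auto simp: KH.pp_def lookup_one_laurent split: if_splits)
  next
    case False
    then obtain s where s: "s \<in> S" "dl s w" using ex_dl less.prems by metis
    define u where "u = s \<otimes> w"
    have u: "u \<in> carrier W" "s \<otimes> u = w" "\<not> dl s u" "len w = Suc (len u)"
      using s less.prems len_down[of s w] by (auto simp: u_def dl_mult)
    have can: "KH.can w = bH s (KH.can u) - (\<Sum>z \<in> KH.lower s u. sc (of_int (KH.mm z u)) (KH.can z))"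
      using KH.b_can_up[OF s(1) u(1,3)] u less.prems by simp
    have y: "y \<in> carrier W" using less.prems by simp
    have IHu: "even (j + int (len z) + int (len u))"
      if "z \<in> carrier W" "Poly_Mapping.lookup (B.cf (KH.can u) z) j \<noteq> 0" for z j
      using less.hyps[of u z j] u that by (simp add: KH.pp_def)
    have "Poly_Mapping.lookup (B.cf (bH s (KH.can u)) y) k \<noteq> 0 \<or>
        Poly_Mapping.lookup (B.cf (\<Sum>z \<in> KH.lower s u. sc (of_int (KH.mm z u)) (KH.can z)) y) k \<noteq> 0"
      using less.prems unfolding KH.pp_def can B.cf_diff lookup_minus by auto
    moreover have "\<exists>z. z \<in> KH.lower s u \<and> Poly_Mapping.lookup (B.cf (KH.can z) y) k \<noteq> 0"
      if "Poly_Mapping.lookup (B.cf (\<Sum>z \<in> KH.lower s u. sc (of_int (KH.mm z u)) (KH.can z)) y) k \<noteq> 0"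
    proof -
      have "(\<Sum>z \<in> KH.lower s u. KH.mm z u * Poly_Mapping.lookup (B.cf (KH.can z) y) k) \<noteq> 0"
        using that by (simp add: B.cf_sum B.cf_scale lookup_sum lookup_of_int_mult)
      then obtain z where "z \<in> KH.lower s u" "KH.mm z u * Poly_Mapping.lookup (B.cf (KH.can z) y) k \<noteq> 0"
        by (rule sum.not_neutral_contains_not_neutral)
      then show ?thesis by auto
    qed
    moreover have "Poly_Mapping.lookup (B.cf (KH.can u) (s \<otimes> y)) k \<noteq> 0 \<or>
        Poly_Mapping.lookup (B.cf (KH.can u) y) (k - (if dl s y then 1 else - 1)) \<noteq> 0"
      if "Poly_Mapping.lookup (B.cf (bH s (KH.can u)) y) k \<noteq> 0"
      using that unfolding cf_bH[OF s(1) y] lookup_add lookup_vpow_mult by linarith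
    ultimately consider "Poly_Mapping.lookup (B.cf (KH.can u) (s \<otimes> y)) k \<noteq> 0"
      | "Poly_Mapping.lookup (B.cf (KH.can u) y) (k - (if dl s y then 1 else - 1)) \<noteq> 0"
      | z where "z \<in> KH.lower s u" "Poly_Mapping.lookup (B.cf (KH.can z) y) k \<noteq> 0"
      by blast
    then show ?thesis
    proof cases
      case 1
      then have "even (k + int (len (s \<otimes> y)) + int (len u))" using IHu s y by simp
      moreover have "even (len (s \<otimes> y)) \<longleftrightarrow> odd (len y)" using even_len_mult[of s y] s y by simp
      ultimately show ?thesis using u(4) by simp presburger
    next
      case 2
      then have "even (k - (if dl s y then 1 else - 1) + int (len y) + int (len u))" using IHu y by blast
      then show ?thesis using u by (auto split: if_splits)
    next
      case 3
      then have zc: "z \<in> carrier W" "KH.mm z u \<noteq> 0" by (auto simp: KH.lower_def)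
      have "even (- 1 + int (len z) + int (len u))"
        using IHu[OF zc(1), of "- 1"] zc(2) by (simp add: KH.mm_def KH.pp_def)
      moreover have "len z < len w"
        using KH.mm_len[OF u(1) KH.can_exists[OF u(1)] zc] u by simp
      then have "even (k + int (len y) + int (len z))"
        using less.hyps[of z y k] zc y 3 by (simp add: KH.pp_def)
      ultimately show ?thesis using u by simp presburger
    qed
  qed
qed

lemma finite_bruhat_less: "finite {y. bruhat_less y w}"
  by (rule finite_subset[OF _ finite_len_le[of "len w"]]) (use bruhat_less_imp in force)

lemma KL_eq_can:
  assumes w: "w \<in> carrier W"
  shows "KL w = KH.can w"
  unfolding KL_def
proof (rule the_equality)
  have c: "KH.is_can w (KH.can w)" using KH.is_can_can w by blast
  let ?F = "insert w {y. bruhat_less y w}"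
  have ww: "\<not> bruhat_less w w" using bruhat_less_imp by blast
  have "KH.can w = B.ext (\<lambda>a. a) Tn (KH.can w)"
    unfolding B.ext_def by (rule B.expand)
  also have "\<dots> = (\<Sum>y \<in> ?F. sc (B.cf (KH.can w) y) (Tn y))"
    using supp_KH_can[OF w] bruhat_less_imp w finite_bruhat_less
    by (intro B.ext_superset) auto
  also have "\<dots> = Tn w + (\<Sum>y | bruhat_less y w. sc (KH.pp y w) (Tn y))"
    using KH.pp_self[OF w KH.can_exists[OF w]] finite_bruhat_less ww by (simp add: KH.pp_def)
  finally have eq: "KH.can w = \<dots>" .
  have P: "KH.pp y w \<in> v_inv_A_minus" if "bruhat_less y w" for y
    using KH.pp_deg[OF w KH.can_exists[OF w], of y] bruhat_less_imp[OF that] ww that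
    by (auto simp: v_inv_A_minus_iff)
  have "bar_H (KH.can w) = KH.can w" using c by (simp add: KH.is_can_def)
  then show "bar_H (KH.can w) = KH.can w \<and> (\<exists>P. (\<forall>y. bruhat_less y w \<longrightarrow> P y \<in> v_inv_A_minus) \<and>
      KH.can w = Tn w + (\<Sum>y | bruhat_less y w. sc (P y) (Tn y)))"
    using P eq by (intro conjI exI[of _ "\<lambda>y. KH.pp y w"]) auto
next
  fix h assume h: "bar_H h = h \<and> (\<exists>P. (\<forall>y. bruhat_less y w \<longrightarrow> P y \<in> v_inv_A_minus) \<and>
      h = Tn w + (\<Sum>y | bruhat_less y w. sc (P y) (Tn y)))"
  then obtain P where P: "\<And>y. bruhat_less y w \<Longrightarrow> deg_le (- 1) (P y)"
    "h = Tn w + (\<Sum>y | bruhat_less y w. sc (P y) (Tn y))"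
    by (auto simp: v_inv_A_minus_iff)
  have "B.lat (- 1) (\<Sum>y | bruhat_less y w. sc (P y) (Tn y))"
  proof (rule B.lat_sum)
    fix y assume "y \<in> {y. bruhat_less y w}"
    then show "B.lat (- 1) (sc (P y) (Tn y))"
      using B.lat_scale[OF P(1) B.lat_basis, of y y] bruhat_less_imp by auto
  qed
  then have "KH.is_can w h" using h P(2) by (simp add: KH.is_can_def)
  then show "h = KH.can w" using KH.can_eqI by simp
qed

text \<open>\<open>KL_poly\<close> shifts exponents by l(w) - l(y), so the coefficient of
  q^((l(w)-l(y)-1)/2) is the coefficient of v^-1 before the shift. Where it is nonzero, the Bruhat
  relation and the odd length difference follow from the two preceding results on support and
  parity.\<close>

lemma mu_eq_mm:
  assumes "y \<in> carrier W" "w \<in> carrier W"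
  shows "mu y w = KH.mm y w"
proof -
  have l: "Poly_Mapping.lookup (KL_poly y w) (int (len w) - int (len y) - 1) = KH.mm y w"
    using assms by (simp add: KL_poly_def KL_eq_can coeff_eq KH.mm_def KH.pp_def)
  have "bruhat_less y w \<and> odd (int (len w) - int (len y))" if n: "KH.mm y w \<noteq> 0"
  proof
    have "y \<in> B.supp (KH.can w)"
      using n assms by (auto simp: B.supp_def KH.mm_def KH.pp_def)
    moreover have "y \<noteq> w"
      using n KH.mm_len[OF assms(2) KH.can_exists assms(1)] assms by auto
    ultimately show "bruhat_less y w" using supp_KH_can assms by blast
    show "odd (int (len w) - int (len y))"
      using KH_parity[OF assms(2,1), of "- 1"] n by (simp add: KH.mm_def)
  qed
  then show ?thesis unfolding mu_def using l by auto
qed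

end

section \<open>Chebyshev coefficients\<close>

text \<open>\<open>cheb k j\<close> is the coefficient of the alternating product with \<open>k - 2j\<close> factors in the
  Kazhdan--Lusztig element of the dihedral element of length \<open>k\<close>.\<close>

fun cheb :: "nat \<Rightarrow> nat \<Rightarrow> int" where
  "cheb 0 j = 0"
| "cheb (Suc 0) j = (if j = 0 then 1 else 0)"
| "cheb (Suc (Suc k)) j = cheb (Suc k) j - (case j of 0 \<Rightarrow> 0 | Suc i \<Rightarrow> cheb k i)"

lemma cheb_0: "cheb (Suc k) 0 = 1"
  by (induction k) auto

lemma cheb_zero: "k \<le> 2 * j \<Longrightarrow> cheb k j = 0"
  by (induction k j rule: cheb.induct) (auto split: nat.splits)

section \<open>The regular representation of the Temperley--Lieb algebra\<close>

context hecke_algebra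
begin

text \<open>The module spanned by \<open>Tn w\<close> for \<open>w\<close> fully commutative carries an action of the
  Temperley--Lieb algebra in which \<open>Tn w\<close> plays the role of the monomial \<open>b\<^sub>s\<^sub>1 \<dots> b\<^sub>s\<^sub>k\<close>
  attached to a reduced word of \<open>w\<close>, and \<open>lam s w\<close> that of the product of \<open>b\<^sub>s\<close> with it.\<close>

definition lower_terms :: "'w \<Rightarrow> 'w \<Rightarrow> nat \<Rightarrow> 'w \<Rightarrow> 'h" where
  "lower_terms s t m z =
    - (\<Sum>j | 0 < j \<and> 2 * j < m. sc (of_int (cheb m j)) (Tn (al s t (m - 2 * j) \<otimes> z)))"

abbreviation delta :: laurent where "delta \<equiv> vpow 1 + vpow (- 1)"

text \<open>The cases follow \<open>not_fc_cases\<close>. With a noncommuting \<open>t\<close>, the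
  braid relation is solved for its longest monomial; with a commuting \<open>p\<close>, the letter
  \<open>p\<close> is moved to the front of the product. The restriction to
  \<open>len y < len w\<close> in the last sum makes the recursion terminate, and by
  \<open>R2\<close> it removes nothing.\<close>

function lam :: "'w \<Rightarrow> 'w \<Rightarrow> 'h" where
  "lam s w =
    (if dl s w then sc delta (Tn w)
     else if s \<otimes> w \<in> W\<^sub>c then Tn (s \<otimes> w)
     else if \<exists>t. noncommuting s t \<and> dl t w then
       (let t = (SOME t. noncommuting s t \<and> dl t w); m = the_enat (cox_mat W s t)
        in lower_terms s t m (inv (al t s (m - 1)) \<otimes> w))
     else if \<exists>p. p \<in> S \<and> dl p w then
       (let p = (SOME p. p \<in> S \<and> dl p w)
        in \<Sum>y \<in> {y \<in> B.supp (lam s (p \<otimes> w)). len y < len w}. sc (B.cf (lam s (p \<otimes> w)) y) (lam p y))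
     else 0)"
  by auto
termination
proof (relation "measure (\<lambda>(s, w). len w)")
  fix s w and p
  assume "\<exists>p. p \<in> S \<and> dl p w" "p = (SOME p. p \<in> S \<and> dl p w)"
  then have "p \<in> S \<and> dl p w" by (metis (mono_tags, lifting) someI_ex)
  then show "((s, p \<otimes> w), s, w) \<in> measure (\<lambda>(s, w). len w)" "((s, p \<otimes> w), s, w) \<in> measure (\<lambda>(s, w). len w)"
    by (simp_all add: dl_def)
qed auto

declare lam.simps [simp del]

definition L :: "'w \<Rightarrow> 'h \<Rightarrow> 'h" where
  "L s = B.ext (\<lambda>a. a) (lam s)"

lemma L_add: "L s (g + h) = L s g + L s h"
  unfolding L_def by (rule B.ext_add) simp

lemma L_scale: "L s (sc a h) = sc a (L s h)"
  unfolding L_def by (rule B.ext_scale) auto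

lemma L_Tn: "w \<in> carrier W \<Longrightarrow> L s (Tn w) = lam s w"
  unfolding L_def by (rule B.ext_basis) auto

lemma L_0: "L s 0 = 0"
  using L_add[of s 0 0] by simp

lemma L_uminus: "L s (- h) = - L s h"
  using L_add[of s "- h" h] L_0 by (simp add: eq_neg_iff_add_eq_0)

lemma L_sum: "L s (sum f I) = (\<Sum>i\<in>I. L s (f i))"
  by (induction I rule: infinite_finite_induct) (auto simp: L_0 L_add)

text \<open>The span of the fully commutative \<open>Tn y\<close> of length below \<open>n\<close>.
  The relations between the operators \<open>L s\<close> are proved on these subspaces.\<close>

definition inV :: "nat \<Rightarrow> 'h \<Rightarrow> bool" where
  "inV n h \<longleftrightarrow> (\<forall>y \<in> B.supp h. y \<in> W\<^sub>c \<and> len y < n)"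

lemma inV_iff: "inV n h \<longleftrightarrow> (\<forall>y \<in> carrier W. B.cf h y \<noteq> 0 \<longrightarrow> y \<in> W\<^sub>c \<and> len y < n)"
  by (auto simp: inV_def B.supp_def)

lemma inV_0 [simp]: "inV n 0" by (simp add: inV_iff)

lemma inV_add: "inV n g \<Longrightarrow> inV n h \<Longrightarrow> inV n (g + h)"
  unfolding inV_iff B.cf_add by (metis add.right_neutral)

lemma inV_scale: "inV n h \<Longrightarrow> inV n (sc a h)"
  unfolding inV_iff B.cf_scale by (metis mult_zero_right)

lemma inV_uminus: "inV n h \<Longrightarrow> inV n (- h)"
  unfolding inV_iff B.cf_uminus by (metis neg_equal_0_iff_equal)

lemma inV_sum: "(\<And>i. i \<in> I \<Longrightarrow> inV n (f i)) \<Longrightarrow> inV n (sum f I)"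
  by (induction I rule: infinite_finite_induct) (auto intro: inV_add)

lemma inV_basis: "\<lbrakk>w \<in> W\<^sub>c; len w < n\<rbrakk> \<Longrightarrow> inV n (Tn w)"
  by (auto simp: inV_def B.supp_basis)

lemma inV_mono: "inV n h \<Longrightarrow> n \<le> n' \<Longrightarrow> inV n' h"
  by (auto simp: inV_def)

lemma inV_induct [consumes 1, case_names basis zero add scale]:
  assumes "inV n h" "\<And>y. \<lbrakk>y \<in> W\<^sub>c; len y < n\<rbrakk> \<Longrightarrow> P (Tn y)" "P 0"
    "\<And>g h. P g \<Longrightarrow> P h \<Longrightarrow> P (g + h)" "\<And>a h. P h \<Longrightarrow> P (sc a h)"
  shows "P h"
proof -
  have "P (\<Sum>w \<in> F. sc (B.cf h w) (Tn w))" if "finite F" "F \<subseteq> B.supp h" for F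
    using that by (induction F rule: finite_induct) (use assms in \<open>auto simp: inV_def\<close>)
  then show ?thesis
    using B.expand[of h] by (metis B.finite_supp subset_refl)
qed

lemma lam_dl: "dl s w \<Longrightarrow> lam s w = sc delta (Tn w)"
  by (simp add: lam.simps)

lemma lam_fc: "\<not> dl s w \<Longrightarrow> s \<otimes> w \<in> W\<^sub>c \<Longrightarrow> lam s w = Tn (s \<otimes> w)"
  by (simp add: lam.simps)

lemma fc_al_suffix:
  assumes "noncommuting s t" "cox_mat W s t = enat m" "z \<in> carrier W" "\<not> dl s z" "\<not> dl t z"
    "al s t (j + k) \<otimes> z \<in> W\<^sub>c" "j + k \<le> m"
  shows "(if even j then al s t k else al t s k) \<otimes> z \<in> W\<^sub>c"
proof (rule fc_suffix[of "al s t j"])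
  note st = noncommutingD[OF assms(1)]
  have mt: "cox_mat W t s = enat m" using assms st mat_sym by simp
  show "al s t j \<in> carrier W" "(if even j then al s t k else al t s k) \<otimes> z \<in> carrier W"
    using st assms by auto
  have eq: "al s t j \<otimes> ((if even j then al s t k else al t s k) \<otimes> z) = al s t (j + k) \<otimes> z"
    using al_add[OF st(1,2)] st assms(3) by (simp add: m_assoc)
  then show "al s t j \<otimes> ((if even j then al s t k else al t s k) \<otimes> z) \<in> W\<^sub>c"
    using assms by simp
  show "len (al s t j \<otimes> ((if even j then al s t k else al t s k) \<otimes> z)) =
      len (al s t j) + len ((if even j then al s t k else al t s k) \<otimes> z)"
    unfolding eq using len_al_mult[OF st(1-3) assms(3-5)] len_al_mult[OF st(2,1) st(3)[symmetric] assms(3,5,4)]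
      len_al[OF st(1-3)] assms(2,7) mt by simp
qed

text \<open>Uniqueness makes the letter chosen in \<open>lam\<close> equal to the given
  \<open>t\<close>. As both \<open>s\<close> and \<open>t\<close> are descents of sw,
  \<open>two_descents\<close> supplies m and \<open>z\<close>.\<close>

lemma lam_noncommuting:
  assumes nc: "noncommuting s t" and w: "w \<in> W\<^sub>c" and dt: "dl t w" and sw: "s \<otimes> w \<notin> W\<^sub>c"
  obtains m z where "cox_mat W s t = enat m" "3 \<le> m" "z \<in> carrier W" "\<not> dl s z" "\<not> dl t z"
    "w = al t s (m - 1) \<otimes> z" "len w = m - 1 + len z" "lam s w = lower_terms s t m z"
proof -
  note st = noncommutingD[OF nc]
  have ds: "\<not> dl s w" using fc_down st w sw by blast
  have "dl t (s \<otimes> w)" using not_fc_descent[OF noncommuting_sym[OF nc] w dt sw] .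
  then obtain m z where m: "cox_mat W s t = enat m" "z \<in> carrier W" "\<not> dl s z" "\<not> dl t z"
    "s \<otimes> w = al s t m \<otimes> z" "len (s \<otimes> w) = m + len z"
    using two_descents[of s t "s \<otimes> w"] st w ds dl_mult by (metis fc_closed gens_closed m_closed)
  have m3: "3 \<le> m" using noncommuting_cox_mat nc m by blast
  then have ms: "m = Suc (m - 1)" by simp
  have "s \<otimes> (s \<otimes> w) = s \<otimes> (s \<otimes> al t s (m - 1) \<otimes> z)"
    unfolding m(5) by (subst ms) (simp only: al_Suc)
  then have weq: "w = al t s (m - 1) \<otimes> z"
    using st w m(2) by (simp add: m_assoc)
  have lw: "len w = m - 1 + len z"
    using len_up[OF st(1) fc_closed[OF w] ds] m(6) m3 by simp
  have ex: "\<exists>t. noncommuting s t \<and> dl t w" using nc dt by blast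
  have some: "(SOME t. noncommuting s t \<and> dl t w) = t"
    using noncommuting_descent_unique[OF w sw] nc dt by (intro some_equality) auto
  have "lam s w = lower_terms s t m (inv (al t s (m - 1)) \<otimes> w)"
    using ds sw ex some m(1) by (subst lam.simps) (simp add: Let_def)
  also have "inv (al t s (m - 1)) \<otimes> w = z"
    unfolding weq using st m(2) by simp
  finally show ?thesis using that[OF m(1) m3 m(2-4) weq lw] by blast
qed

text \<open>The two families are suffixes of the fully commutative element
  \<open>al t s (m - 1) \<otimes> z\<close>, left after removal of 2j - 1 and 2j letters.\<close>

lemma fc_lower_terms:
  assumes "noncommuting s t" "cox_mat W s t = enat m" "z \<in> carrier W" "\<not> dl s z" "\<not> dl t z"
    "al t s (m - 1) \<otimes> z \<in> W\<^sub>c" "0 < j" "2 * j < m"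
  shows "al s t (m - 2 * j) \<otimes> z \<in> W\<^sub>c" "al t s (m - 2 * j - 1) \<otimes> z \<in> W\<^sub>c"
    "len (al s t (m - 2 * j) \<otimes> z) = m - 2 * j + len z"
    "len (al t s (m - 2 * j - 1) \<otimes> z) = m - 2 * j - 1 + len z"
    "L s (Tn (al t s (m - 2 * j - 1) \<otimes> z)) = Tn (al s t (m - 2 * j) \<otimes> z)"
proof -
  note st = noncommutingD[OF assms(1)]
  have mt: "cox_mat W t s = enat m" using assms st mat_sym by simp
  have nc: "noncommuting t s" using noncommuting_sym assms by blast
  have i1: "(2 * j - 1) + (m - 2 * j) = m - 1" "2 * j + (m - 2 * j - 1) = m - 1" using assms by auto
  have o: "odd (2 * j - 1)" using assms(7) by simp
  show fc1: "al s t (m - 2 * j) \<otimes> z \<in> W\<^sub>c"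
    using fc_al_suffix[OF nc mt assms(3,5,4), of "2 * j - 1" "m - 2 * j"] assms o unfolding i1 by auto
  show fc2: "al t s (m - 2 * j - 1) \<otimes> z \<in> W\<^sub>c"
    using fc_al_suffix[OF nc mt assms(3,5,4), of "2 * j" "m - 2 * j - 1"] assms unfolding i1 by auto
  show l1: "len (al s t (m - 2 * j) \<otimes> z) = m - 2 * j + len z"
    using len_al_mult[OF st(1-3) assms(3-5)] assms(2) by simp
  show l2: "len (al t s (m - 2 * j - 1) \<otimes> z) = m - 2 * j - 1 + len z"
    using len_al_mult[OF st(2,1) st(3)[symmetric] assms(3,5,4)] mt by simp
  have eq: "s \<otimes> (al t s (m - 2 * j - 1) \<otimes> z) = al s t (m - 2 * j) \<otimes> z"
  proof -
    have "m - 2 * j = Suc (m - 2 * j - 1)" using assms by simp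
    then have "al s t (m - 2 * j) = s \<otimes> al t s (m - 2 * j - 1)" using al_Suc by metis
    then show ?thesis using st assms by (simp add: m_assoc)
  qed
  then have "\<not> dl s (al t s (m - 2 * j - 1) \<otimes> z)"
    using l1 l2 assms by (simp add: dl_def)
  then show "L s (Tn (al t s (m - 2 * j - 1) \<otimes> z)) = Tn (al s t (m - 2 * j) \<otimes> z)"
    using lam_fc eq fc1 fc2 L_Tn fc_closed by metis
qed

lemma al_commute:
  assumes "s \<in> S" "t \<in> S" "p \<in> S" "p \<otimes> s = s \<otimes> p" "p \<otimes> t = t \<otimes> p"
  shows "p \<otimes> al s t k = al s t k \<otimes> p"
  using assms
proof (induction k arbitrary: s t)
  case (Suc k)
  have "p \<otimes> al s t (Suc k) = (p \<otimes> s) \<otimes> al t s k"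
    using Suc.prems(1-3) by (simp add: al_Suc m_assoc)
  also have "\<dots> = (s \<otimes> p) \<otimes> al t s k"
    by (simp only: Suc.prems(4))
  also have "\<dots> = s \<otimes> (p \<otimes> al t s k)"
    using Suc.prems(1-3) by (simp add: m_assoc)
  also have "p \<otimes> al t s k = al t s k \<otimes> p"
    using Suc by auto
  finally show ?case using Suc.prems by (simp add: al_Suc m_assoc)
qed simp

section \<open>Alternating products of the operators and the relations between them\<close>

definition aop :: "'w \<Rightarrow> 'w \<Rightarrow> nat \<Rightarrow> 'h \<Rightarrow> 'h" where
  "aop s t k h = foldr L (alternating s t k) h"

text \<open>The Kazhdan-Lusztig element of the alternating element with m factors, written in
  monomials of the operators (see \<open>PP_eq_kl_op\<close>). For m = m(s,t) its vanishing is the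
  relation imposed by \<open>J\<close>.\<close>

definition PP :: "nat \<Rightarrow> 'w \<Rightarrow> 'w \<Rightarrow> 'h \<Rightarrow> 'h" where
  "PP m s t h = (\<Sum>j | 2 * j < m. sc (of_int (cheb m j)) (aop s t (m - 2 * j) h))"

lemma aop_0 [simp]: "aop s t 0 h = h"
  by (simp add: aop_def)

lemma aop_Suc: "aop s t (Suc k) h = L s (aop t s k h)"
  by (simp add: aop_def)

lemma aop_snoc: "aop s t (Suc k) h = aop s t k (L (if even k then s else t) h)"
  unfolding aop_def alternating_snoc by simp

lemma aop_add: "aop s t k (g + h) = aop s t k g + aop s t k h"
  by (induction k arbitrary: s t) (auto simp: aop_Suc L_add)

lemma aop_scale: "aop s t k (sc a h) = sc a (aop s t k h)"
  by (induction k arbitrary: s t) (auto simp: aop_Suc L_scale)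

lemma PP_add: "PP m s t (g + h) = PP m s t g + PP m s t h"
  by (simp add: PP_def aop_add H.scale_right_distrib sum.distrib)

lemma PP_scale: "PP m s t (sc a h) = sc a (PP m s t h)"
  by (simp add: PP_def aop_scale H.scale_sum_right mult.commute)

lemma PP_0: "PP m s t 0 = 0"
  using PP_add[of m s t 0 0] by simp

lemma finite_halves [simp]: "finite {j :: nat. 2 * j < m}" "finite {j :: nat. 0 < j \<and> 2 * j < m}"
  by (auto intro: finite_subset[of _ "{..<m}"])

lemma PP_split:
  assumes "0 < m"
  shows "PP m s t h = aop s t m h + (\<Sum>j | 0 < j \<and> 2 * j < m. sc (of_int (cheb m j)) (aop s t (m - 2 * j) h))"
proof -
  have "{j. 2 * j < m} = insert 0 {j. 0 < j \<and> 2 * j < m}"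
    using assms by auto
  moreover have "cheb m 0 = 1" using assms cheb_0[of "m - 1"] by simp
  ultimately show ?thesis by (simp add: PP_def)
qed

text \<open>The numbers of factors m - 2j all have the parity of m, so every monomial applies the
  same operator first.\<close>

lemma PP_last_cong:
  assumes "L (if odd m then s else t) h = L (if odd m then s else t) h'"
  shows "PP m s t h = PP m s t h'"
  unfolding PP_def
proof (rule sum.cong[OF HOL.refl])
  fix j assume "j \<in> {j. 2 * j < m}"
  then obtain k where k1: "m - 2 * j = Suc k" by (cases "m - 2 * j") auto
  then have "m = Suc k + 2 * j" by simp
  then have k: "m - 2 * j = Suc k" "even k \<longleftrightarrow> odd m" by simp_all
  show "sc (of_int (cheb m j)) (aop s t (m - 2 * j) h) = sc (of_int (cheb m j)) (aop s t (m - 2 * j) h')"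
    unfolding k(1) aop_snoc k(2) assms ..
qed

text \<open>If the other generator has been applied before, each monomial grows to an alternating
  one with an additional factor, whose outermost operator is \<open>L s\<close>.\<close>

lemma PP_other: "PP m s t (L (if odd m then t else s) h) = L s (PP m t s h)"
proof -
  have "aop s t (m - 2 * j) (L (if odd m then t else s) h) = L s (aop t s (m - 2 * j) h)" if "2 * j < m" for j
  proof -
    have "even (m - 2 * j) \<longleftrightarrow> even m" using that by auto
    then show ?thesis
      using aop_snoc[of s t "m - 2 * j" h] aop_Suc[of s t "m - 2 * j" h] by (auto split: if_splits)
  qed
  then show ?thesis
    by (simp add: PP_def L_sum L_scale)
qed

text \<open>\<open>R1\<close> says that the choice of \<open>p\<close> in \<open>lam\<close> is
  immaterial, \<open>R2\<close> that a product outside \<open>W\<^sub>c\<close> falls below the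
  length of \<open>w\<close> and factors through b_s. \<open>R3\<close>, \<open>R4\<close> and
  \<open>R5\<close> are the quadratic, commutation and braid relations at one basis element.\<close>

definition R1 :: "'w \<Rightarrow> bool" where
  "R1 w \<longleftrightarrow> (\<forall>s \<in> S. \<forall>p \<in> S. dl p w \<and> s \<otimes> p = p \<otimes> s \<and> s \<otimes> w \<notin> W\<^sub>c \<longrightarrow> lam s w = L p (lam s (p \<otimes> w)))"

definition R2 :: "'w \<Rightarrow> bool" where
  "R2 w \<longleftrightarrow> (\<forall>s \<in> S. s \<otimes> w \<notin> W\<^sub>c \<longrightarrow>
    inV (len w) (lam s w) \<and> (\<exists>v. inV (len w - 1) v \<and> lam s w = L s v))"

definition R3 :: "'w \<Rightarrow> bool" where
  "R3 w \<longleftrightarrow> (\<forall>s \<in> S. L s (lam s w) = sc delta (lam s w))"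

definition R4 :: "'w \<Rightarrow> bool" where
  "R4 w \<longleftrightarrow> (\<forall>s \<in> S. \<forall>p \<in> S. s \<otimes> p = p \<otimes> s \<longrightarrow> L s (lam p w) = L p (lam s w))"

definition R5 :: "'w \<Rightarrow> bool" where
  "R5 w \<longleftrightarrow> (\<forall>s t m. noncommuting s t \<and> cox_mat W s t = enat m \<longrightarrow> PP m s t (Tn w) = 0)"

section \<open>Verification of the relations by induction on length\<close>

lemma L_inV:
  assumes "\<And>y. \<lbrakk>y \<in> W\<^sub>c; len y < n\<rbrakk> \<Longrightarrow> R2 y" "s \<in> S" "inV n h"
  shows "inV (Suc n) (L s h)"
  using assms(3)
proof (induction h rule: inV_induct)
  case (basis y)
  consider "dl s y" | "\<not> dl s y" "s \<otimes> y \<in> W\<^sub>c" | "s \<otimes> y \<notin> W\<^sub>c" by blast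
  then show ?case
  proof cases
    case 1
    then show ?thesis using basis by (auto simp: L_Tn lam_dl intro!: inV_scale inV_basis)
  next
    case 2
    then show ?thesis
      using basis len_up[OF assms(2) fc_closed[OF basis(1)]] by (auto simp: L_Tn lam_fc intro!: inV_basis)
  next
    case 3
    then show ?thesis
      using basis assms(1)[OF basis] assms(2) inV_mono[of "len y" _ "Suc n"] by (auto simp: L_Tn R2_def)
  qed
qed (auto simp: L_0 L_add L_scale intro: inV_add inV_scale)

lemma R4_extend:
  assumes "\<And>y. \<lbrakk>y \<in> W\<^sub>c; len y < n\<rbrakk> \<Longrightarrow> R4 y" "s \<in> S" "p \<in> S" "s \<otimes> p = p \<otimes> s" "inV n h"
  shows "L s (L p h) = L p (L s h)"
  using assms(5)
proof (induction h rule: inV_induct)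
  case (basis y)
  then show ?case using assms(1)[OF basis] assms(2-4) by (simp add: L_Tn R4_def)
qed (auto simp: L_0 L_add L_scale)

lemma R3_extend:
  assumes "\<And>y. \<lbrakk>y \<in> W\<^sub>c; len y < n\<rbrakk> \<Longrightarrow> R3 y" "s \<in> S" "inV n h"
  shows "L s (L s h) = sc delta (L s h)"
  using assms(3)
proof (induction h rule: inV_induct)
  case (basis y)
  then show ?case using assms(1)[OF basis] assms(2) by (simp add: L_Tn R3_def)
next
  case (scale a h)
  then show ?case by (simp add: L_scale mult.commute)
qed (auto simp: L_0 L_add H.scale_right_distrib)

lemma R5_extend:
  assumes "\<And>y. \<lbrakk>y \<in> W\<^sub>c; len y < n\<rbrakk> \<Longrightarrow> R5 y" "noncommuting s t" "cox_mat W s t = enat m" "inV n h"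
  shows "PP m s t h = 0"
  using assms(4)
proof (induction h rule: inV_induct)
  case (basis y)
  then show ?case using assms(1)[OF basis] assms(2,3) by (auto simp: R5_def)
qed (auto simp: PP_0 PP_add PP_scale)

text \<open>With a noncommuting \<open>t\<close>, the letter \<open>p\<close> commutes with
  \<open>s\<close> and \<open>t\<close> and passes into the factor \<open>z\<close>. Otherwise, if
  \<open>p0\<close> is the letter chosen in \<open>lam\<close>, both sides reduce to the element
  without \<open>p\<close> and \<open>p0\<close>, and these two operators commute by
  \<open>R4\<close> at a smaller length.\<close>

lemma R1_step:
  assumes w: "w \<in> W\<^sub>c" and IH: "\<And>y. \<lbrakk>y \<in> W\<^sub>c; len y < len w\<rbrakk> \<Longrightarrow> R1 y \<and> R2 y"
    and IH4: "\<And>y. \<lbrakk>y \<in> W\<^sub>c; len y < len w - 1\<rbrakk> \<Longrightarrow> R4 y"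
  shows "R1 w"
  unfolding R1_def
proof (intro ballI impI, elim conjE)
  fix s p assume s: "s \<in> S" and p: "p \<in> S" "dl p w" "s \<otimes> p = p \<otimes> s" and sw: "s \<otimes> w \<notin> W\<^sub>c"
  have wc: "w \<in> carrier W" using w by simp
  have ds: "\<not> dl s w" using fc_down s w sw by blast
  have pw: "p \<otimes> w \<in> W\<^sub>c" using fc_down p w by blast
  have spw: "s \<otimes> (p \<otimes> w) \<notin> W\<^sub>c" using not_fc_commuting_descent[OF s w sw p] .
  show "lam s w = L p (lam s (p \<otimes> w))"
  proof (cases "\<exists>t. noncommuting s t \<and> dl t w")
    case True
    then obtain t where t: "noncommuting s t" "dl t w" by blast
    note st = noncommutingD[OF t(1)]
    obtain m z where m: "cox_mat W s t = enat m" "3 \<le> m" "z \<in> carrier W" "\<not> dl s z" "\<not> dl t z"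
      "w = al t s (m - 1) \<otimes> z" "len w = m - 1 + len z" "lam s w = lower_terms s t m z"
      using lam_noncommuting[OF t(1) w t(2) sw] .
    have pt: "p \<otimes> t = t \<otimes> p" "t \<noteq> p" using fc_descents_commute[OF p(1) st(2) w p(2) t(2)] p(3) st by auto
    have "dl t (p \<otimes> w)" using commuting_descent[of t p w] pt st p wc t by auto
    then obtain m' z' where m': "cox_mat W s t = enat m'" "z' \<in> carrier W" "\<not> dl s z'" "\<not> dl t z'"
      "p \<otimes> w = al t s (m' - 1) \<otimes> z'" "len (p \<otimes> w) = m' - 1 + len z'"
      "lam s (p \<otimes> w) = lower_terms s t m' z'"
      using lam_noncommuting[OF t(1) pw _ spw] by metis
    have [simp]: "m' = m" using m m' by simp
    have com: "p \<otimes> al x y k = al x y k \<otimes> p" if "{x, y} = {s, t}" for x y k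
      using al_commute[of x y p k] that st p pt by (auto simp: doubleton_eq_iff)
    have "al t s (m - 1) \<otimes> (p \<otimes> z') = p \<otimes> (p \<otimes> w)"
      unfolding m'(5) using com[of t s "m - 1"] st p m'(2) by (simp add: m_assoc[symmetric] insert_commute)
    also have "\<dots> = al t s (m - 1) \<otimes> z" using m(6) p wc by simp
    finally have z: "p \<otimes> z' = z" using st p m(3) m'(2) by simp
    have lz: "len z = Suc (len z')"
      using len_down[OF p(1) wc p(2)] m(2,7) m'(6) by simp
    have "L p (Tn (al s t (m - 2 * j) \<otimes> z')) = Tn (al s t (m - 2 * j) \<otimes> z)" if j: "0 < j" "2 * j < m" for j
    proof -
      have eq: "p \<otimes> (al s t (m - 2 * j) \<otimes> z') = al s t (m - 2 * j) \<otimes> z"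
        unfolding z[symmetric] using com[of s t] st p m'(2) by (simp add: m_assoc[symmetric])
      have "len (al s t (m - 2 * j) \<otimes> z) = m - 2 * j + len z"
        "len (al s t (m - 2 * j) \<otimes> z') = m - 2 * j + len z'"
        using len_al_mult[OF st(1-3) m(3-5)] len_al_mult[OF st(1-3) m'(2-4)] m(1) by auto
      then have "\<not> dl p (al s t (m - 2 * j) \<otimes> z')"
        using eq lz by (simp add: dl_def)
      moreover have "al s t (m - 2 * j) \<otimes> z \<in> W\<^sub>c"
        using fc_lower_terms(1)[OF t(1) m(1,3-5)] m(6) w j by simp
      ultimately show ?thesis
        using st m'(2) by (simp add: L_Tn lam_fc eq)
    qed
    then show ?thesis
      unfolding m(8) m'(7) lower_terms_def by (simp add: L_uminus L_sum L_scale)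
  next
    case False
    define p0 where "p0 = (SOME p. p \<in> S \<and> dl p w)"
    have "\<exists>p. p \<in> S \<and> dl p w" using p by blast
    then have p0: "p0 \<in> S" "dl p0 w" unfolding p0_def by (metis (mono_tags, lifting) someI_ex)+
    have sp0: "s \<otimes> p0 = p0 \<otimes> s"
      using False p0 s by (auto simp: noncommuting_def)
    have p0w: "p0 \<otimes> w \<in> W\<^sub>c" "len (p0 \<otimes> w) < len w"
      using fc_down p0 w by (auto simp: dl_def)
    have sp0w: "s \<otimes> (p0 \<otimes> w) \<notin> W\<^sub>c" using not_fc_commuting_descent[OF s w sw p0 sp0] .
    have inv0: "inV (len (p0 \<otimes> w)) (lam s (p0 \<otimes> w))"
      using IH[OF p0w] s sp0w by (simp add: R2_def)
    \<comment> \<open>By \<open>R2\<close> for the shorter element, the length restriction in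
      \<open>lam\<close> is void here.\<close>
    then have supp: "{y \<in> B.supp (lam s (p0 \<otimes> w)). len y < len w} = B.supp (lam s (p0 \<otimes> w))"
      using p0w by (auto simp: inV_def)
    have "lam s w = (\<Sum>y \<in> {y \<in> B.supp (lam s (p0 \<otimes> w)). len y < len w}. sc (B.cf (lam s (p0 \<otimes> w)) y) (lam p0 y))"
      using ds sw False p by (subst lam.simps) (auto simp: Let_def p0_def[symmetric])
    then have lam0: "lam s w = L p0 (lam s (p0 \<otimes> w))"
      unfolding supp by (simp add: L_def B.ext_def)
    show ?thesis
    proof (cases "p = p0")
      case False
      have pp: "p \<otimes> p0 = p0 \<otimes> p" using fc_descents_commute[OF p(1) p0(1) w p(2) p0(2)] .
      have d: "dl p (p0 \<otimes> w)" "dl p0 (p \<otimes> w)"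
        using commuting_descent[of p p0 w] commuting_descent[of p0 p w] pp False p p0 wc by auto
      define w0 where "w0 = p \<otimes> (p0 \<otimes> w)"
      have w0: "w0 = p0 \<otimes> (p \<otimes> w)"
        unfolding w0_def using pp p p0 wc by (metis gens_closed m_assoc)
      have w0c: "w0 \<in> W\<^sub>c" "len w0 < len w - 1"
        using fc_down[OF p(1) p0w(1) d(1)] len_down[OF p(1) fc_closed[OF p0w(1)] d(1)] len_down[OF p0(1) wc p0(2)]
        by (auto simp: w0_def)
      have sw0: "s \<otimes> w0 \<notin> W\<^sub>c"
        unfolding w0_def using not_fc_commuting_descent[OF s p0w(1) sp0w p(1) d(1) p(3)] .
      have l1: "lam s (p0 \<otimes> w) = L p (lam s w0)"
        using IH[OF p0w] s p sp0w d(1) unfolding R1_def w0_def by blast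
      have "len (p \<otimes> w) < len w" using p by (simp add: dl_def)
      then have l2: "lam s (p \<otimes> w) = L p0 (lam s w0)"
        using IH[OF pw] s p0 sp0 spw d(2) unfolding R1_def w0 by blast
      have "len w0 < len w" using w0c by simp
      then have "inV (len w - 1) (lam s w0)"
        using IH[OF w0c(1)] s sw0 inV_mono[of "len w0" "lam s w0" "len w - 1"] w0c unfolding R2_def by auto
      then have "L p0 (L p (lam s w0)) = L p (L p0 (lam s w0))"
        using R4_extend[of "len w - 1" p0 p] IH4 p p0 pp by auto
      then show ?thesis using lam0 l1 l2 by simp
    qed (use lam0 in simp)
  qed
qed

text \<open>In the braid case \<open>v\<close> consists of the lower terms with the first letter
  \<open>s\<close> removed; in the commuting case \<open>R1\<close> and \<open>R4\<close> carry
  \<open>p\<close> past \<open>s\<close>. The factorization through b_s is what later reduces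
  \<open>R3\<close> and \<open>R5\<close> to smaller lengths.\<close>

lemma R2_step:
  assumes w: "w \<in> W\<^sub>c" and IH: "\<And>y. \<lbrakk>y \<in> W\<^sub>c; len y < len w\<rbrakk> \<Longrightarrow> R1 y \<and> R2 y"
    and IH4: "\<And>y. \<lbrakk>y \<in> W\<^sub>c; len y < len w - 1\<rbrakk> \<Longrightarrow> R4 y"
  shows "R2 w"
  unfolding R2_def
proof (intro ballI impI)
  fix s assume s: "s \<in> S" and sw: "s \<otimes> w \<notin> W\<^sub>c"
  have wc: "w \<in> carrier W" using w by simp
  from s w sw show "inV (len w) (lam s w) \<and> (\<exists>v. inV (len w - 1) v \<and> lam s w = L s v)"
  proof (cases rule: not_fc_cases)
    case (noncomm t)
    note st = noncommutingD[OF noncomm(1)]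
    obtain m z where m: "cox_mat W s t = enat m" "3 \<le> m" "z \<in> carrier W" "\<not> dl s z" "\<not> dl t z"
      "w = al t s (m - 1) \<otimes> z" "len w = m - 1 + len z" "lam s w = lower_terms s t m z"
      using lam_noncommuting[OF noncomm(1) w noncomm(2) sw] .
    have alw: "al t s (m - 1) \<otimes> z \<in> W\<^sub>c" using m w by simp
    note low = fc_lower_terms[OF noncomm(1) m(1,3-5) alw]
    define v where "v = - (\<Sum>j | 0 < j \<and> 2 * j < m. sc (of_int (cheb m j)) (Tn (al t s (m - 2 * j - 1) \<otimes> z)))"
    have "inV (len w) (lam s w)"
      unfolding m(8) lower_terms_def
      by (intro inV_uminus inV_sum inV_scale inV_basis) (use low m in auto)
    moreover have "inV (len w - 1) v"
      unfolding v_def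
      by (intro inV_uminus inV_sum inV_scale inV_basis) (use low m in auto)
    moreover have "lam s w = L s v"
      unfolding m(8) lower_terms_def v_def using low(5) by (simp add: L_uminus L_sum L_scale)
    ultimately show ?thesis by blast
  next
    case (comm p)
    have pw: "p \<otimes> w \<in> W\<^sub>c" "Suc (len (p \<otimes> w)) = len w"
      using fc_down len_down comm w by auto
    then have lpw: "len (p \<otimes> w) < len w" by simp
    have "R1 w" using R1_step assms by blast
    then have lam: "lam s w = L p (lam s (p \<otimes> w))"
      using s comm sw unfolding R1_def by blast
    obtain v where v: "inV (len (p \<otimes> w)) (lam s (p \<otimes> w))" "inV (len (p \<otimes> w) - 1) v" "lam s (p \<otimes> w) = L s v"
      using IH[OF pw(1) lpw] s comm unfolding R2_def by blast
    have R2: "R2 y" if "y \<in> W\<^sub>c" "len y < len w" for y using IH that by blast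
    \<comment> \<open>An element that is not fully commutative has length at least 3, so the
      truncated subtraction in \<open>len (p \<otimes> w) - 1\<close> is a true one.\<close>
    have "3 \<le> len (s \<otimes> (p \<otimes> w))" using len_ge_3_if_not_fc comm s wc by simp
    then have l2: "2 \<le> len (p \<otimes> w)"
      using len_mult_le[of s "p \<otimes> w"] s comm wc by simp
    have "inV (Suc (len (p \<otimes> w))) (lam s w)"
      unfolding lam using R2 comm pw v by (intro L_inV) auto
    moreover have V: "inV (Suc (len (p \<otimes> w) - 1)) (L p v)"
      using R2 comm pw v by (intro L_inV) auto
    moreover have "lam s w = L s (L p v)"
      unfolding lam v(3) using inV_mono[OF v(2), of "len w - 1"] comm s pw IH4
      by (intro R4_extend[of "len w - 1"]) auto
    moreover have "Suc (len (p \<otimes> w) - 1) = len w - 1" using pw l2 by simp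
    then have "inV (len w - 1) (L p v)" using V by (simp only:)
    ultimately show ?thesis using pw(2) by (intro conjI exI[of _ "L p v"]) simp_all
  qed
qed

text \<open>\<open>R1\<close> and \<open>R2\<close> are supplied one length beyond n, because
  \<open>R4\<close> at length n evaluates \<open>lam\<close> at elements of length n + 1. There is
  no circle: at length n + 1 their own proof uses \<open>R4\<close> only below n.\<close>

context
  fixes n
  assumes R12: "\<And>y. \<lbrakk>y \<in> W\<^sub>c; len y \<le> Suc n\<rbrakk> \<Longrightarrow> R1 y \<and> R2 y"
    and R345: "\<And>y. \<lbrakk>y \<in> W\<^sub>c; len y < n\<rbrakk> \<Longrightarrow> R3 y \<and> R4 y \<and> R5 y"
begin

lemma R3_step:
  assumes w: "w \<in> W\<^sub>c" "len w = n"
  shows "R3 w"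
  unfolding R3_def
proof
  fix s assume s: "s \<in> S"
  have wc: "w \<in> carrier W" using w by simp
  consider "dl s w" | "\<not> dl s w" "s \<otimes> w \<in> W\<^sub>c" | "s \<otimes> w \<notin> W\<^sub>c" by blast
  then show "L s (lam s w) = sc delta (lam s w)"
  proof cases
    case 1
    then show ?thesis using wc by (simp add: lam_dl L_scale L_Tn)
  next
    case 2
    then have "dl s (s \<otimes> w)" using s wc dl_mult by simp
    then show ?thesis using 2 s wc by (simp add: lam_fc L_Tn lam_dl)
  next
    case 3
    then obtain v where v: "inV (len w - 1) v" "lam s w = L s v"
      using R12[of w] s w unfolding R2_def by fastforce
    have "inV n v" using v w inV_mono by auto
    then show ?thesis
      unfolding v using R3_extend[of n s v] R345 s by blast
  qed
qed

text \<open>The braid relation is applied to \<open>lam p z\<close> instead of \<open>w\<close>. As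
  \<open>p\<close> commutes with \<open>s\<close> and \<open>t\<close>, it is carried through the
  shorter alternating products by \<open>R4\<close>, and the relation turns into b_p applied to the
  definition of \<open>lam s w\<close>.\<close>

lemma R4_braid:
  assumes w: "w \<in> W\<^sub>c" "len w = n" and s: "s \<in> S" and p: "p \<in> S" "s \<otimes> p = p \<otimes> s"
    and sw: "s \<otimes> w \<notin> W\<^sub>c" and t: "noncommuting s t" "dl t w" "p \<otimes> t = t \<otimes> p"
  shows "L s (lam p w) = L p (lam s w)"
proof -
  note st = noncommutingD[OF t(1)]
  obtain m z where m: "cox_mat W s t = enat m" "3 \<le> m" "z \<in> carrier W" "\<not> dl s z" "\<not> dl t z"
    "w = al t s (m - 1) \<otimes> z" "len w = m - 1 + len z" "lam s w = lower_terms s t m z"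
    using lam_noncommuting[OF t(1) w(1) t(2) sw] .
  have mt: "cox_mat W t s = enat m" using m(1) st mat_sym by simp
  have alw: "al t s (m - 1) \<otimes> z \<in> W\<^sub>c" using m w by simp
  note low = fc_lower_terms[OF t(1) m(1,3-5) alw]
  have move: "aop x y k (lam p z) = lam p (al x y k \<otimes> z)"
    if "x = s \<and> y = t \<or> x = t \<and> y = s" "al x y k \<otimes> z \<in> W\<^sub>c" "k \<le> m - 1" for x y k
    using that
  proof (induction k arbitrary: x y)
    case 0
    then show ?case using m by simp
  next
    case (Suc k)
    have xy: "x \<in> S" "y \<in> S" "x \<noteq> y" "cox_mat W x y = enat m" "\<not> dl x z" "\<not> dl y z" "p \<otimes> x = x \<otimes> p"
      "cox_mat W y x = enat m" "noncommuting x y"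
      using Suc.prems st m mt t p noncommuting_sym by auto
    have eq: "al x y (Suc k) \<otimes> z = x \<otimes> (al y x k \<otimes> z)"
      using xy m(3) by (simp add: al_Suc m_assoc)
    have l: "len (al y x k \<otimes> z) = k + len z" "len (al x y (Suc k) \<otimes> z) = Suc k + len z"
      using len_al_mult[OF xy(1-3) m(3) xy(5,6)] len_al_mult[OF xy(2,1) xy(3)[symmetric] m(3) xy(6,5)]
        xy(4,8) Suc.prems by auto
    then have nd: "\<not> dl x (al y x k \<otimes> z)" using eq by (simp add: dl_def)
    have fc: "al y x k \<otimes> z \<in> W\<^sub>c"
      using fc_al_suffix[OF xy(9,4) m(3) xy(5,6), of 1 k] Suc.prems m(2) by simp
    have "aop x y (Suc k) (lam p z) = L x (lam p (al y x k \<otimes> z))"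
      using Suc.IH[of y x] Suc.prems fc by (auto simp: aop_Suc)
    also have "\<dots> = L p (lam x (al y x k \<otimes> z))"
      using R345[OF fc] l(1) Suc.prems w m xy p unfolding R4_def by auto
    also have "lam x (al y x k \<otimes> z) = Tn (al x y (Suc k) \<otimes> z)"
      using lam_fc[OF nd] eq Suc.prems by simp
    finally show ?case using Suc.prems L_Tn by simp
  qed
  have lp: "L p (Tn (al s t (m - 2 * j) \<otimes> z)) = aop s t (m - 2 * j) (lam p z)"
    if "0 < j" "2 * j < m" for j
    using move[of s t "m - 2 * j"] low(1)[OF that] that L_Tn by simp
  have z: "z \<in> W\<^sub>c"
    using fc_al_suffix[OF noncommuting_sym[OF t(1)] mt m(3,5,4), of "m - 1" 0] alw m(3) by (simp split: if_splits)
  \<comment> \<open>As m \<ge> 3, \<open>lam p z\<close> involves only lengths at most l(z) + 1 < n,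
    where \<open>R5\<close> is known.\<close>
  have "inV (len z + 1) (Tn z)" using z by (intro inV_basis) auto
  then have "inV (Suc (len z + 1)) (L p (Tn z))"
    using R12 m w p by (intro L_inV) auto
  then have "inV n (lam p z)" using m(2,3,7) w L_Tn inV_mono[of "Suc (len z + 1)" _ n] by auto
  then have "PP m s t (lam p z) = 0"
    using R5_extend[of n s t m] R345 t m by blast
  then have "aop s t m (lam p z) = - (\<Sum>j | 0 < j \<and> 2 * j < m. sc (of_int (cheb m j)) (aop s t (m - 2 * j) (lam p z)))"
    using m(2) by (simp add: PP_split eq_neg_iff_add_eq_0)
  also have "\<dots> = L p (lam s w)"
    unfolding m(8) lower_terms_def using lp by (simp add: L_uminus L_sum L_scale)
  finally have "aop s t m (lam p z) = L p (lam s w)" .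
  moreover have "aop s t m (lam p z) = L s (aop t s (m - 1) (lam p z))"
    using m(2) aop_Suc[of s t "m - 1"] by simp
  moreover have "aop t s (m - 1) (lam p z) = lam p w"
    using move[of t s "m - 1"] alw m(6) by simp
  ultimately show ?thesis by simp
qed

text \<open>Both \<open>s\<close> and \<open>p\<close> close a braid with the same \<open>t\<close>.
  This forces m(s,t) = 3, so the lower part is the single basis element of tw, which is the same for
  \<open>s\<close> and for \<open>p\<close>.\<close>

lemma R4_single:
  assumes w: "w \<in> W\<^sub>c" and s: "s \<in> S" and p: "p \<in> S" "s \<otimes> p = p \<otimes> s" "s \<noteq> p"
    and sw: "s \<otimes> w \<notin> W\<^sub>c" and pw: "p \<otimes> w \<notin> W\<^sub>c"
    and t: "noncommuting s t" "dl t w" "noncommuting p t"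
  shows "lam s w = Tn (t \<otimes> w) \<and> dl s (t \<otimes> w)"
proof -
  note st = noncommutingD[OF t(1)]
  have wc: "w \<in> carrier W" using w by simp
  have d: "dl a (t \<otimes> w)" if "a \<in> S" "a \<otimes> w \<notin> W\<^sub>c" "noncommuting a t" for a
  proof -
    have "\<not> dl a w" using fc_down that w by blast
    moreover have "dl t (a \<otimes> w)"
      using not_fc_descent[OF noncommuting_sym[OF that(3)] w t(2) that(2)] .
    ultimately show ?thesis
      using noncommuting_descents(2)[OF that(3), of "a \<otimes> w"] that wc dl_mult by simp
  qed
  have ds: "dl s (t \<otimes> w)" and dp: "dl p (t \<otimes> w)" using d s p sw pw t by auto
  obtain m z where m: "cox_mat W s t = enat m" "3 \<le> m" "z \<in> carrier W" "\<not> dl s z" "\<not> dl t z"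
    "w = al t s (m - 1) \<otimes> z" "len w = m - 1 + len z" "lam s w = lower_terms s t m z"
    using lam_noncommuting[OF t(1) w t(2) sw] .
  obtain k where k: "m = Suc (Suc (Suc k))"
    using m(2) by (metis add.commute add_Suc_right le_Suc_ex numeral_3_eq_3 plus_nat.add_0)
  have tw: "t \<otimes> w = al s t (Suc k) \<otimes> z" "s \<otimes> (t \<otimes> w) = al t s k \<otimes> z"
    using m st k by (auto simp: al_Suc m_assoc)
  have stw: "s \<otimes> (t \<otimes> w) \<in> W\<^sub>c"
    using fc_down[OF s _ ds] fc_down[OF st(2) w t(2)] by blast
  \<comment> \<open>If a further letter were left, the fully commutative element s(tw) would have
    the noncommuting descents \<open>t\<close> and \<open>p\<close>.\<close>
  have "k = 0"
  proof (rule ccontr)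
    assume "k \<noteq> 0"
    then obtain k' where k': "k = Suc k'" by (cases k) auto
    have ttw: "t \<otimes> (s \<otimes> (t \<otimes> w)) = al s t k' \<otimes> z"
      unfolding tw using m st k' by (simp add: al_Suc m_assoc)
    have "dl t (s \<otimes> (t \<otimes> w))"
      unfolding dl_def ttw unfolding tw(2)
      using len_al_mult[OF st(1-3) m(3-5), of k'] len_al_mult[OF st(2,1) st(3)[symmetric] m(3,5,4), of k]
        m(1) mat_sym[OF st(1,2)] k k' by simp
    moreover have "dl p (s \<otimes> (t \<otimes> w))"
      using commuting_descent[of p s "t \<otimes> w"] p s ds dp st wc by auto
    ultimately show False
      using two_descents_not_fc[OF t(3), of "s \<otimes> (t \<otimes> w)"] stw fc_closed by blast
  qed
  \<comment> \<open>For m = 3 the only lower term is j = 1. Its coefficient in \<open>cheb\<close>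
    is -1, which the sign in \<open>lower_terms\<close> turns into 1.\<close>
  have "{j :: nat. 0 < j \<and> 2 * j < m} = {1}" using k \<open>k = 0\<close> by auto
  then have "lam s w = Tn (al s t 1 \<otimes> z)"
    unfolding m(8) lower_terms_def using k \<open>k = 0\<close> by simp
  then show ?thesis using tw \<open>k = 0\<close> ds by simp
qed

lemma R4_aux:
  assumes w: "w \<in> W\<^sub>c" "len w = n" and s: "s \<in> S" and p: "p \<in> S" "s \<otimes> p = p \<otimes> s" "s \<noteq> p"
    and dp: "dl p w" and ds: "\<not> dl s w"
  shows "L s (lam p w) = L p (lam s w)"
proof -
  have wc: "w \<in> carrier W" using w by simp
  have L: "L s (lam p w) = sc delta (lam s w)"
    using dp wc by (simp add: lam_dl L_scale L_Tn)
  show ?thesis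
  proof (cases "s \<otimes> w \<in> W\<^sub>c")
    case True
    have "dl p (s \<otimes> w)" using commuting_descent_up[of s p w] s p wc dp ds by simp
    then show ?thesis
      unfolding L using True ds s wc by (simp add: lam_fc L_Tn lam_dl)
  next
    case False
    have pw: "p \<otimes> w \<in> W\<^sub>c" "len (p \<otimes> w) < len w" using fc_down p dp w by (auto simp: dl_def)
    have "s \<otimes> (p \<otimes> w) \<notin> W\<^sub>c" using not_fc_commuting_descent[OF s w(1) False p(1) dp p(2)] .
    then have "inV (len (p \<otimes> w)) (lam s (p \<otimes> w))"
      using R12[OF pw(1)] pw w s unfolding R2_def by simp
    then have "inV n (lam s (p \<otimes> w))" using pw w inV_mono by auto
    then have "L p (L p (lam s (p \<otimes> w))) = sc delta (L p (lam s (p \<otimes> w)))"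
      using R3_extend[of n p] R345 p by blast
    moreover have "lam s w = L p (lam s (p \<otimes> w))"
      using R12[of w] w s p dp False unfolding R1_def by auto
    ultimately show ?thesis unfolding L by simp
  qed
qed

text \<open>If s(pw) is not fully commutative, the left side is \<open>lam\<close> at an element of
  length n + 1, and \<open>R1\<close> there brings \<open>p\<close> back to the front.\<close>

lemma R4_aux2:
  assumes w: "w \<in> W\<^sub>c" "len w = n" and s: "s \<in> S" and p: "p \<in> S" "s \<otimes> p = p \<otimes> s" "s \<noteq> p"
    and dp: "\<not> dl p w" and ds: "\<not> dl s w" and pw: "p \<otimes> w \<in> W\<^sub>c"
  shows "L s (lam p w) = L p (lam s w)"
proof -
  have wc: "w \<in> carrier W" using w by simp
  have dpp: "dl p (p \<otimes> w)" using p wc dp dl_mult by simp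
  have com: "s \<otimes> (p \<otimes> w) = p \<otimes> (s \<otimes> w)" using p s wc by (metis gens_closed m_assoc)
  have dspw: "\<not> dl s (p \<otimes> w)"
    using commuting_descent[of s p "p \<otimes> w"] p s ds dpp wc by auto
  have dpsw: "\<not> dl p (s \<otimes> w)"
    using commuting_descent[of p s "s \<otimes> w"] p s ds dp wc dl_mult by auto
  have LHS: "L s (lam p w) = lam s (p \<otimes> w)"
    using dp pw p wc by (simp add: lam_fc L_Tn)
  show ?thesis
  proof (cases "s \<otimes> (p \<otimes> w) \<in> W\<^sub>c")
    case True
    have "s \<otimes> w \<in> W\<^sub>c" using fc_up[of p "s \<otimes> w"] True com dpsw p s wc by auto
    then show ?thesis
      unfolding LHS using True dspw dpsw ds com s p wc by (simp add: lam_fc L_Tn)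
  next
    case False
    have sw: "s \<otimes> w \<notin> W\<^sub>c"
      using not_fc_commuting_descent[OF s pw False p(1) dpp p(2)] p wc by simp
    have "len (p \<otimes> w) = Suc n" using len_up p wc dp w by simp
    then have "lam s (p \<otimes> w) = L p (lam s (p \<otimes> (p \<otimes> w)))"
      using R12[OF pw] s p dpp False unfolding R1_def by auto
    then show ?thesis unfolding LHS using p wc by simp
  qed
qed

lemma R4_step:
  assumes w: "w \<in> W\<^sub>c" "len w = n"
  shows "R4 w"
  unfolding R4_def
proof (intro ballI impI)
  fix s p assume s: "s \<in> S" and p: "p \<in> S" and sp: "s \<otimes> p = p \<otimes> s"
  have wc: "w \<in> carrier W" using w by simp
  show "L s (lam p w) = L p (lam s w)"
  proof (cases "s = p")
    case False
    note ps = sp[symmetric] and ne = False False[symmetric]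
    consider "dl s w" "dl p w" | "dl p w" "\<not> dl s w" | "dl s w" "\<not> dl p w"
      | "\<not> dl s w" "\<not> dl p w" "p \<otimes> w \<in> W\<^sub>c" | "\<not> dl s w" "\<not> dl p w" "s \<otimes> w \<in> W\<^sub>c"
      | "s \<otimes> w \<notin> W\<^sub>c" "p \<otimes> w \<notin> W\<^sub>c" by blast
    then show ?thesis
    proof cases
      case 1
      then show ?thesis using wc by (simp add: lam_dl L_scale L_Tn)
    next
      case 2
      then show ?thesis using R4_aux[OF w s p sp ne(1)] by simp
    next
      case 3
      then show ?thesis using R4_aux[OF w p s ps ne(2)] by simp
    next
      case 4
      then show ?thesis using R4_aux2[OF w s p sp ne(1)] by simp
    next
      case 5
      then show ?thesis using R4_aux2[OF w p s ps ne(2)] by simp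
    next
      case 6
      \<comment> \<open>Neither product is fully commutative. A braid partner \<open>t\<close> of
        \<open>s\<close> either commutes with \<open>p\<close> or closes braids with both; a letter
        \<open>q\<close> commuting with \<open>s\<close> is either a braid partner of
        \<open>p\<close> or can be removed from both products.\<close>
      show ?thesis
        using s w(1) 6(1)
      proof (cases rule: not_fc_cases)
        case (noncomm t)
        show ?thesis
        proof (cases "p \<otimes> t = t \<otimes> p")
          case True
          then show ?thesis using R4_braid[OF w s p sp 6(1) noncomm] by simp
        next
          case nc: False
          have pt: "noncommuting p t" using nc p noncommutingD[OF noncomm(1)] by (simp add: noncommuting_def)
          have "lam s w = Tn (t \<otimes> w)" "dl s (t \<otimes> w)"
            using R4_single[OF w(1) s p sp ne(1) 6 noncomm pt] by auto
          moreover have "lam p w = Tn (t \<otimes> w)" "dl p (t \<otimes> w)"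
            using R4_single[OF w(1) p s ps ne(2) 6(2,1) pt noncomm(2,1)] by auto
          ultimately show ?thesis
            using wc noncommutingD[OF noncomm(1)] by (simp add: L_Tn lam_dl)
        qed
      next
        case (comm q)
        show ?thesis
        proof (cases "p \<otimes> q = q \<otimes> p")
          case False
          then have "noncommuting p q" using p comm by (simp add: noncommuting_def)
          then show ?thesis using R4_braid[OF w p s ps 6(2) _ comm(4,3)] by simp
        next
          case True
          have qw: "q \<otimes> w \<in> W\<^sub>c" "len (q \<otimes> w) < n" using fc_down comm w by (auto simp: dl_def)
          have pqw: "p \<otimes> (q \<otimes> w) \<notin> W\<^sub>c"
            using not_fc_commuting_descent[OF p w(1) 6(2) comm(1,4) True] .
          have R1: "R1 w" using R12 w by simp
          have lp: "lam p w = L q (lam p (q \<otimes> w))" and ls: "lam s w = L q (lam s (q \<otimes> w))"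
            using R1 comm 6 True s p unfolding R1_def by auto
          have "R2 (q \<otimes> w)" using R12 qw by simp
          then have V: "inV n (lam p (q \<otimes> w))" "inV n (lam s (q \<otimes> w))"
            using pqw comm(5) s p inV_mono[of "len (q \<otimes> w)" _ n] qw unfolding R2_def by auto
          have "L s (L q (lam p (q \<otimes> w))) = L q (L s (lam p (q \<otimes> w)))"
            using R4_extend[of n s q] R345 s comm V by blast
          also have "L s (lam p (q \<otimes> w)) = L p (lam s (q \<otimes> w))"
            using R345[OF qw] s p sp unfolding R4_def by blast
          also have "L q (L p (lam s (q \<otimes> w))) = L p (L q (lam s (q \<otimes> w)))"
            using R4_extend[of n q p] R345 p comm V True by metis
          finally show ?thesis unfolding lp ls .
        qed
      qed
    qed
  qed simp
qed

text \<open>\<open>r\<close> is the operator that all monomials of \<open>PP\<close> apply first,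
  and \<open>q\<close> is the other one. If \<open>r\<close> or \<open>q\<close> is a descent, or rw
  is not fully commutative, the claim reduces to shorter elements. Otherwise the lower monomials are
  basis elements, and the definition of \<open>lam\<close> evaluates the longest one as minus their
  sum.\<close>

lemma R5_step:
  assumes w: "w \<in> W\<^sub>c" "len w = n"
  shows "R5 w"
  unfolding R5_def
proof (intro allI impI, elim conjE)
  fix s t m assume nc: "noncommuting s t" and m: "cox_mat W s t = enat m"
  note st = noncommutingD[OF nc]
  have mt: "cox_mat W t s = enat m" using m st mat_sym by simp
  have m3: "3 \<le> m" using noncommuting_cox_mat nc m by blast
  have wc: "w \<in> carrier W" using w by simp
  define r where "r = (if odd m then s else t)"
  define q where "q = (if odd m then t else s)"
  have r: "r \<in> S" "q \<in> S" "noncommuting r q" using st nc noncommuting_sym by (auto simp: r_def q_def)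
  have IH: "PP m a b (Tn y) = 0" if "y \<in> W\<^sub>c" "len y < n" "a = s \<and> b = t \<or> a = t \<and> b = s" for a b y
    using R345[OF that(1,2)] that(3) nc m mt noncommuting_sym[OF nc] unfolding R5_def by auto
  consider "dl r w" | "r \<otimes> w \<notin> W\<^sub>c" | "dl q w" | "\<not> dl r w" "\<not> dl q w" "r \<otimes> w \<in> W\<^sub>c" by blast
  then show "PP m s t (Tn w) = 0"
  proof cases
    case 1
    define y where "y = r \<otimes> w"
    have y: "y \<in> W\<^sub>c" "len y < n" "r \<otimes> y = w" "\<not> dl r y"
      using fc_down r 1 w dl_mult by (auto simp: y_def dl_def)
    have Tw: "Tn w = L r (Tn y)" using y w by (simp add: L_Tn lam_fc)
    have "L r (L r (Tn y)) = sc delta (L r (Tn y))"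
      using R345[OF y(1,2)] r y(1) unfolding R3_def by (simp add: L_Tn)
    then have "L r (L r (Tn y)) = L r (sc delta (Tn y))" by (simp add: L_scale)
    then have "PP m s t (L r (Tn y)) = PP m s t (sc delta (Tn y))"
      unfolding r_def by (rule PP_last_cong)
    also have "\<dots> = 0" using IH[OF y(1,2)] by (simp add: PP_scale)
    finally show ?thesis unfolding Tw .
  next
    case 2
    then obtain v where v: "inV (len w - 1) v" "lam r w = L r v"
      using R12[of w] r w unfolding R2_def by fastforce
    have "inV n v" using v w inV_mono by auto
    then have "PP m s t v = 0" using R5_extend[of n s t m] R345 nc m by blast
    moreover have "PP m s t (Tn w) = PP m s t v"
      using v wc by (intro PP_last_cong) (simp add: L_Tn r_def)
    ultimately show ?thesis by simp
  next
    case 3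
    define y where "y = q \<otimes> w"
    have y: "y \<in> W\<^sub>c" "len y < n" "q \<otimes> y = w" "\<not> dl q y"
      using fc_down r 3 w dl_mult by (auto simp: y_def dl_def)
    have Tw: "Tn w = L q (Tn y)" using y w by (simp add: L_Tn lam_fc)
    show ?thesis
      unfolding Tw unfolding q_def PP_other using IH[OF y(1,2)] L_0 by simp
  next
    case 4
    have nd: "\<not> dl s w" "\<not> dl t w" using 4 by (auto simp: r_def q_def split: if_splits)
    have chain: "al x y k \<otimes> w \<in> W\<^sub>c \<and> aop x y k (Tn w) = Tn (al x y k \<otimes> w)"
      if "x = s \<and> y = t \<or> x = t \<and> y = s" "k \<le> m - 1" "(if odd k then x else y) = r" for x y k
      using that
    proof (induction k arbitrary: x y)
      case 0
      then show ?case using w by simp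
    next
      case (Suc k)
      have xy: "x \<in> S" "y \<in> S" "x \<noteq> y" "cox_mat W x y = enat m" "\<not> dl x w" "\<not> dl y w" "noncommuting y x"
        "cox_mat W y x = enat m"
        using Suc.prems st m mt nd nc noncommuting_sym by auto
      have IHk: "al y x k \<otimes> w \<in> W\<^sub>c" "aop y x k (Tn w) = Tn (al y x k \<otimes> w)"
        using Suc.IH[of y x] Suc.prems by auto
      have eq: "al x y (Suc k) \<otimes> w = x \<otimes> (al y x k \<otimes> w)"
        using xy wc by (simp add: al_Suc m_assoc)
      have l: "len (al a b i \<otimes> w) = i + len w" if "a = x \<and> b = y \<or> a = y \<and> b = x" "i \<le> m" for a b i
        using len_al_mult[OF xy(1-3) wc xy(5,6)] len_al_mult[OF xy(2,1) xy(3)[symmetric] wc xy(6,5)]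
          xy(4,8) that by auto
      have nd: "\<not> dl x (al y x k \<otimes> w)"
        unfolding dl_def eq[symmetric] using l[of x y "Suc k"] l[of y x k] Suc.prems by simp
      \<comment> \<open>Leaving \<open>W\<^sub>c\<close> would make \<open>y\<close> a descent of
        the new product, whereas alternating products in front of \<open>w\<close> keep growing up
        to m factors. For k = 0 the letter is \<open>r\<close>, and rw is fully commutative by
        assumption.\<close>
      have fc: "x \<otimes> (al y x k \<otimes> w) \<in> W\<^sub>c"
      proof (rule ccontr)
        assume n: "x \<otimes> (al y x k \<otimes> w) \<notin> W\<^sub>c"
        show False
        proof (cases k)
          case 0
          then have "x = r" using Suc.prems by simp
          then show False using n 0 4(3) wc by simp
        next
          case (Suc k')
          have "y \<otimes> (al y x k \<otimes> w) = al x y k' \<otimes> w"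
            using xy wc by (simp add: al_Suc m_assoc Suc)
          then have "dl y (al y x k \<otimes> w)"
            using l[of x y k'] l[of y x k] Suc Suc.prems by (simp add: dl_def)
          then have "dl y (x \<otimes> (al y x k \<otimes> w))"
            using not_fc_descent[OF xy(7) IHk(1)] n by simp
          moreover have eq2: "y \<otimes> (x \<otimes> (al y x k \<otimes> w)) = al y x (Suc (Suc k)) \<otimes> w"
            using xy wc by (simp add: al_Suc m_assoc)
          have "len (y \<otimes> (x \<otimes> (al y x k \<otimes> w))) = Suc (Suc k) + len w"
            unfolding eq2 using l[of y x "Suc (Suc k)"] Suc.prems m3 by simp
          moreover have "len (x \<otimes> (al y x k \<otimes> w)) = Suc k + len w"
            unfolding eq[symmetric] using l[of x y "Suc k"] Suc.prems m3 by simp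
          ultimately show False by (simp add: dl_def)
        qed
      qed
      then show ?case
        using lam_fc[OF nd fc] IHk eq by (simp add: aop_Suc L_Tn)
    qed
    have par: "(if odd (m - 2 * j) then s else t) = r" if "2 * j < m" for j
      using that by (auto simp: r_def)
    have par': "(if odd (m - 1) then t else s) = r"
      using m3 by (auto simp: r_def)
    define u where "u = al t s (m - 1) \<otimes> w"
    have u: "u \<in> W\<^sub>c" "aop t s (m - 1) (Tn w) = Tn u"
      using chain[of t s "m - 1"] par' by (auto simp: u_def)
    have su: "s \<otimes> u = al s t m \<otimes> w"
      using al_Suc[of s t "m - 1"] m3 st wc by (simp add: u_def m_assoc)
    have top: "s \<otimes> u \<notin> W\<^sub>c"
      unfolding su using al_top_not_fc[OF nc m wc] len_al_mult[OF st(1-3) wc nd] m by simp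
    have dt: "dl t u"
    proof -
      have "t \<otimes> u = al s t (m - 2) \<otimes> w"
        using al_Suc[of t s "m - 2"] m3 st wc by (simp add: u_def m_assoc numeral_2_eq_2 Suc_diff_Suc)
      then show ?thesis
        using len_al_mult[OF st(1-3) wc nd, of "m - 2"] len_al_mult[OF st(2,1) st(3)[symmetric] wc nd(2,1), of "m - 1"]
          m mt m3 by (simp add: dl_def u_def)
    qed
    obtain m' z where z: "cox_mat W s t = enat m'" "z \<in> carrier W" "u = al t s (m' - 1) \<otimes> z"
      "lam s u = lower_terms s t m' z"
      using lam_noncommuting[OF nc u(1) dt top] by metis
    have "z = w" using z m st wc by (simp add: u_def)
    have "aop s t m (Tn w) = L s (aop t s (m - 1) (Tn w))"
      using m3 aop_Suc[of s t "m - 1"] by simp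
    also have "\<dots> = lower_terms s t m w"
      using u z m \<open>z = w\<close> by (simp add: L_Tn)
    finally have top_eq: "aop s t m (Tn w) = lower_terms s t m w" .
    have "aop s t (m - 2 * j) (Tn w) = Tn (al s t (m - 2 * j) \<otimes> w)" if "0 < j" "2 * j < m" for j
      using chain[of s t "m - 2 * j"] par that by simp
    then show ?thesis
      using m3 by (simp add: PP_split top_eq lower_terms_def)
  qed
qed

end

lemma relations:
  "(\<forall>y \<in> W\<^sub>c. len y \<le> n \<longrightarrow> R1 y \<and> R2 y) \<and> (\<forall>y \<in> W\<^sub>c. len y < n \<longrightarrow> R3 y \<and> R4 y \<and> R5 y)"
proof (induction n)
  case 0
  have "R1 y \<and> R2 y" if "y \<in> W\<^sub>c" "len y = 0" for y
    using R1_step[of y] R2_step[of y] that by simp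
  then show ?case by simp
next
  case (Suc n)
  have R12: "R1 y \<and> R2 y" if "y \<in> W\<^sub>c" "len y \<le> Suc n" for y
  proof (cases "len y \<le> n")
    case False
    then have "len y = Suc n" using that by simp
    then show ?thesis using R1_step[of y] R2_step[of y] Suc that by simp
  qed (use Suc that in simp)
  have R345: "R3 y \<and> R4 y \<and> R5 y" if "y \<in> W\<^sub>c" "len y < n" for y
    using Suc that by blast
  have "R3 y \<and> R4 y \<and> R5 y" if "y \<in> W\<^sub>c" "len y < Suc n" for y
  proof (cases "len y = n")
    case True
    then show ?thesis
      using R3_step[OF R12 R345 that(1)] R4_step[OF R12 R345 that(1)] R5_step[OF R12 R345 that(1)] by blast
  qed (use R345 that in simp)
  then show ?case using R12 by blast
qed

lemma L_inV': "s \<in> S \<Longrightarrow> inV n h \<Longrightarrow> inV (Suc n) (L s h)"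
  using L_inV[of n s h] relations[of n] by auto

lemma L_square: "s \<in> S \<Longrightarrow> inV n h \<Longrightarrow> L s (L s h) = sc delta (L s h)"
  using R3_extend[of n s h] relations[of n] by blast

lemma L_commute: "\<lbrakk>s \<in> S; p \<in> S; s \<otimes> p = p \<otimes> s; inV n h\<rbrakk> \<Longrightarrow> L s (L p h) = L p (L s h)"
  using R4_extend[of n s p h] relations[of n] by blast

lemma L_braid: "\<lbrakk>noncommuting s t; cox_mat W s t = enat m; inV n h\<rbrakk> \<Longrightarrow> PP m s t h = 0"
  using R5_extend[of n s t m h] relations[of n] by blast

end

context hecke_algebra
begin

section \<open>Kazhdan--Lusztig elements of dihedral subgroups\<close>

definition alt_op :: "('w \<Rightarrow> 'h \<Rightarrow> 'h) \<Rightarrow> 'w \<Rightarrow> 'w \<Rightarrow> nat \<Rightarrow> 'h \<Rightarrow> 'h" where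
  "alt_op N s t k h = foldr N (alternating s t k) h"

text \<open>If \<open>N s\<close> and \<open>N t\<close> are the actions of \<open>Tn s\<close> and \<open>Tn t\<close>, then \<open>kl_op N s t k\<close> is the action
  of the Kazhdan--Lusztig basis element of \<open>al s t k\<close>, and \<open>kl_low N s t k\<close> that of its part below
  \<open>al s t k\<close>. The value at \<open>k = 0\<close> makes the recursion start correctly.\<close>

primrec kl_low :: "('w \<Rightarrow> 'h \<Rightarrow> 'h) \<Rightarrow> 'w \<Rightarrow> 'w \<Rightarrow> nat \<Rightarrow> 'h \<Rightarrow> 'h" where
  "kl_low N s t 0 h = - h"
| "kl_low N s t (Suc k) h = sc (vpow (- 1)) (kl_low N s t k h + alt_op N s t k h + alt_op N t s k h)"

definition kl_op :: "('w \<Rightarrow> 'h \<Rightarrow> 'h) \<Rightarrow> 'w \<Rightarrow> 'w \<Rightarrow> nat \<Rightarrow> 'h \<Rightarrow> 'h" where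
  "kl_op N s t k h = alt_op N s t k h + kl_low N s t k h"

lemma alt_op_0 [simp]: "alt_op N s t 0 h = h"
  by (simp add: alt_op_def)

lemma alt_op_Suc: "alt_op N s t (Suc k) h = N s (alt_op N t s k h)"
  by (simp add: alt_op_def)

lemma kl_low_commute: "kl_low N s t k h = kl_low N t s k h"
  by (induction k) (auto simp: algebra_simps)

lemma kl_op_0 [simp]: "kl_op N s t 0 h = 0"
  by (simp add: kl_op_def)

lemma kl_op_1: "kl_op N s t (Suc 0) h = N s h + sc (vpow (- 1)) h"
  by (simp add: kl_op_def alt_op_Suc)

lemma kl_low_mult:
  assumes add: "\<And>g h. N s (g + h) = N s g + N s h" and scale: "\<And>a h. N s (sc a h) = sc a (N s h)"
    and quad: "\<And>j. N s (N s (alt_op N t s j h)) = alt_op N t s j h + sc vdiff (N s (alt_op N t s j h))"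
  shows "N s (kl_low N s t (Suc k) h) =
    sc (vpow (- 1)) (alt_op N s t (Suc k) h) + alt_op N s t k h + kl_low N s t k h"
proof (induction k)
  case 0
  then show ?case by (simp add: scale alt_op_Suc)
next
  case (Suc k)
  let ?A = "alt_op N s t" and ?B = "alt_op N t s"
  have A: "N s (?A (Suc k) h) = ?B k h + sc vdiff (?A (Suc k) h)"
    using quad[of k] by (simp add: alt_op_Suc)
  have "N s (kl_low N s t (Suc (Suc k)) h) =
      sc (vpow (- 1)) (N s (kl_low N s t (Suc k) h) + N s (?A (Suc k) h) + N s (?B (Suc k) h))"
    by (subst kl_low.simps(2)) (simp only: scale add)
  also have "\<dots> = sc (vpow (- 1)) (?A (Suc (Suc k)) h)
      + sc (vpow (- 1)) (sc (vpow (- 1)) (?A (Suc k) h) + sc vdiff (?A (Suc k) h))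
      + sc (vpow (- 1)) (kl_low N s t k h + ?A k h + ?B k h)"
    unfolding Suc.IH A alt_op_Suc[of N s t "Suc k"] by (simp add: H.scale_right_distrib algebra_simps)
  also have "sc (vpow (- 1)) (sc (vpow (- 1)) (?A (Suc k) h) + sc vdiff (?A (Suc k) h)) = ?A (Suc k) h"
    by (simp add: H.scale_left_distrib[symmetric] vpow_add)
  finally show ?case by simp
qed

text \<open>The product rule of the infinite dihedral group: a generator in front gives the next
  longer element plus the one two steps below that. The quadratic relation is assumed on the
  alternating vectors, so that the rule also applies to \<open>nop\<close>, for which it is known on
  \<open>inV\<close>.\<close>

lemma kl_op_mult:
  assumes add: "\<And>g h. N s (g + h) = N s g + N s h" and scale: "\<And>a h. N s (sc a h) = sc a (N s h)"
    and quad: "\<And>j. N s (N s (alt_op N t s j h)) = alt_op N t s j h + sc vdiff (N s (alt_op N t s j h))"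
  shows "N s (kl_op N t s (Suc k) h) + sc (vpow (- 1)) (kl_op N t s (Suc k) h) =
    kl_op N s t (Suc (Suc k)) h + kl_op N s t k h"
proof -
  have low: "kl_low N t s (Suc k) h = kl_low N s t (Suc k) h" by (rule kl_low_commute)
  have "N s (kl_op N t s (Suc k) h) = alt_op N s t (Suc (Suc k)) h + (sc (vpow (- 1)) (alt_op N s t (Suc k) h)
      + alt_op N s t k h + kl_low N s t k h)"
    unfolding kl_op_def add low kl_low_mult[of N s t h k, OF assms] by (simp add: alt_op_Suc)
  moreover have "kl_low N s t (Suc (Suc k)) h = sc (vpow (- 1)) (kl_low N s t (Suc k) h)
      + sc (vpow (- 1)) (alt_op N s t (Suc k) h) + sc (vpow (- 1)) (alt_op N t s (Suc k) h)"
    by (subst kl_low.simps(2)) (simp only: H.scale_right_distrib)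
  ultimately show ?thesis
    unfolding kl_op_def low by (simp only: H.scale_right_distrib) (simp add: algebra_simps)
qed

definition lmul :: "'w \<Rightarrow> 'h \<Rightarrow> 'h" where
  "lmul s h = Tn s * h"

lemma lmul_add: "lmul s (g + h) = lmul s g + lmul s h"
  by (simp add: lmul_def distrib_left)

lemma lmul_scale: "lmul s (sc a h) = sc a (lmul s h)"
  by (simp add: lmul_def sc_mult_right)

lemma lmul_quad: "s \<in> S \<Longrightarrow> lmul s (lmul s h) = h + sc vdiff (lmul s h)"
  by (simp add: lmul_def mult.assoc[symmetric] Tn_square distrib_right sc_mult_left)

lemma alt_op_lmul: "alt_op lmul s t k h = alt_op lmul s t k 1 * h"
  by (induction k arbitrary: s t) (auto simp: alt_op_Suc lmul_def mult.assoc)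

lemma kl_low_lmul: "kl_low lmul s t k h = kl_low lmul s t k 1 * h"
proof (induction k)
  case (Suc k)
  show ?case
    using alt_op_lmul[of s t k h] alt_op_lmul[of t s k h] Suc by (simp add: distrib_right sc_mult_left)
qed simp

lemma kl_op_lmul: "kl_op lmul s t k h = kl_op lmul s t k 1 * h"
  unfolding kl_op_def using alt_op_lmul[of s t k h] kl_low_lmul[of s t k h] by (simp add: distrib_right)

lemma alt_op_lmul_Tn:
  assumes "s \<in> S" "t \<in> S" "s \<noteq> t" "enat k \<le> cox_mat W s t"
  shows "alt_op lmul s t k 1 = Tn (al s t k)"
  using assms
proof (induction k arbitrary: s t)
  case (Suc k)
  have k: "enat k \<le> cox_mat W t s"
    using Suc.prems mat_sym[of s t] by (metis Suc_ile_eq order_less_imp_le)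
  have "len (s \<otimes> al t s k) = Suc (len (al t s k))"
    using len_al[of s t "Suc k"] len_al[of t s k] Suc.prems k by (simp add: al_Suc)
  then have "Tn s * Tn (al t s k) = Tn (s \<otimes> al t s k)"
    using Tn_mult[of s "al t s k"] Suc.prems by simp
  then show ?case using Suc.IH[of t s] Suc.prems k by (simp add: alt_op_Suc lmul_def al_Suc)
qed simp

lemma kl_op_lmul_step:
  "s \<in> S \<Longrightarrow> bH s (kl_op lmul t s (Suc k) 1) = kl_op lmul s t (Suc (Suc k)) 1 + kl_op lmul s t k 1"
  unfolding bH_def lmul_def[symmetric]
  by (rule kl_op_mult) (auto simp: lmul_quad lmul_add lmul_scale)

text \<open>The recursion expresses the element through \<open>bH\<close> and shorter elements of
  the same kind, all compatible with bar.\<close>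

lemma bar_H_kl_op: "\<lbrakk>s \<in> S; t \<in> S\<rbrakk> \<Longrightarrow> bar_H (kl_op lmul s t k 1) = kl_op lmul s t k 1"
proof (induction k arbitrary: s t rule: less_induct)
  case (less k)
  consider "k = 0" | "k = Suc 0" | j where "k = Suc (Suc j)" by (metis not0_implies_Suc)
  then show ?case
  proof cases
    case 2
    have "kl_op lmul s t (Suc 0) 1 = bH s 1" by (simp add: kl_op_1 lmul_def bH_def)
    then show ?thesis using 2 less.prems bar_H_bH[of s 1] by simp
  next
    case 3
    then have "kl_op lmul s t k 1 = bH s (kl_op lmul t s (Suc j) 1) - kl_op lmul s t j 1"
      using kl_op_lmul_step[OF less.prems(1), of t j] by simp
    then show ?thesis
      using less.IH[of "Suc j" t s] less.IH[of j s t] less.prems 3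
      by (simp add: KH.bar_diff bar_H_bH)
  qed simp
qed

lemma kl_low_explicit:
  "kl_low N s t (Suc k) h = sc (vpow (- 1 - int k)) h
    + (\<Sum>j = 1..k. sc (vpow (int j - int k - 1)) (alt_op N s t j h + alt_op N t s j h))"
proof (induction k)
  case (Suc k)
  have "kl_low N s t (Suc (Suc k)) h = sc (vpow (- 1)) (kl_low N s t (Suc k) h)
      + sc (vpow (- 1)) (alt_op N s t (Suc k) h + alt_op N t s (Suc k) h)"
    by (subst kl_low.simps(2)) (simp add: H.scale_right_distrib algebra_simps)
  also have "sc (vpow (- 1)) (kl_low N s t (Suc k) h) = sc (vpow (- 1 - int (Suc k))) h
      + (\<Sum>j = 1..k. sc (vpow (int j - int (Suc k) - 1)) (alt_op N s t j h + alt_op N t s j h))"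
  proof -
    have "- 1 + (- 1 - int k) = - 1 - int (Suc k)" "- 1 + (int j - int k - 1) = int j - int (Suc k) - 1" for j
      by simp_all
    then show ?thesis
      unfolding Suc.IH H.scale_right_distrib H.scale_sum_right H.scale_scale vpow_add by simp
  qed
  finally show ?case by (simp add: algebra_simps)
qed simp

text \<open>The generator of \<open>J\<close> is v^m times the Kazhdan-Lusztig element of the
  longest element, in which an alternating product with j factors has coefficient v^(j-m).\<close>

lemma sum_T_dihedral:
  assumes nc: "noncommuting s t" and m: "cox_mat W s t = enat m"
  shows "(\<Sum>w \<in> generate W {s, t}. T w) = sc (vpow (int m)) (kl_op lmul s t m 1)"
proof -
  note st = noncommutingD[OF nc]
  have mt: "cox_mat W t s = enat m" using m st mat_sym by simp
  obtain k where k: "m = Suc k" using noncommuting_cox_mat[OF nc m] by (cases m) auto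
  note len = len_al[OF st(1-3)] len_al[OF st(2,1) st(3)[symmetric]]
  \<comment> \<open>Below length m the two families are disjoint: a common element would have both
    descents and hence length at least m.\<close>
  have ne: "al s t i \<noteq> al t s j" if ij: "i \<in> {1..k}" "j \<in> {1..k}" for i j
  proof
    assume eq: "al s t i = al t s j"
    then have "i = j" using len[of i] len[of j] m mt that k by simp
    then have "al s t i = al t s i" using eq by simp
    then have d: "dl s (al s t i)" "dl t (al s t i)"
    proof -
      obtain i' where i': "i = Suc i'" using ij by (cases i) auto
      have "t \<otimes> al t s i = al s t i'" "s \<otimes> al s t i = al t s i'"
        using st by (simp_all add: i' al_Suc)
      then show "dl s (al s t i)" "dl t (al s t i)"
        using \<open>al s t i = al t s i\<close> len[of i] len[of i'] m mt that k i' by (simp_all add: dl_def)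
    qed
    obtain m' z where "cox_mat W s t = enat m'" "len (al s t i) = m' + len z"
      by (rule two_descents[OF st(1-3) al_closed[OF st(1,2)] d])
    then show False using len(1)[of i] m ij k by simp
  qed
  have inj: "inj_on (al s t) {..m}" "inj_on (al t s) {..m}"
    using len m mt by (auto intro!: inj_onI) (metis enat_ord_simps(1))+
  have set: "generate W {s, t} = insert \<one> (insert (al s t m) (al s t ` {1..k} \<union> al t s ` {1..k}))"
  proof -
    have "{..m} = insert 0 (insert m {1..k})" using k by auto
    then show ?thesis
      unfolding generate_pair[OF st(1,2)] dihedral_eq[OF st(1,2) m] using al_braid[OF st(1,2) m] by auto
  qed
  have n1: "\<one> \<notin> insert (al s t m) (al s t ` {1..k} \<union> al t s ` {1..k})"
  proof
    assume "\<one> \<in> insert (al s t m) (al s t ` {1..k} \<union> al t s ` {1..k})"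
    then consider "\<one> = al s t m" | i where "i \<in> {1..k}" "\<one> = al s t i \<or> \<one> = al t s i" by auto
    then show False
    proof cases
      case 1
      then show False using len(1)[of m] m k len_one by (metis enat_ord_simps(1) le_refl nat.distinct(1))
    next
      case 2
      then show False using len[of i] m mt k by (metis atLeastAtMost_iff enat_ord_simps(1) le_SucI len_one not_one_le_zero)
    qed
  qed
  have n2: "al s t m \<notin> al s t ` {1..k} \<union> al t s ` {1..k}"
  proof
    assume "al s t m \<in> al s t ` {1..k} \<union> al t s ` {1..k}"
    then obtain i where "i \<in> {1..k}" "al s t m = al s t i \<or> al s t m = al t s i" by auto
    then show False using len[of i] len(1)[of m] m mt k by auto
  qed
  have "(\<Sum>w \<in> generate W {s, t}. T w) = T \<one> + (T (al s t m) + (\<Sum>w \<in> al s t ` {1..k} \<union> al t s ` {1..k}. T w))"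
    unfolding set using n1 n2 by simp
  also have "(\<Sum>w \<in> al s t ` {1..k} \<union> al t s ` {1..k}. T w) = (\<Sum>j = 1..k. T (al s t j) + T (al t s j))"
  proof -
    have "al s t ` {1..k} \<inter> al t s ` {1..k} = {}" using ne by auto
    moreover have "inj_on (al s t) {1..k}" "inj_on (al t s) {1..k}"
      using inj k by (auto intro: inj_on_subset)
    ultimately show ?thesis
      by (simp add: sum.union_disjoint sum.reindex sum.distrib)
  qed
  finally have L: "(\<Sum>w \<in> generate W {s, t}. T w) =
      T \<one> + (T (al s t m) + (\<Sum>j = 1..k. T (al s t j) + T (al t s j)))" .
  have T: "T (al s t j) = sc (vpow (int j)) (alt_op lmul s t j 1)" "T (al t s j) = sc (vpow (int j)) (alt_op lmul t s j 1)"
    if "j \<le> m" for j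
    using alt_op_lmul_Tn[OF st(1-3), of j] alt_op_lmul_Tn[OF st(2,1) st(3)[symmetric], of j] len[of j] m mt that
      T_eq_Tn[of "al s t j"] T_eq_Tn[of "al t s j"] by auto
  have "sc (vpow (int m)) (kl_op lmul s t m 1) = sc (vpow (int m)) (alt_op lmul s t m 1)
      + (sc (vpow (int m)) (sc (vpow (- 1 - int k)) 1)
      + (\<Sum>j = 1..k. sc (vpow (int m)) (sc (vpow (int j - int k - 1)) (alt_op lmul s t j 1 + alt_op lmul t s j 1))))"
    unfolding kl_op_def k kl_low_explicit H.scale_right_distrib H.scale_sum_right ..
  also have "\<dots> = T (al s t m) + (T \<one> + (\<Sum>j = 1..k. T (al s t j) + T (al t s j)))"
  proof -
    have "sc (vpow (int m)) (sc (vpow (- 1 - int k)) 1) = T \<one>"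
      by (simp add: vpow_add k T_one)
    moreover have "sc (vpow (int m)) (sc (vpow (int j - int k - 1)) (alt_op lmul s t j 1 + alt_op lmul t s j 1)) =
        T (al s t j) + T (al t s j)" if "j \<in> {1..k}" for j
      using T[of j] that k by (simp add: vpow_add H.scale_right_distrib)
    ultimately show ?thesis using T(1)[of m] by simp
  qed
  finally show ?thesis unfolding L by (simp add: algebra_simps)
qed

section \<open>The ideal\<close>

lemma two_sided_ideal_J: "two_sided_ideal J"
  unfolding J_def two_sided_ideal_def by blast

lemma J_gens_subset: "J_gens \<subseteq> J"
  unfolding J_def by blast

lemma J_minimal: "two_sided_ideal I \<Longrightarrow> J_gens \<subseteq> I \<Longrightarrow> J \<subseteq> I"
  unfolding J_def by blast

lemma ideal_0: "two_sided_ideal I \<Longrightarrow> 0 \<in> I"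
  by (simp add: two_sided_ideal_def)

lemma ideal_diff: "two_sided_ideal I \<Longrightarrow> x \<in> I \<Longrightarrow> y \<in> I \<Longrightarrow> x - y \<in> I"
  by (simp add: two_sided_ideal_def)

lemma ideal_mult: "two_sided_ideal I \<Longrightarrow> x \<in> I \<Longrightarrow> r * x \<in> I" "two_sided_ideal I \<Longrightarrow> x \<in> I \<Longrightarrow> x * r \<in> I"
  by (simp_all add: two_sided_ideal_def)

lemma ideal_scale: "two_sided_ideal I \<Longrightarrow> x \<in> I \<Longrightarrow> sc a x \<in> I"
  using ideal_mult(1)[of I x "sc a 1"] by (simp add: sc_mult_left)

lemma J_gensE:
  assumes "x \<in> J_gens"
  obtains s t m where "noncommuting s t" "cox_mat W s t = enat m" "x = sc (vpow (int m)) (kl_op lmul s t m 1)"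
proof -
  obtain s t where st: "x = (\<Sum>w \<in> generate W {s, t}. T w)" "noncommuting s t" "cox_mat W s t < \<infinity>"
    using assms unfolding J_gens_def by blast
  then obtain m where "cox_mat W s t = enat m" by (cases "cox_mat W s t") auto
  then show ?thesis using that st sum_T_dihedral by blast
qed

lemma kl_op_in_J: "noncommuting s t \<Longrightarrow> cox_mat W s t = enat m \<Longrightarrow> kl_op lmul s t m 1 \<in> J"
proof -
  assume st: "noncommuting s t" "cox_mat W s t = enat m"
  have "(\<Sum>w \<in> generate W {s, t}. T w) \<in> J_gens"
    unfolding J_gens_def using st by auto
  then have "sc (vpow (int m)) (kl_op lmul s t m 1) \<in> J"
    using sum_T_dihedral[OF st] J_gens_subset by auto
  then have "sc (vpow (- int m)) (sc (vpow (int m)) (kl_op lmul s t m 1)) \<in> J"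
    by (rule ideal_scale[OF two_sided_ideal_J])
  then show ?thesis by (simp add: vpow_add)
qed

text \<open>\<open>J\<close> is generated by scalar multiples of bar-invariant elements which lie in
  \<open>J\<close> themselves.\<close>

lemma bar_H_J: "x \<in> J \<Longrightarrow> bar_H x \<in> J"
proof -
  have "two_sided_ideal {x. bar_H x \<in> J}"
    unfolding two_sided_ideal_def
    using ideal_0[OF two_sided_ideal_J] ideal_diff[OF two_sided_ideal_J] ideal_mult[OF two_sided_ideal_J]
    by (auto simp: KH.bar_diff bar_H_mult)
  moreover have "J_gens \<subseteq> {x. bar_H x \<in> J}"
  proof
    fix x assume "x \<in> J_gens"
    then obtain s t m where *: "noncommuting s t" "cox_mat W s t = enat m"
      "x = sc (vpow (int m)) (kl_op lmul s t m 1)" by (rule J_gensE)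
    have "bar_H (kl_op lmul s t m 1) \<in> J"
      using bar_H_kl_op noncommutingD[OF *(1)] kl_op_in_J[OF *(1,2)] by simp
    then show "x \<in> {x. bar_H x \<in> J}"
      using *(3) ideal_scale[OF two_sided_ideal_J] by (simp add: bar_H_scale)
  qed
  ultimately show "x \<in> J \<Longrightarrow> bar_H x \<in> J" using J_minimal by blast
qed

text \<open>Inversion permutes a dihedral subgroup, so the anti-involution fixes each generator of
  \<open>J\<close>.\<close>

lemma star_J: "x \<in> J \<Longrightarrow> star x \<in> J"
proof -
  have diff: "star (x - y) = star x - star y" for x y
    using star_add[of "x - y" y] by (simp add: algebra_simps)
  have "star 0 = 0" using star_add[of 0 0] by simp
  then have "two_sided_ideal {x. star x \<in> J}"
    unfolding two_sided_ideal_def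
    using ideal_0[OF two_sided_ideal_J] ideal_diff[OF two_sided_ideal_J] ideal_mult[OF two_sided_ideal_J]
    by (auto simp: diff star_mult)
  moreover have "J_gens \<subseteq> {x. star x \<in> J}"
  proof
    fix x assume x: "x \<in> J_gens"
    then obtain s t where st: "x = (\<Sum>w \<in> generate W {s, t}. T w)" "noncommuting s t"
      unfolding J_gens_def by blast
    note D = noncommutingD[OF st(2)]
    interpret st: additive star by standard (rule star_add)
    have c: "w \<in> carrier W" "inv w \<in> dihedral s t" if "w \<in> dihedral s t" for w
      using dihedral_closed dihedral_inv D that by blast+
    have "star x = (\<Sum>w \<in> dihedral s t. T (inv w))"
      unfolding st(1) generate_pair[OF D(1,2)] st.sum
      by (rule sum.cong) (use c in \<open>auto simp: T_eq_Tn star_scale star_Tn\<close>)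
    also have "\<dots> = (\<Sum>w \<in> dihedral s t. T w)"
      by (rule sum.reindex_bij_witness[of _ "\<lambda>w. inv w" "\<lambda>w. inv w"]) (use c in auto)
    also have "\<dots> = x" unfolding st(1) generate_pair[OF D(1,2)] ..
    finally show "x \<in> {x. star x \<in> J}" using x J_gens_subset by auto
  qed
  ultimately show "x \<in> J \<Longrightarrow> star x \<in> J" using J_minimal by blast
qed

section \<open>Linear independence modulo the ideal\<close>

text \<open>The operator by which \<open>Tn s\<close> acts, as \<open>L s\<close> plays the role of
  \<open>Tn s\<close> plus v^-1.\<close>

definition nop :: "'w \<Rightarrow> 'h \<Rightarrow> 'h" where
  "nop s h = L s h - sc (vpow (- 1)) h"

lemma nop_add: "nop s (g + h) = nop s g + nop s h"
  by (simp add: nop_def L_add H.scale_right_distrib)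

lemma nop_scale: "nop s (sc a h) = sc a (nop s h)"
  by (simp add: nop_def L_scale H.scale_right_diff_distrib mult.commute)

lemma inV_diff: "inV n g \<Longrightarrow> inV n h \<Longrightarrow> inV n (g - h)"
  using inV_add[of n g "- h"] inV_uminus by simp

lemma nop_inV: "s \<in> S \<Longrightarrow> inV n h \<Longrightarrow> inV (Suc n) (nop s h)"
  unfolding nop_def using L_inV' inV_mono[of n h "Suc n"] by (intro inV_diff inV_scale) auto

lemma nop_quad:
  assumes "s \<in> S" "inV n h"
  shows "nop s (nop s h) = h + sc vdiff (nop s h)"
proof -
  have "nop s (nop s h) = L s (L s h) - sc (vpow (- 1)) (L s h) - (sc (vpow (- 1)) (L s h) - sc (vpow (- 1) * vpow (- 1)) h)"
    using L_add[of s "L s h - sc (vpow (- 1)) h" "sc (vpow (- 1)) h"]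
    by (simp add: nop_def L_scale H.scale_right_diff_distrib algebra_simps)
  also have "\<dots> = sc delta (L s h) - sc (vpow (- 1)) (L s h) - (sc (vpow (- 1)) (L s h) - sc (vpow (- 1) * vpow (- 1)) h)"
    unfolding L_square[OF assms] ..
  also have "\<dots> = h + sc vdiff (nop s h)"
  proof -
    have "vdiff * vpow (- 1) = 1 - vpow (- 1) * vpow (- 1)"
      by (simp add: left_diff_distrib vpow_add)
    then show ?thesis
      by (simp add: nop_def H.scale_right_diff_distrib H.scale_left_distrib H.scale_left_diff_distrib)
  qed
  finally show ?thesis .
qed

lemma alt_op_nop_inV: "\<lbrakk>s \<in> S; t \<in> S; inV n h\<rbrakk> \<Longrightarrow> inV (n + k) (alt_op nop s t k h)"
proof (induction k arbitrary: s t)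
  case (Suc k)
  then show ?case using nop_inV[of s "n + k"] by (simp add: alt_op_Suc)
qed simp

lemma PP_rec: "PP (Suc (Suc k)) s t h = L s (PP (Suc k) t s h) - PP k s t h"
proof -
  let ?f = "\<lambda>j. aop s t (Suc (Suc k) - 2 * j) h"
  have set: "{j. 2 * j < Suc (Suc k)} = insert 0 (Suc ` {j. 2 * j < k})"
  proof (intro Set.set_eqI iffI)
    fix j assume "j \<in> {j. 2 * j < Suc (Suc k)}"
    then show "j \<in> insert 0 (Suc ` {j. 2 * j < k})" by (cases j) auto
  qed auto
  have "L s (PP (Suc k) t s h) = (\<Sum>j | 2 * j < Suc k. sc (of_int (cheb (Suc k) j)) (?f j))"
    unfolding PP_def L_sum L_scale
    by (rule sum.cong) (auto simp: aop_Suc[symmetric] Suc_diff_le)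
  also have "\<dots> = (\<Sum>j | 2 * j < Suc (Suc k). sc (of_int (cheb (Suc k) j)) (?f j))"
  proof (rule sum.mono_neutral_left)
    show "\<forall>i \<in> {j. 2 * j < Suc (Suc k)} - {j. 2 * j < Suc k}. sc (of_int (cheb (Suc k) i)) (?f i) = 0"
      by (auto simp: cheb_zero)
  qed auto
  finally have L: "L s (PP (Suc k) t s h) = \<dots>" .
  have "PP k s t h = (\<Sum>j | 2 * j < Suc (Suc k). sc (of_int (case j of 0 \<Rightarrow> 0 | Suc i \<Rightarrow> cheb k i)) (?f j))"
    unfolding set by (simp add: sum.reindex PP_def)
  then show ?thesis
    unfolding L by (simp add: PP_def sum_subtractf[symmetric] H.scale_left_diff_distrib[symmetric])
qed

text \<open>Both sides start equally and obey the same recursion: \<open>PP\<close> by that of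
  \<open>cheb\<close>, \<open>kl_op\<close> by the dihedral product rule.\<close>

lemma PP_eq_kl_op:
  "\<lbrakk>s \<in> S; t \<in> S; inV n h\<rbrakk> \<Longrightarrow> PP k s t h = kl_op nop s t k h"
proof (induction k arbitrary: s t rule: less_induct)
  case (less k)
  consider "k = 0" | "k = Suc 0" | j where "k = Suc (Suc j)" by (metis not0_implies_Suc)
  then show ?case
  proof cases
    case 1
    then show ?thesis by (simp add: PP_def)
  next
    case 2
    have "{j :: nat. 2 * j < Suc 0} = {0}" by auto
    then show ?thesis using 2 by (simp add: PP_def aop_Suc kl_op_1 nop_def)
  next
    case 3
    have "nop s (kl_op nop t s (Suc j) h) + sc (vpow (- 1)) (kl_op nop t s (Suc j) h) =
        kl_op nop s t (Suc (Suc j)) h + kl_op nop s t j h"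
    proof (rule kl_op_mult)
      fix i show "nop s (nop s (alt_op nop t s i h)) = alt_op nop t s i h + sc vdiff (nop s (alt_op nop t s i h))"
        using nop_quad[OF less.prems(1) alt_op_nop_inV[OF less.prems(2,1,3)]] .
    qed (auto simp: nop_add nop_scale)
    then have "L s (kl_op nop t s (Suc j) h) = kl_op nop s t (Suc (Suc j)) h + kl_op nop s t j h"
      by (simp add: nop_def)
    then show ?thesis
      using 3 less.IH[of "Suc j" t s] less.IH[of j s t] less.prems by (simp add: PP_rec)
  qed
qed

lemma kl_op_nop_zero:
  "\<lbrakk>noncommuting s t; cox_mat W s t = enat m; inV n h\<rbrakk> \<Longrightarrow> kl_op nop s t m h = 0"
  using PP_eq_kl_op L_braid noncommutingD by metis

text \<open>The Kazhdan-Lusztig operators for both orders of \<open>s\<close> and \<open>t\<close>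
  vanish and share their lower part, so the leading terms agree. A commuting pair gives no generator
  of \<open>J\<close>; there m = 2 and the operators commute by \<open>L_commute\<close>.\<close>

lemma nop_braid:
  assumes st: "s \<in> S" "t \<in> S" "s \<noteq> t" and m: "cox_mat W s t = enat m" and h: "inV n h"
  shows "alt_op nop s t m h = alt_op nop t s m h"
proof (cases "s \<otimes> t = t \<otimes> s")
  case True
  have "m = 2" using commuting_cox_mat[OF st] True m by (simp add: numeral_eq_enat)
  moreover have "nop s (nop t h) = nop t (nop s h)"
    using L_commute[OF st(1,2) True h] L_add[of s "L t h - sc (vpow (- 1)) h" "sc (vpow (- 1)) h"]
      L_add[of t "L s h - sc (vpow (- 1)) h" "sc (vpow (- 1)) h"]
    by (simp add: nop_def L_scale H.scale_right_diff_distrib algebra_simps)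
  ultimately show ?thesis by (simp add: numeral_2_eq_2 alt_op_Suc)
next
  case False
  then have nc: "noncommuting s t" using st by (simp add: noncommuting_def)
  have "kl_op nop s t m h = 0" "kl_op nop t s m h = 0"
    using kl_op_nop_zero[OF nc m h] kl_op_nop_zero[OF noncommuting_sym[OF nc] _ h] m mat_sym st by auto
  then show ?thesis
    using kl_low_commute[of nop s t m h] by (metis add_right_cancel kl_op_def)
qed

text \<open>The action of \<open>Tn w\<close> on the unit vector along a reduced word chosen by
  descents; \<open>phi_step\<close> shows that the choice is immaterial.\<close>

function phi :: "'w \<Rightarrow> 'h" where
  "phi w = (if \<exists>s. s \<in> S \<and> dl s w
    then (let s = (SOME s. s \<in> S \<and> dl s w) in nop s (phi (s \<otimes> w))) else Tn \<one>)"
  by auto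
termination
proof (relation "measure len")
  fix w s
  assume "\<exists>s. s \<in> S \<and> dl s w" "s = (SOME s. s \<in> S \<and> dl s w)"
  then have "s \<in> S \<and> dl s w" by (metis (mono_tags, lifting) someI_ex)
  then show "(s \<otimes> w, w) \<in> measure len" by (simp add: dl_def)
qed auto

declare phi.simps [simp del]

lemma phi_one: "phi \<one> = Tn \<one>"
  by (simp add: phi.simps)

lemma phi_inV: "w \<in> carrier W \<Longrightarrow> inV (Suc (len w)) (phi w)"
proof (induction "len w" arbitrary: w rule: less_induct)
  case less
  define s where "s = (SOME s. s \<in> S \<and> dl s w)"
  show ?case
  proof (cases "\<exists>s. s \<in> S \<and> dl s w")
    case True
    then have s: "s \<in> S" "dl s w" unfolding s_def by (metis (mono_tags, lifting) someI_ex)+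
    have "phi w = nop s (phi (s \<otimes> w))"
      using True by (subst phi.simps) (simp add: Let_def s_def)
    moreover have "inV (Suc (len (s \<otimes> w))) (phi (s \<otimes> w))"
      using less s by (simp add: dl_def)
    ultimately show ?thesis
      using nop_inV[OF s(1)] len_down[OF s(1) less.prems s(2)] by metis
  next
    case False
    then have "phi w = Tn \<one>" unfolding phi.simps[of w] by (rule if_not_P)
    then show ?thesis using inV_basis[OF one_fc, of "Suc (len w)"] by simp
  qed
qed

text \<open>An argument in the style of Matsumoto: with two different descents, \<open>w\<close>
  begins with the longest element of a finite dihedral subgroup, and the two alternating words for
  it act equally by \<open>nop_braid\<close>.\<close>

lemma phi_step:
  "\<lbrakk>w \<in> carrier W; s \<in> S; dl s w\<rbrakk> \<Longrightarrow> phi w = nop s (phi (s \<otimes> w))"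
proof (induction "len w" arbitrary: w s rule: less_induct)
  case less
  define r where "r = (SOME s. s \<in> S \<and> dl s w)"
  have ex: "\<exists>s. s \<in> S \<and> dl s w" using less.prems by blast
  then have r: "r \<in> S" "dl r w" unfolding r_def by (metis (mono_tags, lifting) someI_ex)+
  have pr: "phi w = nop r (phi (r \<otimes> w))"
    using ex by (subst phi.simps) (simp add: Let_def r_def)
  show ?case
  proof (cases "s = r")
    case False
    note s = less.prems(2,3)
    obtain m z where m: "cox_mat W s r = enat m" "z \<in> carrier W" "\<not> dl s z" "\<not> dl r z" "w = al s r m \<otimes> z"
      "len w = m + len z"
      using two_descents[OF s(1) r(1) False less.prems(1) s(2) r(2)] .
    have mr: "cox_mat W r s = enat m" using m(1) s r mat_sym by simp
    have chain: "phi (al x y k \<otimes> z) = alt_op nop x y k (phi z)"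
      if "x = s \<and> y = r \<or> x = r \<and> y = s" "k < m" for x y k
      using that
    proof (induction k arbitrary: x y)
      case 0
      then show ?case using m by simp
    next
      case (Suc k)
      have xy: "x \<in> S" "y \<in> S" "x \<noteq> y" "cox_mat W x y = enat m" "\<not> dl x z" "\<not> dl y z" "cox_mat W y x = enat m"
        using Suc.prems s r m mr False by auto
      have eq: "x \<otimes> (al x y (Suc k) \<otimes> z) = al y x k \<otimes> z"
        using xy m(2) by (simp add: al_Suc m_assoc)
      have l: "len (al y x k \<otimes> z) = k + len z" "len (al x y (Suc k) \<otimes> z) = Suc k + len z"
        using len_al_mult[OF xy(1-3) m(2) xy(5,6)] len_al_mult[OF xy(2,1) xy(3)[symmetric] m(2) xy(6,5)]
          xy(4,7) Suc.prems by auto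
      have "dl x (al x y (Suc k) \<otimes> z)" unfolding dl_def eq using l by simp
      then have "phi (al x y (Suc k) \<otimes> z) = nop x (phi (al y x k \<otimes> z))"
        using less.hyps[of "al x y (Suc k) \<otimes> z" x] l m xy Suc.prems eq by simp
      then show ?case using Suc.IH[of y x] Suc.prems by (auto simp: alt_op_Suc)
    qed
    have m0: "m = Suc (m - 1)"
      using mat_off_diag[OF s(1) r(1) False] m(1) by (simp add: numeral_eq_enat)
    have sw: "s \<otimes> w = al r s (m - 1) \<otimes> z"
      unfolding m(5) by (subst m0) (use s r m(2) in \<open>simp add: al_Suc m_assoc\<close>)
    have rw: "r \<otimes> w = al s r (m - 1) \<otimes> z"
      unfolding m(5) al_braid[OF s(1) r(1) m(1)]
      by (subst m0) (use s r m(2) in \<open>simp add: al_Suc m_assoc\<close>)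
    have "nop s (phi (s \<otimes> w)) = alt_op nop s r m (phi z)"
      unfolding sw using chain[of r s "m - 1"] m0 by (metis alt_op_Suc diff_less less_numeral_extra(1) zero_less_Suc)
    also have "\<dots> = alt_op nop r s m (phi z)"
      using nop_braid[OF s(1) r(1) False m(1) phi_inV[OF m(2)]] .
    also have "\<dots> = nop r (phi (r \<otimes> w))"
      unfolding rw using chain[of s r "m - 1"] m0 by (metis alt_op_Suc diff_less less_numeral_extra(1) zero_less_Suc)
    finally show ?thesis using pr by simp
  qed (use pr in simp)
qed

definition Phi :: "'h \<Rightarrow> 'h" where
  "Phi = B.ext (\<lambda>a. a) phi"

lemma Phi_add: "Phi (g + h) = Phi g + Phi h"
  unfolding Phi_def by (rule B.ext_add) simp

lemma Phi_scale: "Phi (sc a h) = sc a (Phi h)"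
  unfolding Phi_def by (rule B.ext_scale) auto

lemma Phi_0: "Phi 0 = 0"
  using Phi_add[of 0 0] by simp

lemma Phi_diff: "Phi (g - h) = Phi g - Phi h"
  using Phi_add[of "g - h" h] by (simp add: algebra_simps)

lemma Phi_Tn: "w \<in> carrier W \<Longrightarrow> Phi (Tn w) = phi w"
  unfolding Phi_def by (rule B.ext_basis) auto

lemma Phi_inV: "\<exists>n. inV n (Phi h)"
proof (induction h rule: Hecke_induct)
  case (basis w)
  then show ?case using phi_inV Phi_Tn by auto
next
  case (add g h)
  then obtain i j where "inV i (Phi g)" "inV j (Phi h)" by blast
  then have "inV (i + j) (Phi g)" "inV (i + j) (Phi h)" by (auto intro: inV_mono)
  then show ?case using inV_add by (auto simp: Phi_add)
next
  case (scale a h)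
  then show ?case using inV_scale by (auto simp: Phi_scale)
qed

lemma Phi_gen_mult:
  assumes "s \<in> S"
  shows "Phi (Tn s * h) = nop s (Phi h)"
proof (rule B.semilinear_eqI[where f = "\<lambda>h. Phi (Tn s * h)" and f' = "\<lambda>h. nop s (Phi h)" and \<sigma> = "\<lambda>a. a"])
  fix w assume w: "w \<in> carrier W"
  show "Phi (Tn s * Tn w) = nop s (Phi (Tn w))"
  proof (cases "dl s w")
    case False
    then show ?thesis
      using Tn_up[OF assms w False] phi_step[of "s \<otimes> w" s] assms w dl_mult by (simp add: Phi_Tn)
  next
    case True
    have "nop s (nop s (phi (s \<otimes> w))) = phi (s \<otimes> w) + sc vdiff (nop s (phi (s \<otimes> w)))"
      using nop_quad[OF assms phi_inV] assms w by simp
    then show ?thesis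
      using Tn_down[OF assms w True] phi_step[OF w assms True] assms w
      by (simp add: Phi_Tn Phi_add Phi_scale)
  qed
qed (auto simp: distrib_left Phi_add sc_mult_right Phi_scale nop_add nop_scale)

lemma Phi_alt_op: "\<lbrakk>s \<in> S; t \<in> S\<rbrakk> \<Longrightarrow> Phi (alt_op lmul s t k h) = alt_op nop s t k (Phi h)"
  by (induction k arbitrary: s t) (auto simp: alt_op_Suc lmul_def Phi_gen_mult)

lemma Phi_kl_op: "\<lbrakk>s \<in> S; t \<in> S\<rbrakk> \<Longrightarrow> Phi (kl_op lmul s t k h) = kl_op nop s t k (Phi h)"
proof -
  assume st: "s \<in> S" "t \<in> S"
  have "Phi (kl_low lmul s t k h) = kl_low nop s t k (Phi h)"
  proof (induction k)
    case 0
    show ?case using Phi_diff[of 0 h] Phi_0 by simp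
  next
    case (Suc k)
    then show ?case using Phi_alt_op st by (simp add: Phi_add Phi_scale)
  qed
  then show ?thesis using Phi_alt_op st by (simp add: kl_op_def Phi_add)
qed

lemma Phi_mult_zero: "Phi x = 0 \<Longrightarrow> Phi (r * x) = 0"
proof (induction r rule: Hecke_induct)
  case (basis w)
  then show ?case
  proof (induction "len w" arbitrary: w)
    case 0
    then have "w = \<one>" using len_eq_0_iff by simp
    then show ?case using 0 by simp
  next
    case (Suc n)
    then have "w \<noteq> \<one>" by auto
    then obtain s where s: "s \<in> S" "dl s w" using ex_dl Suc.prems by metis
    define u where "u = s \<otimes> w"
    have u: "u \<in> carrier W" "s \<otimes> u = w" "\<not> dl s u" "len w = Suc (len u)"
      using s Suc.prems len_down[of s w] by (auto simp: u_def dl_mult)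
    have "Tn w * x = Tn s * (Tn u * x)"
      using Tn_up[OF s(1) u(1,3)] u by (simp add: mult.assoc[symmetric])
    moreover have "Phi (Tn u * x) = 0" using Suc u by simp
    moreover have "nop s 0 = 0" using nop_scale[of s 0 0] by simp
    ultimately show ?case using Phi_gen_mult[OF s(1)] by simp
  qed
next
  case (add g h)
  then show ?case by (simp add: distrib_right Phi_add)
next
  case (scale a h)
  then show ?case by (simp add: sc_mult_left Phi_scale)
qed

text \<open>The \<open>x\<close> with \<open>Phi (x * g) = 0\<close> for all \<open>g\<close> form a
  two-sided ideal, closed on the left by \<open>Phi_mult_zero\<close>; it contains the generators by
  \<open>kl_op_nop_zero\<close>. Taking g = 1 gives the claim.\<close>

lemma Phi_J: "x \<in> J \<Longrightarrow> Phi x = 0"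
proof -
  let ?I = "{x. \<forall>g. Phi (x * g) = 0}"
  have "two_sided_ideal ?I"
    unfolding two_sided_ideal_def
    by (auto simp: left_diff_distrib Phi_diff Phi_0 mult.assoc Phi_mult_zero)
  moreover have "J_gens \<subseteq> ?I"
  proof
    fix x assume "x \<in> J_gens"
    then obtain s t m where *: "noncommuting s t" "cox_mat W s t = enat m"
      "x = sc (vpow (int m)) (kl_op lmul s t m 1)" by (rule J_gensE)
    have "Phi (x * g) = 0" for g
    proof -
      obtain n where "inV n (Phi g)" using Phi_inV by blast
      then have "kl_op nop s t m (Phi g) = 0" using kl_op_nop_zero * by blast
      then have "Phi (kl_op lmul s t m 1 * g) = 0"
        using Phi_kl_op[of s t m g] noncommutingD[OF *(1)] by (simp add: kl_op_lmul[symmetric])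
      then show ?thesis unfolding *(3) by (simp add: sc_mult_left Phi_scale)
    qed
    then show "x \<in> ?I" by blast
  qed
  ultimately have "J \<subseteq> ?I" by (rule J_minimal)
  then show "x \<in> J \<Longrightarrow> Phi x = 0" by (metis (mono_tags) mem_Collect_eq mult_1_right subsetD)
qed

lemma phi_leading: "w \<in> W\<^sub>c \<Longrightarrow> inV (len w) (phi w - Tn w)"
proof (induction "len w" arbitrary: w)
  case 0
  then have "w = \<one>" using len_eq_0_iff by simp
  then show ?case by (simp add: phi_one)
next
  case (Suc n)
  have wc: "w \<in> carrier W" using Suc by simp
  have "w \<noteq> \<one>" using Suc by auto
  then obtain s where s: "s \<in> S" "dl s w" using ex_dl wc by metis
  define u where "u = s \<otimes> w"
  have u: "u \<in> W\<^sub>c" "s \<otimes> u = w" "\<not> dl s u" "len w = Suc (len u)"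
    using s Suc.prems len_down[of s w] fc_down[of s w] by (auto simp: u_def dl_mult)
  have "phi w = nop s (phi u - Tn u) + nop s (Tn u)"
    using phi_step[OF wc s] nop_add[of s "phi u - Tn u" "Tn u"] by (simp add: u_def)
  also have "nop s (Tn u) = Tn w - sc (vpow (- 1)) (Tn u)"
    using u Suc.prems by (simp add: nop_def L_Tn lam_fc)
  finally have "phi w - Tn w = nop s (phi u - Tn u) - sc (vpow (- 1)) (Tn u)" by simp
  moreover have "inV (Suc (len u)) (nop s (phi u - Tn u))"
    using Suc u s by (intro nop_inV) auto
  moreover have "inV (Suc (len u)) (sc (vpow (- 1)) (Tn u))"
    using u by (intro inV_scale inV_basis) auto
  ultimately show ?case using inV_diff u by simp
qed

text \<open>\<open>Phi\<close> kills \<open>J\<close> but is unitriangular on the span of the fully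
  commutative \<open>Tn w\<close>, so the coefficient at a longest element of the support would have
  to vanish.\<close>

lemma inV_J_zero:
  assumes "inV n h" "h \<in> J"
  shows "h = 0"
proof (rule ccontr)
  assume "h \<noteq> 0"
  then have "B.supp h \<noteq> {}" using B.expand[of h] by auto
  then have "Max (len ` B.supp h) \<in> len ` B.supp h" by (intro Max_in) auto
  then obtain w where w: "w \<in> B.supp h" "len w = Max (len ` B.supp h)" by auto
  have max: "len y \<le> len w" if "y \<in> B.supp h" for y
    using that w(2) by simp
  have summand: "B.cf (sc (B.cf h y) (phi y)) w = (if y = w then B.cf h w else 0)" if y: "y \<in> B.supp h" for y
  proof -
    have yc: "y \<in> W\<^sub>c" using assms(1) y by (simp add: inV_def)
    have lead: "inV (len y) (phi y - Tn y)" using phi_leading yc by simp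
    have wc: "w \<in> carrier W" using w(1) by (simp add: B.supp_def)
    have "B.cf (phi y - Tn y) w = 0"
    proof (rule ccontr)
      assume "B.cf (phi y - Tn y) w \<noteq> 0"
      then have "len w < len y" using lead wc unfolding inV_iff by blast
      then show False using max[OF y] by simp
    qed
    then have "B.cf (phi y) w = B.cf (Tn y) w" by (simp add: B.cf_diff)
    then show ?thesis using w(1) yc by (auto simp: B.cf_scale B.cf_basis B.supp_def)
  qed
  have "B.cf (Phi h) w = (\<Sum>y \<in> B.supp h. B.cf (sc (B.cf h y) (phi y)) w)"
    by (simp add: Phi_def B.ext_def B.cf_sum)
  also have "\<dots> = B.cf h w"
    using w(1) by (subst sum.cong[OF HOL.refl summand]) auto
  finally show False using Phi_J[OF assms(2)] w(1) by (simp add: B.supp_def)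
qed

section \<open>Reduction to fully commutative elements\<close>

lemma below_Tn_mult: "x \<in> carrier W \<Longrightarrow> KH.below n h \<Longrightarrow> KH.below (n + len x) (Tn x * h)"
proof (induction "len x" arbitrary: x)
  case 0
  then have "x = \<one>" using len_eq_0_iff by simp
  then show ?case using 0 by simp
next
  case (Suc k)
  have "x \<noteq> \<one>" using Suc by auto
  then obtain s where s: "s \<in> S" "dl s x" using ex_dl Suc.prems by metis
  define u where "u = s \<otimes> x"
  have u: "u \<in> carrier W" "s \<otimes> u = x" "\<not> dl s u" "len x = Suc (len u)"
    using s Suc.prems len_down[of s x] by (auto simp: u_def dl_mult)
  have IH: "KH.below (n + len u) (Tn u * h)" using Suc u by simp
  have "Tn x * h = bH s (Tn u * h) - sc (vpow (- 1)) (Tn u * h)"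
    using Tn_up[OF s(1) u(1,3)] u by (simp add: bH_def mult.assoc[symmetric])
  moreover have "KH.below (Suc (n + len u)) (bH s (Tn u * h))" using KH.below_b s IH by blast
  moreover have "KH.below (Suc (n + len u)) (sc (vpow (- 1)) (Tn u * h))"
    using KH.below_scale KH.below_mono[OF IH] by simp
  ultimately show ?case using KH.below_diff u by simp
qed

lemma below_star: "KH.below n h \<Longrightarrow> KH.below n (star h)"
proof -
  assume b: "KH.below n h"
  have "star h = (\<Sum>w \<in> B.supp h. sc (B.cf h w) (Tn (inv w)))"
    by (simp add: star_def B.ext_def)
  moreover have "KH.below n \<dots>"
    by (intro KH.below_sum KH.below_scale KH.below_basis) (use b in \<open>auto simp: KH.below_def B.supp_def\<close>)
  ultimately show ?thesis by simp
qed

lemma below_mult_Tn: "y \<in> carrier W \<Longrightarrow> KH.below n h \<Longrightarrow> KH.below (n + len y) (h * Tn y)"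
proof -
  assume y: "y \<in> carrier W" and b: "KH.below n h"
  have "KH.below (n + len (inv y)) (Tn (inv y) * star h)"
    using below_Tn_mult[of "inv y"] below_star[OF b] y by simp
  then have "KH.below (n + len y) (star (Tn (inv y) * star h))"
    using below_star y by simp
  then show ?thesis using y by (simp add: star_mult star_star star_Tn)
qed

lemma below_kl_low:
  assumes st: "s \<in> S" "t \<in> S" "s \<noteq> t"
  shows "enat (Suc k) \<le> cox_mat W s t \<Longrightarrow> KH.below (Suc k) (kl_low lmul s t (Suc k) 1)"
proof -
  assume k: "enat (Suc k) \<le> cox_mat W s t"
  have "KH.below (Suc k) (alt_op lmul s t j 1)" "KH.below (Suc k) (alt_op lmul t s j 1)" if "j \<le> k" for j
  proof -
    have "enat j \<le> enat (Suc k)" using that by simp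
    then have j: "enat j \<le> cox_mat W s t" "enat j \<le> cox_mat W t s"
      using order_trans[OF _ k] mat_sym[OF st(1,2)] by auto
    show "KH.below (Suc k) (alt_op lmul s t j 1)" "KH.below (Suc k) (alt_op lmul t s j 1)"
      using alt_op_lmul_Tn[of s t j] alt_op_lmul_Tn[of t s j] len_al[of s t j] len_al[of t s j] st j that
      by (auto intro!: KH.below_basis)
  qed
  then show ?thesis
    unfolding kl_low_explicit using KH.below_basis[of \<one> "Suc k"]
    by (intro KH.below_add KH.below_scale KH.below_sum) auto
qed

text \<open>Inside \<open>Tn w\<close>, the factor of the longest dihedral element is replaced
  modulo \<open>J\<close> by minus the lower part of its Kazhdan-Lusztig element, and multiplication
  by the outer factors adds at most their lengths.\<close>

lemma reduce_complex:
  assumes "w \<in> carrier W" "w \<notin> W\<^sub>c"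
  shows "\<exists>g. KH.below (len w) g \<and> Tn w - g \<in> J"
proof -
  have "complex w" using assms fc_iff by blast
  then obtain s t m x y where *: "noncommuting s t" "cox_mat W s t = enat m" "x \<in> carrier W" "y \<in> carrier W"
    "w = x \<otimes> al s t m \<otimes> y" "len w = len x + m + len y" by (rule complexE)
  note st = noncommutingD[OF *(1)]
  obtain k where k: "m = Suc k" using noncommuting_cox_mat[OF *(1,2)] by (cases m) auto
  have la: "len (al s t m) = m" using len_al st * by simp
  have lxa: "len (x \<otimes> al s t m) = len x + len (al s t m)"
    using len_mult_le[of "x \<otimes> al s t m" y] len_mult_le[of x "al s t m"] * st la by simp
  have "Tn w = Tn x * Tn (al s t m) * Tn y"
    using Tn_mult[of "x \<otimes> al s t m" y] Tn_mult[of x "al s t m"] lxa la * st by simp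
  then have eq: "Tn w = Tn x * kl_op lmul s t m 1 * Tn y - Tn x * kl_low lmul s t m 1 * Tn y"
    using alt_op_lmul_Tn[of s t m] st * by (simp add: kl_op_def distrib_left distrib_right)
  define g where "g = - (Tn x * kl_low lmul s t m 1 * Tn y)"
  have "KH.below m (kl_low lmul s t m 1)" using below_kl_low[of s t k] st * k by simp
  then have "KH.below (m + len x + len y) (Tn x * kl_low lmul s t m 1 * Tn y)"
    using below_mult_Tn below_Tn_mult * by blast
  then have "KH.below (len w) g"
    using *(6) KH.below_diff[of _ 0] by (simp add: g_def KH.below_iff add.commute add.left_commute B.cf_uminus)
  moreover have "Tn w - g \<in> J"
    using eq kl_op_in_J[OF *(1,2)] ideal_mult[OF two_sided_ideal_J] by (simp add: g_def)
  ultimately show ?thesis by blast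
qed

lemma reduce: "KH.below n h \<Longrightarrow> \<exists>g. inV n g \<and> h - g \<in> J"
proof (induction n arbitrary: h)
  case 0
  then have "h = 0" by (intro B.cf_eqI) (simp add: KH.below_iff)
  then show ?case using ideal_0[OF two_sided_ideal_J] by (intro exI[of _ 0]) simp
next
  case (Suc n)
  have J_add: "a + b \<in> J" if "a \<in> J" "b \<in> J" for a b
    using ideal_diff[OF two_sided_ideal_J that(1), of "0 - b"] ideal_diff[OF two_sided_ideal_J ideal_0[OF two_sided_ideal_J] that(2)]
    by simp
  have basis: "\<exists>g. inV (Suc n) g \<and> Tn w - g \<in> J" if w: "w \<in> carrier W" "len w \<le> n" for w
  proof (cases "w \<in> W\<^sub>c")
    case True
    then have "inV (Suc n) (Tn w) \<and> Tn w - Tn w \<in> J"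
      using w ideal_0[OF two_sided_ideal_J] by (auto intro: inV_basis)
    then show ?thesis by blast
  next
    case False
    then obtain g where g: "KH.below (len w) g" "Tn w - g \<in> J" using reduce_complex w by blast
    then obtain g' where g': "inV n g'" "g - g' \<in> J" using Suc.IH[of g] KH.below_mono w by blast
    have "Tn w - g' \<in> J" using J_add[OF g(2) g'(2)] by simp
    then show ?thesis using g' inV_mono[of n g' "Suc n"] by auto
  qed
  have "\<exists>g. inV (Suc n) g \<and> (\<Sum>w \<in> F. sc (B.cf h w) (Tn w)) - g \<in> J" if "finite F" "F \<subseteq> B.supp h" for F
    using that
  proof (induction F rule: finite_induct)
    case empty
    then show ?case using ideal_0[OF two_sided_ideal_J] by (intro exI[of _ 0]) simp
  next
    case (insert w F)
    then obtain g where g: "inV (Suc n) g" "(\<Sum>w \<in> F. sc (B.cf h w) (Tn w)) - g \<in> J" by auto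
    have "w \<in> carrier W" "len w \<le> n"
      using insert.prems Suc.prems by (auto simp: KH.below_def B.supp_def)
    then obtain g' where g': "inV (Suc n) g'" "Tn w - g' \<in> J" using basis by blast
    have "sc (B.cf h w) (Tn w - g') + ((\<Sum>w \<in> F. sc (B.cf h w) (Tn w)) - g) \<in> J"
      using J_add ideal_scale[OF two_sided_ideal_J g'(2)] g(2) by blast
    then have "(\<Sum>w \<in> insert w F. sc (B.cf h w) (Tn w)) - (sc (B.cf h w) g' + g) \<in> J"
      using insert.hyps by (simp add: H.scale_right_diff_distrib algebra_simps)
    then show ?case using inV_add[OF inV_scale[OF g'(1)] g(1)] by blast
  qed
  from this[of "B.supp h"] show ?case
    using B.expand[of h] by simp
qed

end

section \<open>The Temperley--Lieb algebra\<close>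

context temperley_lieb
begin

lemma pr_diff_J: "pr x = pr y \<longleftrightarrow> x - y \<in> J"
  using pr_kernel[of "x - y"] TL.diff[of x y] by simp

lemma pr_inV_inj: "inV n g \<Longrightarrow> inV n h \<Longrightarrow> pr g = pr h \<Longrightarrow> g = h"
  using inV_J_zero[of n "g - h"] inV_diff pr_diff_J by simp

lemma reduce_tn: "KH.below n h \<Longrightarrow> \<exists>g. inV n g \<and> pr g = pr h"
  using reduce pr_diff_J by metis

lemma inV_span: "inV n g \<Longrightarrow> g \<in> H.span (Tn ` W\<^sub>c)"
  by (induction g rule: inV_induct) (auto intro: H.span_base H.span_zero H.span_add H.span_scale)

lemma span_inV: "g \<in> H.span (Tn ` W\<^sub>c) \<Longrightarrow> \<exists>n. inV n g"
proof (induction g rule: H.span_induct_alt)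
  case base
  show ?case by auto
next
  case (step a x y)
  then obtain n w where n: "inV n y" and w: "x = Tn w" "w \<in> W\<^sub>c" by auto
  have "inV (n + Suc (len w)) (sc a x + y)"
    using w n by (intro inV_add inV_scale) (auto intro: inV_basis inV_mono)
  then show ?case by blast
qed

lemma inj_on_pr: "inj_on pr (H.span (Tn ` W\<^sub>c))"
proof (rule inj_onI)
  fix g h assume "g \<in> H.span (Tn ` W\<^sub>c)" "h \<in> H.span (Tn ` W\<^sub>c)" and eq: "pr g = pr h"
  then obtain i j where "inV i g" "inV j h" using span_inV by blast
  then have "inV (i + j) g" "inV (i + j) h" by (auto intro: inV_mono)
  then show "g = h" using pr_inV_inj eq by blast
qed

lemma every_below: "\<exists>n. KH.below n h"
proof -
  have "KH.below (Suc (Max (insert 0 (len ` B.supp h)))) h"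
    by (auto simp: KH.below_def less_Suc_eq_le)
  then show ?thesis by blast
qed

text \<open>Spanning comes from \<open>reduce_tn\<close>. Independence is inherited from the
  \<open>Tn w\<close>, because \<open>pr\<close> is injective on the span of those with fully
  commutative \<open>w\<close>.\<close>

lemma based_module_tn: "based_module scq W\<^sub>c tn"
proof unfold_locales
  have sub: "Tn ` W\<^sub>c \<subseteq> Tn ` carrier W" by auto
  have tn_image: "tn ` W\<^sub>c = pr ` Tn ` W\<^sub>c" by (auto simp: tn_def)
  show "inj_on tn W\<^sub>c"
  proof (rule inj_onI)
    fix x y assume xy: "x \<in> W\<^sub>c" "y \<in> W\<^sub>c" "tn x = tn y"
    then have "Tn x = Tn y"
      using inj_on_pr H.span_base[of _ "Tn ` W\<^sub>c"] by (auto simp: tn_def dest!: inj_onD)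
    then show "x = y" using B.inj_e xy by (auto dest: inj_onD)
  qed
  have "\<not> H.dependent (Tn ` W\<^sub>c)"
    using H.independent_mono[OF B.independent_e sub] .
  then show "\<not> TL.m2.dependent (tn ` W\<^sub>c)"
    unfolding tn_image by (rule TL.independent_injective_image) (rule inj_on_pr)
  show "TL.m2.span (tn ` W\<^sub>c) = UNIV"
  proof -
    have "x \<in> TL.m2.span (tn ` W\<^sub>c)" for x
    proof -
      obtain h where h: "x = pr h" using pr_surj by (metis surjD)
      obtain n g where g: "inV n g" "pr g = pr h" using every_below reduce_tn by blast
      have "pr g \<in> pr ` H.span (Tn ` W\<^sub>c)" using inV_span g by blast
      then show ?thesis unfolding h tn_image TL.span_image g(2) .
    qed
    then show ?thesis by auto
  qed
qed

end

sublocale temperley_lieb \<subseteq> Q: based_module scq "W\<^sub>c" tn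
  by (rule based_module_tn)

context temperley_lieb
begin

lemma Q_cf_inV: "inV n g \<Longrightarrow> y \<in> W\<^sub>c \<Longrightarrow> Q.cf (pr g) y = B.cf g y"
proof (induction g rule: inV_induct)
  case (basis w)
  then show ?case using Q.cf_basis[of w y] B.cf_basis[of w y] by (simp add: tn_def[symmetric])
qed (auto simp: TL.add TL.scale Q.cf_add Q.cf_scale B.cf_add B.cf_scale)

lemma Q_supp_tn_len:
  assumes "w \<in> carrier W" "y \<in> Q.supp (tn w)"
  shows "len y \<le> len w"
proof -
  have "KH.below (Suc (len w)) (Tn w)" using assms by (auto intro: KH.below_basis)
  then obtain g where g: "inV (Suc (len w)) g" "pr g = tn w"
    using reduce_tn unfolding tn_def by blast
  have "y \<in> W\<^sub>c" "Q.cf (tn w) y \<noteq> 0" using assms by (auto simp: Q.supp_def)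
  then have "B.cf g y \<noteq> 0" using Q_cf_inV[OF g(1)] g(2) by simp
  then have "len y < Suc (len w)"
    using g(1) fc_closed[OF \<open>y \<in> W\<^sub>c\<close>] unfolding inV_iff by blast
  then show ?thesis by simp
qed

lemma v_inv_L_iff: "x \<in> v_inv_L \<longleftrightarrow> Q.lat (- 1) x"
proof
  assume "x \<in> v_inv_L"
  then obtain F a where F: "finite F" "F \<subseteq> W\<^sub>c" "\<And>w. w \<in> F \<Longrightarrow> a w \<in> A_minus"
    "x = scq (vpow (- 1)) (\<Sum>w \<in> F. scq (a w) (tn w))"
    unfolding v_inv_L_def lattice_L_def by blast
  have "Q.lat 0 (\<Sum>w \<in> F. scq (a w) (tn w))"
  proof (rule Q.lat_sum)
    fix w assume "w \<in> F"
    then show "Q.lat 0 (scq (a w) (tn w))"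
      using Q.lat_scale[of 0 "a w" 0 "tn w"] Q.lat_basis[of w] F by (auto simp: A_minus_iff)
  qed
  then show "Q.lat (- 1) x"
    unfolding F(4) using Q.lat_scale[of "- 1" "vpow (- 1)" 0] deg_le_vpow by simp
next
  assume l: "Q.lat (- 1) x"
  have "x = (\<Sum>w \<in> Q.supp x. scq (Q.cf x w) (tn w))" by (rule Q.expand)
  also have "\<dots> = scq (vpow (- 1)) (\<Sum>w \<in> Q.supp x. scq (vpow 1 * Q.cf x w) (tn w))"
    by (simp add: TL.m2.scale_sum_right mult.assoc[symmetric] vpow_add)
  finally have "x = \<dots>" .
  moreover have "vpow 1 * Q.cf x w \<in> A_minus" if "w \<in> Q.supp x" for w
    using l that Q.supp_subset by (auto simp: A_minus_iff deg_le_vpow_mult Q.lat_def)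
  ultimately show "x \<in> v_inv_L"
    unfolding v_inv_L_def lattice_L_def
    by (intro image_eqI[of _ _ "\<Sum>w \<in> Q.supp x. scq (vpow 1 * Q.cf x w) (tn w)"] CollectI
        exI[of _ "Q.supp x"] exI[of _ "\<lambda>w. vpow 1 * Q.cf x w"]) (use Q.supp_subset in auto)
qed

text \<open>Any preimage may be used, since \<open>J\<close> is stable under bar.\<close>

lemma bar_TL_pr: "bar_TL (pr h) = pr (bar_H h)"
  unfolding bar_TL_def
proof (rule the_equality)
  show "\<forall>g. pr g = pr h \<longrightarrow> pr (bar_H h) = pr (bar_H g)"
  proof (intro allI impI)
    fix g assume "pr g = pr h"
    then have "bar_H (h - g) \<in> J" using pr_diff_J bar_H_J by metis
    then show "pr (bar_H h) = pr (bar_H g)" by (simp add: pr_diff_J KH.bar_diff)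
  qed
qed auto

definition bq :: "'w \<Rightarrow> 'q \<Rightarrow> 'q" where
  "bq s x = tn s * x + scq (vpow (- 1)) x"

lemma bq_pr: "bq s (pr h) = pr (bH s h)"
  by (simp add: bq_def bH_def tn_def TL.add TL.scale pr_mult)

lemma pr_cases: obtains h where "x = pr h"
  using pr_surj by (metis surjD)

definition star_TL :: "'q \<Rightarrow> 'q" where
  "star_TL x = (THE y. \<forall>h. pr h = x \<longrightarrow> y = pr (star h))"

lemma star_diff: "star (g - h) = star g - star h"
  using star_add[of "g - h" h] by (simp add: algebra_simps)

lemma star_TL_pr: "star_TL (pr h) = pr (star h)"
  unfolding star_TL_def
proof (rule the_equality)
  show "\<forall>g. pr g = pr h \<longrightarrow> pr (star h) = pr (star g)"
  proof (intro allI impI)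
    fix g assume "pr g = pr h"
    then have "star (h - g) \<in> J" using pr_diff_J star_J by metis
    then show "pr (star h) = pr (star g)" by (simp add: pr_diff_J star_diff)
  qed
qed auto

end

locale temperley_lieb_W = temperley_lieb W sc T scq pr
  for W :: "'w coxeter" (structure)
    and sc :: "laurent \<Rightarrow> 'h \<Rightarrow> 'h::ring_1"
    and T :: "'w \<Rightarrow> 'h"
    and scq :: "laurent \<Rightarrow> 'q \<Rightarrow> 'q::{ring, monoid_mult}"
    and pr :: "'h \<Rightarrow> 'q" +
  assumes property_W: property_W
begin

lemma kl_module_TL: "kl_module W scq W\<^sub>c tn bq bar_TL"
proof unfold_locales
  show "W\<^sub>c \<subseteq> carrier W" by auto
  show "\<one> \<in> W\<^sub>c" by simp
  show "s \<otimes> w \<in> W\<^sub>c" if "s \<in> S" "w \<in> W\<^sub>c" "dl s w" for s w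
    using fc_down that .
  show "bq s (g + h) = bq s g + bq s h" for s g h
    by (simp add: bq_def distrib_left TL.m2.scale_right_distrib)
  show "bq s (scq a h) = scq a (bq s h)" for s a h
  proof -
    obtain k where "h = pr k" by (rule pr_cases)
    then show ?thesis using bq_pr by (simp add: TL.scale[symmetric] bH_scale)
  qed
  show "bq s (bq s h) = scq (vpow 1 + vpow (- 1)) (bq s h)" if "s \<in> S" for s h
  proof -
    obtain k where "h = pr k" by (rule pr_cases)
    then show ?thesis using bq_pr bH_square[OF that] by (simp add: TL.scale[symmetric])
  qed
  show "bar_TL (g + h) = bar_TL g + bar_TL h" for g h
  proof -
    obtain i k where "g = pr i" "h = pr k" by (metis pr_cases)
    then show ?thesis by (simp add: TL.add[symmetric] bar_TL_pr bar_H_add)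
  qed
  show "bar_TL (scq a h) = scq (bar_A a) (bar_TL h)" for a h
  proof -
    obtain k where "h = pr k" by (rule pr_cases)
    then show ?thesis by (simp add: TL.scale[symmetric] bar_TL_pr bar_H_scale)
  qed
  show "bar_TL (tn \<one>) = tn \<one>" by (simp add: tn_def bar_TL_pr)
  show "bar_TL (bq s h) = bq s (bar_TL h)" if "s \<in> S" for s h
  proof -
    obtain k where "h = pr k" by (rule pr_cases)
    then show ?thesis using that by (simp add: bq_pr bar_TL_pr bar_H_bH)
  qed
  have up: "bq s (tn w) = tn (s \<otimes> w) + scq (vpow (- 1)) (tn w)" if "s \<in> S" "w \<in> W\<^sub>c" "\<not> dl s w" for s w
    using that by (simp add: tn_def bq_pr bH_up TL.add TL.scale)
  show "bq s (tn w) = tn (s \<otimes> w) + scq (vpow (- 1)) (tn w)"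
    if "s \<in> S" "w \<in> W\<^sub>c" "\<not> dl s w" "s \<otimes> w \<in> W\<^sub>c" for s w
    using up that by blast
  show "bq s (tn w) = tn (s \<otimes> w) + scq (vpow 1) (tn w)" if "s \<in> S" "w \<in> W\<^sub>c" "dl s w" for s w
    using that by (simp add: tn_def bq_pr bH_down TL.add TL.scale)
  \<comment> \<open>Here Property W enters: sw is weakly complex, so its image lies in v^-1 times
    the lattice.\<close>
  show "Q.lat (- 1) (bq s (tn w))" if "s \<in> S" "w \<in> W\<^sub>c" "\<not> dl s w" "s \<otimes> w \<notin> W\<^sub>c" for s w
  proof -
    have "s \<otimes> w \<in> carrier W" using that by simp
    then have "complex (s \<otimes> w)" using that(4) fc_iff by blast
    then have "weakly_complex (s \<otimes> w)" unfolding weakly_complex_def using that by blast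
    then have "Q.lat (- 1) (tn (s \<otimes> w))"
      using property_W unfolding property_W_def v_inv_L_iff by blast
    moreover have "Q.lat (- 1) (scq (vpow (- 1)) (tn w))"
      using Q.lat_scale[of "- 1" "vpow (- 1)" 0] Q.lat_basis that deg_le_vpow by simp
    ultimately show ?thesis unfolding up[OF that(1-3)] by (rule Q.lat_add)
  qed
  show "len y \<le> Suc (len w)"
    if "s \<in> S" "w \<in> W\<^sub>c" "\<not> dl s w" "s \<otimes> w \<notin> W\<^sub>c" "y \<in> Q.supp (bq s (tn w))" for s w y
  proof -
    have y: "y \<in> W\<^sub>c" "Q.cf (tn (s \<otimes> w)) y \<noteq> 0 \<or> Q.cf (tn w) y \<noteq> 0"
      using that(5) unfolding up[OF that(1-3)] by (auto simp: Q.supp_def Q.cf_add Q.cf_scale)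
    then have "y \<in> Q.supp (tn (s \<otimes> w)) \<or> y \<in> Q.supp (tn w)" by (auto simp: Q.supp_def)
    then show ?thesis
      using Q_supp_tn_len[of "s \<otimes> w" y] Q_supp_tn_len[of w y] len_up[of s w] that by auto
  qed
qed

end

sublocale temperley_lieb_W \<subseteq> KT: kl_module W scq "W\<^sub>c" tn bq bar_TL
  by (rule kl_module_TL)

context temperley_lieb_W
begin

lemma c_eq_can: "w \<in> W\<^sub>c \<Longrightarrow> c w = KT.can w"
  by (simp add: c_def KT.can_def KT.is_can_def v_inv_L_iff)

lemma M_eq_mm: "w \<in> W\<^sub>c \<Longrightarrow> M y w = KT.mm y w"
  by (simp add: M_def p_star_def KT.mm_def KT.pp_def Q.cf_def c_eq_can)

lemma KT_mm_inv: "\<lbrakk>x \<in> W\<^sub>c; w \<in> W\<^sub>c\<rbrakk> \<Longrightarrow> KT.mm (inv x) (inv w) = KT.mm x w"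
proof (rule KT.can_anti[where st = star_TL])
  show "star_TL (g + h) = star_TL g + star_TL h" for g h
  proof -
    obtain i k where "g = pr i" "h = pr k" by (metis pr_cases)
    then show ?thesis by (simp add: TL.add[symmetric] star_TL_pr star_add)
  qed
  show "star_TL (scq a h) = scq a (star_TL h)" for a h
  proof -
    obtain k where "h = pr k" by (rule pr_cases)
    then show ?thesis by (simp add: TL.scale[symmetric] star_TL_pr star_scale)
  qed
  show "star_TL (tn w) = tn (inv w)" if "w \<in> W\<^sub>c" for w
    using that by (simp add: tn_def star_TL_pr star_Tn)
  show "inv w \<in> W\<^sub>c" if "w \<in> W\<^sub>c" for w using fc_inv that .
  show "bar_TL (star_TL h) = star_TL (bar_TL h)" for h
  proof -
    obtain k where "h = pr k" by (rule pr_cases)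
    then show ?thesis by (simp add: bar_TL_pr star_TL_pr bar_H_star)
  qed
qed

text \<open>c_s is the image of \<open>Tn s\<close> plus v^-1, so the formulas for \<open>bq\<close>
  are the product formulas of the theorem.\<close>

lemma c_gen_mult: "s \<in> S \<Longrightarrow> c s * x = bq s x"
proof -
  assume s: "s \<in> S"
  have one: "KT.can \<one> = tn \<one>"
    by (rule KT.can_eqI) (simp add: KT.is_can_def KT.bar_one)
  have "KT.is_can s (bq s (tn \<one>))"
    unfolding KT.is_can_def
  proof
    show "bar_TL (bq s (tn \<one>)) = bq s (tn \<one>)" using s by (simp add: KT.bar_b KT.bar_one)
    have "bq s (tn \<one>) - tn s = scq (vpow (- 1)) (tn \<one>)"
      using KT.b_up[OF s, of \<one>] s by simp
    then show "Q.lat (- 1) (bq s (tn \<one>) - tn s)"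
      using Q.lat_scale[of "- 1" "vpow (- 1)" 0] Q.lat_basis[of \<one>] deg_le_vpow by simp
  qed
  then have "c s = bq s (tn \<one>)" using KT.can_eqI c_eq_can s by simp
  also have "\<dots> = tn s + scq (vpow (- 1)) 1"
    by (simp add: bq_def tn_def pr_one)
  finally have cs: "c s = tn s + scq (vpow (- 1)) 1" .
  obtain k where k: "x = pr k" by (rule pr_cases)
  have "scq (vpow (- 1)) 1 * x = pr (sc (vpow (- 1)) 1 * k)"
    unfolding k pr_mult TL.scale pr_one ..
  also have "\<dots> = scq (vpow (- 1)) x" unfolding k by (simp add: sc_mult_left TL.scale)
  finally show ?thesis by (simp add: cs bq_def distrib_right)
qed

section \<open>Comparison of the two canonical bases\<close>

lemma alt_left_Suc: "alt_left s t (Suc k) = (if even k then s else t) \<otimes> alt_left s t k"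
  by simp

lemma alt_left_eq_al: "alt_left s t k = (if odd k then al s t k else al t s k)"
  by (induction k) (auto simp: al_Suc)

text \<open>Neighbours in a string differ by one letter \<open>a\<close> in front. Strings start at
  k = 1, so the shorter neighbour still has a first letter \<open>b\<close>, which is a descent and
  does not commute with \<open>a\<close>.\<close>

lemma left_star_reducible_step:
  assumes "left_star_reducible y x"
  obtains a b where "noncommuting a b" "x \<in> carrier W" "y = a \<otimes> x" "\<not> dl a x" "dl b x"
proof -
  obtain s t u i j where st: "noncommuting s t" and u: "u \<in> carrier W" "\<not> dl s u" "\<not> dl t u"
    and i: "1 \<le> i" "enat i < cox_mat W s t" "x = alt_left s t i \<otimes> u"
    and j: "1 \<le> j" "enat j < cox_mat W s t" "y = alt_left s t j \<otimes> u" and len: "Suc (len x) = len y"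
    using assms unfolding left_star_reducible_def left_string_def dl_def by fastforce
  note D = noncommutingD[OF st]
  have l: "len (alt_left s t k \<otimes> u) = k + len u" if "enat k < cox_mat W s t" for k
    using len_al_mult[OF D(1-3) u] len_al_mult[OF D(2,1) D(3)[symmetric] u(1,3,2)] mat_sym[OF D(1,2)] that
    by (simp add: alt_left_eq_al)
  have ji: "j = Suc i" using l[OF i(2)] l[OF j(2)] i j len by simp
  obtain k where k: "i = Suc k" using i by (cases i) auto
  have "enat k < cox_mat W s t" using i(2) k by (metis Suc_ile_eq order_less_imp_le)
  define a where "a = (if even i then s else t)"
  define b where "b = (if even k then s else t)"
  have c: "alt_left s t n \<in> carrier W" for n using D by (simp add: alt_left_eq_al)
  have ab: "a \<in> S" "b \<in> S" "noncommuting a b"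
    using D st noncommuting_sym k by (auto simp: a_def b_def)
  have ya: "y = a \<otimes> x"
    unfolding j(3) ji i(3) alt_left_Suc a_def[symmetric] using c ab u by (simp add: m_assoc)
  have "x = b \<otimes> (alt_left s t k \<otimes> u)"
    unfolding i(3) k alt_left_Suc b_def[symmetric] using c ab u by (simp add: m_assoc)
  then have "b \<otimes> x = alt_left s t k \<otimes> u" using c ab u by simp
  then have "dl b x"
    using l[OF \<open>enat k < cox_mat W s t\<close>] l[OF i(2)] i(3) k by (simp add: dl_def)
  moreover have "\<not> dl a x" using ya len by (simp add: dl_def)
  moreover have "x \<in> carrier W" using i c u by simp
  ultimately show ?thesis using that ab ya by blast
qed

lemma inv_alt_right: "\<lbrakk>s \<in> S; t \<in> S\<rbrakk> \<Longrightarrow> alt_right s t k \<in> carrier W \<and> inv (alt_right s t k) = alt_left s t k"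
  by (induction k) (auto simp: inv_mult_group)

lemma right_star_reducible_inv:
  assumes "right_star_reducible y x"
  shows "left_star_reducible (inv y) (inv x) \<and> x \<in> carrier W \<and> y \<in> carrier W"
proof -
  obtain s t u where st: "noncommuting s t" and u: "u \<in> carrier W" "len u < len (u \<otimes> s)" "len u < len (u \<otimes> t)"
    and xy: "x \<in> right_string s t u" "y \<in> right_string s t u" and len: "Suc (len x) = len y"
    using assms unfolding right_star_reducible_def by blast
  note D = noncommutingD[OF st]
  have str: "inv z \<in> left_string s t (inv u) \<and> z \<in> carrier W" if z: "z \<in> right_string s t u" for z
  proof -
    obtain k where k: "z = u \<otimes> alt_right s t k" "1 \<le> k" "enat k < cox_mat W s t"
      using z unfolding right_string_def by blast
    have "inv z = alt_left s t k \<otimes> inv u"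
      using k(1) inv_alt_right[OF D(1,2), of k] u by (simp add: inv_mult_group)
    then show ?thesis
      unfolding left_string_def using k inv_alt_right[OF D(1,2), of k] u by auto
  qed
  have "len (inv u) < len (a \<otimes> inv u)" if "a \<in> S" "len u < len (u \<otimes> a)" for a
    using len_inv[of "u \<otimes> a"] that u by (simp add: inv_mult_group)
  then have "len (inv u) < len (s \<otimes> inv u)" "len (inv u) < len (t \<otimes> inv u)" using D u by auto
  then show ?thesis
    unfolding left_star_reducible_def using str[OF xy(1)] str[OF xy(2)] st u(1) len
    by (intro conjI exI[of _ s] exI[of _ t] exI[of _ "inv u"]) auto
qed

definition agree :: "'w \<Rightarrow> bool" where
  "agree w \<longleftrightarrow> (\<forall>x \<in> W\<^sub>c. KT.mm x w = KH.mm x w)"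

lemma agree_inv: "w \<in> W\<^sub>c \<Longrightarrow> agree (inv w) \<Longrightarrow> agree w"
  unfolding agree_def
proof
  fix x assume w: "w \<in> W\<^sub>c" and a: "\<forall>x \<in> W\<^sub>c. KT.mm x (inv w) = KH.mm x (inv w)" and x: "x \<in> W\<^sub>c"
  have "KT.mm (inv x) (inv w) = KH.mm (inv x) (inv w)" using a fc_inv x by blast
  then show "KT.mm x w = KH.mm x w" using KT_mm_inv[OF x w] KH_mm_inv x w by simp
qed

text \<open>By \<open>mm_descent\<close>, both numbers depend only on whether sx = w.\<close>

lemma mm_descent_agree:
  assumes "s \<in> S" "w \<in> W\<^sub>c" "x \<in> W\<^sub>c" "dl s w" "\<not> dl s x"
  shows "KT.mm x w = KH.mm x w"
  using KT.mm_descent[OF assms] KH.mm_descent[of s w x] assms by simp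

text \<open>If \<open>s\<close> is no descent of \<open>x\<close>, \<open>mm_descent\<close>
  decides. Otherwise \<open>mm_recursion\<close> has the same form in both algebras up to its
  condition that tx lies in \<open>X\<close>. This makes no difference: if tx is not fully
  commutative, then \<open>s\<close> is a descent of tx by \<open>not_fc_descent\<close>, and the
  term is absent from both recursions.\<close>

lemma agree_left_star:
  assumes w: "w \<in> W\<^sub>c" and IH: "\<And>y. \<lbrakk>y \<in> W\<^sub>c; len y < len w\<rbrakk> \<Longrightarrow> agree y"
    and red: "left_star_reducible w u"
  shows "agree w"
  unfolding agree_def
proof
  fix x assume x: "x \<in> W\<^sub>c"
  obtain s t where st: "noncommuting s t" and u: "u \<in> carrier W" "w = s \<otimes> u" "\<not> dl s u" "dl t u"
    using left_star_reducible_step[OF red] .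
  note D = noncommutingD[OF st]
  have ds: "dl s w" using u D dl_mult by simp
  have uc: "u \<in> W\<^sub>c" using fc_down[OF D(1) w ds] u D by simp
  have tuc: "t \<otimes> u \<in> W\<^sub>c" using fc_down D uc u by blast
  have lu: "len w = Suc (len u)" "len (t \<otimes> u) < len u" using len_up u D by (auto simp: dl_def)
  have au: "agree u" "agree (t \<otimes> u)" using IH uc tuc lu by auto
  show "KT.mm x w = KH.mm x w"
  proof (cases "dl s x")
    case False
    then show ?thesis using mm_descent_agree[OF D(1) w x ds] by simp
  next
    case True
    have nt: "\<not> dl t x" using two_descents_not_fc[OF st fc_closed[OF x] True] x by blast
    have sx: "s \<otimes> x \<in> W\<^sub>c" using fc_down D x True by blast
    have tx: "t \<otimes> x \<in> W\<^sub>c" if "\<not> dl s (t \<otimes> x)"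
      using not_fc_descent[OF st x True] that by blast
    have sw: "s \<otimes> u \<in> W\<^sub>c" using w u(2) by simp
    have xc: "x \<in> carrier W" "s \<otimes> u \<in> carrier W" "t \<otimes> x \<in> carrier W" using x u(1) D by simp_all
    have "KT.mm x w = KT.mm (s \<otimes> x) u + (if \<not> dl s (t \<otimes> x) then KT.mm (t \<otimes> x) u else 0)
        - (if dl s (t \<otimes> u) then KT.mm x (t \<otimes> u) else 0)"
      unfolding u(2) KT.mm_recursion[OF D(1,2) uc x sw u(4,3) True nt] using tx by simp
    also have "KT.mm (s \<otimes> x) u = KH.mm (s \<otimes> x) u"
      using au(1) sx by (simp add: agree_def)
    also have "(if \<not> dl s (t \<otimes> x) then KT.mm (t \<otimes> x) u else 0) =
        (if \<not> dl s (t \<otimes> x) then KH.mm (t \<otimes> x) u else 0)"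
      using au(1) tx by (simp add: agree_def)
    also have "KT.mm x (t \<otimes> u) = KH.mm x (t \<otimes> u)"
      using au(2) x by (simp add: agree_def)
    finally show ?thesis
      unfolding u(2) KH.mm_recursion[OF D(1,2) u(1) xc(1,2) u(4,3) True nt] using xc(3) by simp
  qed
qed

text \<open>If \<open>s\<close> were a descent of the product of the other letters, exchange would
  delete some \<open>u\<close> from it; after commuting the letters this gives s = u, against
  distinctness.\<close>

lemma len_commuting_product:
  assumes "distinct ss" "set ss \<subseteq> S" "\<forall>s \<in> set ss. \<forall>t \<in> set ss. s \<otimes> t = t \<otimes> s"
  shows "len (word_prod W ss) = length ss \<and> (\<forall>s \<in> set ss. dl s (word_prod W ss))"
  using assms
proof (induction ss)
  case Nil
  then show ?case by simp
next
  case (Cons s ss)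
  have sS: "s \<in> S" "ss \<in> lists S" using Cons.prems by auto
  have IH: "len (word_prod W ss) = length ss" "\<And>r. r \<in> set ss \<Longrightarrow> dl r (word_prod W ss)"
    using Cons by auto
  have com: "word_prod W us \<otimes> a = a \<otimes> word_prod W us"
    if "a \<in> S" "us \<in> lists S" "\<forall>b \<in> set us. a \<otimes> b = b \<otimes> a" for a us
    using that
  proof (induction us)
    case (Cons b us)
    have "b \<otimes> word_prod W us \<otimes> a = b \<otimes> (a \<otimes> word_prod W us)"
      using Cons by (simp add: m_assoc)
    also have "\<dots> = a \<otimes> (b \<otimes> word_prod W us)"
      using Cons.prems by (simp add: m_assoc[symmetric])
    finally show ?case by simp
  qed simp
  have "\<not> dl s (word_prod W ss)"
  proof
    assume "dl s (word_prod W ss)"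
    then obtain us u vs where d: "ss = us @ u # vs" "s \<otimes> word_prod W ss = word_prod W (us @ vs)"
      using exchange[OF sS(2,1)] by metis
    have S: "us \<in> lists S" "vs \<in> lists S" "u \<in> S" using d sS by auto
    then have wuv: "word_prod W (us @ vs) \<in> carrier W" by (intro word_prod_closed) auto
    have "set vs \<subseteq> set (s # ss)" "u \<in> set (s # ss)" "set (us @ vs) \<subseteq> set (s # ss)" "s \<in> set (s # ss)"
      using d(1) by auto
    then have "\<forall>b \<in> set vs. u \<otimes> b = b \<otimes> u" "\<forall>b \<in> set (us @ vs). s \<otimes> b = b \<otimes> s"
      using Cons.prems(3) by blast+
    then have c: "word_prod W vs \<otimes> u = u \<otimes> word_prod W vs"
      "word_prod W (us @ vs) \<otimes> s = s \<otimes> word_prod W (us @ vs)"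
      using com[of u vs] com[of s "us @ vs"] S sS by auto
    have "word_prod W ss = word_prod W us \<otimes> (u \<otimes> word_prod W vs)"
      unfolding d(1) using S by (simp add: word_prod_append)
    also have "\<dots> = word_prod W (us @ vs) \<otimes> u"
      unfolding c(1)[symmetric] using S by (simp add: word_prod_append m_assoc)
    finally have "s \<otimes> word_prod W ss = (s \<otimes> word_prod W (us @ vs)) \<otimes> u"
      using S sS wuv by (simp add: m_assoc)
    also have "\<dots> = word_prod W (us @ vs) \<otimes> (s \<otimes> u)"
      unfolding c(2)[symmetric] using S sS wuv by (simp add: m_assoc)
    finally have "s \<otimes> word_prod W ss = word_prod W (us @ vs) \<otimes> (s \<otimes> u)" .
    then have "word_prod W (us @ vs) = word_prod W (us @ vs) \<otimes> (s \<otimes> u)" using d(2) by simp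
    then have "s \<otimes> u = \<one>" using S sS wuv by (subst (asm) l_cancel_one') auto
    then have "s = u" using S sS by (metis gen_cancel gens_closed r_one)
    then show False using Cons.prems(1) d(1) by simp
  qed
  then have l: "len (word_prod W (s # ss)) = length (s # ss)"
    using len_up[of s "word_prod W ss"] IH sS by simp
  have "dl r (word_prod W (s # ss))" if "r \<in> set (s # ss)" for r
  proof (cases "r = s")
    case True
    then show ?thesis using \<open>\<not> dl s (word_prod W ss)\<close> dl_mult sS by simp
  next
    case False
    then have r: "r \<in> set ss" using that by simp
    then have "s \<in> set (s # ss)" "r \<in> set (s # ss)" by simp_all
    then have "s \<otimes> r = r \<otimes> s" "r \<in> S" using Cons.prems(2,3) by blast+
    then show ?thesis
      using commuting_descent_up[of s r "word_prod W ss"] IH(2)[OF r] \<open>\<not> dl s (word_prod W ss)\<close> sS by simp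
  qed
  then show ?case using l by blast
qed

lemma len_commuting_descents:
  assumes "distinct ss" "set ss \<subseteq> S" "\<forall>s \<in> set ss. \<forall>t \<in> set ss. s \<otimes> t = t \<otimes> s"
    "x \<in> carrier W" "\<forall>s \<in> set ss. dl s x"
  shows "length ss \<le> len x"
  using assms
proof (induction ss arbitrary: x)
  case (Cons s ss)
  have s: "s \<in> S" "dl s x" using Cons.prems by auto
  have "dl r (s \<otimes> x)" if "r \<in> set ss" for r
    using commuting_descent[of r s x] Cons.prems that by auto
  then have "length ss \<le> len (s \<otimes> x)" using Cons.IH[of "s \<otimes> x"] Cons.prems by simp
  then show ?case using len_down[OF s(1) Cons.prems(4) s(2)] by simp
qed simp

text \<open>If all letters of \<open>w\<close> are descents of \<open>x\<close>, then
  \<open>x\<close> is at least as long as \<open>w\<close> and both numbers vanish. Otherwise a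
  letter of \<open>w\<close> that is no descent of \<open>x\<close> settles the comparison through
  \<open>mm_descent\<close>.\<close>

lemma agree_commuting_product:
  assumes w: "w \<in> W\<^sub>c" and c: "commuting_product w"
  shows "agree w"
  unfolding agree_def
proof
  fix x assume x: "x \<in> W\<^sub>c"
  obtain ss where ss: "distinct ss" "set ss \<subseteq> S" "\<forall>s \<in> set ss. \<forall>t \<in> set ss. s \<otimes> t = t \<otimes> s"
    "w = word_prod W ss"
    using c unfolding commuting_product_def by blast
  note lw = len_commuting_product[OF ss(1-3), folded ss(4)]
  show "KT.mm x w = KH.mm x w"
  proof (cases "\<forall>s \<in> set ss. dl s x")
    case True
    then have "length ss \<le> len x" using len_commuting_descents[OF ss(1-3)] x by simp
    then have "\<not> len x < len w" using lw by simp
    then have "KT.mm x w = 0" "KH.mm x w = 0"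
      using KT.mm_len[OF w KT.can_exists[OF w] x] KH.mm_len[of w x] KH.can_exists[of w] w x by auto
    then show ?thesis by simp
  next
    case False
    then obtain s where "s \<in> set ss" "\<not> dl s x" by blast
    then show ?thesis using mm_descent_agree[of s w x] ss lw w x by auto
  qed
qed

text \<open>The recursion at \<open>w\<close> refers to the neighbour u in a first star step and to
  the still shorter tu, both fully commutative, so induction on length applies. A right step at
  \<open>w\<close> is a left step at its inverse, which has the same length.\<close>

theorem agree_all:
  assumes F: property_F
  shows "w \<in> W\<^sub>c \<Longrightarrow> agree w"
proof (induction "len w" arbitrary: w rule: less_induct)
  case less
  note w = less.prems
  obtain z where z: "commuting_product z" "star_reducible w z"
    using F w unfolding property_F_def by blast
  show ?case
    using z(2) unfolding star_reducible_def
  proof (cases rule: converse_rtranclpE)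
    case base
    then show ?thesis using agree_commuting_product[OF w] z by simp
  next
    case (step u)
    from step(1) show ?thesis
    proof
      assume "left_star_reducible w u"
      then show ?thesis using agree_left_star[OF w] less.hyps by blast
    next
      assume "right_star_reducible w u"
      then have r: "left_star_reducible (inv w) (inv u)" using right_star_reducible_inv by blast
      have "agree (inv w)"
        by (rule agree_left_star[OF fc_inv[OF w] _ r]) (use less.hyps w in simp)
      then show ?thesis using agree_inv w by blast
    qed
  qed
qed

text \<open>The sum in the theorem runs over all \<open>y\<close>, but c_y = 0 outside
  \<open>W\<^sub>c\<close>, and the Bruhat relation between sy and \<open>y\<close> is the descent
  condition.\<close>

lemma lower_sum_eq:
  assumes F: property_F and s: "s \<in> S" and w: "w \<in> W\<^sub>c"
  shows "(\<Sum>y \<in> KT.lower s w. scq (of_int (KT.mm y w)) (KT.can y)) =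
    (\<Sum>y | y \<in> carrier W \<and> bruhat_less (s \<otimes> y) y \<and> mu y w \<noteq> 0. scq (of_int (mu y w)) (c y))"
proof (rule sum.mono_neutral_cong_left)
  have mm: "mu y w = KT.mm y w" if "y \<in> W\<^sub>c" for y
    using agree_all[OF F w] mu_eq_mm[of y w] that w by (simp add: agree_def)
  show "finite {y \<in> carrier W. bruhat_less (s \<otimes> y) y \<and> mu y w \<noteq> 0}"
    by (rule finite_subset[OF _ finite_bruhat_less[of w]]) (auto simp: mu_def split: if_splits)
  show "KT.lower s w \<subseteq> {y \<in> carrier W. bruhat_less (s \<otimes> y) y \<and> mu y w \<noteq> 0}"
    using mm s by (auto simp: KT.lower_def bruhat_less_gen_iff)
  show "\<forall>y \<in> {y \<in> carrier W. bruhat_less (s \<otimes> y) y \<and> mu y w \<noteq> 0} - KT.lower s w.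
      scq (of_int (mu y w)) (c y) = 0"
  proof
    fix y assume y: "y \<in> {y \<in> carrier W. bruhat_less (s \<otimes> y) y \<and> mu y w \<noteq> 0} - KT.lower s w"
    have "y \<notin> W\<^sub>c"
    proof
      assume "y \<in> W\<^sub>c"
      then have "y \<in> KT.lower s w" using y mm s by (auto simp: KT.lower_def bruhat_less_gen_iff)
      then show False using y by blast
    qed
    then show "scq (of_int (mu y w)) (c y) = 0" by (simp add: c_def)
  qed
  show "scq (of_int (KT.mm y w)) (KT.can y) = scq (of_int (mu y w)) (c y)" if "y \<in> KT.lower s w" for y
    using that mm c_eq_can by (auto simp: KT.lower_def)
qed

end

theorem theorem5p13:
  fixes W :: "'w coxeter" (structure)
    and sc :: "laurent \<Rightarrow> 'h \<Rightarrow> 'h::ring_1"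
    and T :: "'w \<Rightarrow> 'h"
    and scq :: "laurent \<Rightarrow> 'q \<Rightarrow> 'q::{ring, monoid_mult}"
    and pr :: "'h \<Rightarrow> 'q"
  assumes TL: "temperley_lieb W sc T scq pr"
    and F: "coxeter_system.property_F W"
    and PW: "temperley_lieb.property_W W sc T scq pr"
  shows
    "(\<forall>x \<in> coxeter_system.W\<^sub>c W. \<forall>w \<in> coxeter_system.W\<^sub>c W.
        temperley_lieb.M W sc T scq pr x w = hecke_algebra.mu W sc T x w)
     \<and>
     (\<forall>s \<in> cox_gens W. \<forall>w \<in> coxeter_system.W\<^sub>c W.
        (coxeter_system.len W (s \<otimes> w) < coxeter_system.len W w \<longrightarrow>
          temperley_lieb.c W sc T scq pr s * temperley_lieb.c W sc T scq pr w
          = scq (vpow 1 + vpow (- 1)) (temperley_lieb.c W sc T scq pr w))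
        \<and>
        (coxeter_system.len W (s \<otimes> w) > coxeter_system.len W w \<longrightarrow>
          temperley_lieb.c W sc T scq pr s * temperley_lieb.c W sc T scq pr w
          = temperley_lieb.c W sc T scq pr (s \<otimes> w)
            + (\<Sum>y | y \<in> carrier W \<and> coxeter_system.bruhat_less W (s \<otimes> y) y
                    \<and> hecke_algebra.mu W sc T y w \<noteq> 0.
                scq (of_int (hecke_algebra.mu W sc T y w))
                  (temperley_lieb.c W sc T scq pr y))))"
proof -
  interpret temperley_lieb_W W sc T scq pr
    by (rule temperley_lieb_W.intro[OF TL]) (unfold_locales, rule PW)
  have "M x w = mu x w" if "x \<in> W\<^sub>c" "w \<in> W\<^sub>c" for x w
    using agree_all[OF F that(2)] that mu_eq_mm[of x w] M_eq_mm by (simp add: agree_def)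
  moreover have "c s * c w = scq (vpow 1 + vpow (- 1)) (c w)"
    if "s \<in> S" "w \<in> W\<^sub>c" "len (s \<otimes> w) < len w" for s w
    unfolding c_gen_mult[OF that(1)] c_eq_can[OF that(2)]
    using that KT.b_can_down[of s w] by (simp add: dl_def)
  moreover have "c s * c w = c (s \<otimes> w)
      + (\<Sum>y | y \<in> carrier W \<and> bruhat_less (s \<otimes> y) y \<and> mu y w \<noteq> 0. scq (of_int (mu y w)) (c y))"
    if "s \<in> S" "w \<in> W\<^sub>c" "len w < len (s \<otimes> w)" for s w
  proof -
    have "\<not> dl s w" using that by (simp add: dl_def)
    then have "c s * c w = (if s \<otimes> w \<in> W\<^sub>c then KT.can (s \<otimes> w) else 0)
        + (\<Sum>y \<in> KT.lower s w. scq (of_int (KT.mm y w)) (KT.can y))"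
      unfolding c_gen_mult[OF that(1)] c_eq_can[OF that(2)] using that KT.b_can_up[of s w] by simp
    \<comment> \<open>For sw outside \<open>W\<^sub>c\<close> this is the convention that c_sw is
      zero.\<close>
    also have "(if s \<otimes> w \<in> W\<^sub>c then KT.can (s \<otimes> w) else 0) = c (s \<otimes> w)"
      by (simp add: c_eq_can) (simp add: c_def)
    finally show ?thesis unfolding lower_sum_eq[OF F that(1,2)] .
  qed
  ultimately show ?thesis by blast
qed

end
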